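(* Let $n\ge2$, $\gamma>1$, and let $Cone_\Sigma\subset\mathbb{R}^n$ be a $C^{1,1}$ epigraphical cone with norms $(L,K)$ whose frequency satisfies $\phi_\Sigma=\frac{2}{1+\gamma}$. Let $\Omega=Cone_\Sigma\cap B_1$, let $f$ satisfy $0<\lambda\le f\le\Lambda$ in $\Omega$, and let $u,v>0$ be two distinct solutions of $$-\Delta u=f\,u^{-\gamma},\qquad -\Delta v=f\,v^{-\gamma}\qquad\text{in }\Omega,$$ both vanishing on $\partial Cone_\Sigma$ (within $B_1$). Then the ratio $\frac{u(x)}{v(x)}$ is continuous on $\overline{\Omega\cap B_{1/16}}$ (i.e. extends continuously to it), is bounded away from $0$ and $\infty$ there, and its limit at every point of $B_{1/16}\cap\partial Cone_\Sigma$ is $1$.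
   Context: $B_r$ is the open ball of radius $r$ centered at $0$ in $\mathbb{R}^n$; points are written $x=(x',x_n)$ and $B_r'$ is the ball in $\mathbb{R}^{n-1}$. Cones: for $\Sigma\subseteq\partial B_1=\mathbb{S}^{n-1}$, $Cone_\Sigma=\{x\in\mathbb{R}^n\setminus\{0\}: x/|x|\in\Sigma\}$. It is a $C^{1,1}$ epigraphical cone if $Cone_\Sigma=\{x_n>g(x')\}$ for some $g:\mathbb{R}^{n-1}\to\mathbb{R}$ with $g(\lambda x')=\lambda g(x')$ for all $\lambda\ge0$, and $g\in C^{1,1}(B_2'\setminus B_1')$. Its norms are $L=\|g\|_{C^{0,1}(B_2'\setminus B_1')}$ and $K=[g]_{C^{1,1}(B_2'\setminus B_1')}$. Frequency: let $\lambda_\Sigma$ be the first Dirichlet eigenvalue of the Laplace-Beltrami operator $-\Delta_\Sigma$ on $\Sigma$; the frequency $\phi_\Sigma$ is the positive solution of $\phi(\phi+n-2)=\lambda_\Sigma$. Solutions: $f$ is a measurable function on $\Omega$; $u,v$ are positive functions, continuous on $\Omega\cup(B_1\cap\partial Cone_\Sigma)$, equal to $0$ on $B_1\cap\partial Cone_\Sigma$, satisfying the equation in $\Omega$ in the sense of distributions. *)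

theory Defs
  imports "HOL-Analysis.Analysis"
begin

text \<open>
  The ambient space is \<open>(real ^ 'm) \<times> real\<close>, so that a point is literally a pair \<open>(x', x\<^sub>n)\<close>;
  its norm is the Euclidean one. Here \<open>n = CARD('m) + 1\<close>, and as \<open>'m\<close> ranges over all finite types
  \<open>n\<close> ranges over all integers \<open>\<ge> 2\<close>.
\<close>

definition pderivative :: "'a::euclidean_space \<Rightarrow> ('a \<Rightarrow> real) \<Rightarrow> 'a \<Rightarrow> real" where
  "pderivative b F x = frechet_derivative F (at x) b"

definition laplacian :: "('a::euclidean_space \<Rightarrow> real) \<Rightarrow> 'a \<Rightarrow> real" where
  "laplacian F x = (\<Sum>b\<in>Basis. pderivative b (pderivative b F) x)"

text \<open>The class $C^k(U)$; meant for open \<open>U\<close>.\<close>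

primrec Ck_on :: "nat \<Rightarrow> 'a::euclidean_space set \<Rightarrow> ('a \<Rightarrow> real) \<Rightarrow> bool" where
  "Ck_on 0 U F \<longleftrightarrow> continuous_on U F"
| "Ck_on (Suc k) U F \<longleftrightarrow>
     (\<forall>x\<in>U. F differentiable (at x)) \<and> (\<forall>b\<in>Basis. Ck_on k U (pderivative b F))"

definition test_functions :: "'a::euclidean_space set \<Rightarrow> ('a \<Rightarrow> real) set" where
  "test_functions U =
     {\<psi>. (\<forall>k. Ck_on k UNIV \<psi>) \<and> compact (closure {x. \<psi> x \<noteq> 0}) \<and> closure {x. \<psi> x \<noteq> 0} \<subseteq> U}"

text \<open>
  $-\Delta u = h$ in \<open>U\<close> in the sense of distributions, for locally integrable \<open>u\<close> and \<open>h\<close>. Local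
  integrability is not part of the definition: below, \<open>u\<close> is continuous and positive and
  \<open>h = f * u powr (- \<gamma>)\<close> with \<open>f\<close> measurable and bounded, so it holds automatically.
\<close>

definition neg_laplacian_distr_eq ::
    "'a::euclidean_space set \<Rightarrow> ('a \<Rightarrow> real) \<Rightarrow> ('a \<Rightarrow> real) \<Rightarrow> bool" where
  "neg_laplacian_distr_eq U u h \<longleftrightarrow>
     (\<forall>\<psi>\<in>test_functions U.
        - (LINT x|lebesgue_on U. u x * laplacian \<psi> x) = (LINT x|lebesgue_on U. h x * \<psi> x))"

definition cone_over :: "'a::euclidean_space set \<Rightarrow> 'a set" where
  "cone_over S = {x. x \<noteq> 0 \<and> x /\<^sub>R norm x \<in> S}"

text \<open>The optimal Lipschitz constant; only meaningful for Lipschitz functions.\<close>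

definition lip_seminorm :: "'a::metric_space set \<Rightarrow> ('a \<Rightarrow> 'b::metric_space) \<Rightarrow> real" where
  "lip_seminorm A F = Sup {dist (F x) (F y) / dist x y | x y. x \<in> A \<and> y \<in> A \<and> x \<noteq> y}"

definition C01_norm :: "'a::metric_space set \<Rightarrow> ('a \<Rightarrow> real) \<Rightarrow> real" where
  "C01_norm A g = (SUP x\<in>A. \<bar>g x\<bar>) + lip_seminorm A g"

definition is_gradient_on ::
    "'a::euclidean_space set \<Rightarrow> ('a \<Rightarrow> real) \<Rightarrow> ('a \<Rightarrow> 'a) \<Rightarrow> bool" where
  "is_gradient_on A g G \<longleftrightarrow> (\<forall>x\<in>A. (g has_derivative (\<lambda>h. G x \<bullet> h)) (at x within A))"

text \<open>
  On the annulus, which is bounded, membership of \<open>g\<close> in $C^{1,1}$ amounts to having a Lipschitz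
  gradient; \<open>K\<close> is the best Lipschitz constant of that gradient.
\<close>

definition C11_epigraphical_cone ::
    "((real ^ 'm) \<times> real) set \<Rightarrow> real \<Rightarrow> real \<Rightarrow> bool" where
  "C11_epigraphical_cone C L K \<longleftrightarrow>
     (\<exists>(g :: real ^ 'm \<Rightarrow> real) G. let A = ball 0 2 - ball 0 1 in
        (\<forall>t\<ge>0. \<forall>x'. g (t *\<^sub>R x') = t * g x') \<and>
        C = {(x', x\<^sub>n). x\<^sub>n > g x'} \<and>
        is_gradient_on A g G \<and> (\<exists>M. M-lipschitz_on A G) \<and>
        L = C01_norm A g \<and> K = lip_seminorm A G)"

definition radial_ext :: "('a::euclidean_space \<Rightarrow> real) \<Rightarrow> 'a \<Rightarrow> real" where
  "radial_ext w x = w (x /\<^sub>R norm x)"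

text \<open>
  The Laplace--Beltrami operator of the unit sphere, computed as the restriction to the sphere of the
  Euclidean Laplacian of the extension that is homogeneous of degree 0.
\<close>

definition sphere_laplacian :: "('a::euclidean_space \<Rightarrow> real) \<Rightarrow> 'a \<Rightarrow> real" where
  "sphere_laplacian w x = laplacian (radial_ext w) x"

text \<open>
  \<open>S\<close> is a relatively open subset of the unit sphere. Eigenfunctions are classical: $C^2$ in \<open>S\<close> and
  continuous up to the boundary. For domains with regular boundary, such as those cut out by
  $C^{1,1}$ epigraphical cones, these are exactly the weak ($H^1_0$) eigenfunctions. That \<open>w\<close> is
  $C^2$ on \<open>S\<close> is expressed through its degree-0 extension to the open cone over \<open>S\<close>.
\<close>

definition dirichlet_eigenvalue :: "'a::euclidean_space set \<Rightarrow> real \<Rightarrow> bool" where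
  "dirichlet_eigenvalue S \<mu> \<longleftrightarrow>
     (\<exists>w. continuous_on (closure S) w \<and>
          (\<forall>x \<in> top_of_set (sphere 0 1) frontier_of S. w x = 0) \<and>
          (\<exists>x\<in>S. w x \<noteq> 0) \<and>
          Ck_on 2 (cone_over S) (radial_ext w) \<and>
          (\<forall>x\<in>S. - sphere_laplacian w x = \<mu> * w x))"

definition first_dirichlet_eigenvalue :: "'a::euclidean_space set \<Rightarrow> real \<Rightarrow> bool" where
  "first_dirichlet_eigenvalue S \<mu> \<longleftrightarrow>
     dirichlet_eigenvalue S \<mu> \<and> (\<forall>\<nu>. dirichlet_eigenvalue S \<nu> \<longrightarrow> \<mu> \<le> \<nu>)"

definition is_frequency :: "'a::euclidean_space set \<Rightarrow> real \<Rightarrow> bool" where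
  "is_frequency S \<phi> \<longleftrightarrow>
     (\<exists>\<mu>. first_dirichlet_eigenvalue S \<mu> \<and> \<phi> > 0 \<and> \<phi> * (\<phi> + real DIM('a) - 2) = \<mu>)"

definition singular_solution ::
    "'a::euclidean_space set \<Rightarrow> real \<Rightarrow> ('a \<Rightarrow> real) \<Rightarrow> ('a \<Rightarrow> real) \<Rightarrow> bool" where
  "singular_solution C \<gamma> f u \<longleftrightarrow>
     continuous_on ((C \<inter> ball 0 1) \<union> (ball 0 1 \<inter> frontier C)) u \<and>
     (\<forall>x \<in> C \<inter> ball 0 1. u x > 0) \<and>
     (\<forall>x \<in> ball 0 1 \<inter> frontier C. u x = 0) \<and>
     neg_laplacian_distr_eq (C \<inter> ball 0 1) u (\<lambda>x. f x * u x powr (- \<gamma>))"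

end

theory Submission imports Defs "HOL-Library.Diagonal_Subsequence" begin

text \<open>
  The cone carries a positive harmonic function \<open>h\<close>, homogeneous of some degree \<open>\<beta>\<close> and vanishing on
  the boundary; its restriction to the sphere is a Dirichlet eigenfunction, so \<open>\<beta>\<close> is at least the
  frequency $\varphi = 2/(1+\gamma)$. Solutions are compared through
  $-\Delta(u - v) = f (u^{-\gamma} - v^{-\gamma})$, whose right-hand side is nonpositive where
  $u \ge v$.
  Away from the vertex, exterior ball barriers bound $|u - v|$ by a multiple of the distance $d$ to
  the boundary, while the subsolutions $A (\rho^2 - |y - x|^2)^{\varphi}$ give $v \ge c\, d^{\varphi}$
  with $\varphi < 1$; so $u/v \to 1$ there. At the vertex, comparison with
  $(1 + \varepsilon) v + C h$ gives $u \le (1 + \varepsilon) v + C h$, and $h/v \to 0$ because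
  $\varepsilon_0 h (-\ln |x|)^{\varphi/2}$ is a subsolution; the logarithm is what makes the critical
  case $\beta = \varphi$ work.
\<close>

section \<open>Functions with a continuous Laplacian\<close>

text \<open>The frequency hypothesis speaks of eigenfunctions with no prescribed sign or boundary
  rate. So \<open>h\<close> is built from the cone alone, and minimality of the first eigenvalue
  enters as \<open>\<phi> * (\<phi> + n - 2) \<le> \<beta> * (\<beta> + n - 2)\<close>, that is,
  \<open>\<phi> \<le> \<beta>\<close>. The exponent \<phi>/2 = 1/(1+\<gamma>) of the logarithm l =
  -ln |x| is forced: minus the Laplacian of h l^a is of order l^(a-1), the right-hand side of the
  equation allows l^(-a \<gamma>), and the two agree exactly for this a. The factor 1 + \<epsilon>
  stands in for a Hopf lemma. A bound of h from below by the distance would be needed at the rim of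
  the cap |x| = 1/3 if u were compared with v + C h; but near the rim u is already at most (1 +
  \<epsilon>) v, and C h has to dominate only on a compact part of the cap, where h is bounded
  below. Since u and v are merely continuous and f merely measurable, every comparison runs through
  a single minimum principle for continuous functions with a one-sided mean value property.\<close>

text \<open>Function, gradient and Laplacian together are closed under sums, products and
  composition with scalar functions: the rules for these never mention the Hessian, which is
  therefore hidden in an existential. Its continuity is asked column by column, so no space of
  linear operators has to be topologised.\<close>

definition has_grad_lap ::
    "'a::euclidean_space set \<Rightarrow> ('a \<Rightarrow> real) \<Rightarrow> ('a \<Rightarrow> 'a) \<Rightarrow> ('a \<Rightarrow> real) \<Rightarrow> bool" where
  "has_grad_lap U F G L \<longleftrightarrow> open U \<and>
     (\<forall>x\<in>U. (F has_derivative (\<lambda>h. G x \<bullet> h)) (at x)) \<and>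
     (\<exists>H. (\<forall>x\<in>U. (G has_derivative H x) (at x)) \<and>
          (\<forall>b\<in>Basis. continuous_on U (\<lambda>x. H x b)) \<and>
          (\<forall>x\<in>U. L x = (\<Sum>b\<in>Basis. H x b \<bullet> b)))"

lemma has_grad_lapI:
  assumes "open U" "\<And>x. x \<in> U \<Longrightarrow> (F has_derivative (\<lambda>h. G x \<bullet> h)) (at x)"
    "\<And>x. x \<in> U \<Longrightarrow> (G has_derivative H x) (at x)"
    "\<And>b. b \<in> Basis \<Longrightarrow> continuous_on U (\<lambda>x. H x b)"
    "\<And>x. x \<in> U \<Longrightarrow> L x = (\<Sum>b\<in>Basis. H x b \<bullet> b)"
  shows "has_grad_lap U F G L"
  unfolding has_grad_lap_def using assms by blast

lemma has_grad_lap_open: "has_grad_lap U F G L \<Longrightarrow> open U"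
  and has_grad_lap_derivative:
    "has_grad_lap U F G L \<Longrightarrow> x \<in> U \<Longrightarrow> (F has_derivative (\<lambda>h. G x \<bullet> h)) (at x)"
  by (auto simp: has_grad_lap_def)

lemma has_grad_lap_continuous_on: "has_grad_lap U F G L \<Longrightarrow> continuous_on U F"
  by (metis continuous_at_imp_continuous_on has_derivative_continuous has_grad_lap_derivative)

lemma has_grad_lap_continuous_on_grad: "has_grad_lap U F G L \<Longrightarrow> continuous_on U G"
  unfolding has_grad_lap_def
  by (meson continuous_at_imp_continuous_on has_derivative_continuous)

lemma has_grad_lap_continuous_on_lap:
  assumes "has_grad_lap U F G L"
  shows "continuous_on U L"
proof -
  obtain H where "\<forall>x\<in>U. (G has_derivative H x) (at x)"
    and H: "\<forall>b\<in>Basis. continuous_on U (\<lambda>x. H x b)" "\<forall>x\<in>U. L x = (\<Sum>b\<in>Basis. H x b \<bullet> b)"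
    using assms unfolding has_grad_lap_def by blast
  have "continuous_on U (\<lambda>x. \<Sum>b\<in>Basis. H x b \<bullet> b)"
    using H(1) by (intro continuous_intros) auto
  then show ?thesis using H(2) by (simp cong: continuous_on_cong)
qed

lemma has_grad_lap_cong:
  assumes "has_grad_lap U F G L" and "\<And>x. x \<in> U \<Longrightarrow> F x = F' x" and "\<And>x. x \<in> U \<Longrightarrow> G x = G' x"
    and "\<And>x. x \<in> U \<Longrightarrow> L x = L' x"
  shows "has_grad_lap U F' G' L'"
proof -
  obtain H where U: "open U" and F: "\<forall>x\<in>U. (F has_derivative (\<lambda>h. G x \<bullet> h)) (at x)"
    and H: "\<forall>x\<in>U. (G has_derivative H x) (at x)" 
     "\<forall>b\<in>Basis. continuous_on U (\<lambda>x. H x b)" "\<forall>x\<in>U. L x = (\<Sum>b\<in>Basis. H x b \<bullet> b)"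
    using assms(1) unfolding has_grad_lap_def by blast
  show ?thesis
  proof (rule has_grad_lapI[OF U])
    show "(F' has_derivative (\<lambda>h. G' x \<bullet> h)) (at x)" if "x \<in> U" for x
      using has_derivative_transform_within_open[OF F[rule_format, OF that] U that] assms that by auto
    show "(G' has_derivative H x) (at x)" if "x \<in> U" for x
      using has_derivative_transform_within_open[OF H(1)[rule_format, OF that] U that] assms that by auto
  qed (use H assms in auto)
qed

lemma has_grad_lap_subset: "has_grad_lap U F G L \<Longrightarrow> open V \<Longrightarrow> V \<subseteq> U \<Longrightarrow> has_grad_lap V F G L"
  unfolding has_grad_lap_def by (meson continuous_on_subset subsetD)

lemma has_grad_lap_const: "open U \<Longrightarrow> has_grad_lap U (\<lambda>x. c) (\<lambda>x. 0) (\<lambda>x. 0)"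
  by (rule has_grad_lapI[where H="\<lambda>x h. 0"]) auto

lemma has_grad_lap_inner: "open U \<Longrightarrow> has_grad_lap U (\<lambda>x. a \<bullet> x) (\<lambda>x. a) (\<lambda>x. 0)"
  by (rule has_grad_lapI[where H="\<lambda>x h. 0"]) (auto intro!: derivative_eq_intros)

lemma has_grad_lap_norm_sq:
  fixes c :: "'a::euclidean_space"
  shows "open U \<Longrightarrow> has_grad_lap U (\<lambda>x. (norm (x - c))\<^sup>2) (\<lambda>x. 2 *\<^sub>R (x - c)) (\<lambda>x. 2 * real DIM('a))"
  by (rule has_grad_lapI[where H="\<lambda>x h. 2 *\<^sub>R h"])
    (auto intro!: derivative_eq_intros simp: power2_norm_eq_inner inner_commute algebra_simps)

lemma has_grad_lap_mult:
  assumes "has_grad_lap U F G L" "has_grad_lap U F' G' L'"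
  shows "has_grad_lap U (\<lambda>x. F x * F' x) (\<lambda>x. F x *\<^sub>R G' x + F' x *\<^sub>R G x)
           (\<lambda>x. F x * L' x + 2 * (G x \<bullet> G' x) + F' x * L x)"
proof -
  obtain H where U: "open U" and F: "\<forall>x\<in>U. (F has_derivative (\<lambda>h. G x \<bullet> h)) (at x)"
    and H: "\<forall>x\<in>U. (G has_derivative H x) (at x)" 
     "\<forall>b\<in>Basis. continuous_on U (\<lambda>x. H x b)" "\<forall>x\<in>U. L x = (\<Sum>b\<in>Basis. H x b \<bullet> b)"
    using assms(1) unfolding has_grad_lap_def by blast
  obtain H' where F': "\<forall>x\<in>U. (F' has_derivative (\<lambda>h. G' x \<bullet> h)) (at x)"
    and H': "\<forall>x\<in>U. (G' has_derivative H' x) (at x)" 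
     "\<forall>b\<in>Basis. continuous_on U (\<lambda>x. H' x b)" "\<forall>x\<in>U. L' x = (\<Sum>b\<in>Basis. H' x b \<bullet> b)"
    using assms(2) unfolding has_grad_lap_def by blast
  note cont = assms[THEN has_grad_lap_continuous_on] assms[THEN has_grad_lap_continuous_on_grad]
  show ?thesis
  proof (rule has_grad_lapI[OF U, where H="\<lambda>x h. F x *\<^sub>R H' x h + (G x \<bullet> h) *\<^sub>R G' x 
                   + (F' x *\<^sub>R H x h + (G' x \<bullet> h) *\<^sub>R G x)"])
    show "((\<lambda>x. F x * F' x) has_derivative (\<lambda>h. (F x *\<^sub>R G' x + F' x *\<^sub>R G x) \<bullet> h)) (at x)" if "x \<in> U" for x
      using F[rule_format, OF that] F'[rule_format, OF that]
      by (auto intro!: derivative_eq_intros simp: inner_left_distrib)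
    show "((\<lambda>x. F x *\<^sub>R G' x + F' x *\<^sub>R G x) has_derivative 
        (\<lambda>h. F x *\<^sub>R H' x h + (G x \<bullet> h) *\<^sub>R G' x + (F' x *\<^sub>R H x h + (G' x \<bullet> h) *\<^sub>R G x))) (at x)" if "x \<in> U" for x
      using F[rule_format, OF that] F'[rule_format, OF that] H(1)[rule_format, OF that] H'(1)[rule_format, OF that]
      by (auto intro!: derivative_eq_intros)
    show "continuous_on U (\<lambda>x. F x *\<^sub>R H' x b + (G x \<bullet> b) *\<^sub>R G' x + (F' x *\<^sub>R H x b + (G' x \<bullet> b) *\<^sub>R G x))"
      if "b \<in> Basis" for b
      using H(2) H'(2) that by (intro continuous_intros cont) auto
    show "F x * L' x + 2 * (G x \<bullet> G' x) + F' x * L x =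
         (\<Sum>b\<in>Basis. (F x *\<^sub>R H' x b + (G x \<bullet> b) *\<^sub>R G' x + (F' x *\<^sub>R H x b + (G' x \<bullet> b) *\<^sub>R G x)) \<bullet> b)"
      if "x \<in> U" for x
    proof -
      have e: "G x \<bullet> G' x = (\<Sum>b\<in>Basis. (G x \<bullet> b) * (G' x \<bullet> b))"
        by (rule euclidean_inner)
      show ?thesis
        using H(3) H'(3) that
        by (simp add: e inner_left_distrib sum.distrib sum_distrib_left mult_ac)
    qed
  qed
qed

lemma has_grad_lap_chain:
  assumes "has_grad_lap U F G L"
    and "\<And>x. x \<in> U \<Longrightarrow> (\<phi> has_real_derivative \<phi>' (F x)) (at (F x))"
    and "\<And>x. x \<in> U \<Longrightarrow> (\<phi>' has_real_derivative \<phi>'' (F x)) (at (F x))"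
    and "continuous_on U (\<lambda>x. \<phi>'' (F x))"
  shows "has_grad_lap U (\<lambda>x. \<phi> (F x)) (\<lambda>x. \<phi>' (F x) *\<^sub>R G x)
           (\<lambda>x. \<phi>'' (F x) * (norm (G x))\<^sup>2 + \<phi>' (F x) * L x)"
proof -
  obtain H where U: "open U" and F: "\<forall>x\<in>U. (F has_derivative (\<lambda>h. G x \<bullet> h)) (at x)"
    and H: "\<forall>x\<in>U. (G has_derivative H x) (at x)" 
     "\<forall>b\<in>Basis. continuous_on U (\<lambda>x. H x b)" "\<forall>x\<in>U. L x = (\<Sum>b\<in>Basis. H x b \<bullet> b)"
    using assms(1) unfolding has_grad_lap_def by blast
  have d: "((\<lambda>x. \<phi>' (F x)) has_derivative (\<lambda>h. \<phi>'' (F x) * (G x \<bullet> h))) (at x)" if "x \<in> U" for x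
    using has_derivative_compose[OF F[rule_format, OF that] assms(3)[OF that, unfolded has_field_derivative_def]] 
    by (simp add: mult.commute)
  have c1: "continuous_on U (\<lambda>x. \<phi>' (F x))"
    using d by (auto intro!: continuous_at_imp_continuous_on has_derivative_continuous)
  note cont = assms(1)[THEN has_grad_lap_continuous_on] assms(1)[THEN has_grad_lap_continuous_on_grad] c1 assms(4)
  show ?thesis
  proof (rule has_grad_lapI[OF U, where H="\<lambda>x h. \<phi>' (F x) *\<^sub>R H x h + (\<phi>'' (F x) * (G x \<bullet> h)) *\<^sub>R G x"])
    show "((\<lambda>x. \<phi> (F x)) has_derivative (\<lambda>h. (\<phi>' (F x) *\<^sub>R G x) \<bullet> h)) (at x)" if "x \<in> U" for x
      using has_derivative_compose[OF F[rule_format, OF that] assms(2)[OF that, unfolded has_field_derivative_def]] 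
      by (simp add: mult.commute)
    show "((\<lambda>x. \<phi>' (F x) *\<^sub>R G x) has_derivative 
        (\<lambda>h. \<phi>' (F x) *\<^sub>R H x h + (\<phi>'' (F x) * (G x \<bullet> h)) *\<^sub>R G x)) (at x)" if "x \<in> U" for x
      using d[OF that] H(1)[rule_format, OF that]
      by (auto intro!: derivative_eq_intros)
    show "continuous_on U (\<lambda>x. \<phi>' (F x) *\<^sub>R H x b + (\<phi>'' (F x) * (G x \<bullet> b)) *\<^sub>R G x)" if "b \<in> Basis" for b
      using H(2) that by (intro continuous_intros cont) auto
    show "\<phi>'' (F x) * (norm (G x))\<^sup>2 + \<phi>' (F x) * L x = 
       (\<Sum>b\<in>Basis. (\<phi>' (F x) *\<^sub>R H x b + (\<phi>'' (F x) * (G x \<bullet> b)) *\<^sub>R G x) \<bullet> b)" if "x \<in> U" for x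
    proof -
      have e: "(norm (G x))\<^sup>2 = (\<Sum>b\<in>Basis. (G x \<bullet> b) * (G x \<bullet> b))"
        unfolding power2_norm_eq_inner by (rule euclidean_inner)
      show ?thesis
        using H(3) that
        by (simp add: e inner_left_distrib sum.distrib sum_distrib_left mult_ac)
    qed
  qed
qed

lemma has_grad_lap_add:
  assumes "has_grad_lap U F G L" "has_grad_lap U F' G' L'"
  shows "has_grad_lap U (\<lambda>x. F x + F' x) (\<lambda>x. G x + G' x) (\<lambda>x. L x + L' x)"
proof -
  obtain H where U: "open U" and F: "\<forall>x\<in>U. (F has_derivative (\<lambda>h. G x \<bullet> h)) (at x)"
    and H: "\<forall>x\<in>U. (G has_derivative H x) (at x)" 
     "\<forall>b\<in>Basis. continuous_on U (\<lambda>x. H x b)" "\<forall>x\<in>U. L x = (\<Sum>b\<in>Basis. H x b \<bullet> b)"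
    using assms(1) unfolding has_grad_lap_def by blast
  obtain H' where F': "\<forall>x\<in>U. (F' has_derivative (\<lambda>h. G' x \<bullet> h)) (at x)"
    and H': "\<forall>x\<in>U. (G' has_derivative H' x) (at x)" 
     "\<forall>b\<in>Basis. continuous_on U (\<lambda>x. H' x b)" "\<forall>x\<in>U. L' x = (\<Sum>b\<in>Basis. H' x b \<bullet> b)"
    using assms(2) unfolding has_grad_lap_def by blast
  show ?thesis
  proof (rule has_grad_lapI[OF U, where H="\<lambda>x h. H x h + H' x h"])
    show "((\<lambda>x. F x + F' x) has_derivative (\<lambda>h. (G x + G' x) \<bullet> h)) (at x)" if "x \<in> U" for x
      using F[rule_format, OF that] F'[rule_format, OF that]
      by (auto intro!: derivative_eq_intros simp: inner_left_distrib)
    show "((\<lambda>x. G x + G' x) has_derivative (\<lambda>h. H x h + H' x h)) (at x)" if "x \<in> U" for x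
      using H(1)[rule_format, OF that] H'(1)[rule_format, OF that]
      by (auto intro!: derivative_eq_intros)
  qed (use H H' in \<open>auto intro!: continuous_intros simp: inner_left_distrib sum.distrib\<close>)
qed

lemma has_grad_lap_cmult:
  assumes "has_grad_lap U F G L"
  shows "has_grad_lap U (\<lambda>x. c * F x) (\<lambda>x. c *\<^sub>R G x) (\<lambda>x. c * L x)"
  using has_grad_lap_mult[OF has_grad_lap_const[OF has_grad_lap_open[OF assms]] assms, of c]
  by simp

lemma has_grad_lap_diff:
  assumes "has_grad_lap U F G L" "has_grad_lap U F' G' L'"
  shows "has_grad_lap U (\<lambda>x. F x - F' x) (\<lambda>x. G x - G' x) (\<lambda>x. L x - L' x)"
  using has_grad_lap_add[OF assms(1) has_grad_lap_cmult[OF assms(2), of "-1"]] by simp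

lemma has_grad_lap_pderivative:
  assumes "has_grad_lap U F G L" "x \<in> U"
  shows "pderivative b F x = G x \<bullet> b"
  unfolding pderivative_def using frechet_derivative_at[OF has_grad_lap_derivative[OF assms]]
  by metis

lemma has_grad_lap_laplacian:
  assumes "has_grad_lap U F G L" "x \<in> U"
  shows "laplacian F x = L x"
proof -
  obtain H where H: "\<forall>x\<in>U. (G has_derivative H x) (at x)" 
     "\<forall>b\<in>Basis. continuous_on U (\<lambda>x. H x b)" "\<forall>x\<in>U. L x = (\<Sum>b\<in>Basis. H x b \<bullet> b)"
    using assms(1) unfolding has_grad_lap_def by blast
  have "pderivative b (pderivative b F) x = H x b \<bullet> b" for b
  proof -
    have "(pderivative b F has_derivative (\<lambda>h. H x h \<bullet> b)) (at x)"
    proof (rule has_derivative_transform_within_open[OF _ has_grad_lap_open[OF assms(1)] assms(2)])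
      show "((\<lambda>x. G x \<bullet> b) has_derivative (\<lambda>h. H x h \<bullet> b)) (at x)"
        using H(1) assms by (auto intro!: derivative_eq_intros)
    qed (simp add: has_grad_lap_pderivative[OF assms(1)])
    from frechet_derivative_at[OF this] show ?thesis unfolding pderivative_def by metis
  qed
  then show ?thesis using H(3) assms(2) by (simp add: laplacian_def)
qed

lemma has_grad_lap_Ck_on_2:
  assumes "has_grad_lap U F G L"
  shows "Ck_on 2 U F"
proof -
  obtain H where U: "open U" 
    and H: "\<forall>x\<in>U. (G has_derivative H x) (at x)" 
     "\<forall>b\<in>Basis. continuous_on U (\<lambda>x. H x b)" "\<forall>x\<in>U. L x = (\<Sum>b\<in>Basis. H x b \<bullet> b)"
    using assms(1) unfolding has_grad_lap_def by blast
  have d: "(pderivative b F has_derivative (\<lambda>h. H x h \<bullet> b)) (at x)" if "x \<in> U" for x b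
  proof (rule has_derivative_transform_within_open[OF _ U that])
    show "((\<lambda>x. G x \<bullet> b) has_derivative (\<lambda>h. H x h \<bullet> b)) (at x)"
      using H(1) that by (auto intro!: derivative_eq_intros)
  qed (simp add: has_grad_lap_pderivative[OF assms])
  have e: "pderivative c (pderivative b F) x = H x c \<bullet> b" if "x \<in> U" for x b c
    using frechet_derivative_at[OF d[OF that]] unfolding pderivative_def by metis
  have "continuous_on U (pderivative c (pderivative b F))" if "c \<in> Basis" for b c
  proof -
    have "continuous_on U (\<lambda>x. H x c \<bullet> b)" using H(2) that by (intro continuous_intros) auto
    then show ?thesis using e by (simp cong: continuous_on_cong)
  qed
  moreover have "F differentiable (at x)" if "x \<in> U" for x
    using has_grad_lap_derivative[OF assms that] by (auto simp: differentiable_def)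
  moreover have "pderivative b F differentiable (at x)" if "x \<in> U" for b x
    using d[OF that] by (rule differentiableI)
  ultimately show ?thesis
    by (simp add: numeral_2_eq_2)
qed

text \<open>Applying the chain rule to the square of the norm avoids the second derivative of the
  norm itself. The factor \<open>p * (p + DIM - 2)\<close> is the one that links a degree of
  homogeneity to an eigenvalue on the sphere.\<close>

lemma has_grad_lap_norm_powr:
  fixes U :: "'a::euclidean_space set"
  assumes "open U" "0 \<notin> U"
  shows "has_grad_lap U (\<lambda>x. norm x powr p) (\<lambda>x. (p * norm x powr (p - 2)) *\<^sub>R x)
           (\<lambda>x. p * (p + real DIM('a) - 2) * norm x powr (p - 2))"
proof -
  have pos: "0 < (norm x)\<^sup>2" if "x \<in> U" for x :: 'a using assms that by auto
  have eq: "((norm x)\<^sup>2) powr s = norm x powr (2 * s)" for x :: 'a and s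
    by (cases "x = 0") (auto simp: powr_powr simp flip: powr_numeral)
  have "has_grad_lap U (\<lambda>x. ((norm (x - 0))\<^sup>2) powr (p/2)) 
     (\<lambda>x. (p/2 * ((norm (x - 0))\<^sup>2) powr (p/2 - 1)) *\<^sub>R (2 *\<^sub>R (x - 0)))
     (\<lambda>x. (p/2 * (p/2-1) * ((norm (x - 0))\<^sup>2) powr (p/2 - 1 - 1)) * (norm (2 *\<^sub>R (x - 0)))\<^sup>2
        + (p/2 * ((norm (x - 0))\<^sup>2) powr (p/2 - 1)) * (2 * real DIM('a)))"
  proof (rule has_grad_lap_chain[OF has_grad_lap_norm_sq[OF assms(1)], 
      where \<phi>="\<lambda>t. t powr (p/2)" and \<phi>'="\<lambda>t. p/2 * t powr (p/2 - 1)" and \<phi>''="\<lambda>t. p/2 * (p/2-1) * t powr (p/2 - 1 - 1)"])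
    show "continuous_on U (\<lambda>x. p/2 * (p/2-1) * (norm (x - 0))\<^sup>2 powr (p/2 - 1 - 1))"
      using pos by (intro continuous_intros) force
  next
    fix x assume "x \<in> U"
    note p = pos[OF this]
    show "((\<lambda>t. t powr (p/2)) has_real_derivative p/2 * (norm (x - 0))\<^sup>2 powr (p/2 - 1)) (at ((norm (x - 0))\<^sup>2))"
      using has_real_derivative_powr[of "(norm x)\<^sup>2" "p/2"] p by simp
    show "((\<lambda>t. p/2 * t powr (p/2 - 1)) has_real_derivative p/2 * (p/2-1) * (norm (x - 0))\<^sup>2 powr (p/2 - 1 - 1))
        (at ((norm (x - 0))\<^sup>2))"
      using DERIV_cmult[OF has_real_derivative_powr[of "(norm x)\<^sup>2" "p/2-1"], of "p/2"] p by (simp add: mult.assoc)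
  qed
  then show ?thesis
  proof (rule has_grad_lap_cong)
    fix x assume x: "x \<in> U"
    show "(norm (x - 0))\<^sup>2 powr (p/2) = norm x powr p"
      by (simp add: eq)
    show "(p/2 * (norm (x - 0))\<^sup>2 powr (p/2 - 1)) *\<^sub>R (2 *\<^sub>R (x - 0)) = (p * norm x powr (p - 2)) *\<^sub>R x"
      by (simp add: eq right_diff_distrib)
    have n: "norm x powr (p - 4) * (norm x)\<^sup>2 = norm x powr (p - 2)"
      using pos[OF x] by (simp flip: powr_numeral powr_add)
    show "(p/2 * (p/2-1) * ((norm (x - 0))\<^sup>2) powr (p/2 - 1 - 1)) * (norm (2 *\<^sub>R (x - 0)))\<^sup>2
        + (p/2 * ((norm (x - 0))\<^sup>2) powr (p/2 - 1)) * (2 * real DIM('a))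
      = p * (p + real DIM('a) - 2) * norm x powr (p - 2)"
      using n by (simp add: eq right_diff_distrib power_mult_distrib) (simp add: algebra_simps flip: n)
  qed
qed

section \<open>Radial bump functions\<close>

text \<open>The functions exp(-1/s) / s^j, extended by 0, have a span that is closed under
  differentiation (\<open>Phi_derivative\<close>), so smoothness of the bump needs just one
  derivative formula.\<close>

definition Phi :: "nat \<Rightarrow> real \<Rightarrow> real" where
  "Phi j s = (if s \<le> 0 then 0 else exp (- 1 / s) / s ^ j)"

lemma Phi_nonneg: "0 \<le> Phi j s"
  and Phi_pos: "0 < s \<Longrightarrow> 0 < Phi j s"
  and Phi_eq_0: "s \<le> 0 \<Longrightarrow> Phi j s = 0"
  by (auto simp: Phi_def)

lemma Phi_tendsto_0: "(Phi j \<longlongrightarrow> 0) (at 0)"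
proof -
  have "((\<lambda>s::real. exp (- 1 / s) / s ^ j) \<longlongrightarrow> 0) (at_right 0)"
  proof -
    have "((\<lambda>t::real. t ^ j / exp t) \<longlongrightarrow> 0) at_top"
      by (rule tendsto_power_div_exp_0)
    then have "((\<lambda>s::real. inverse s ^ j / exp (inverse s)) \<longlongrightarrow> 0) (at_right 0)"
      by (rule filterlim_compose) (rule filterlim_inverse_at_top_right)
    then show ?thesis by (simp add: exp_minus field_simps)
  qed
  then have r: "(Phi j \<longlongrightarrow> 0) (at_right 0)"
    by (rule Lim_transform_eventually) (auto simp: Phi_def eventually_at_filter)
  have "(Phi j \<longlongrightarrow> 0) (at_left 0)"
    by (rule Lim_transform_eventually[OF tendsto_const]) (auto simp: Phi_def eventually_at_filter)
  with r show ?thesis by (simp add: filterlim_at_split)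
qed

lemma Phi_derivative:
  "(Phi j has_real_derivative Phi (j + 2) s - real j * Phi (j + 1) s) (at s)"
proof -
  consider "s > 0" | "s < 0" | "s = 0" by linarith
  then show ?thesis
  proof cases
    case 1
    have "((\<lambda>s. exp (- 1 / s) / s ^ j) has_real_derivative Phi (j + 2) s - real j * Phi (j + 1) s) (at s)"
    proof (cases j)
      case 0
      with 1 show ?thesis 
        by (auto intro!: derivative_eq_intros simp: Phi_def field_simps power2_eq_square)
    next
      case (Suc k)
      with 1 show ?thesis 
        by (auto intro!: derivative_eq_intros simp: Phi_def divide_simps)
           (cases k; auto simp: algebra_simps power2_eq_square)
    qed
    then show ?thesis
      by (rule has_field_derivative_transform_within_open[of _ _ _ "{0<..}"]) (use 1 in \<open>auto simp: Phi_def\<close>)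
  next
    case 2
    have "((\<lambda>s. 0) has_real_derivative Phi (j + 2) s - real j * Phi (j + 1) s) (at s)"
      using 2 by (simp add: Phi_def)
    then show ?thesis
      by (rule has_field_derivative_transform_within_open[of _ _ _ "{..<0}"]) (use 2 in \<open>auto simp: Phi_def\<close>)
  next
    case 3
    \<comment> \<open>The difference quotient of \<open>Phi j\<close> at 0 is
      \<open>Phi (Suc j)\<close>, which tends to 0.\<close>
    have "(Phi j has_real_derivative 0) (at 0)"
      unfolding has_field_derivative_iff
      by (rule Lim_transform_eventually[OF Phi_tendsto_0[of "Suc j"]])
         (auto simp: Phi_def eventually_at_filter)
    with 3 show ?thesis by (simp add: Phi_def)
  qed
qed

lemma isCont_Phi: "isCont (Phi j) s"
  using Phi_derivative by (rule DERIV_isCont)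

lemma continuous_on_Phi [continuous_intros]:
  "continuous_on S f \<Longrightarrow> continuous_on S (\<lambda>x. Phi j (f x))"
  using continuous_on_compose2[of UNIV "Phi j" S f]
    continuous_at_imp_continuous_on[of UNIV "Phi j"] isCont_Phi by blast

text \<open>A test function must be \<open>Ck_on\<close> for every \<open>k\<close>. Instead of
  tracking iterated derivatives of a bump, it suffices to place it in a set of functions that is
  closed under all directional derivatives; then induction on \<open>k\<close> does the
  rest.\<close>

inductive_set bump_algebra :: "('a::euclidean_space \<Rightarrow> real) set" where
  "(\<lambda>x. c) \<in> bump_algebra"
| "(\<lambda>x. x \<bullet> b) \<in> bump_algebra"
| "(\<lambda>x. Phi j (c - d * (norm (x - a))\<^sup>2)) \<in> bump_algebra"
| "F \<in> bump_algebra \<Longrightarrow> G \<in> bump_algebra \<Longrightarrow> (\<lambda>x. F x + G x) \<in> bump_algebra"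
| "F \<in> bump_algebra \<Longrightarrow> G \<in> bump_algebra \<Longrightarrow> (\<lambda>x. F x * G x) \<in> bump_algebra"

lemma pderivativeI:
  assumes "\<And>x. (F has_derivative D x) (at x)"
  shows "pderivative b F = (\<lambda>x. D x b)"
  unfolding pderivative_def using frechet_derivative_at[OF assms] by (metis ext)

lemma bump_algebra_derivative:
  assumes "F \<in> bump_algebra"
  shows "\<exists>D. (\<forall>x. (F has_derivative D x) (at x)) \<and> (\<forall>b. (\<lambda>x. D x b) \<in> bump_algebra)"
  using assms
proof induction
  case (1 c)
  show ?case by (rule exI[of _ "\<lambda>x h. 0"]) (auto intro: bump_algebra.intros)
next
  case (2 b)
  show ?case by (rule exI[of _ "\<lambda>x h. h \<bullet> b"]) (auto intro!: bump_algebra.intros derivative_eq_intros)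
next
  case (3 j c d a)
  let ?D = "\<lambda>x h. (Phi (j + 2) (c - d * (norm (x - a))\<^sup>2) + (- real j) * Phi (j + 1) (c - d * (norm (x - a))\<^sup>2))
      * ((- 2 * d) * (x \<bullet> h + (- (a \<bullet> h))))"
  have 1: "((\<lambda>x. c - d * (norm (x - a))\<^sup>2) has_derivative (\<lambda>h. (- 2 * d) * (x \<bullet> h + (- (a \<bullet> h))))) (at x)" for x
    by (auto intro!: derivative_eq_intros simp: power2_norm_eq_inner inner_commute algebra_simps)
  have "((\<lambda>x. Phi j (c - d * (norm (x - a))\<^sup>2)) has_derivative ?D x) (at x)" for x
    using has_derivative_compose[OF 1 Phi_derivative[unfolded has_field_derivative_def]] by simp
  moreover have "(\<lambda>x. ?D x b) \<in> bump_algebra" for b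
    by (intro bump_algebra.intros)
  ultimately show ?case by (intro exI[of _ ?D] conjI allI)
next
  case (4 F G)
  then obtain D E where "\<forall>x. (F has_derivative D x) (at x)" "\<forall>b. (\<lambda>x. D x b) \<in> bump_algebra"
    "\<forall>x. (G has_derivative E x) (at x)" "\<forall>b. (\<lambda>x. E x b) \<in> bump_algebra" by auto
  then show ?case
    by (intro exI[of _ "\<lambda>x h. D x h + E x h"]) (auto intro!: bump_algebra.intros derivative_eq_intros)
next
  case (5 F G)
  then obtain D E where *: "\<forall>x. (F has_derivative D x) (at x)" "\<forall>b. (\<lambda>x. D x b) \<in> bump_algebra"
    "\<forall>x. (G has_derivative E x) (at x)" "\<forall>b. (\<lambda>x. E x b) \<in> bump_algebra" by auto
  have "((\<lambda>x. F x * G x) has_derivative (\<lambda>h. F x * E x h + D x h * G x)) (at x)" for x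
    using * by (auto intro!: derivative_eq_intros)
  then show ?case
    using * 5
    by (intro exI[of _ "\<lambda>x h. F x * E x h + D x h * G x"]) (auto intro!: bump_algebra.intros)
qed

lemma bump_algebra_Ck_on: "F \<in> bump_algebra \<Longrightarrow> Ck_on k UNIV F"
proof (induction k arbitrary: F)
  case 0
  from bump_algebra_derivative[OF this] show ?case
    by (auto intro: continuous_at_imp_continuous_on has_derivative_continuous)
next
  case (Suc k)
  obtain D where D: "\<forall>x. (F has_derivative D x) (at x)" "\<forall>b. (\<lambda>x. D x b) \<in> bump_algebra"
    using bump_algebra_derivative[OF Suc.prems] by auto
  have "pderivative b F = (\<lambda>x. D x b)" for b using D by (intro pderivativeI) auto
  then show ?case using D Suc.IH by (auto intro: differentiableI)
qed

definition bump :: "'a::euclidean_space \<Rightarrow> real \<Rightarrow> 'a \<Rightarrow> real" where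
  "bump a r x = Phi 0 (1 - (1 / r\<^sup>2) * (norm (x - a))\<^sup>2)"

definition bump_lap :: "'a::euclidean_space \<Rightarrow> real \<Rightarrow> 'a \<Rightarrow> real" where
  "bump_lap a r x = (4 / r ^ 4) * (norm (x - a))\<^sup>2
        * (Phi 4 (1 - (1 / r\<^sup>2) * (norm (x - a))\<^sup>2) - 2 * Phi 3 (1 - (1 / r\<^sup>2) * (norm (x - a))\<^sup>2))
     - (2 * real DIM('a) / r\<^sup>2) * Phi 2 (1 - (1 / r\<^sup>2) * (norm (x - a))\<^sup>2)"

lemma bump_arg_le_0_iff: "0 < r \<Longrightarrow> 1 - (1 / r\<^sup>2) * (norm (x - a))\<^sup>2 \<le> 0 \<longleftrightarrow> r \<le> norm (x - a)"
  by (simp add: divide_simps)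

lemma bump_nonneg: "0 \<le> bump a r x"
  by (simp add: bump_def Phi_nonneg)

lemma bump_pos: "0 < r \<Longrightarrow> norm (x - a) < r \<Longrightarrow> 0 < bump a r x"
  using bump_arg_le_0_iff[of r x a] unfolding bump_def by (intro Phi_pos) linarith

lemma bump_eq_0: "0 < r \<Longrightarrow> r \<le> norm (x - a) \<Longrightarrow> bump a r x = 0"
  by (simp add: bump_def Phi_eq_0 bump_arg_le_0_iff)

lemma bump_lap_eq_0: "0 < r \<Longrightarrow> r \<le> norm (x - a) \<Longrightarrow> bump_lap a r x = 0"
  by (simp add: bump_lap_def Phi_eq_0 bump_arg_le_0_iff)

lemma has_grad_lap_bump:
  "has_grad_lap UNIV (bump a r)
    (\<lambda>x. (- (2 / r\<^sup>2) * Phi 2 (1 - (1 / r\<^sup>2) * (norm (x - a))\<^sup>2)) *\<^sub>R (x - a)) (bump_lap a r)"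
proof -
  let ?q = "\<lambda>x. 1 - (1 / r\<^sup>2) * (norm (x - a))\<^sup>2"
  have q: "has_grad_lap UNIV ?q (\<lambda>x. 0 - (1 / r\<^sup>2) *\<^sub>R (2 *\<^sub>R (x - a))) (\<lambda>x. 0 - (1 / r\<^sup>2) * (2 * real DIM('a)))"
    by (intro has_grad_lap_diff has_grad_lap_const has_grad_lap_cmult has_grad_lap_norm_sq) auto
  have "has_grad_lap UNIV (\<lambda>x. Phi 0 (?q x)) (\<lambda>x. Phi 2 (?q x) *\<^sub>R (0 - (1 / r\<^sup>2) *\<^sub>R (2 *\<^sub>R (x - a))))
     (\<lambda>x. (Phi 4 (?q x) - 2 * Phi 3 (?q x)) * (norm (0 - (1 / r\<^sup>2) *\<^sub>R (2 *\<^sub>R (x - a))))\<^sup>2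
          + Phi 2 (?q x) * (0 - (1 / r\<^sup>2) * (2 * real DIM('a))))"
    using Phi_derivative[of 0] Phi_derivative[of 2]
    by (intro has_grad_lap_chain[OF q, where \<phi>''="\<lambda>s. Phi 4 s - 2 * Phi 3 s"] continuous_intros)
       (simp_all add: numeral_eq_Suc)
  note main = this
  have eq: "(norm (0 - (1 / r\<^sup>2) *\<^sub>R (2 *\<^sub>R (x - a))))\<^sup>2 = (4 / r ^ 4) * (norm (x - a))\<^sup>2" for x
    by (simp add: power_divide power_mult_distrib flip: power_mult)
  show ?thesis
    by (rule has_grad_lap_cong[OF main[unfolded eq]]) (simp_all add: bump_def bump_lap_def field_simps)
qed

lemma laplacian_bump: "laplacian (bump a r) = bump_lap a r"
  using has_grad_lap_laplacian[OF has_grad_lap_bump] by auto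

lemma continuous_on_bump: "continuous_on S (bump a r)" "continuous_on S (bump_lap a r)"
  unfolding bump_def bump_lap_def by (intro continuous_intros)+

lemma bump_in_test_functions:
  assumes "0 < r" "cball a r \<subseteq> U"
  shows "bump a r \<in> test_functions U"
proof -
  have s: "closure {x. bump a r x \<noteq> 0} \<subseteq> cball a r"
    by (rule closure_minimal) (use bump_eq_0[OF assms(1)] in \<open>force simp: dist_norm norm_minus_commute\<close>)+
  have "bump a r \<in> bump_algebra"
    unfolding bump_def[abs_def] by (intro bump_algebra.intros)
  then show ?thesis
    using s assms(2) bump_algebra_Ck_on bounded_subset[OF bounded_cball s]
    unfolding test_functions_def by (auto simp: compact_eq_bounded_closed)
qed

section \<open>Integration over compact sets and Green's identity for bumps\<close>

lemma set_integrable_compact: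
  fixes f :: "'a::euclidean_space \<Rightarrow> real"
  assumes "compact S" "continuous_on S f"
  shows "set_integrable lborel S f"
  using borel_integrable_compact[OF assms] by (simp add: set_integrable_def)

lemma set_integral_zero_outside:
  fixes f :: "'a::euclidean_space \<Rightarrow> real"
  assumes "S \<subseteq> T" "\<And>x. x \<in> T - S \<Longrightarrow> f x = 0"
  shows "(LINT x:T|lborel. f x) = (LINT x:S|lborel. f x)"
  unfolding set_lebesgue_integral_def
  by (rule Bochner_Integration.integral_cong) (use assms in \<open>auto simp: indicator_def\<close>)

lemma integral_lborel_affine:
  fixes f :: "'a::euclidean_space \<Rightarrow> real"
  assumes "c \<noteq> 0" "f \<in> borel_measurable borel"
  shows "(LINT x|lborel. f x) = \<bar>c\<bar> ^ DIM('a) * (LINT x|lborel. f (t + c *\<^sub>R x))"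
proof -
  have "(LINT x|lborel. f x) = (LINT x|density (distr lborel borel (\<lambda>x. t + c *\<^sub>R x)) (\<lambda>_. ennreal (\<bar>c\<bar>^DIM('a))). f x)"
    by (subst lborel_affine[OF assms(1), of t]) (simp add: ennreal_power)
  also have "\<dots> = \<bar>c\<bar> ^ DIM('a) * (LINT x|lborel. f (t + c *\<^sub>R x))"
    using assms(2) by (simp add: integral_density integral_distr)
  finally show ?thesis .
qed

lemma set_integral_affine_cball:
  fixes f :: "'a::euclidean_space \<Rightarrow> real"
  assumes "0 < r" "continuous_on (cball a r) f"
  shows "(LINT y:cball a r|lborel. f y) = r ^ DIM('a) * (LINT z:cball 0 1|lborel. f (a + r *\<^sub>R z))"
proof -
  have "(\<lambda>x. indicator (cball a r) x *\<^sub>R f x) \<in> borel_measurable borel"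
    using borel_measurable_integrable[OF set_integrable_compact[OF compact_cball assms(2), unfolded set_integrable_def]]
    by simp
  from integral_lborel_affine[OF _ this, of r a] assms(1)
  have "(LINT y:cball a r|lborel. f y) = r ^ DIM('a) *
      (LINT x|lborel. indicator (cball a r) (a + r *\<^sub>R x) *\<^sub>R f (a + r *\<^sub>R x))"
    by (simp add: set_lebesgue_integral_def)
  moreover have "a + r *\<^sub>R x \<in> cball a r \<longleftrightarrow> x \<in> cball 0 1" for x
    using assms(1) by (simp add: dist_norm)
  then have "indicator (cball a r) (a + r *\<^sub>R x) = (indicator (cball 0 1) x :: real)" for x
    by (simp add: indicator_def)
  ultimately show ?thesis by (simp add: set_lebesgue_integral_def)
qed

lemma set_integral_translate:
  fixes f :: "'a::euclidean_space \<Rightarrow> real"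
  assumes "0 < r" "continuous_on (cball (a + t) r) f"
  shows "(LINT y:cball (a + t) r|lborel. f y) = (LINT y:cball a r|lborel. f (y + t))"
proof -
  have c: "continuous_on (cball a r) (\<lambda>y. f (y + t))"
    by (rule continuous_on_compose2[OF assms(2)]) (auto intro!: continuous_intros simp: dist_norm)
  show ?thesis
    unfolding set_integral_affine_cball[OF assms] set_integral_affine_cball[OF assms(1) c]
    by (simp add: algebra_simps)
qed

lemma set_integral_pos:
  fixes f :: "'a::euclidean_space \<Rightarrow> real"
  assumes S: "compact S" "continuous_on S f" "\<And>x. x \<in> S \<Longrightarrow> 0 \<le> f x"
    and x: "x \<in> interior S" "0 < f x"
  shows "0 < (LINT y:S|lborel. f y)"
proof -
  have "isCont f x"
    using S(2) x(1) continuous_on_interior by blast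
  then have "\<forall>\<^sub>F y in at x. f y > f x / 2"
    using x(2) by (intro order_tendstoD(1)[of f "f x"]) (auto simp: isCont_def)
  then obtain e where e: "0 < e" "\<And>y. y \<noteq> x \<Longrightarrow> dist y x < e \<Longrightarrow> f y > f x / 2"
    unfolding eventually_at by auto
  obtain d where d: "0 < d" "ball x d \<subseteq> S"
    using x(1) mem_interior by blast
  define r where "r = min d e / 2"
  have r: "0 < r" "cball x r \<subseteq> S" "\<And>y. y \<in> cball x r \<Longrightarrow> f y \<ge> f x / 2"
  proof -
    show "0 < r" using d e by (simp add: r_def)
    show "cball x r \<subseteq> S" using d e unfolding r_def by (intro subset_trans[OF _ d(2)]) (auto simp: min_def)
    show "f y \<ge> f x / 2" if "y \<in> cball x r" for y
    proof (cases "y = x")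
      case False
      moreover have "dist y x < e" using that d(1) e(1) by (auto simp: dist_commute r_def min_def split: if_splits)
      ultimately show ?thesis using e(2)[of y] by linarith
    qed (use x in auto)
  qed
  have i: "set_integrable lborel (cball x r) (\<lambda>y. f x / 2)"
    by (rule set_integrable_compact) auto
  have "0 < measure lborel (cball x r) * (f x / 2)"
    using r x content_cball_pos[OF r(1), of x] by simp
  also have "\<dots> = (LINT y:cball x r|lborel. f x / 2)"
    by (simp add: set_lebesgue_integral_def)
  also have "\<dots> \<le> (LINT y:S|lborel. f y)"
    using i set_integrable_compact[OF S(1,2)] r(2,3) S(3)
    unfolding set_lebesgue_integral_def set_integrable_def
    by (intro integral_mono) (auto simp: indicator_def)
  finally show ?thesis .
qed

text \<open>Differentiation under the integral sign. By the mean value theorem the maximum of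
  \<open>g'\<close> over the compact set \<open>{p..q} \<times> S\<close> bounds all difference
  quotients and serves as the dominating constant.\<close>

lemma set_integral_has_real_derivative:
  fixes g :: "real \<Rightarrow> 'a::euclidean_space \<Rightarrow> real"
  assumes S: "compact S" and t0: "p < t0" "t0 < q"
    and g: "\<And>t. t \<in> {p..q} \<Longrightarrow> continuous_on S (g t)"
    and g': "continuous_on ({p..q} \<times> S) (\<lambda>(t, y). g' t y)"
    and d: "\<And>t y. t \<in> {p..q} \<Longrightarrow> y \<in> S \<Longrightarrow> ((\<lambda>t. g t y) has_real_derivative g' t y) (at t)"
  shows "((\<lambda>t. LINT y:S|lborel. g t y) has_real_derivative (LINT y:S|lborel. g' t0 y)) (at t0)"
proof -
  have c': "continuous_on S (g' t)" if "t \<in> {p..q}" for t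
  proof -
    have "continuous_on S (\<lambda>y. case (t, y) of (t, y) \<Rightarrow> g' t y)"
      by (rule continuous_on_compose2[OF g']) (use that in \<open>auto intro!: continuous_intros\<close>)
    then show ?thesis by simp
  qed
  have "compact ((\<lambda>(t, y). g' t y) ` ({p..q} \<times> S))"
    by (intro compact_continuous_image g' compact_Times S) auto
  then obtain B where "\<forall>t\<in>{p..q}. \<forall>y\<in>S. \<bar>g' t y\<bar> \<le> B"
    by (auto dest!: compact_imp_bounded simp: bounded_iff)
  then have B: "\<And>t y. t \<in> {p..q} \<Longrightarrow> y \<in> S \<Longrightarrow> \<bar>g' t y\<bar> \<le> B" by blast
  have lip: "\<bar>(g t y - g t0 y) / (t - t0)\<bar> \<le> B" if "t \<in> {p..q}" "t \<noteq> t0" "y \<in> S" for t y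
  proof -
    have "norm (g t y - g t0 y) \<le> B * norm (t - t0)"
      using t0 that B
      by (intro field_differentiable_bound[of "{p..q}" "\<lambda>t. g t y" "\<lambda>t. g' t y"])
        (use d in \<open>auto intro: has_field_derivative_at_within\<close>)
    then show ?thesis using that by (simp add: divide_simps mult.commute abs_divide)
  qed
  show ?thesis
    unfolding has_field_derivative_iff tendsto_at_iff_sequentially
  proof (intro allI impI)
    fix X :: "nat \<Rightarrow> real" assume X: "\<forall>i. X i \<in> UNIV - {t0}" "X \<longlonglongrightarrow> t0"
    from X(2) t0 have "\<forall>\<^sub>F i in sequentially. X i \<in> {p<..<q}"
      by (intro topological_tendstoD) auto
    then obtain N where N: "\<And>i. i \<ge> N \<Longrightarrow> X i \<in> {p..q}"
      by (force simp: eventually_sequentially)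
    define Y where "Y i = X (i + N)" for i
    have Y: "Y i \<in> {p..q}" "Y i \<noteq> t0" for i using N X by (auto simp: Y_def)
    have Yl: "Y \<longlonglongrightarrow> t0" unfolding Y_def using X(2) by (rule LIMSEQ_ignore_initial_segment)
    have eq: "((LINT y:S|lborel. g (Y i) y) - (LINT y:S|lborel. g t0 y)) / (Y i - t0)
        = (LINT y:S|lborel. (g (Y i) y - g t0 y) / (Y i - t0))" for i
    proof -
      have "set_integrable lborel S (g (Y i))" "set_integrable lborel S (g t0)"
        using Y t0 by (auto intro!: set_integrable_compact S g)
      then show ?thesis by (subst set_integral_diff(2)[symmetric]) auto
    qed
    have "(\<lambda>i. LINT y:S|lborel. (g (Y i) y - g t0 y) / (Y i - t0)) \<longlonglongrightarrow> (LINT y:S|lborel. g' t0 y)"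
      unfolding set_lebesgue_integral_def
    proof (rule integral_dominated_convergence[where w="\<lambda>y. indicator S y *\<^sub>R B"])
      have "set_integrable lborel S (g' t0)" using c' t0 by (intro set_integrable_compact S) auto
      then show "(\<lambda>y. indicator S y *\<^sub>R g' t0 y) \<in> borel_measurable lborel"
        by (auto simp: set_integrable_def)
      have "set_integrable lborel S (\<lambda>y. (g (Y i) y - g t0 y) / (Y i - t0))" for i
        using Y t0 by (intro set_integrable_compact S continuous_intros g) auto
      then show "(\<lambda>y. indicator S y *\<^sub>R ((g (Y i) y - g t0 y) / (Y i - t0))) \<in> borel_measurable lborel" for i
        by (auto simp: set_integrable_def)
      have "set_integrable lborel S (\<lambda>y. B)" by (intro set_integrable_compact S) auto
      then show "integrable lborel (\<lambda>y. indicator S y *\<^sub>R B)" by (simp add: set_integrable_def)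
      show "AE y in lborel. norm (indicator S y *\<^sub>R ((g (Y i) y - g t0 y) / (Y i - t0))) \<le> indicator S y *\<^sub>R B" for i
        using lip[OF Y] by (auto simp: indicator_def)
      have "(\<lambda>i. (g (Y i) y - g t0 y) / (Y i - t0)) \<longlonglongrightarrow> g' t0 y" if "y \<in> S" for y
      proof -
        have "((\<lambda>t. (g t y - g t0 y) / (t - t0)) \<longlongrightarrow> g' t0 y) (at t0)"
          using d[of t0 y] t0 that by (simp add: has_field_derivative_iff)
        then show ?thesis using Y Yl unfolding tendsto_at_iff_sequentially comp_def by auto
      qed
      then show "AE y in lborel. (\<lambda>i. indicator S y *\<^sub>R ((g (Y i) y - g t0 y) / (Y i - t0)))
           \<longlonglongrightarrow> indicator S y *\<^sub>R g' t0 y"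
        by (auto simp: indicator_def)
    qed
    then have "(\<lambda>i. ((LINT y:S|lborel. g (Y i) y) - (LINT y:S|lborel. g t0 y)) / (Y i - t0))
       \<longlonglongrightarrow> (LINT y:S|lborel. g' t0 y)"
      by (simp add: eq)
    then show "((\<lambda>t. ((LINT y:S|lborel. g t y) - (LINT y:S|lborel. g t0 y)) / (t - t0)) \<circ> X)
        \<longlonglongrightarrow> (LINT y:S|lborel. g' t0 y)"
      unfolding Y_def comp_def by (rule LIMSEQ_offset)
  qed
qed

lemma eventually_line_in_open:
  fixes x b :: "'a::real_normed_vector"
  assumes "open A" "x \<in> A"
  shows "\<forall>\<^sub>F t in nhds 0. x + t *\<^sub>R b \<in> A"
proof -
  have "isCont (\<lambda>t. x + t *\<^sub>R b) 0" by (intro continuous_intros)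
  then have "((\<lambda>t. x + t *\<^sub>R b) \<longlongrightarrow> x) (nhds 0)"
    by (simp add: isCont_def tendsto_nhds_iff)
  then show ?thesis using assms by (rule topological_tendstoD)
qed

text \<open>The integral of a compactly supported function does not change under translation by
  \<open>t *\<^sub>R b\<close>; differentiating in \<open>t\<close> at 0 gives the claim.\<close>

lemma set_integral_directional_derivative_zero:
  fixes f :: "'a::euclidean_space \<Rightarrow> real"
  assumes "0 < r" and f: "continuous_on UNIV f" and f': "continuous_on UNIV f'"
    and 0: "\<And>x. x \<notin> cball a r \<Longrightarrow> f x = 0"
    and d: "\<And>x. ((\<lambda>t. f (x + t *\<^sub>R b)) has_real_derivative f' x) (at 0)"
  shows "(LINT y:cball a r|lborel. f' y) = 0"
proof -
  \<comment> \<open>Large enough that the ball of radius \<open>R\<close>, translated by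
    \<open>t *\<^sub>R b\<close> with |t| < 1, still contains the support.\<close>
  define R where "R = r + norm b"
  have R: "0 < R" using assms by (simp add: R_def add_pos_nonneg)
  have f'0: "f' x = 0" if "x \<notin> cball a r" for x
  proof (rule DERIV_unique[OF d])
    have "\<forall>\<^sub>F t in nhds 0. x + t *\<^sub>R b \<in> - cball a r"
      using that by (intro eventually_line_in_open) auto
    then have "\<forall>\<^sub>F t in nhds 0. f (x + t *\<^sub>R b) = 0"
      by eventually_elim (auto simp: 0)
    then show "((\<lambda>t. f (x + t *\<^sub>R b)) has_real_derivative 0) (at 0)"
      using DERIV_cong_ev[of 0 0 "\<lambda>t. f (x + t *\<^sub>R b)" "\<lambda>t. 0" 0 0] by simp
  qed
  have d': "((\<lambda>t. f (x + t *\<^sub>R b)) has_real_derivative f' (x + s *\<^sub>R b)) (at s)" for x s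
    using d[of "x + s *\<^sub>R b"] DERIV_shift[of "\<lambda>t. f (x + t *\<^sub>R b)" "f' (x + s *\<^sub>R b)" 0 s]
    by (simp add: algebra_simps)
  have "((\<lambda>t. LINT y:cball a R|lborel. f (y + t *\<^sub>R b)) has_real_derivative
          (LINT y:cball a R|lborel. f' (y + 0 *\<^sub>R b))) (at 0)"
  proof (rule set_integral_has_real_derivative[where p="-1" and q=1 and g'="\<lambda>t y. f' (y + t *\<^sub>R b)"])
    show "continuous_on (cball a R) (\<lambda>y. f (y + t *\<^sub>R b))" for t
      by (rule continuous_on_compose2[OF f]) (auto intro!: continuous_intros)
    show "continuous_on ({-1..1} \<times> cball a R) (\<lambda>(t, y). f' (y + t *\<^sub>R b))"
      unfolding case_prod_beta
      by (rule continuous_on_compose2[OF f']) (auto intro!: continuous_intros)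
  qed (auto intro: d')
  moreover have "(LINT y:cball a R|lborel. f (y + t *\<^sub>R b)) = (LINT y:cball a r|lborel. f y)" if "t \<in> {-1<..<1}" for t
  proof -
    have tb: "norm (t *\<^sub>R b) \<le> norm b" using that by (auto simp: mult_left_le_one_le)
    have "(LINT y:cball a R|lborel. f (y + t *\<^sub>R b)) = (LINT y:cball (a + t *\<^sub>R b) R|lborel. f y)"
      by (rule set_integral_translate[symmetric]) (use R f in \<open>auto intro: continuous_on_subset\<close>)
    also have "\<dots> = (LINT y:cball a r|lborel. f y)"
    proof (rule set_integral_zero_outside)
      show "cball a r \<subseteq> cball (a + t *\<^sub>R b) R"
      proof
        fix x assume "x \<in> cball a r"
        then have "dist (a + t *\<^sub>R b) x \<le> dist (a + t *\<^sub>R b) a + r"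
          using dist_triangle[of "a + t *\<^sub>R b" x a] by simp
        then show "x \<in> cball (a + t *\<^sub>R b) R" using tb by (simp add: R_def dist_norm)
      qed
    qed (use 0 in auto)
    finally show ?thesis .
  qed
  then have "\<forall>\<^sub>F t in nhds 0. (LINT y:cball a R|lborel. f (y + t *\<^sub>R b)) = (LINT y:cball a r|lborel. f y)"
    by (intro eventually_nhds[THEN iffD2] exI[of _ "{-1<..<1}"]) auto
  then have "((\<lambda>t. LINT y:cball a R|lborel. f (y + t *\<^sub>R b)) has_real_derivative
          (LINT y:cball a R|lborel. f' y)) (at 0)
      \<longleftrightarrow> ((\<lambda>t. (LINT y:cball a r|lborel. f y)) has_real_derivative (LINT y:cball a R|lborel. f' y)) (at 0)"
    by (intro DERIV_cong_ev) auto
  ultimately have "((\<lambda>t. (LINT y:cball a r|lborel. f y)) has_real_derivative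
      (LINT y:cball a R|lborel. f' y)) (at 0)"
    by simp
  then have "(LINT y:cball a R|lborel. f' y) = 0" using DERIV_unique DERIV_const by blast
  moreover have "(LINT y:cball a R|lborel. f' y) = (LINT y:cball a r|lborel. f' y)"
    by (rule set_integral_zero_outside) (use f'0 in \<open>auto simp: R_def add_increasing2\<close>)
  ultimately show ?thesis by simp
qed

text \<open>The difference of the two integrands is the divergence of F grad(bump) - bump grad(F), a
  field supported in the ball, so each coordinate contributes zero by the previous lemma.\<close>

lemma integration_by_parts_bump:
  fixes F :: "'a::euclidean_space \<Rightarrow> real"
  assumes FGL: "has_grad_lap U F G L" and r: "0 < r" "cball a r \<subseteq> U"
  shows "(LINT y:cball a r|lborel. F y * bump_lap a r y) = (LINT y:cball a r|lborel. L y * bump a r y)"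
proof -
  obtain H where U: "open U" and F: "\<forall>x\<in>U. (F has_derivative (\<lambda>h. G x \<bullet> h)) (at x)"
    and H: "\<forall>x\<in>U. (G has_derivative H x) (at x)" 
     "\<forall>b\<in>Basis. continuous_on U (\<lambda>x. H x b)" "\<forall>x\<in>U. L x = (\<Sum>b\<in>Basis. H x b \<bullet> b)"
    using FGL unfolding has_grad_lap_def by blast
  obtain G' where GB: "has_grad_lap UNIV (bump a r) G' (bump_lap a r)"
    using has_grad_lap_bump by blast
  then obtain H' where B: "\<forall>x\<in>UNIV. (bump a r has_derivative (\<lambda>h. G' x \<bullet> h)) (at x)"
    and H': "\<forall>x\<in>UNIV. (G' has_derivative H' x) (at x)" 
     "\<forall>b\<in>Basis. continuous_on UNIV (\<lambda>x. H' x b)" "\<forall>x\<in>UNIV. bump_lap a r x = (\<Sum>b\<in>Basis. H' x b \<bullet> b)"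
    unfolding has_grad_lap_def by blast
  have G'0: "G' x = 0" if "x \<notin> cball a r" for x
  proof -
    have "(bump a r has_derivative (\<lambda>h. 0)) (at x)"
      by (rule has_derivative_transform_within_open[where f="\<lambda>x. 0" and s="- cball a r"])
         (use that in \<open>auto simp: bump_eq_0[OF r(1)] dist_norm norm_minus_commute\<close>)
    from fun_cong[OF has_derivative_unique[OF this B[rule_format, of x]], of "G' x"]
    have "0 = G' x \<bullet> G' x" by simp
    then show ?thesis by simp
  qed
  have cF: "continuous_on U F" and cG: "continuous_on U G"
    using FGL by (auto intro: has_grad_lap_continuous_on has_grad_lap_continuous_on_grad)
  have cB: "continuous_on U (bump a r)" and cG': "continuous_on U G'"
    using H'(1) by (auto intro!: continuous_on_bump continuous_at_imp_continuous_on has_derivative_continuous)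
  \<comment> \<open>Component of the field in direction \<open>b\<close>, extended by zero. The
    extension is differentiable everywhere because the field already vanishes outside the closed
    ball, which lies inside \<open>U\<close>.\<close>
  define f where "f b x = (if x \<in> U then F x * (G' x \<bullet> b) - bump a r x * (G x \<bullet> b) else 0)" for b x
  define f' where "f' b x = (if x \<in> U then F x * (H' x b \<bullet> b) - bump a r x * (H x b \<bullet> b) else 0)" for b x
  have f0: "f b x = 0" if "x \<notin> cball a r" for b x
    using that G'0[OF that] bump_eq_0[OF r(1), of x a] by (auto simp: f_def dist_norm norm_minus_commute)
  have df: "((\<lambda>t. f b (x + t *\<^sub>R b)) has_real_derivative f' b x) (at 0)" if "b \<in> Basis" for b x
  proof (cases "x \<in> U")
    case True
    have "((\<lambda>x. F x * (G' x \<bullet> b) - bump a r x * (G x \<bullet> b)) has_derivative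
        (\<lambda>h. F x * (H' x h \<bullet> b) + (G x \<bullet> h) * (G' x \<bullet> b) - (bump a r x * (H x h \<bullet> b) + (G' x \<bullet> h) * (G x \<bullet> b)))) (at x)"
      using F[rule_format, OF True] B[rule_format, of x] H(1)[rule_format, OF True] H'(1)[rule_format, of x]
      by (auto intro!: derivative_eq_intros)
    then have "(f b has_derivative
        (\<lambda>h. F x * (H' x h \<bullet> b) + (G x \<bullet> h) * (G' x \<bullet> b) - (bump a r x * (H x h \<bullet> b) + (G' x \<bullet> h) * (G x \<bullet> b)))) (at x)"
      by (rule has_derivative_transform_within_open[OF _ U True]) (simp add: f_def)
    then have "(f b has_derivative
        (\<lambda>h. F x * (H' x h \<bullet> b) + (G x \<bullet> h) * (G' x \<bullet> b) - (bump a r x * (H x h \<bullet> b) + (G' x \<bullet> h) * (G x \<bullet> b))))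
          (at (x + 0 *\<^sub>R b))" by simp
    then have *: "((\<lambda>t. f b (x + t *\<^sub>R b)) has_derivative
        (\<lambda>t. F x * (H' x (t *\<^sub>R b) \<bullet> b) + (G x \<bullet> (t *\<^sub>R b)) * (G' x \<bullet> b)
          - (bump a r x * (H x (t *\<^sub>R b) \<bullet> b) + (G' x \<bullet> (t *\<^sub>R b)) * (G x \<bullet> b)))) (at 0)"
      by (rule has_derivative_compose[where f="\<lambda>t. x + t *\<^sub>R b" and g="f b", rotated]) 
        (auto intro!: derivative_eq_intros)
    have l: "H x (t *\<^sub>R b) = t *\<^sub>R H x b" "H' x (t *\<^sub>R b) = t *\<^sub>R H' x b" for t
      using linear_scale[OF has_derivative_linear[OF H(1)[rule_format, OF True]]]
        linear_scale[OF has_derivative_linear[OF H'(1)[rule_format, OF UNIV_I]]] by auto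
    show ?thesis
      unfolding has_field_derivative_def
      by (rule has_derivative_eq_rhs[OF *]) (use True in \<open>auto simp: l f'_def algebra_simps\<close>)
  next
    case False
    have "((\<lambda>t. f b (x + t *\<^sub>R b)) has_real_derivative 0) (at 0)"
    proof -
      have "\<forall>\<^sub>F t in nhds 0. x + t *\<^sub>R b \<in> - cball a r"
        using False r by (intro eventually_line_in_open) auto
      then have "\<forall>\<^sub>F t in nhds 0. f b (x + t *\<^sub>R b) = 0"
        by eventually_elim (auto simp: f0)
      then show ?thesis
        using DERIV_cong_ev[of 0 0 "\<lambda>t. f b (x + t *\<^sub>R b)" "\<lambda>t. 0" 0 0] by simp
    qed
    then show ?thesis using False by (simp add: f'_def)
  qed
  have f'0: "f' b x = 0" if "b \<in> Basis" "x \<notin> cball a r" for b x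
  proof (rule DERIV_unique[OF df[OF that(1)]])
    have "\<forall>\<^sub>F t in nhds 0. x + t *\<^sub>R b \<in> - cball a r"
      using that by (intro eventually_line_in_open) auto
    then have "\<forall>\<^sub>F t in nhds 0. f b (x + t *\<^sub>R b) = 0"
      by eventually_elim (auto simp: f0)
    then show "((\<lambda>t. f b (x + t *\<^sub>R b)) has_real_derivative 0) (at 0)"
      using DERIV_cong_ev[of 0 0 "\<lambda>t. f b (x + t *\<^sub>R b)" "\<lambda>t. 0" 0 0] by simp
  qed
  have UNIV: "(UNIV :: 'a set) = U \<union> - cball a r" using r by auto
  have c0: "continuous_on (- cball a r) k" if "\<And>x. x \<notin> cball a r \<Longrightarrow> k x = 0" for k :: "'a \<Rightarrow> real"
    using continuous_on_const[of "- cball a r" 0] by (rule continuous_on_eq) (use that in auto)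
  have cf: "continuous_on UNIV (f b)" for b
    unfolding UNIV
  proof (rule continuous_on_open_Un)
    show "continuous_on U (f b)" 
      by (rule continuous_on_eq[where f="\<lambda>x. F x * (G' x \<bullet> b) - bump a r x * (G x \<bullet> b)"])
        (auto intro!: continuous_intros cF cG cB cG' simp: f_def)
  qed (use U f0 in \<open>auto intro: c0\<close>)
  have cf': "continuous_on UNIV (f' b)" if b: "b \<in> Basis" for b
    unfolding UNIV
  proof (rule continuous_on_open_Un)
    show "continuous_on U (f' b)" 
      by (rule continuous_on_eq[where f="\<lambda>x. F x * (H' x b \<bullet> b) - bump a r x * (H x b \<bullet> b)"])
        (use b H(2) H'(2) in \<open>auto intro!: continuous_intros cF cB simp: f'_def intro: continuous_on_subset\<close>)
  qed (use U f'0[OF b] in \<open>auto intro: c0\<close>)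
  have z: "(LINT y:cball a r|lborel. f' b y) = 0" if "b \<in> Basis" for b
    using r(1) cf cf'[OF that] f0 df[OF that] by (rule set_integral_directional_derivative_zero)
  have cL: "continuous_on (cball a r) L" "continuous_on (cball a r) F"
    using FGL r by (auto intro: continuous_on_subset has_grad_lap_continuous_on has_grad_lap_continuous_on_lap)
  have "(LINT y:cball a r|lborel. F y * bump_lap a r y) - (LINT y:cball a r|lborel. L y * bump a r y)
     = (LINT y:cball a r|lborel. F y * bump_lap a r y - L y * bump a r y)"
    by (intro set_integral_diff(2)[symmetric] set_integrable_compact continuous_intros cL continuous_on_bump) auto
  also have "\<dots> = (LINT y:cball a r|lborel. (\<Sum>b\<in>Basis. f' b y))"
  proof (rule set_lebesgue_integral_cong)
    show "\<forall>y. y \<in> cball a r \<longrightarrow> F y * bump_lap a r y - L y * bump a r y = (\<Sum>b\<in>Basis. f' b y)"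
      using H(3) H'(3) r
      by (auto simp: f'_def sum_subtractf sum_distrib_left mult.commute)
  qed auto
  also have "\<dots> = (\<Sum>b\<in>Basis. LINT y:cball a r|lborel. f' b y)"
  proof -
    have "set_integrable lborel (cball a r) (f' b)" if "b \<in> Basis" for b
      by (intro set_integrable_compact continuous_on_subset[OF cf'[OF that]]) auto
    then show ?thesis
      unfolding set_lebesgue_integral_def set_integrable_def scaleR_sum_right
      by (intro Bochner_Integration.integral_sum) auto
  qed
  also have "\<dots> = 0" by (simp add: z)
  finally show ?thesis by simp
qed

section \<open>Weighted means and superharmonic functions\<close>

text \<open>
  The weight is chosen so that the derivative of the mean in \<open>r\<close> is a positive multiple of the integral
  against the Laplacian of a bump. A distributional inequality tested on bumps is therefore the same
  as monotonicity of these means.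
\<close>

definition kern :: "real \<Rightarrow> 'a::euclidean_space \<Rightarrow> real" where
  "kern r x = Phi 2 (1 - (1 / r\<^sup>2) * (norm x)\<^sup>2)
     / (r ^ DIM('a) * (LINT z:cball (0::'a) 1|lborel. Phi 2 (1 - (norm z)\<^sup>2)))"

definition mean :: "('a::euclidean_space \<Rightarrow> real) \<Rightarrow> 'a \<Rightarrow> real \<Rightarrow> real" where
  "mean F a r = (LINT y:cball a r|lborel. F y * kern r (y - a))"

lemma kern_mass_pos: "0 < (LINT z:cball (0::'a::euclidean_space) 1|lborel. Phi 2 (1 - (norm z)\<^sup>2))"
  by (rule set_integral_pos[where x=0]) (auto intro!: continuous_intros Phi_nonneg Phi_pos simp: interior_cball)

lemma kern_nonneg: "0 < r \<Longrightarrow> 0 \<le> kern r x"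
  unfolding kern_def by (intro divide_nonneg_pos Phi_nonneg mult_pos_pos kern_mass_pos) auto

lemma kern_pos: 
  fixes x :: "'a::euclidean_space"
  assumes "0 < r" "norm x < r"
  shows "0 < kern r x"
  unfolding kern_def
proof (intro divide_pos_pos Phi_pos mult_pos_pos kern_mass_pos)
  show "0 < 1 - (1 / r\<^sup>2) * (norm x)\<^sup>2"
    using bump_arg_le_0_iff[of r x 0] assms by (simp del: times_divide_eq_left)
qed (use assms in auto)

lemma kern_eq_0: "0 < r \<Longrightarrow> r \<le> norm x \<Longrightarrow> kern r x = 0"
  using bump_arg_le_0_iff[of r x 0] by (auto simp: kern_def Phi_eq_0)

lemma continuous_on_kern [continuous_intros]:
  "continuous_on S f \<Longrightarrow> continuous_on S (\<lambda>x. kern r (f x))"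
  using kern_mass_pos unfolding kern_def divide_inverse by (intro continuous_intros)

lemma integral_kern:
  fixes a :: "'a::euclidean_space"
  assumes "0 < r"
  shows "(LINT y:cball a r|lborel. kern r (y - a)) = 1"
proof -
  let ?m = "LINT z:cball (0::'a) 1|lborel. Phi 2 (1 - (norm z)\<^sup>2)"
  have "(LINT y:cball a r|lborel. kern r (y - a)) = r ^ DIM('a) * (LINT z:cball (0::'a) 1|lborel. kern r (r *\<^sub>R z))"
    by (subst set_integral_affine_cball[OF assms]) (auto intro!: continuous_intros)
  also have "(LINT z:cball (0::'a) 1|lborel. kern r (r *\<^sub>R z)) =
      (LINT z:cball (0::'a) 1|lborel. Phi 2 (1 - (norm z)\<^sup>2) / (r ^ DIM('a) * ?m))"
    using assms by (simp add: kern_def power_mult_distrib)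
  also have "r ^ DIM('a) * \<dots> = 1"
    using assms kern_mass_pos[where 'a='a] by simp
  finally show ?thesis .
qed

lemma set_integrable_kern:
  fixes F :: "'a::euclidean_space \<Rightarrow> real"
  assumes "continuous_on (cball a r) F"
  shows "set_integrable lborel (cball a r) (\<lambda>y. F y * kern r (y - a))"
  by (intro set_integrable_compact continuous_intros assms compact_cball)

lemma mean_const: "0 < r \<Longrightarrow> mean (\<lambda>y. c) a r = c"
  by (simp add: mean_def integral_kern)

lemma mean_cmult: "mean (\<lambda>y. c * F y) a r = c * mean F a r"
  by (simp add: mean_def mult.assoc)

lemma mean_add:
  assumes "continuous_on (cball a r) F" "continuous_on (cball a r) G"
  shows "mean (\<lambda>y. F y + G y) a r = mean F a r + mean G a r"
  using set_integral_add(2)[OF assms[THEN set_integrable_kern]]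
  by (simp add: mean_def algebra_simps)

lemma mean_mono:
  assumes "0 < r" "continuous_on (cball a r) F" "continuous_on (cball a r) G"
    and "\<And>y. y \<in> cball a r \<Longrightarrow> F y \<le> G y"
  shows "mean F a r \<le> mean G a r"
  unfolding mean_def
  by (intro set_integral_mono set_integrable_kern assms mult_right_mono kern_nonneg)

lemma mean_strict:
  assumes r: "0 < r" and F: "continuous_on (cball a r) F"
    and c: "\<And>y. y \<in> cball a r \<Longrightarrow> c \<le> F y" and y: "y \<in> ball a r" "c < F y"
  shows "c < mean F a r"
proof -
  have "0 < (LINT y:cball a r|lborel. (F y + - c) * kern r (y - a))"
  proof (rule set_integral_pos[where x=y])
    show "0 < (F y + - c) * kern r (y - a)"
      using y r by (intro mult_pos_pos kern_pos) (auto simp: dist_norm norm_minus_commute)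
  qed (use c y r in \<open>auto intro!: continuous_intros F mult_nonneg_nonneg kern_nonneg simp: interior_cball\<close>)
  also have "\<dots> = mean (\<lambda>y. F y + - c) a r" by (simp add: mean_def)
  also have "\<dots> = mean F a r + - c"
    using mean_const[OF r, of "- c" a] by (subst mean_add) (auto intro: F)
  finally show ?thesis by simp
qed

text \<open>The profile \<open>Phi 2\<close> of the kernel is the derivative of the profile
  \<open>Phi 0\<close> of the bump. As a consequence the derivative in t of t^(-n)
  \<open>Phi 2\<close> (1 - |y|^2/t^2) is t^(1-n)/2 times the Laplacian of the bump of radius
  t.\<close>

lemma mean_has_real_derivative:
  fixes F :: "'a::euclidean_space \<Rightarrow> real"
  assumes "continuous_on (cball a R) F" "0 < r" "r < R"
  obtains c where "c > 0"
    "((\<lambda>r. mean F a r) has_real_derivative c * (LINT y:cball a r|lborel. F y * bump_lap a r y)) (at r)"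
proof -
  define k where "k = (LINT z:cball (0::'a) 1|lborel. Phi 2 (1 - (norm z)\<^sup>2))"
  have k: "k > 0" unfolding k_def by (rule kern_mass_pos)
  define n where "n = DIM('a)"
  \<comment> \<open>The domain of integration is frozen to the larger ball, so that only the
    integrand depends on \<open>t\<close>. This changes nothing, since the kernel of radius
    \<open>t\<close> vanishes outside its own ball.\<close>
  define m where "m t = (LINT y:cball a R|lborel. F y * kern t (y - a))" for t
  have n0: "0 < n" by (simp add: n_def)
  define p where "p = r / 2" 
  define q where "q = (r + R) / 2"
  have pq: "0 < p" "p < r" "r < q" "q < R" using assms by (auto simp: p_def q_def)
  have meq: "mean F a t = m t" if "0 < t" "t \<le> R" for t
    unfolding mean_def m_def using that
    by (intro set_integral_zero_outside[symmetric]) 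
       (auto simp: dist_norm norm_minus_commute intro!: kern_eq_0)
  have d: "((\<lambda>t. F y * kern t (y - a)) has_real_derivative F y * ((t / (2 * k * t ^ n)) * bump_lap a t y)) (at t)"
    if "t \<in> {p..q}" for t y
  proof -
    let ?N = "(norm (y - a))\<^sup>2"
    have t: "t > 0" using that pq by auto
    have 1: "((\<lambda>t. 1 - (1 / t\<^sup>2) * ?N) has_real_derivative 2 * ?N / t ^ 3) (at t)"
      using t by (auto intro!: derivative_eq_intros simp: field_simps power2_eq_square power3_eq_cube)
    have 2: "((\<lambda>t. Phi 2 (1 - (1 / t\<^sup>2) * ?N)) has_real_derivative
        (Phi 4 (1 - (1 / t\<^sup>2) * ?N) - 2 * Phi 3 (1 - (1 / t\<^sup>2) * ?N)) * (2 * ?N / t ^ 3)) (at t)"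
      using DERIV_chain2[OF Phi_derivative[of 2] 1] by (simp add: numeral_eq_Suc)
    have 3: "((\<lambda>t. inverse (t ^ n)) has_real_derivative (- real n / (t * t ^ n))) (at t)"
    proof -
      have "t ^ (n - Suc 0) * t = t ^ n" using n0 by (cases n) auto
      then show ?thesis
        using t by (auto intro!: derivative_eq_intros simp: field_simps power2_eq_square)
    qed
    have 4: "F y * kern t (y - a) = (F y / k) * (Phi 2 (1 - (1 / t\<^sup>2) * ?N) * inverse (t ^ n))" for t
      by (simp add: kern_def k_def n_def field_simps)
    have "((\<lambda>t. F y * kern t (y - a)) has_real_derivative (F y / k) *
        ((Phi 4 (1 - (1 / t\<^sup>2) * ?N) - 2 * Phi 3 (1 - (1 / t\<^sup>2) * ?N)) * (2 * ?N / t ^ 3) * inverse (t ^ n)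
          + (- real n / (t * t ^ n)) * Phi 2 (1 - (1 / t\<^sup>2) * ?N))) (at t)"
      unfolding 4 by (rule DERIV_cmult[OF DERIV_mult[OF 2 3]])
    moreover have "(F y / k) *
        ((Phi 4 (1 - (1 / t\<^sup>2) * ?N) - 2 * Phi 3 (1 - (1 / t\<^sup>2) * ?N)) * (2 * ?N / t ^ 3) * inverse (t ^ n)
          + (- real n / (t * t ^ n)) * Phi 2 (1 - (1 / t\<^sup>2) * ?N))
       = F y * ((t / (2 * k * t ^ n)) * bump_lap a t y)"
      using t k by (simp add: bump_lap_def n_def divide_simps) (simp add: algebra_simps power_numeral_reduce)
    ultimately show ?thesis by simp
  qed
  have "(m has_real_derivative (LINT y:cball a R|lborel. F y * ((r / (2 * k * r ^ n)) * bump_lap a r y))) (at r)"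
    unfolding m_def
  proof (rule set_integral_has_real_derivative[where p=p and q=q])
    show "continuous_on ({p..q} \<times> cball a R) (\<lambda>(t, y). F y * ((t / (2 * k * t ^ n)) * bump_lap a t y))"
      unfolding case_prod_beta bump_lap_def using pq k
      by (intro continuous_intros continuous_on_compose2[OF assms(1)]) auto
  qed (use pq d in \<open>auto intro!: continuous_intros assms\<close>)
  moreover have "(LINT y:cball a R|lborel. F y * ((r / (2 * k * r ^ n)) * bump_lap a r y))
      = (r / (2 * k * r ^ n)) * (LINT y:cball a r|lborel. F y * bump_lap a r y)"
  proof -
    have "(LINT y:cball a R|lborel. F y * ((r / (2 * k * r ^ n)) * bump_lap a r y)) 
        = (LINT y:cball a R|lborel. (r / (2 * k * r ^ n)) * (F y * bump_lap a r y))"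
      by (simp add: mult_ac)
    also have "\<dots> = (r / (2 * k * r ^ n)) * (LINT y:cball a R|lborel. F y * bump_lap a r y)" by simp
    also have "(LINT y:cball a R|lborel. F y * bump_lap a r y) = (LINT y:cball a r|lborel. F y * bump_lap a r y)"
      using assms by (intro set_integral_zero_outside) (auto simp: dist_norm norm_minus_commute bump_lap_eq_0)
    finally show ?thesis .
  qed
  ultimately have *: "(m has_real_derivative (r / (2 * k * r ^ n)) * (LINT y:cball a r|lborel. F y * bump_lap a r y)) (at r)"
    by (simp only:)
  have "\<forall>\<^sub>F t in nhds r. t \<in> {0<..<R}" using assms by (intro eventually_nhds_in_open) auto
  then have "\<forall>\<^sub>F t in nhds r. m t = mean F a t" by eventually_elim (simp add: meq)
  then have "((\<lambda>r. mean F a r) has_real_derivative (r / (2 * k * r ^ n)) * (LINT y:cball a r|lborel. F y * bump_lap a r y)) (at r)"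
    using * DERIV_cong_ev[of r r m "mean F a"] by simp
  moreover have "r / (2 * k * r ^ n) > 0" using assms k by simp
  ultimately show ?thesis using that by blast
qed

lemma mean_tendsto:
  fixes F :: "'a::euclidean_space \<Rightarrow> real"
  assumes "continuous_on (cball a R) F" "0 < R" "0 < e"
  obtains d where "0 < d" "\<And>r. 0 < r \<Longrightarrow> r < d \<Longrightarrow> mean F a r \<le> F a + e"
proof -
  have "continuous (at a within cball a R) F" using assms by (auto simp: continuous_on_eq_continuous_within)
  then obtain d where d: "d > 0" "\<And>y. y \<in> cball a R \<Longrightarrow> dist y a < d \<Longrightarrow> dist (F y) (F a) < e"
    using \<open>0 < e\<close> unfolding continuous_within_eps_delta by metis
  show ?thesis
  proof (rule that[of "min d R"])
    fix r assume r: "0 < r" "r < min d R"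
    have "mean F a r \<le> mean (\<lambda>y. F a + e) a r"
    proof (rule mean_mono[OF r(1)])
      show "F y \<le> F a + e" if "y \<in> cball a r" for y
        using d(2)[of y] that r by (force simp: dist_commute dist_real_def)
    qed (use assms r in \<open>auto intro: continuous_on_subset\<close>)
    then show "mean F a r \<le> F a + e" using r by (simp add: mean_const)
  qed (use d assms in auto)
qed

text \<open>The sign condition makes the mean nonincreasing in the radius, and for small radii the
  mean is at most \<open>F a\<close> up to an arbitrarily small error.\<close>

lemma mean_le:
  fixes F :: "'a::euclidean_space \<Rightarrow> real"
  assumes F: "continuous_on (cball a R) F" and r: "0 < r" "r < R"
    and neg: "\<And>t. 0 < t \<Longrightarrow> t < R \<Longrightarrow> (LINT y:cball a t|lborel. F y * bump_lap a t y) \<le> 0"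
  shows "mean F a r \<le> F a"
proof (rule field_le_epsilon)
  fix e :: real assume e: "0 < e"
  obtain d where d: "0 < d" "\<And>r. 0 < r \<Longrightarrow> r < d \<Longrightarrow> mean F a r \<le> F a + e"
    using mean_tendsto[OF F _ e] r by auto
  define s where "s = min d r / 2"
  have s: "0 < s" "s < d" "s \<le> r" using d r by (auto simp: s_def)
  have "mean F a r \<le> mean F a s"
  proof (rule DERIV_nonpos_imp_nonincreasing[OF s(3)])
    fix x assume x: "s \<le> x" "x \<le> r"
    then have "0 < x" "x < R" using s r by auto
    from mean_has_real_derivative[OF F this] neg[OF this]
    show "\<exists>y. ((\<lambda>a'. mean F a a') has_real_derivative y) (at x) \<and> y \<le> 0"
      by (metis mult_le_0_iff order_less_le)
  qed
  also have "\<dots> \<le> F a + e" using s d by simp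
  finally show "mean F a r \<le> F a + e" .
qed

section \<open>Superharmonic functions and the minimum principle\<close>

text \<open>The bound on the admissible radii may depend on the point. This makes the notion local,
  so that minima and functions glued from pieces can be treated point by point, and it is still
  strong enough for the minimum principle.\<close>

definition superh :: "'a::euclidean_space set \<Rightarrow> ('a \<Rightarrow> real) \<Rightarrow> bool" where
  "superh U F \<longleftrightarrow> continuous_on U F \<and>
     (\<forall>x\<in>U. \<exists>r>0. \<forall>t. 0 < t \<and> t < r \<longrightarrow> cball x t \<subseteq> U \<and> mean F x t \<le> F x)"

lemma superh_continuous_on: "superh U F \<Longrightarrow> continuous_on U F"
  by (simp add: superh_def)

lemma superh_open:
  assumes "superh U F" shows "open U"
proof (rule openI)
  fix x assume "x \<in> U"
  then obtain r where "r > 0" "\<forall>t. 0 < t \<and> t < r \<longrightarrow> cball x t \<subseteq> U" using assms unfolding superh_def by blast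
  then have "cball x (r / 2) \<subseteq> U" "r / 2 > 0" by auto
  then show "\<exists>e>0. ball x e \<subseteq> U" using ball_subset_cball by blast
qed

lemma superhI_bump:
  assumes "open U" "continuous_on U F"
    and "\<And>a r. 0 < r \<Longrightarrow> cball a r \<subseteq> U \<Longrightarrow> (LINT y:cball a r|lborel. F y * bump_lap a r y) \<le> 0"
  shows "superh U F"
  unfolding superh_def
proof (intro conjI ballI assms(2))
  fix x assume "x \<in> U"
  with assms(1) obtain R where R: "R > 0" "cball x R \<subseteq> U" using open_contains_cball by blast
  show "\<exists>r>0. \<forall>t. 0 < t \<and> t < r \<longrightarrow> cball x t \<subseteq> U \<and> mean F x t \<le> F x"
  proof (intro exI[of _ R] conjI allI impI R(1))
    fix t assume t: "0 < t \<and> t < R"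
    show "cball x t \<subseteq> U" using R(2) t by (auto simp: subset_iff)
    show "mean F x t \<le> F x"
    proof (rule mean_le[of x R])
      show "(LINT y:cball x s|lborel. F y * bump_lap x s y) \<le> 0" if "0 < s" "s < R" for s
        using that R(2) by (intro assms(3)) auto
    qed (use R assms t in \<open>auto intro: continuous_on_subset\<close>)
  qed
qed

lemma superh_C2:
  fixes F :: "'a::euclidean_space \<Rightarrow> real"
  assumes FGL: "has_grad_lap U F G L" and L: "\<And>x. x \<in> U \<Longrightarrow> L x \<le> 0"
  shows "superh U F"
proof (rule superhI_bump)
  show "open U" "continuous_on U F" using FGL by (auto intro: has_grad_lap_open has_grad_lap_continuous_on)
  fix a :: 'a and r :: real assume r: "0 < r" "cball a r \<subseteq> U"
  have "(LINT y:cball a r|lborel. L y * bump a r y) \<le> (LINT y:cball a r|lborel. 0)"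
  proof (rule set_integral_mono)
    have "continuous_on (cball a r) L" using has_grad_lap_continuous_on_lap[OF FGL] r continuous_on_subset by blast
    then show "set_integrable lborel (cball a r) (\<lambda>y. L y * bump a r y)"
      by (intro set_integrable_compact continuous_intros continuous_on_bump) auto
    show "L y * bump a r y \<le> 0" if "y \<in> cball a r" for y
      using L[of y] r that bump_nonneg[of a r y] by (auto simp: mult_nonpos_nonneg)
  qed (simp add: set_integrable_def)
  then show "(LINT y:cball a r|lborel. F y * bump_lap a r y) \<le> 0"
    using integration_by_parts_bump[OF FGL r] by (simp add: set_lebesgue_integral_def)
qed

text \<open>If a superharmonic \<open>G\<close> touches \<open>F\<close> from above at
  \<open>x\<close>, then mean F \<le> mean G \<le> G x \<le> F x on small balls around
  \<open>x\<close>.\<close>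

lemma superh_patch:
  fixes F :: "'a::euclidean_space \<Rightarrow> real"
  assumes c: "continuous_on U F"
    and *: "\<And>x. x \<in> U \<Longrightarrow> \<exists>V G. x \<in> V \<and> V \<subseteq> U \<and> superh V G \<and> (\<forall>y\<in>V. F y \<le> G y) \<and> G x \<le> F x"
  shows "superh U F"
  unfolding superh_def
proof (intro conjI ballI c)
  fix x assume x: "x \<in> U"
  from *[OF x] obtain V G where V: "x \<in> V" "V \<subseteq> U" "superh V G" "\<forall>y\<in>V. F y \<le> G y" "G x \<le> F x" by blast
  then obtain r where r: "r > 0" "\<And>t. 0 < t \<Longrightarrow> t < r \<Longrightarrow> cball x t \<subseteq> V \<and> mean G x t \<le> G x"
    unfolding superh_def by blast
  show "\<exists>r>0. \<forall>t. 0 < t \<and> t < r \<longrightarrow> cball x t \<subseteq> U \<and> mean F x t \<le> F x"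
  proof (intro exI[of _ r] conjI allI impI r(1))
    fix t assume t: "0 < t \<and> t < r"
    note rt = r(2)[of t, THEN conjunct1] r(2)[of t, THEN conjunct2]
    show "cball x t \<subseteq> U" using rt(1) t V by blast
    have "mean F x t \<le> mean G x t"
      using V rt(1) t superh_continuous_on[OF V(3)]
      by (intro mean_mono continuous_on_subset[OF c] continuous_on_subset[OF superh_continuous_on[OF V(3)]]) auto
    then show "mean F x t \<le> F x" using rt(2) t V by linarith
  qed
qed

lemma superh_cong_local:
  assumes "open U" "\<And>x. x \<in> U \<Longrightarrow> \<exists>V G. x \<in> V \<and> V \<subseteq> U \<and> superh V G \<and> (\<forall>y\<in>V. F y = G y)"
  shows "superh U F"
proof (rule superh_patch)
  show "continuous_on U F"
  proof (rule continuous_at_imp_continuous_on, rule ballI)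
    fix x assume "x \<in> U"
    from assms(2)[OF this] obtain V G where V: "x \<in> V" "V \<subseteq> U" "superh V G" "\<forall>y\<in>V. F y = G y" by blast
    then have "continuous_on V F" using superh_continuous_on[of V G] by (simp cong: continuous_on_cong)
    then show "isCont F x" using V superh_open continuous_on_eq_continuous_at by blast
  qed
next
  fix x assume "x \<in> U"
  from assms(2)[OF this] obtain V G where "x \<in> V" "V \<subseteq> U" "superh V G" "\<forall>y\<in>V. F y = G y" by blast
  then show "\<exists>V G. x \<in> V \<and> V \<subseteq> U \<and> superh V G \<and> (\<forall>y\<in>V. F y \<le> G y) \<and> G x \<le> F x"
    by (intro exI[of _ V] exI[of _ G]) auto
qed

lemma superh_subset:
  assumes "superh U F" "open V" "V \<subseteq> U"
  shows "superh V F"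
  unfolding superh_def
proof (intro conjI ballI)
  show "continuous_on V F" using assms superh_continuous_on continuous_on_subset by blast
  fix x assume x: "x \<in> V"
  then obtain r where r: "r > 0" "\<And>t. 0 < t \<Longrightarrow> t < r \<Longrightarrow> mean F x t \<le> F x"
    using assms unfolding superh_def by blast
  obtain s where s: "s > 0" "cball x s \<subseteq> V" using assms(2) x open_contains_cball by blast
  have "cball x t \<subseteq> V" if "t < s" for t using s(2) that by (auto simp: subset_iff)
  with r s show "\<exists>r>0. \<forall>t. 0 < t \<and> t < r \<longrightarrow> cball x t \<subseteq> V \<and> mean F x t \<le> F x"
    by (intro exI[of _ "min r s"]) auto
qed

lemma superh_min:
  assumes "superh U F" "superh U G"
  shows "superh U (\<lambda>x. min (F x) (G x))"
proof (rule superh_patch)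
  show "continuous_on U (\<lambda>x. min (F x) (G x))"
    using assms by (intro continuous_intros superh_continuous_on)
  show "\<exists>V H. x \<in> V \<and> V \<subseteq> U \<and> superh V H \<and> (\<forall>y\<in>V. min (F y) (G y) \<le> H y) \<and> H x \<le> min (F x) (G x)"
    if "x \<in> U" for x
  proof (cases "F x \<le> G x")
    case True then show ?thesis using assms that by (intro exI[of _ U] exI[of _ F]) auto
  next
    case False then show ?thesis using assms that by (intro exI[of _ U] exI[of _ G]) auto
  qed
qed

lemma superh_add:
  assumes F: "superh U F" and G: "superh U G"
  shows "superh U (\<lambda>x. F x + G x)"
  unfolding superh_def
proof (intro conjI ballI)
  show "continuous_on U (\<lambda>x. F x + G x)"
    using assms by (intro continuous_intros superh_continuous_on)
  fix x assume x: "x \<in> U"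
  then obtain r where r: "r > 0" "\<And>t. 0 < t \<Longrightarrow> t < r \<Longrightarrow> cball x t \<subseteq> U" 
    "\<And>t. 0 < t \<Longrightarrow> t < r \<Longrightarrow> mean F x t \<le> F x"
    using F unfolding superh_def by blast
  obtain s where s: "s > 0" "\<And>t. 0 < t \<Longrightarrow> t < s \<Longrightarrow> mean G x t \<le> G x"
    using G x unfolding superh_def by blast
  show "\<exists>r>0. \<forall>t. 0 < t \<and> t < r \<longrightarrow> cball x t \<subseteq> U \<and> mean (\<lambda>x. F x + G x) x t \<le> F x + G x"
  proof (intro exI[of _ "min r s"] conjI allI impI)
    fix t assume t: "0 < t \<and> t < min r s"
    then show c: "cball x t \<subseteq> U" using r by auto
    have "mean (\<lambda>x. F x + G x) x t = mean F x t + mean G x t"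
      by (intro mean_add continuous_on_subset[OF _ c] superh_continuous_on[OF F] superh_continuous_on[OF G])
    then show "mean (\<lambda>x. F x + G x) x t \<le> F x + G x" using r(3)[of t] s(2)[of t] t by auto
  qed (use r s in auto)
qed

lemma superh_cmult:
  assumes "superh U F" "0 \<le> c"
  shows "superh U (\<lambda>x. c * F x)"
  using assms unfolding superh_def mean_cmult
  by (auto intro!: continuous_intros) (meson mult_left_mono)

lemma superh_const: "open U \<Longrightarrow> superh U (\<lambda>x. c)"
  by (rule superh_C2[OF has_grad_lap_const]) auto

text \<open>Superharmonicity is asked only on the negative set, because the difference of two
  solutions of the singular equation has a signed Laplacian only there. The boundary condition is a
  lower limit, so \<open>F\<close> need not extend to the closure. Connectedness is avoided by
  choosing, among all minimizers, one that is extremal in a coordinate direction.\<close>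

lemma min_principle:
  fixes F :: "'a::euclidean_space \<Rightarrow> real"
  assumes U: "open U" "bounded U" and F: "continuous_on U F"
    and super: "superh {x \<in> U. F x < 0} F"
    and bd: "\<And>z e. z \<in> frontier U \<Longrightarrow> 0 < e \<Longrightarrow> \<forall>\<^sub>F x in at z within U. - e < F x"
    and x0: "x0 \<in> U"
  shows "0 \<le> F x0"
proof (rule ccontr)
  assume neg: "\<not> 0 \<le> F x0"
  define A where "A = {x \<in> U. F x \<le> F x0}"
  have ev: "\<forall>\<^sub>F x in at z within U. F x0 < F x" if "z \<in> closure U" "z \<notin> A" for z
  proof (cases "z \<in> U")
    case True
    then have "F x0 < F z" using that by (auto simp: A_def)
    then show ?thesis using F True unfolding continuous_on_def by (intro order_tendstoD(1)) auto
  next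
    case False
    then have "z \<in> frontier U" using that U by (simp add: frontier_def interior_open)
    then show ?thesis using bd[of z "- F x0"] neg by auto
  qed
  \<comment> \<open>Near the frontier \<open>F\<close> stays above the negative value
    \<open>F x0\<close>, so \<open>A\<close> keeps away from the frontier and is compact although
    \<open>U\<close> is open.\<close>
  have "closed A"
    unfolding closed_limpt
  proof (intro allI impI)
    fix z assume z: "z islimpt A"
    show "z \<in> A"
    proof (rule ccontr)
      assume "z \<notin> A"
      moreover have "z \<in> closure U" 
        using z islimpt_subset[of z A U] by (auto simp: closure_def A_def)
      ultimately have "\<forall>\<^sub>F x in at z within U. F x0 < F x" using ev by blast
      then have "\<forall>\<^sub>F x in at z within A. F x0 < F x"
        by (rule filter_leD[OF at_le, rotated]) (auto simp: A_def)
      then have "\<forall>\<^sub>F x in at z within A. False"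
        unfolding eventually_at_filter by (auto simp: A_def elim!: eventually_mono)
      then show False using z using trivial_limit_within[of z A] by (auto simp: trivial_limit_def)
    qed
  qed
  moreover have "bounded A" using U bounded_subset[of U A] by (auto simp: A_def)
  ultimately have cA: "compact A" by (simp add: compact_eq_bounded_closed)
  have "x0 \<in> A" using x0 by (auto simp: A_def)
  then obtain xm where xm: "xm \<in> A" "\<And>y. y \<in> A \<Longrightarrow> F xm \<le> F y"
    using continuous_attains_inf[OF cA _ continuous_on_subset[OF F]] by (auto simp: A_def)
  \<comment> \<open>The set of minimizers. At the minimizer \<open>x\<close> that is furthest in
    direction \<open>b\<close>, the mean over a small ball cannot exceed the minimum, so every point
    of that ball is a minimizer; a point slightly further in direction \<open>b\<close> contradicts
    the choice of \<open>x\<close>.\<close>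
  define B where "B = {x \<in> A. F x \<le> F xm}"
  have "closed B" unfolding B_def
    using cA compact_imp_closed continuous_on_subset[OF F] 
    by (intro continuous_on_closed_Collect_le) (auto simp: A_def intro!: continuous_intros)
  then have "compact (A \<inter> B)" by (rule compact_Int_closed[OF cA])
  moreover have "A \<inter> B = B" by (auto simp: B_def)
  ultimately have cB: "compact B" by simp
  obtain b :: 'a where b: "b \<in> Basis" using nonempty_Basis by blast
  have "continuous_on B (\<lambda>x. x \<bullet> b)" by (intro continuous_intros)
  moreover have "xm \<in> B" using xm by (auto simp: B_def)
  ultimately obtain x where x: "x \<in> B" "\<And>y. y \<in> B \<Longrightarrow> y \<bullet> b \<le> x \<bullet> b"
    using continuous_attains_sup[OF cB] by blast
  have Fx: "F x = F xm" using x xm by (auto simp: B_def intro: antisym)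
  have "x \<in> {x \<in> U. F x < 0}" using x xm neg \<open>x0 \<in> A\<close> by (fastforce simp: B_def A_def)
  then obtain r where r: "r > 0" "\<forall>t. 0 < t \<and> t < r \<longrightarrow> cball x t \<subseteq> {x \<in> U. F x < 0} \<and> mean F x t \<le> F x"
    using super unfolding superh_def by blast
  define t where "t = r / 2"
  have t: "0 < t" "cball x t \<subseteq> {x \<in> U. F x < 0}" "mean F x t \<le> F x" using r by (auto simp: t_def)
  have low: "F x \<le> F y" if "y \<in> U" for y
  proof (cases "y \<in> A")
    case True then show ?thesis using xm Fx by simp
  next
    case False then show ?thesis using xm(2)[OF \<open>x0 \<in> A\<close>] Fx that by (simp add: A_def)
  qed
  define y where "y = x + (t / 2) *\<^sub>R b"
  have y: "y \<in> ball x t" using t b by (simp add: y_def dist_norm)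
  then have yU: "y \<in> U" using t ball_subset_cball by blast
  have "\<not> F x < F y"
  proof
    assume "F x < F y"
    with t y have "F x < mean F x t"
      by (intro mean_strict[of t x F "F x" y] continuous_on_subset[OF F] low) auto
    then show False using t by simp
  qed
  then have "y \<in> B" using yU Fx x low[OF yU] by (auto simp: B_def A_def)
  then have "y \<bullet> b \<le> x \<bullet> b" using x by blast
  then show False using t b by (simp add: y_def inner_left_distrib)
qed

section \<open>Harmonic functions\<close>

definition conv :: "'a::euclidean_space set \<Rightarrow> ('a \<Rightarrow> real) \<Rightarrow> ('a \<Rightarrow> real) \<Rightarrow> 'a \<Rightarrow> real" where
  "conv S F K x = (LINT y:S|lborel. F y * K (x - y))"

lemma conv_integrable:
  fixes F :: "'a::euclidean_space \<Rightarrow> real"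
  assumes "compact S" "continuous_on S F" "continuous_on UNIV K"
  shows "set_integrable lborel S (\<lambda>y. F y * K (x - y))"
  by (intro set_integrable_compact continuous_intros assms continuous_on_compose2[OF assms(3)]) auto

lemma conv_bound:
  fixes F :: "'a::euclidean_space \<Rightarrow> real"
  assumes S: "compact S" "continuous_on S F" "continuous_on UNIV K"
    and e: "\<And>y. y \<in> S \<Longrightarrow> \<bar>K (x - y)\<bar> \<le> e"
  shows "\<bar>conv S F K x\<bar> \<le> e * (LINT y:S|lborel. \<bar>F y\<bar>)"
proof -
  have "\<bar>conv S F K x\<bar> \<le> (LINT y:S|lborel. \<bar>F y * K (x - y)\<bar>)"
    unfolding conv_def using set_integral_norm_bound[OF conv_integrable[OF S, of x]] by simp
  also have "\<dots> \<le> (LINT y:S|lborel. e * \<bar>F y\<bar>)"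
  proof (rule set_integral_mono)
    show "set_integrable lborel S (\<lambda>y. \<bar>F y * K (x - y)\<bar>)"
      using set_integrable_abs[OF conv_integrable[OF S, of x]] .
    show "set_integrable lborel S (\<lambda>y. e * \<bar>F y\<bar>)"
      by (intro set_integrable_compact continuous_intros S)
    show "\<bar>F y * K (x - y)\<bar> \<le> e * \<bar>F y\<bar>" if "y \<in> S" for y
      using mult_right_mono[OF e[OF that], of "\<bar>F y\<bar>"] by (simp add: abs_mult mult.commute)
  qed
  finally show ?thesis by simp
qed

lemma conv_continuous_on:
  fixes F :: "'a::euclidean_space \<Rightarrow> real"
  assumes S: "compact S" "continuous_on S F" "continuous_on UNIV K"
  shows "continuous_on UNIV (conv S F K)"
proof (rule continuous_at_imp_continuous_on, rule ballI)
  fix x0 :: 'a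
  define C where "C = (LINT y:S|lborel. \<bar>F y\<bar>)"
  have C: "0 \<le> C" unfolding C_def set_lebesgue_integral_def by (rule integral_nonneg_AE) auto
  obtain M where M: "\<And>y. y \<in> S \<Longrightarrow> norm y \<le> M" using compact_imp_bounded[OF S(1)] by (auto simp: bounded_iff)
  define T where "T = cball (0::'a) (M + norm x0 + 1)"
  have "uniformly_continuous_on T K"
    by (intro compact_uniformly_continuous continuous_on_subset[OF S(3)]) (auto simp: T_def)
  show "isCont (conv S F K) x0"
    unfolding continuous_at_eps_delta
  proof (intro allI impI)
    fix e :: real assume e: "0 < e"
    define e' where "e' = e / (C + 1)"
    have "0 < e'" using e C by (simp add: e'_def)
    then obtain d where d: "d > 0" "\<And>z z'. z \<in> T \<Longrightarrow> z' \<in> T \<Longrightarrow> dist z' z < d \<Longrightarrow> dist (K z') (K z) < e'"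
      using \<open>uniformly_continuous_on T K\<close> unfolding uniformly_continuous_on_def by metis
    show "\<exists>d>0. \<forall>x. dist x x0 < d \<longrightarrow> dist (conv S F K x) (conv S F K x0) < e"
    proof (intro exI[of _ "min d 1"] conjI allI impI)
      fix x assume x: "dist x x0 < min d 1"
      let ?K = "\<lambda>z. K z - K (z - (x - x0))"
      have c: "continuous_on UNIV ?K"
        by (intro continuous_intros S continuous_on_compose2[OF S(3)]) auto
      have eq: "conv S F ?K x = conv S F K x - conv S F K x0"
        unfolding conv_def right_diff_distrib 
        using conv_integrable[OF S, of x] conv_integrable[OF S, of x0]
        by (subst set_integral_diff(2)) (auto simp: algebra_simps)
      have "\<bar>conv S F ?K x\<bar> \<le> e' * C"
        unfolding C_def
      proof (rule conv_bound[OF S(1,2) c])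
        fix y assume y: "y \<in> S"
        have "norm x \<le> norm x0 + 1" using x norm_triangle_ineq2[of x x0] by (simp add: dist_norm)
        then have "x - y \<in> T" "x0 - y \<in> T" 
          using M[OF y] norm_triangle_ineq4[of x y] norm_triangle_ineq4[of x0 y] by (auto simp: T_def)
        from d(2)[OF this(2,1)] x show "\<bar>K (x - y) - K (x - y - (x - x0))\<bar> \<le> e'"
          by (simp add: dist_norm algebra_simps)
      qed
      also have "e' * C < e" using e C by (simp add: e'_def divide_simps)
      finally show "dist (conv S F K x) (conv S F K x0) < e" by (simp add: eq dist_real_def)
    qed (use d in auto)
  qed
qed

lemma inner_gradient_Lipschitz:
  fixes K :: "'a::euclidean_space \<Rightarrow> real"
  assumes "convex T" "\<And>z. z \<in> T \<Longrightarrow> (K has_derivative (\<lambda>h. D z \<bullet> h)) (at z)"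
    "\<And>z. z \<in> T \<Longrightarrow> norm (D z) \<le> B" "a \<in> T" "b \<in> T"
  shows "\<bar>K a - K b\<bar> \<le> B * norm (a - b)"
proof -
  have "norm (K a - K b) \<le> B * norm (a - b)"
  proof (rule differentiable_bound[OF assms(1) _ _ assms(4,5)])
    show "(K has_derivative (\<lambda>h. D z \<bullet> h)) (at z within T)" if "z \<in> T" for z
      using assms(2)[OF that] has_derivative_at_withinI by blast
    show "onorm (\<lambda>h. D z \<bullet> h) \<le> B" if "z \<in> T" for z
    proof (rule onorm_le)
      show "norm (D z \<bullet> h) \<le> B * norm h" for h
        using Cauchy_Schwarz_ineq2[of "D z" h] mult_right_mono[OF assms(3)[OF that], of "norm h"] by simp
    qed
  qed
  then show ?thesis by simp
qed

text \<open>The error of the linear approximation is itself a convolution, with the first-order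
  Taylor remainder of \<open>K\<close> as kernel. Uniform continuity of the gradient
  \<open>D\<close> on a compact ball makes this remainder small relative to the increment, uniformly
  over \<open>S\<close>.\<close>

lemma conv_has_derivative:
  fixes F :: "'a::euclidean_space \<Rightarrow> real"
  assumes S: "compact S" "continuous_on S F"
    and K: "\<And>z. (K has_derivative (\<lambda>h. D z \<bullet> h)) (at z)" and D: "continuous_on UNIV D"
  shows "(conv S F K has_derivative (\<lambda>h. (\<Sum>b\<in>Basis. conv S F (\<lambda>z. D z \<bullet> b) x0 *\<^sub>R b) \<bullet> h)) (at x0)"
    (is "(_ has_derivative (\<lambda>h. ?V \<bullet> h)) _")
proof -
  define C where "C = (LINT y:S|lborel. \<bar>F y\<bar>)"
  have C: "0 \<le> C" unfolding C_def set_lebesgue_integral_def by (rule integral_nonneg_AE) auto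
  obtain M where M: "\<And>y. y \<in> S \<Longrightarrow> norm y \<le> M" using compact_imp_bounded[OF S(1)] by (auto simp: bounded_iff)
  \<comment> \<open>Contains every argument \<open>x - y\<close> with \<open>y\<close> in
    \<open>S\<close> and \<open>x\<close> within distance 1 of \<open>x0\<close>.\<close>
  define T where "T = cball (0::'a) (M + norm x0 + 1)"
  have "uniformly_continuous_on T D"
    by (intro compact_uniformly_continuous continuous_on_subset[OF D]) (auto simp: T_def)
  have cK: "continuous_on UNIV K"
    using K by (auto intro: continuous_at_imp_continuous_on has_derivative_continuous)
  have cDb: "continuous_on UNIV (\<lambda>z. D z \<bullet> h)" for h by (intro continuous_intros D)
  have Vh: "?V \<bullet> h = conv S F (\<lambda>z. D z \<bullet> h) x0" for h
  proof -
    have "conv S F (\<lambda>z. D z \<bullet> h) x0 = (LINT y:S|lborel. (\<Sum>b\<in>Basis. (F y * (D (x0 - y) \<bullet> b)) * (h \<bullet> b)))"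
      unfolding conv_def by (subst euclidean_inner) (simp add: sum_distrib_left mult_ac)
    also have "\<dots> = (\<Sum>b\<in>Basis. (LINT y:S|lborel. (F y * (D (x0 - y) \<bullet> b)) * (h \<bullet> b)))"
      using conv_integrable[OF S cDb, of x0]
      unfolding set_lebesgue_integral_def set_integrable_def scaleR_sum_right
      by (intro Bochner_Integration.integral_sum) (auto simp flip: mult.assoc)
    also have "\<dots> = ?V \<bullet> h"
      by (simp add: conv_def inner_sum_left inner_sum_right inner_commute)
    finally show ?thesis by simp
  qed
  show ?thesis
    unfolding has_derivative_at_alt
  proof (intro conjI allI impI)
    show "bounded_linear (\<lambda>h. ?V \<bullet> h)" by (rule bounded_linear_inner_right)
    fix e :: real assume e: "0 < e"
    define e' where "e' = e / (C + 1)"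
    have e': "0 < e'" using e C by (simp add: e'_def)
    then obtain d where d: "d > 0" "\<And>z z'. z \<in> T \<Longrightarrow> z' \<in> T \<Longrightarrow> dist z' z < d \<Longrightarrow> dist (D z') (D z) < e'"
      using \<open>uniformly_continuous_on T D\<close> unfolding uniformly_continuous_on_def by metis
    show "\<exists>d>0. \<forall>x. norm (x - x0) < d \<longrightarrow>
        norm (conv S F K x - conv S F K x0 - ?V \<bullet> (x - x0)) \<le> e * norm (x - x0)"
    proof (intro exI[of _ "min d 1"] conjI allI impI)
      fix x assume x: "norm (x - x0) < min d 1"
      define h where "h = x - x0"
      let ?K = "\<lambda>z. K z - K (z - h) - D (z - h) \<bullet> h"
      have c: "continuous_on UNIV ?K"
        by (intro continuous_intros cK continuous_on_compose2[OF cK] continuous_on_compose2[OF D]) auto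
      have eq: "conv S F ?K x = conv S F K x - conv S F K x0 - ?V \<bullet> h"
      proof -
        note I1 = conv_integrable[OF S cK, of x] and I2 = conv_integrable[OF S cK, of x0]
          and I3 = conv_integrable[OF S cDb, of x0 h]
        have "conv S F ?K x = (LINT y:S|lborel. (F y * K (x - y) - F y * K (x0 - y)) - F y * (D (x0 - y) \<bullet> h))"
          by (simp add: conv_def algebra_simps h_def)
        then show ?thesis
          unfolding Vh unfolding conv_def
          using set_integral_diff(2)[OF set_integral_diff(1)[OF I1 I2] I3] set_integral_diff(2)[OF I1 I2] by simp
      qed
      have "\<bar>conv S F ?K x\<bar> \<le> (e' * norm h) * C"
        unfolding C_def
      proof (rule conv_bound[OF S(1,2) c])
        fix y assume y: "y \<in> S"
        define z0 where "z0 = x0 - y"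
        have xy: "x - y = z0 + h" "x - y - h = z0" by (simp_all add: z0_def h_def)
        let ?B = "cball z0 (norm h)"
        have "norm z0 \<le> norm x0 + M"
          using M[OF y] norm_triangle_ineq4[of x0 y] by (simp add: z0_def)
        then have sub: "z \<in> T" if "z \<in> ?B" for z
          using x that norm_triangle_sub[of z z0] by (auto simp: T_def dist_norm norm_minus_commute h_def)
        have "\<bar>(\<lambda>z. K z - D z0 \<bullet> z) (z0 + h) - (\<lambda>z. K z - D z0 \<bullet> z) z0\<bar> \<le> e' * norm (z0 + h - z0)"
        proof (rule inner_gradient_Lipschitz[where T="?B" and D="\<lambda>z. D z - D z0"])
          show "((\<lambda>z. K z - D z0 \<bullet> z) has_derivative (\<lambda>h. (D z - D z0) \<bullet> h)) (at z)" for z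
            using K[of z] by (auto intro!: derivative_eq_intros simp: inner_diff_left)
          show "norm (D z - D z0) \<le> e'" if "z \<in> ?B" for z
            using d(2)[of z0 z] sub[OF that] sub[of z0] that x by (auto simp: dist_norm h_def norm_minus_commute)
        qed (auto simp: dist_norm)
        then show "\<bar>K (x - y) - K (x - y - h) - D (x - y - h) \<bullet> h\<bar> \<le> e' * norm h"
          unfolding xy by (simp add: inner_add_right algebra_simps)
      qed
      also have "(e' * norm h) * C \<le> e * norm h"
        using e C mult_right_mono[of "e' * C" e "norm h"] by (simp add: e'_def divide_simps mult_ac)
      finally show "norm (conv S F K x - conv S F K x0 - ?V \<bullet> (x - x0)) \<le> e * norm (x - x0)"
        unfolding eq by (simp add: h_def)
    qed (use d in auto)
  qed
qed

lemma conv_has_grad_lap: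
  fixes F :: "'a::euclidean_space \<Rightarrow> real"
  assumes S: "compact S" "continuous_on S F" and K: "has_grad_lap UNIV K G L"
  shows "\<exists>G' L'. has_grad_lap UNIV (conv S F K) G' L'"
proof -
  obtain H where KG: "\<forall>x. (K has_derivative (\<lambda>h. G x \<bullet> h)) (at x)"
    and H: "\<forall>x. (G has_derivative H x) (at x)" "\<forall>b\<in>Basis. continuous_on UNIV (\<lambda>x. H x b)"
    using K unfolding has_grad_lap_def by auto
  \<comment> \<open>The gradient of the component \<open>G z \<bullet> b\<close>, read off from the
    Hessian; with it \<open>conv_has_derivative\<close> can be applied a second time, to the
    gradient.\<close>
  define D where "D b z = (\<Sum>c\<in>Basis. (H z c \<bullet> b) *\<^sub>R c)" for b z
  have Db: "((\<lambda>z. G z \<bullet> b) has_derivative (\<lambda>h. D b z \<bullet> h)) (at z)" for b z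
  proof -
    have l: "linear (H z)" using H(1) has_derivative_linear by blast
    have "H z h \<bullet> b = D b z \<bullet> h" for h
    proof -
      have "H z h = H z (\<Sum>c\<in>Basis. (h \<bullet> c) *\<^sub>R c)" by (simp add: euclidean_representation)
      also have "\<dots> = (\<Sum>c\<in>Basis. (h \<bullet> c) *\<^sub>R H z c)" 
        by (simp add: linear_sum[OF l] linear_scale[OF l])
      finally have "H z h = (\<Sum>c\<in>Basis. (h \<bullet> c) *\<^sub>R H z c)" .
      then show ?thesis by (simp add: D_def inner_sum_left inner_sum_right mult.commute inner_commute)
    qed
    moreover have "((\<lambda>z. G z \<bullet> b) has_derivative (\<lambda>h. H z h \<bullet> b)) (at z)"
      using H(1) by (auto intro: has_derivative_inner_left)
    ultimately show ?thesis by simp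
  qed
  have cD: "continuous_on UNIV (D b)" for b
    unfolding D_def using H(2) by (intro continuous_intros) auto
  have cG: "continuous_on UNIV G" using K by (rule has_grad_lap_continuous_on_grad)
  define G' where "G' x = (\<Sum>b\<in>Basis. conv S F (\<lambda>z. G z \<bullet> b) x *\<^sub>R b)" for x
  define H' where "H' x h = (\<Sum>b\<in>Basis. ((\<Sum>c\<in>Basis. conv S F (\<lambda>z. D b z \<bullet> c) x *\<^sub>R c) \<bullet> h) *\<^sub>R b)" for x h
  have "has_grad_lap UNIV (conv S F K) G' (\<lambda>x. \<Sum>b\<in>Basis. H' x b \<bullet> b)"
  proof (rule has_grad_lapI[where H=H'])
    show "(conv S F K has_derivative (\<lambda>h. G' x \<bullet> h)) (at x)" for x
      unfolding G'_def using KG cG by (intro conv_has_derivative S) auto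
    show "(G' has_derivative H' x) (at x)" for x
      unfolding G'_def H'_def
      by (intro has_derivative_sum has_derivative_scaleR_left conv_has_derivative S Db cD)
    show "continuous_on UNIV (\<lambda>x. H' x b)" for b
      unfolding H'_def 
      by (intro continuous_intros conv_continuous_on[THEN continuous_on_subset] S cD) auto
  qed auto
  then show ?thesis by blast
qed

lemma has_grad_lap_kern: "\<exists>G L. has_grad_lap UNIV (kern r :: 'a::euclidean_space \<Rightarrow> real) G L"
proof -
  define c where "c = 1 / r\<^sup>2"
  let ?q = "\<lambda>x::'a. 1 - c * (norm (x - 0))\<^sup>2"
  define m where "m = 1 / (r ^ DIM('a) * (LINT z:cball (0::'a) 1|lborel. Phi 2 (1 - (norm z)\<^sup>2)))"
  have q: "has_grad_lap UNIV ?q (\<lambda>x. 0 - c *\<^sub>R (2 *\<^sub>R (x - 0))) (\<lambda>x. 0 - c * (2 * real DIM('a)))"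
    by (intro has_grad_lap_diff has_grad_lap_const has_grad_lap_cmult has_grad_lap_norm_sq) auto
  have d2: "((\<lambda>s. Phi 4 s - 2 * Phi 3 s) has_real_derivative
      (Phi 6 s - 4 * Phi 5 s) - 2 * (Phi 5 s - 3 * Phi 4 s)) (at s)" for s
    using DERIV_diff[OF Phi_derivative[of 4] DERIV_cmult[OF Phi_derivative[of 3], of 2]]
    by (simp add: numeral_eq_Suc)
  have "\<exists>G L. has_grad_lap UNIV (\<lambda>x. Phi 2 (?q x)) G L"
    using Phi_derivative[of 2] d2
    by (intro exI) (rule has_grad_lap_chain[OF q, where \<phi>'="\<lambda>s. Phi 4 s - 2 * Phi 3 s" 
       and \<phi>''="\<lambda>s. (Phi 6 s - 4 * Phi 5 s) - 2 * (Phi 5 s - 3 * Phi 4 s)"],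
       auto intro!: continuous_intros simp: numeral_eq_Suc)
  then obtain G L where "has_grad_lap UNIV (\<lambda>x. Phi 2 (?q x)) G L" by blast
  from has_grad_lap_cmult[OF this, of m]
  have "has_grad_lap UNIV (\<lambda>x. m * Phi 2 (?q x)) (\<lambda>x. m *\<^sub>R G x) (\<lambda>x. m * L x)" .
  moreover have "(\<lambda>x. m * Phi 2 (?q x)) = kern r"
    by (auto simp: kern_def m_def c_def)
  ultimately show ?thesis by metis
qed

lemma kern_even: "kern r (x - y) = kern r (y - x)"
  by (simp add: kern_def norm_minus_commute)

lemma kern_Lipschitz:
  assumes "0 < r"
  obtains B where "0 \<le> B" "\<And>x y :: 'a::euclidean_space. \<bar>kern r x - kern r y\<bar> \<le> B * norm (x - y)"
proof -
  obtain G L where GL: "has_grad_lap UNIV (kern r :: 'a \<Rightarrow> real) G L" using has_grad_lap_kern by blast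
  have cG: "continuous_on UNIV G" using GL by (rule has_grad_lap_continuous_on_grad)
  have "bounded (G ` cball 0 r)"
    by (intro compact_imp_bounded compact_continuous_image continuous_on_subset[OF cG]) auto
  then obtain B where "\<forall>x\<in>cball 0 r. norm (G x) \<le> B" by (auto simp: bounded_iff)
  then have B: "\<And>x. x \<in> cball 0 r \<Longrightarrow> norm (G x) \<le> B" by blast
  have out: "G x = 0" if "x \<notin> cball 0 r" for x
  proof -
    have 1: "(kern r has_derivative (\<lambda>h. 0)) (at x)"
      by (rule has_derivative_transform_within_open[where f="\<lambda>x. 0" and s="- cball 0 r"])
         (use that assms in \<open>auto simp: kern_eq_0\<close>)
    have 2: "(kern r has_derivative (\<lambda>h. G x \<bullet> h)) (at x)" using has_grad_lap_derivative[OF GL] by simp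
    from fun_cong[OF has_derivative_unique[OF 1 2], of "G x"] have "0 = G x \<bullet> G x" by simp
    then show ?thesis by simp
  qed
  have B0: "0 \<le> B" using order_trans[OF norm_ge_zero B[of 0]] assms by simp
  have nG: "norm (G x) \<le> B" for x using B[of x] out[of x] B0 by (cases "x \<in> cball 0 r") auto
  show ?thesis
  proof (rule that[OF B0])
    show "\<bar>kern r x - kern r y\<bar> \<le> B * norm (x - y)" for x y :: 'a
      by (rule inner_gradient_Lipschitz[where T=UNIV and D=G]) (use has_grad_lap_derivative[OF GL] nG in auto)
  qed
qed

section \<open>The mean value property\<close>

definition harm :: "'a::euclidean_space set \<Rightarrow> ('a \<Rightarrow> real) \<Rightarrow> bool" where
  "harm U F \<longleftrightarrow> continuous_on U F \<and> (\<forall>x r. 0 < r \<and> cball x r \<subseteq> U \<longrightarrow> mean F x r = F x)"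

lemma harm_continuous_on: "harm U F \<Longrightarrow> continuous_on U F"
  and harm_mean: "harm U F \<Longrightarrow> 0 < r \<Longrightarrow> cball x r \<subseteq> U \<Longrightarrow> mean F x r = F x"
  by (auto simp: harm_def)

lemma harm_subset: "harm U F \<Longrightarrow> V \<subseteq> U \<Longrightarrow> harm V F"
  unfolding harm_def by (meson continuous_on_subset subset_trans)

lemma harm_cmult: "harm U F \<Longrightarrow> harm U (\<lambda>x. c * F x)"
  unfolding harm_def mean_cmult by (auto intro!: continuous_intros)

lemma harm_add: "harm U F \<Longrightarrow> harm U G \<Longrightarrow> harm U (\<lambda>x. F x + G x)"
  unfolding harm_def using mean_add[of _ _ F G]
  by (auto intro!: continuous_intros) (metis continuous_on_subset)

lemma harm_const: "harm U (\<lambda>x. c)"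
  by (simp add: harm_def mean_const)

lemma harm_superh:
  assumes "harm U F" "open U"
  shows "superh U F"
  unfolding superh_def
proof (intro conjI ballI harm_continuous_on[OF assms(1)])
  fix x assume "x \<in> U"
  then obtain r where r: "r > 0" "cball x r \<subseteq> U" using assms(2) open_contains_cball by blast
  have "cball x t \<subseteq> U" if "t < r" for t using r that by (auto simp: subset_iff)
  then show "\<exists>r>0. \<forall>t. 0 < t \<and> t < r \<longrightarrow> cball x t \<subseteq> U \<and> mean F x t \<le> F x"
    using r harm_mean[OF assms(1)] by (intro exI[of _ r]) auto
qed

lemma cball_enlarge:
  fixes x :: "'a::euclidean_space"
  assumes "open U" "cball x r \<subseteq> U" "0 < r"
  obtains R where "r < R" "cball x R \<subseteq> U"
proof -
  obtain e where e: "e > 0" "(\<Union>y\<in>cball x r. cball y e) \<subseteq> U"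
    using compact_subset_open_imp_cball_epsilon_subset[OF compact_cball assms(1,2)] by blast
  have "cball x (r + e) \<subseteq> U"
  proof
    fix z assume z: "z \<in> cball x (r + e)"
    define y where "y = x + (r / (r + e)) *\<^sub>R (z - x)"
    have re: "0 < r + e" using e assms by simp
    have "norm (z - x) \<le> r + e" using z by (simp add: dist_norm norm_minus_commute)
    then have "r / (r + e) * norm (z - x) \<le> r" "e / (r + e) * norm (z - x) \<le> e"
      using re e assms by (simp_all add: pos_divide_le_eq)
    moreover have "dist x y = r / (r + e) * norm (z - x)" 
      using re assms by (simp add: y_def dist_norm)
    moreover have "z - y = (e / (r + e)) *\<^sub>R (z - x)"
    proof -
      have "z - y = (1 - r / (r + e)) *\<^sub>R (z - x)" by (simp add: y_def algebra_simps)
      also have "1 - r / (r + e) = e / (r + e)" using re by (simp add: field_simps)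
      finally show ?thesis .
    qed
    then have "dist y z = e / (r + e) * norm (z - x)"
      using re e by (simp add: dist_norm norm_minus_commute[of y z])
    ultimately have "dist x y \<le> r" "dist y z \<le> e" using re by simp_all
    then have "z \<in> (\<Union>y\<in>cball x r. cball y e)" by auto
    then show "z \<in> U" using e(2) by blast
  qed
  then show ?thesis using that[of "r + e"] e by auto
qed

lemma harm_C2:
  assumes FGL: "has_grad_lap U F G L" and L: "\<And>x. x \<in> U \<Longrightarrow> L x = 0"
  shows "harm U F"
  unfolding harm_def
proof (intro conjI allI impI has_grad_lap_continuous_on[OF FGL])
  fix x r assume r: "0 < r \<and> cball x r \<subseteq> U"
  then obtain R where R: "r < R" "cball x R \<subseteq> U"
    using cball_enlarge[of U x r] has_grad_lap_open[OF FGL] by auto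
  have c: "continuous_on (cball x R) F" using has_grad_lap_continuous_on[OF FGL] R continuous_on_subset by blast
  have z: "(LINT y:cball x t|lborel. F y * bump_lap x t y) = 0" if "0 < t" "t < R" for t
  proof -
    have sub: "cball x t \<subseteq> U" using R that by auto
    have "(LINT y:cball x t|lborel. F y * bump_lap x t y) = (LINT y:cball x t|lborel. L y * bump x t y)"
      by (rule integration_by_parts_bump[OF FGL \<open>0 < t\<close> sub])
    also have "\<dots> = (LINT y:cball x t|lborel. 0)"
      by (rule set_lebesgue_integral_cong) (use L sub in auto)
    finally show ?thesis by (simp add: set_lebesgue_integral_def)
  qed
  have "mean F x r \<le> F x"
    using r R z by (intro mean_le[OF c]) auto
  moreover have "(LINT y:cball x t|lborel. ((-1) * F y) * bump_lap x t y) \<le> 0" if "0 < t" "t < R" for t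
    by (simp only: mult.assoc set_integral_mult_right z[OF that])
  then have "mean (\<lambda>x. (-1) * F x) x r \<le> (-1) * F x"
    using r R by (intro mean_le[of x R] continuous_intros c) auto
  ultimately show "mean F x r = F x" unfolding mean_cmult by simp
qed

text \<open>A canonical gradient, so that gradients obtained on overlapping neighbourhoods agree and
  can be glued in \<open>has_grad_lap_local\<close>.\<close>

definition grad :: "('a::euclidean_space \<Rightarrow> real) \<Rightarrow> 'a \<Rightarrow> 'a" where
  "grad F x = (\<Sum>b\<in>Basis. frechet_derivative F (at x) b *\<^sub>R b)"

lemma has_grad_lap_grad:
  assumes "has_grad_lap U F G L" "x \<in> U"
  shows "grad F x = G x"
proof -
  have "frechet_derivative F (at x) = (\<lambda>h. G x \<bullet> h)"
    using frechet_derivative_at[OF has_grad_lap_derivative[OF assms]] by simp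
  then show ?thesis by (simp add: grad_def euclidean_representation)
qed

lemma has_grad_lap_local:
  fixes F :: "'a::euclidean_space \<Rightarrow> real"
  assumes "open U"
    and ex: "\<And>x. x \<in> U \<Longrightarrow> \<exists>V G L. x \<in> V \<and> V \<subseteq> U \<and> has_grad_lap V F G L"
  shows "has_grad_lap U F (grad F) (laplacian F)"
proof (rule has_grad_lapI[OF assms(1), where H="\<lambda>x. frechet_derivative (grad F) (at x)"])
  have loc: "\<exists>V. open V \<and> x \<in> V \<and> (F has_derivative (\<lambda>h. grad F x \<bullet> h)) (at x) \<and> 
     (\<forall>y\<in>V. (grad F has_derivative frechet_derivative (grad F) (at y)) (at y)) \<and>
     (\<forall>b\<in>Basis. continuous_on V (\<lambda>y. frechet_derivative (grad F) (at y) b)) \<and>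
     laplacian F x = (\<Sum>b\<in>Basis. frechet_derivative (grad F) (at x) b \<bullet> b)" if x: "x \<in> U" for x
  proof -
    obtain V G L where V: "x \<in> V" "V \<subseteq> U" "has_grad_lap V F G L" using ex[OF x] by blast
    note g = has_grad_lap_grad[OF V(3)]
    have "has_grad_lap V F (grad F) L" by (rule has_grad_lap_cong[OF V(3)]) (auto simp: g)
    then obtain H where H: "open V" "\<forall>x\<in>V. (F has_derivative (\<lambda>h. grad F x \<bullet> h)) (at x)"
      "\<forall>x\<in>V. (grad F has_derivative H x) (at x)"
      "\<forall>b\<in>Basis. continuous_on V (\<lambda>x. H x b)" "\<forall>x\<in>V. L x = (\<Sum>b\<in>Basis. H x b \<bullet> b)"
      unfolding has_grad_lap_def by blast
    have h: "frechet_derivative (grad F) (at y) = H y" if "y \<in> V" for y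
      using frechet_derivative_at[of "grad F" "H y" y] H(3) that by simp
    have "\<forall>b\<in>Basis. continuous_on V (\<lambda>y. frechet_derivative (grad F) (at y) b)"
      using H(4) by (auto simp: h cong: continuous_on_cong)
    moreover have "laplacian F x = L x" using has_grad_lap_laplacian[OF V(3,1)] .
    ultimately show ?thesis
      using H V h by (intro exI[of _ V]) auto
  qed
  show "(F has_derivative (\<lambda>h. grad F x \<bullet> h)) (at x)" if "x \<in> U" for x using loc[OF that] by blast
  show "(grad F has_derivative frechet_derivative (grad F) (at x)) (at x)" if "x \<in> U" for x using loc[OF that] by blast
  show "laplacian F x = (\<Sum>b\<in>Basis. frechet_derivative (grad F) (at x) b \<bullet> b)" if "x \<in> U" for x using loc[OF that] by blast
  show "continuous_on U (\<lambda>x. frechet_derivative (grad F) (at x) b)" if b: "b \<in> Basis" for b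
  proof (rule continuous_at_imp_continuous_on, rule ballI)
    fix x assume "x \<in> U"
    from loc[OF this] b obtain V where "open V" "x \<in> V" 
       "continuous_on V (\<lambda>y. frechet_derivative (grad F) (at y) b)" by blast
    then show "isCont (\<lambda>x. frechet_derivative (grad F) (at x) b) x"
      using continuous_on_eq_continuous_at by blast
  qed
qed

lemma mean_eq_conv:
  fixes F :: "'a::euclidean_space \<Rightarrow> real"
  assumes "0 < R" "cball x R \<subseteq> S" 
  shows "mean F x R = conv S F (kern R) x"
proof -
  have "conv S F (kern R) x = (LINT y:cball x R|lborel. F y * kern R (x - y))"
    unfolding conv_def
    by (rule set_integral_zero_outside[OF assms(2)]) (use assms in \<open>auto simp: kern_eq_0 dist_norm\<close>)
  then show ?thesis by (simp add: mean_def kern_even[of R x])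
qed

text \<open>A function with the mean value property equals its own mollification at a fixed radius
  and inherits the smoothness of the kernel.\<close>

lemma harm_local_has_grad_lap:
  fixes F :: "'a::euclidean_space \<Rightarrow> real"
  assumes "harm (cball x0 (2 * R)) F" "0 < R"
  shows "\<exists>G L. has_grad_lap (ball x0 R) F G L"
proof -
  obtain G L where "has_grad_lap UNIV (kern R :: 'a \<Rightarrow> real) G L" using has_grad_lap_kern by blast
  from conv_has_grad_lap[OF compact_cball harm_continuous_on[OF assms(1)] this]
  obtain G L where "has_grad_lap UNIV (conv (cball x0 (2 * R)) F (kern R)) G L" by blast
  then have *: "has_grad_lap (ball x0 R) (conv (cball x0 (2 * R)) F (kern R)) G L"
    by (rule has_grad_lap_subset) auto
  have "has_grad_lap (ball x0 R) F G L"
  proof (rule has_grad_lap_cong[OF *])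
    fix x assume x: "x \<in> ball x0 R"
    have sub: "cball x R \<subseteq> cball x0 (2 * R)"
      using x by (simp add: cball_subset_cball_iff dist_commute)
    show "conv (cball x0 (2 * R)) F (kern R) x = F x"
      using harm_mean[OF assms(1,2) sub] mean_eq_conv[OF assms(2) sub, of F] by simp
  qed auto
  then show ?thesis by blast
qed

text \<open>If the Laplacian were positive at \<open>x\<close>, it would be positive nearby, and by
  Green's identity the mean would have a positive derivative in the radius, which contradicts its
  being constant.\<close>

lemma has_grad_lap_mean_const_lap_nonpos:
  fixes F :: "'a::euclidean_space \<Rightarrow> real"
  assumes FGL: "has_grad_lap U F G L" and x: "x \<in> U" and e: "0 < e"
    and m: "\<And>r. 0 < r \<Longrightarrow> r < e \<Longrightarrow> mean F x r = F x"
  shows "L x \<le> 0"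
proof (rule ccontr)
  assume "\<not> L x \<le> 0"
  moreover have cL: "continuous_on U L" using FGL by (rule has_grad_lap_continuous_on_lap)
  ultimately have "\<forall>\<^sub>F y in at x within U. 0 < L y"
    using x unfolding continuous_on_def by (intro order_tendstoD(1)) auto
  then have "\<forall>\<^sub>F y in at x. 0 < L y"
    using at_within_open[OF x has_grad_lap_open[OF FGL]] by simp
  then obtain d where d: "d > 0" "\<And>y. y \<noteq> x \<Longrightarrow> dist y x < d \<Longrightarrow> 0 < L y"
    unfolding eventually_at by auto
  obtain s where s: "s > 0" "cball x s \<subseteq> U" using has_grad_lap_open[OF FGL] x open_contains_cball by blast
  define R where "R = min s (min d e) / 2"
  have R: "0 < R" "R < d" "R < e" "R \<le> s" using d s e by (auto simp: R_def)
  have sub: "cball x R \<subseteq> U" using s R by auto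
  have c: "continuous_on (cball x R) F" using has_grad_lap_continuous_on[OF FGL] sub continuous_on_subset by blast
  define r where "r = R / 2"
  have r: "0 < r" "r < R" using R by (auto simp: r_def)
  have sub2: "cball x r \<subseteq> U" using sub r by auto
  obtain c where c: "c > 0"
    "((\<lambda>r. mean F x r) has_real_derivative c * (LINT y:cball x r|lborel. F y * bump_lap x r y)) (at r)"
    using mean_has_real_derivative[OF c r] by blast
  have "0 < (LINT y:cball x r|lborel. L y * bump x r y)"
  proof (rule set_integral_pos[where x=x])
    show "continuous_on (cball x r) (\<lambda>y. L y * bump x r y)"
      by (intro continuous_intros continuous_on_bump continuous_on_subset[OF cL] sub2)
    show "0 \<le> L y * bump x r y" if "y \<in> cball x r" for y
      using d(2)[of y] that r R \<open>\<not> L x \<le> 0\<close> bump_nonneg[of x r y]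
      by (cases "y = x") (auto simp: dist_commute intro!: mult_nonneg_nonneg less_imp_le)
    show "0 < L x * bump x r x" using \<open>\<not> L x \<le> 0\<close> r by (intro mult_pos_pos bump_pos) auto
  qed (use r in \<open>auto simp: interior_cball\<close>)
  then have pos: "0 < c * (LINT y:cball x r|lborel. F y * bump_lap x r y)"
    using integration_by_parts_bump[OF FGL r(1) sub2] c by simp
  have "\<forall>\<^sub>F t in nhds r. t \<in> {0<..<R}" using r by (intro eventually_nhds_in_open) auto
  then have "\<forall>\<^sub>F t in nhds r. mean F x t = F x" by eventually_elim (use m R in auto)
  then have "((\<lambda>t. F x) has_real_derivative c * (LINT y:cball x r|lborel. F y * bump_lap x r y)) (at r)"
    using c(2) DERIV_cong_ev[of r r "mean F x" "\<lambda>t. F x"] by simp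
  then show False using pos DERIV_unique[OF DERIV_const] by (metis less_irrefl)
qed

lemma has_grad_lap_mean_const_lap_zero:
  fixes F :: "'a::euclidean_space \<Rightarrow> real"
  assumes FGL: "has_grad_lap U F G L" and x: "x \<in> U" and e: "0 < e"
    and m: "\<And>r. 0 < r \<Longrightarrow> r < e \<Longrightarrow> mean F x r = F x"
  shows "L x = 0"
proof -
  have "(-1) * L x \<le> 0"
    by (rule has_grad_lap_mean_const_lap_nonpos[OF has_grad_lap_cmult[OF FGL, of "-1"] x e])
      (subst mean_cmult, simp add: m)
  then show ?thesis using has_grad_lap_mean_const_lap_nonpos[OF assms] by simp
qed

lemma harm_has_grad_lap_of_local:
  fixes F :: "'a::euclidean_space \<Rightarrow> real"
  assumes U: "open U" and h: "\<And>x. x \<in> U \<Longrightarrow> \<exists>R>0. ball x R \<subseteq> U \<and> harm (ball x R) F"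
  shows "has_grad_lap U F (grad F) (\<lambda>x. 0)"
proof -
  have loc: "\<exists>R>0. cball x (2 * R) \<subseteq> U \<and> harm (cball x (2 * R)) F" if x: "x \<in> U" for x
  proof -
    obtain R where "R > 0" "ball x R \<subseteq> U" "harm (ball x R) F" using h[OF x] by blast
    then have "cball x (2 * (R / 4)) \<subseteq> ball x R" by auto
    moreover from this have "harm (cball x (2 * (R / 4))) F" using harm_subset[OF \<open>harm (ball x R) F\<close>] by blast
    ultimately show ?thesis using \<open>ball x R \<subseteq> U\<close> \<open>R > 0\<close> by (intro exI[of _ "R / 4"]) auto
  qed
  have *: "has_grad_lap U F (grad F) (laplacian F)"
  proof (rule has_grad_lap_local[OF U])
    fix x assume "x \<in> U"
    from loc[OF this] obtain R where R: "R > 0" "cball x (2 * R) \<subseteq> U" "harm (cball x (2 * R)) F" by blast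
    have "ball x R \<subseteq> U" using R by (auto simp: subset_iff)
    then show "\<exists>V G L. x \<in> V \<and> V \<subseteq> U \<and> has_grad_lap V F G L"
      using harm_local_has_grad_lap[OF R(3,1)] R by (intro exI[of _ "ball x R"]) auto
  qed
  show ?thesis
  proof (rule has_grad_lap_cong[OF *])
    fix x assume x: "x \<in> U"
    from loc[OF this] obtain R where R: "R > 0" "harm (cball x (2 * R)) F" by blast
    show "laplacian F x = 0"
      by (rule has_grad_lap_mean_const_lap_zero[OF * x R(1)])
         (use R in \<open>auto intro!: harm_mean[OF R(2)]\<close>)
  qed auto
qed

text \<open>The passage from small balls to all balls goes through the vanishing of the Laplacian,
  which is a local condition.\<close>

lemma harm_of_local:
  assumes "open U" and "\<And>x. x \<in> U \<Longrightarrow> \<exists>R>0. ball x R \<subseteq> U \<and> harm (ball x R) F"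
  shows "harm U F"
  by (rule harm_C2[OF harm_has_grad_lap_of_local[OF assms]]) auto

lemma harm_has_grad_lap:
  assumes "open U" and "harm U F"
  shows "has_grad_lap U F (grad F) (\<lambda>x. 0)"
proof (rule harm_has_grad_lap_of_local[OF assms(1)])
  fix x assume "x \<in> U"
  then obtain R where "R > 0" "ball x R \<subseteq> U" using assms(1) open_contains_ball by blast
  then show "\<exists>R>0. ball x R \<subseteq> U \<and> harm (ball x R) F" using harm_subset[OF assms(2)] by blast
qed

section \<open>Gradient estimate, limits and Harnack's inequality\<close>

text \<open>An interior gradient estimate for harmonic functions, stated for means. The constant
  depends on \<open>R\<close> alone, and this uniformity in the function and the centre is the
  source of equicontinuity both in Perron's method and in the limit that produces
  \<open>h\<close>.\<close>

lemma mean_Lipschitz: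
  assumes R: "0 < R"
  obtains \<Lambda> where "0 \<le> \<Lambda>"
    "\<And>(F :: 'a::euclidean_space \<Rightarrow> real) x0 B x y. continuous_on (cball x0 (2 * R)) F \<Longrightarrow>
      (\<And>z. z \<in> cball x0 (2 * R) \<Longrightarrow> \<bar>F z\<bar> \<le> B) \<Longrightarrow> x \<in> cball x0 R \<Longrightarrow> y \<in> cball x0 R \<Longrightarrow>
      \<bar>mean F x R - mean F y R\<bar> \<le> \<Lambda> * B * norm (x - y)"
proof -
  obtain l where l: "0 \<le> l" "\<And>x y :: 'a. \<bar>kern R x - kern R y\<bar> \<le> l * norm (x - y)"
    using kern_Lipschitz[OF R] by blast
  define V where "V = (2 * R) ^ DIM('a) * measure lborel (ball (0 :: 'a) 1)"
  have V: "measure lborel (cball x0 (2 * R)) = V" for x0 :: 'a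
    using content_ball_conv_unit_ball[of "2 * R" x0] content_cball_conv_ball[of x0 "2 * R"] R by (simp add: V_def)
  have V0: "0 \<le> V" using R by (simp add: V_def)
  show ?thesis
  proof (rule that[of "l * V"])
    fix F :: "'a \<Rightarrow> real" and x0 B x y
    assume F: "continuous_on (cball x0 (2 * R)) F" and B: "\<And>z. z \<in> cball x0 (2 * R) \<Longrightarrow> \<bar>F z\<bar> \<le> B"
      and xy: "x \<in> cball x0 R" "y \<in> cball x0 R"
    let ?S = "cball x0 (2 * R)"
    have sub: "cball z R \<subseteq> ?S" if "z \<in> cball x0 R" for z
      using that by (simp add: cball_subset_cball_iff dist_commute)
    have c: "continuous_on UNIV (kern R :: 'a \<Rightarrow> real)" by (intro continuous_intros)
    note i = conv_integrable[OF compact_cball F c]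
    have "mean F x R - mean F y R = (LINT z:?S|lborel. F z * kern R (x - z) - F z * kern R (y - z))"
      using set_integral_diff(2)[OF i[of x] i[of y]] mean_eq_conv[OF R sub[OF xy(1)], of F]
        mean_eq_conv[OF R sub[OF xy(2)], of F] by (simp add: conv_def)
    also have "\<bar>\<dots>\<bar> \<le> (LINT z:?S|lborel. \<bar>F z * kern R (x - z) - F z * kern R (y - z)\<bar>)"
      using set_integral_norm_bound[OF set_integral_diff(1)[OF i[of x] i[of y]]] by simp
    also have "\<dots> \<le> (LINT z:?S|lborel. B * (l * norm (x - y)))"
    proof (rule set_integral_mono)
      show "set_integrable lborel ?S (\<lambda>z. \<bar>F z * kern R (x - z) - F z * kern R (y - z)\<bar>)"
        using set_integrable_abs[OF set_integral_diff(1)[OF i[of x] i[of y]]] .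
      show "set_integrable lborel ?S (\<lambda>z. B * (l * norm (x - y)))"
        by (intro set_integrable_compact) auto
      show "\<bar>F z * kern R (x - z) - F z * kern R (y - z)\<bar> \<le> B * (l * norm (x - y))" if "z \<in> ?S" for z
      proof -
        have "\<bar>F z * kern R (x - z) - F z * kern R (y - z)\<bar> = \<bar>F z\<bar> * \<bar>kern R (x - z) - kern R (y - z)\<bar>"
          by (simp add: abs_mult flip: right_diff_distrib)
        also have "\<dots> \<le> B * (l * norm (x - y))"
          using B[OF that] l(2)[of "x - z" "y - z"] abs_ge_zero[of "F z"] by (intro mult_mono) auto
        finally show ?thesis .
      qed
    qed
    also have "\<dots> = (l * V) * B * norm (x - y)"
      by (simp add: set_lebesgue_integral_def V)
    finally show "\<bar>mean F x R - mean F y R\<bar> \<le> (l * V) * B * norm (x - y)" .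
  qed (use l V0 in simp)
qed

lemma mean_limit:
  fixes F :: "nat \<Rightarrow> 'a::euclidean_space \<Rightarrow> real"
  assumes r: "0 < r" and F: "\<And>k. continuous_on (cball x r) (F k)" and f: "continuous_on (cball x r) f"
    and B: "\<And>k y. y \<in> cball x r \<Longrightarrow> \<bar>F k y\<bar> \<le> B"
    and lim: "\<And>y. y \<in> cball x r \<Longrightarrow> (\<lambda>k. F k y) \<longlonglongrightarrow> f y"
  shows "(\<lambda>k. mean (F k) x r) \<longlonglongrightarrow> mean f x r"
  unfolding mean_def set_lebesgue_integral_def
proof (rule integral_dominated_convergence[where w="\<lambda>y. indicator (cball x r) y *\<^sub>R (B * kern r (y - x))"])
  have "set_integrable lborel (cball x r) (\<lambda>y. f y * kern r (y - x))" by (rule set_integrable_kern[OF f])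
  then show "(\<lambda>y. indicator (cball x r) y *\<^sub>R (f y * kern r (y - x))) \<in> borel_measurable lborel"
    by (auto simp: set_integrable_def)
  have "set_integrable lborel (cball x r) (\<lambda>y. F k y * kern r (y - x))" for k by (rule set_integrable_kern[OF F])
  then show "(\<lambda>y. indicator (cball x r) y *\<^sub>R (F k y * kern r (y - x))) \<in> borel_measurable lborel" for k
    by (auto simp: set_integrable_def)
  have "set_integrable lborel (cball x r) (\<lambda>y. B * kern r (y - x))" by (rule set_integrable_kern) auto
  then show "integrable lborel (\<lambda>y. indicator (cball x r) y *\<^sub>R (B * kern r (y - x)))" by (simp add: set_integrable_def)
  show "AE y in lborel. norm (indicator (cball x r) y *\<^sub>R (F k y * kern r (y - x)))
      \<le> indicator (cball x r) y *\<^sub>R (B * kern r (y - x))" for k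
    using B kern_nonneg[OF r, of "_ - x"] by (intro AE_I2) (auto simp: indicator_def abs_mult intro!: mult_right_mono)
  show "AE y in lborel. (\<lambda>k. indicator (cball x r) y *\<^sub>R (F k y * kern r (y - x)))
      \<longlonglongrightarrow> indicator (cball x r) y *\<^sub>R (f y * kern r (y - x))"
    using lim by (intro AE_I2) (auto simp: indicator_def intro!: tendsto_intros)
qed

lemma harm_limit:
  fixes F :: "nat \<Rightarrow> 'a::euclidean_space \<Rightarrow> real"
  assumes F: "\<And>k. harm U (F k)" and f: "continuous_on U f"
    and B: "\<And>x r. 0 < r \<Longrightarrow> cball x r \<subseteq> U \<Longrightarrow> \<exists>B. \<forall>k. \<forall>y\<in>cball x r. \<bar>F k y\<bar> \<le> B"
    and lim: "\<And>y. y \<in> U \<Longrightarrow> (\<lambda>k. F k y) \<longlonglongrightarrow> f y"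
  shows "harm U f"
  unfolding harm_def
proof (intro conjI allI impI f)
  fix x r assume r: "0 < r \<and> cball x r \<subseteq> U"
  then have x: "x \<in> U" by auto
  obtain B' where B': "\<And>k y. y \<in> cball x r \<Longrightarrow> \<bar>F k y\<bar> \<le> B'" using B r by blast
  have "(\<lambda>k. mean (F k) x r) \<longlonglongrightarrow> mean f x r"
    using r B' lim continuous_on_subset[OF f] continuous_on_subset[OF harm_continuous_on[OF F]]
    by (intro mean_limit) auto
  moreover have "mean (F k) x r = F k x" for k using harm_mean[OF F] r by auto
  ultimately have "(\<lambda>k. F k x) \<longlonglongrightarrow> mean f x r" by simp
  then show "mean f x r = f x" using lim[OF x] LIMSEQ_unique by blast
qed

text \<open>The kernel of radius R/4 around \<open>x\<close> lives in the ball of radius R/2 around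
  \<open>c\<close>, where the kernel of radius R around \<open>c\<close> has a positive minimum. So
  the small kernel is at most a constant times the large one, and integrating the nonnegative
  \<open>F\<close> against both gives the inequality.\<close>

lemma harm_Harnack:
  assumes R: "0 < R"
  obtains C where "0 < C"
    "\<And>(F :: 'a::euclidean_space \<Rightarrow> real) c x. harm (cball c R) F \<Longrightarrow> (\<And>y. y \<in> cball c R \<Longrightarrow> 0 \<le> F y) \<Longrightarrow> 
       x \<in> cball c (R / 4) \<Longrightarrow> F x \<le> C * F c"
proof -
  have c: "continuous_on S (kern r :: 'a \<Rightarrow> real)" for r S by (intro continuous_intros)
  obtain a where a: "a \<in> cball (0::'a) (R / 2)" "\<And>y. y \<in> cball (0::'a) (R / 2) \<Longrightarrow> kern R a \<le> kern R y"
    using continuous_attains_inf[OF compact_cball _ c, of "0::'a" "R/2"] R by fastforce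
  obtain b where b: "\<And>y. y \<in> cball (0::'a) (R / 4) \<Longrightarrow> kern (R / 4) y \<le> kern (R / 4) (b :: 'a)"
    using continuous_attains_sup[OF compact_cball _ c, of "0::'a" "R/4"] R by fastforce
  have kb: "0 < kern (R / 4) b" using b[of 0] kern_pos[of "R / 4" "0::'a"] R by simp
  have ka: "0 < kern R a" using a R by (intro kern_pos) auto
  show ?thesis
  proof (rule that[of "kern (R / 4) b / kern R a"])
    fix F :: "'a \<Rightarrow> real" and c x
    assume h: "harm (cball c R) F" and pos: "\<And>y. y \<in> cball c R \<Longrightarrow> 0 \<le> F y" and x: "x \<in> cball c (R / 4)"
    let ?C = "kern (R / 4) b / kern R a"
    have sub1: "cball x (R / 4) \<subseteq> cball c (R / 2)"
      using x by (simp add: cball_subset_cball_iff dist_commute)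
    have sub2: "cball c (R / 2) \<subseteq> cball c R" using R by auto
    have cF: "continuous_on (cball c R) F" using h by (rule harm_continuous_on)
    have kle: "kern (R / 4) (y - x) \<le> ?C * kern R (y - c)" if "y \<in> cball c R" for y
    proof (cases "y \<in> cball x (R / 4)")
      case True
      then have "y - x \<in> cball 0 (R / 4)" "y - c \<in> cball 0 (R / 2)"
        using sub1 by (auto simp: dist_norm norm_minus_commute)
      then have "kern (R / 4) (y - x) \<le> kern (R / 4) b" "kern R a \<le> kern R (y - c)" using a b by auto
      then show ?thesis using ka kb by (simp add: divide_simps) (meson less_imp_le mult_mono order_trans mult_left_mono mult_right_mono)
    next
      case False
      then have "kern (R / 4) (y - x) = 0" using R by (intro kern_eq_0) (auto simp: dist_norm norm_minus_commute)
      then show ?thesis using ka kb R by (auto intro!: mult_nonneg_nonneg divide_nonneg_pos kern_nonneg)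
    qed
    have "F x = mean F x (R / 4)"
      using harm_mean[OF h, of "R / 4" x] sub1 sub2 R by auto
    also have "\<dots> = (LINT y:cball c R|lborel. F y * kern (R / 4) (y - x))"
      unfolding mean_def
      by (rule set_integral_zero_outside[symmetric]) 
         (use sub1 sub2 R in \<open>auto intro!: kern_eq_0 simp: dist_norm norm_minus_commute\<close>)
    also have "\<dots> \<le> (LINT y:cball c R|lborel. ?C * (F y * kern R (y - c)))"
    proof (rule set_integral_mono)
      show "F y * kern (R / 4) (y - x) \<le> ?C * (F y * kern R (y - c))" if "y \<in> cball c R" for y
        using mult_left_mono[OF kle[OF that] pos[OF that]] by (simp add: mult_ac)
    qed (intro set_integrable_compact continuous_intros cF compact_cball)+
    also have "\<dots> = ?C * mean F c R" by (simp add: mean_def)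
    also have "mean F c R = F c" using harm_mean[OF h R] by simp
    finally show "F x \<le> ?C * F c" .
  qed (use ka kb in simp)
qed

text \<open>The zero set is closed by continuity and open by the strict mean inequality.\<close>

lemma harm_pos_or_zero:
  fixes F :: "'a::euclidean_space \<Rightarrow> real"
  assumes U: "open U" "connected U" and F: "harm U F" and nn: "\<And>x. x \<in> U \<Longrightarrow> 0 \<le> F x"
    and p: "p \<in> U" "0 < F p" and x: "x \<in> U"
  shows "0 < F x"
proof (rule ccontr)
  assume "\<not> 0 < F x"
  define Z where "Z = {y \<in> U. F y = 0}"
  have cF: "continuous_on U F" using F by (rule harm_continuous_on)
  have "openin (top_of_set U) Z"
    unfolding openin_open
  proof (intro exI conjI)
    show "open (\<Union>{V. open V \<and> V \<subseteq> Z})" by auto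
    have "\<exists>V. open V \<and> V \<subseteq> Z \<and> y \<in> V" if "y \<in> Z" for y
    proof -
      have y: "y \<in> U" "F y = 0" using that by (auto simp: Z_def)
      obtain r where r: "r > 0" "cball y r \<subseteq> U" using U(1) y open_contains_cball by blast
      have "F z = 0" if z: "z \<in> ball y r" for z
      proof (rule ccontr)
        have "z \<in> U" using z r ball_subset_cball by blast
        moreover assume "F z \<noteq> 0"
        ultimately have "0 < F z" using nn[of z] by simp
        then have "0 < mean F y r"
          using r nn z by (intro mean_strict[of r y F 0 z] continuous_on_subset[OF cF]) auto
        then show False using harm_mean[OF F r] y by simp
      qed
      then have "ball y r \<subseteq> Z" using r ball_subset_cball by (fastforce simp: Z_def)
      then show ?thesis using r by (intro exI[of _ "ball y r"]) auto
    qed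
    then show "Z = U \<inter> \<Union>{V. open V \<and> V \<subseteq> Z}" by (auto simp: Z_def)
  qed
  moreover have "closedin (top_of_set U) Z"
    unfolding Z_def using continuous_closedin_preimage_constant[OF cF] by simp
  moreover have "x \<in> Z" using x \<open>\<not> 0 < F x\<close> nn[OF x] by (simp add: Z_def)
  ultimately have "Z = U" using U(2) unfolding connected_clopen by blast
  then have "p \<in> Z" using p by simp
  then show False using p by (simp add: Z_def)
qed

section \<open>The Dirichlet problem on balls\<close>

lemma nn_integral_lborel_translate:
  fixes f :: "'a::euclidean_space \<Rightarrow> ennreal"
  assumes "f \<in> borel_measurable borel"
  shows "(\<integral>\<^sup>+x. f (c + x) \<partial>lborel) = (\<integral>\<^sup>+x. f x \<partial>lborel)"
proof -
  have "(\<integral>\<^sup>+x. f x \<partial>lborel) = (\<integral>\<^sup>+x. f x \<partial>distr lborel borel ((+) c))"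
    by (simp add: lborel_distr_plus)
  also have "\<dots> = (\<integral>\<^sup>+x. f (c + x) \<partial>lborel)"
    using assms by (intro nn_integral_distr) auto
  finally show ?thesis by simp
qed

text \<open>
  Integrate \<open>f (T x + y)\<close> over \<open>x \<in> UNIV\<close>, \<open>y \<in> ball 0 1\<close> in both orders.
\<close>

lemma nn_integral_lborel_orthogonal:
  fixes f :: "'a::euclidean_space \<Rightarrow> ennreal" and T :: "'a \<Rightarrow> 'a"
  assumes T: "orthogonal_transformation T" and f: "f \<in> borel_measurable borel"
  shows "(\<integral>\<^sup>+x. f (T x) \<partial>lborel) = (\<integral>\<^sup>+x. f x \<partial>lborel)"
proof -
  obtain S where S: "\<And>x. T (S x) = x" 
    using orthogonal_transformation_surj[OF T] unfolding surj_def by metis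
  have l: "linear T" using T by (rule orthogonal_transformation_linear)
  have [measurable]: "T \<in> borel_measurable borel"
    using l by (intro borel_measurable_continuous_onI linear_continuous_on linear_conv_bounded_linear[THEN iffD1])
  note [measurable] = f
  define g where "g = (indicator (ball (0::'a) 1) :: 'a \<Rightarrow> ennreal)"
  have [measurable]: "g \<in> borel_measurable borel" unfolding g_def by (intro borel_measurable_indicator) simp
  let ?v = "emeasure lborel (ball (0::'a) 1)"
  have iso: "norm (T x - T y) = norm (x - y)" for x y
    using orthogonal_transformation_norm[OF T, of "x - y"] by (simp add: linear_diff[OF l])
  have vol: "(\<integral>\<^sup>+x. g (y - T x) \<partial>lborel) = ?v" for y
  proof -
    have "norm (y - T x) = norm (S y - x)" for x using iso[of "S y" x] S by simp
    then have "g (y - T x) = g (- S y + x)" for x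
      by (simp add: g_def indicator_def norm_minus_commute)
    then have "(\<integral>\<^sup>+x. g (y - T x) \<partial>lborel) = (\<integral>\<^sup>+x. g (- S y + x) \<partial>lborel)" by simp
    also have "\<dots> = (\<integral>\<^sup>+x. g x \<partial>lborel)" by (rule nn_integral_lborel_translate) measurable
    finally show ?thesis by (simp add: g_def)
  qed
  have gv: "(\<integral>\<^sup>+x. g x \<partial>lborel) = ?v" by (simp add: g_def)
  have "(\<integral>\<^sup>+x. f (T x) \<partial>lborel) * ?v = (\<integral>\<^sup>+y. (\<integral>\<^sup>+x. f (T x) \<partial>lborel) * g y \<partial>lborel)"
    by (simp add: nn_integral_cmult gv)
  also have "\<dots> = (\<integral>\<^sup>+y. (\<integral>\<^sup>+x. f (T x + y) * g y \<partial>lborel) \<partial>lborel)"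
  proof (rule nn_integral_cong)
    fix y
    have "(\<integral>\<^sup>+x. f (T x) \<partial>lborel) = (\<integral>\<^sup>+x. f (T (S y + x)) \<partial>lborel)"
      by (rule nn_integral_lborel_translate[symmetric]) measurable
    also have "\<dots> = (\<integral>\<^sup>+x. f (T x + y) \<partial>lborel)"
      by (simp add: linear_add[OF l] S add.commute)
    finally show "(\<integral>\<^sup>+x. f (T x) \<partial>lborel) * g y = (\<integral>\<^sup>+x. f (T x + y) * g y \<partial>lborel)"
      by (simp add: nn_integral_multc)
  qed
  also have "\<dots> = (\<integral>\<^sup>+x. (\<integral>\<^sup>+y. f (T x + y) * g y \<partial>lborel) \<partial>lborel)"
    by (rule lborel_pair.Fubini') measurable
  also have "\<dots> = (\<integral>\<^sup>+x. (\<integral>\<^sup>+y. f y * g (y - T x) \<partial>lborel) \<partial>lborel)"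
  proof (rule nn_integral_cong)
    fix x
    show "(\<integral>\<^sup>+y. f (T x + y) * g y \<partial>lborel) = (\<integral>\<^sup>+y. f y * g (y - T x) \<partial>lborel)"
      using nn_integral_lborel_translate[of "\<lambda>y. f y * g (y - T x)" "T x"] by simp
  qed
  also have "\<dots> = (\<integral>\<^sup>+y. (\<integral>\<^sup>+x. f y * g (y - T x) \<partial>lborel) \<partial>lborel)"
    by (rule lborel_pair.Fubini') measurable
  also have "\<dots> = (\<integral>\<^sup>+y. f y * ?v \<partial>lborel)"
    by (simp add: nn_integral_cmult vol)
  also have "\<dots> = (\<integral>\<^sup>+y. f y \<partial>lborel) * ?v" by (simp add: nn_integral_multc)
  finally have eq: "(\<integral>\<^sup>+x. f (T x) \<partial>lborel) * ?v = (\<integral>\<^sup>+y. f y \<partial>lborel) * ?v" .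
  define r where "r = measure lborel (ball (0::'a) 1)"
  have r: "0 < r" unfolding r_def by (rule content_ball_pos) simp
  have v: "?v = ennreal r"
    unfolding r_def using emeasure_lborel_ball_finite[of "0::'a" 1] by (intro emeasure_eq_ennreal_measure) auto
  have cancel: "k * ?v * ennreal (1 / r) = k" for k
    using r by (simp add: v mult.assoc flip: ennreal_mult)
  show ?thesis using arg_cong[OF eq, of "\<lambda>k. k * ennreal (1 / r)"] unfolding cancel .
qed

lemma integral_lborel_orthogonal:
  fixes f :: "'a::euclidean_space \<Rightarrow> real" and T :: "'a \<Rightarrow> 'a"
  assumes T: "orthogonal_transformation T" and f: "f \<in> borel_measurable borel"
  shows "(LINT x|lborel. f (T x)) = (LINT x|lborel. f x)"
proof -
  have [measurable]: "T \<in> borel_measurable borel"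
    using orthogonal_transformation_linear[OF T] 
    by (intro borel_measurable_continuous_onI linear_continuous_on linear_conv_bounded_linear[THEN iffD1])
  have "distr lborel borel T = lborel"
  proof (rule measure_eqI)
    fix A assume "A \<in> sets (distr lborel borel T)"
    then have [measurable]: "A \<in> sets borel" by simp
    have "emeasure (distr lborel borel T) A = (\<integral>\<^sup>+x. indicator A x \<partial>distr lborel borel T)"
      by simp
    also have "\<dots> = (\<integral>\<^sup>+x. indicator A (T x) \<partial>lborel)" by (rule nn_integral_distr) auto
    also have "\<dots> = (\<integral>\<^sup>+x. indicator A x \<partial>lborel)" by (rule nn_integral_lborel_orthogonal[OF T]) auto
    finally show "emeasure (distr lborel borel T) A = emeasure lborel A" by simp
  qed simp
  then show ?thesis using integral_distr[of T lborel borel f] f by simp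
qed

section \<open>Superpositions of harmonic functions and the Poisson kernel\<close>

lemma set_integral_swap:
  fixes g :: "'a::euclidean_space \<Rightarrow> 'b::euclidean_space \<Rightarrow> real"
  assumes A: "compact A" and S: "compact S" and g: "continuous_on (A \<times> S) (\<lambda>(x, y). g x y)"
  shows "(LINT x:A|lborel. LINT y:S|lborel. g x y) = (LINT y:S|lborel. LINT x:A|lborel. g x y)"
proof -
  have "integrable lborel (\<lambda>z. indicator (A \<times> S) z *\<^sub>R (case z of (x, y) \<Rightarrow> g x y))"
    using borel_integrable_compact[OF compact_Times[OF A S] g] .
  then have i: "integrable (lborel \<Otimes>\<^sub>M lborel) (\<lambda>(x, y). indicator A x *\<^sub>R (indicator S y *\<^sub>R g x y))"
    unfolding lborel_prod
    by (rule back_subst[of "integrable lborel"]) (auto simp: fun_eq_iff indicator_times mult.assoc)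
  have "(LINT x:A|lborel. LINT y:S|lborel. g x y)
      = (LINT x|lborel. LINT y|lborel. indicator A x *\<^sub>R (indicator S y *\<^sub>R g x y))"
    by (simp add: set_lebesgue_integral_def)
  also have "\<dots> = (LINT y|lborel. LINT x|lborel. indicator A x *\<^sub>R (indicator S y *\<^sub>R g x y))"
    by (rule lborel_pair.Fubini_integral[OF i, symmetric])
  also have "\<dots> = (LINT y:S|lborel. LINT x:A|lborel. g x y)"
  proof -
    have "(LINT x|lborel. indicator A x *\<^sub>R (indicator S y *\<^sub>R g x y))
        = indicator S y *\<^sub>R (LINT x|lborel. indicator A x *\<^sub>R g x y)" for y
      unfolding real_scaleR_def
      by (subst integral_mult_right_zero[symmetric]) (rule Bochner_Integration.integral_cong, auto)
    then show ?thesis by (simp add: set_lebesgue_integral_def)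
  qed
  finally show ?thesis .
qed

lemma set_integral_parametric_continuous:
  fixes g :: "'a::euclidean_space \<Rightarrow> 'b::euclidean_space \<Rightarrow> real"
  assumes A: "compact A" and S: "compact S" and g: "continuous_on (A \<times> S) (\<lambda>(x, y). g x y)"
  shows "continuous_on A (\<lambda>x. LINT y:S|lborel. g x y)"
proof -
  have gx: "set_integrable lborel S (g x)" if "x \<in> A" for x
  proof -
    have "continuous_on S (\<lambda>y. case (x, y) of (x, y) \<Rightarrow> g x y)"
      by (rule continuous_on_compose2[OF g]) (use that in \<open>auto intro!: continuous_intros\<close>)
    then show ?thesis by (intro set_integrable_compact S) simp
  qed
  have "compact ((\<lambda>(x, y). g x y) ` (A \<times> S))"
    by (intro compact_continuous_image g compact_Times A S)
  then obtain B where B: "\<forall>x\<in>A. \<forall>y\<in>S. \<bar>g x y\<bar> \<le> B"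
    by (auto dest!: compact_imp_bounded simp: bounded_iff)
  show ?thesis
    unfolding continuous_on_sequentially comp_def
  proof (intro allI ballI impI)
    fix X x assume x: "x \<in> A" and "(\<forall>n. X n \<in> A) \<and> X \<longlonglongrightarrow> x"
    then have X: "\<And>n. X n \<in> A" "X \<longlonglongrightarrow> x" by auto
    show "(\<lambda>n. LINT y:S|lborel. g (X n) y) \<longlonglongrightarrow> (LINT y:S|lborel. g x y)"
      unfolding set_lebesgue_integral_def
    proof (rule integral_dominated_convergence[where w="\<lambda>y. indicator S y *\<^sub>R B"])
      have "set_integrable lborel S (\<lambda>y. B)" by (intro set_integrable_compact S) auto
      then show "integrable lborel (\<lambda>y. indicator S y *\<^sub>R B)" by (simp add: set_integrable_def)
      show "(\<lambda>y. indicator S y *\<^sub>R g x y) \<in> borel_measurable lborel"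
        using gx[OF x] by (auto simp: set_integrable_def)
      show "(\<lambda>y. indicator S y *\<^sub>R g (X n) y) \<in> borel_measurable lborel" for n
        using gx[OF X(1)] by (auto simp: set_integrable_def)
      show "AE y in lborel. norm (indicator S y *\<^sub>R g (X n) y) \<le> indicator S y *\<^sub>R B" for n
        using B X by (intro AE_I2) (auto simp: indicator_def)
      have "(\<lambda>n. g (X n) y) \<longlonglongrightarrow> g x y" if y: "y \<in> S" for y
      proof -
        have "(\<lambda>n. case (X n, y) of (x, y) \<Rightarrow> g x y) \<longlonglongrightarrow> (case (x, y) of (x, y) \<Rightarrow> g x y)"
          by (rule continuous_on_tendsto_compose[OF g]) (use X x y in \<open>auto intro!: tendsto_intros\<close>)
        then show ?thesis by simp
      qed
      then show "AE y in lborel. (\<lambda>n. indicator S y *\<^sub>R g (X n) y) \<longlonglongrightarrow> indicator S y *\<^sub>R g x y"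
        by (intro AE_I2) (auto simp: indicator_def)
    qed
  qed
qed

text \<open>By Fubini the weighted mean in \<open>x\<close> commutes with the integral over the
  parameter \<open>y\<close>.\<close>

lemma harm_integral:
  fixes g :: "'a::euclidean_space \<Rightarrow> 'b::euclidean_space \<Rightarrow> real"
  assumes U: "open U" and S: "compact S" and g: "continuous_on (U \<times> S) (\<lambda>(x, y). g x y)"
    and h: "\<And>y. y \<in> S \<Longrightarrow> harm U (\<lambda>x. g x y)"
  shows "harm U (\<lambda>x. LINT y:S|lborel. g x y)"
  unfolding harm_def
proof (intro conjI allI impI)
  have c: "continuous_on (cball x r) (\<lambda>x. LINT y:S|lborel. g x y)" if "cball x r \<subseteq> U" for x r
    using that by (intro set_integral_parametric_continuous S continuous_on_subset[OF g]) auto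
  show "continuous_on U (\<lambda>x. LINT y:S|lborel. g x y)"
  proof (rule continuous_at_imp_continuous_on, rule ballI)
    fix x assume "x \<in> U"
    then obtain r where r: "r > 0" "cball x r \<subseteq> U" using U open_contains_cball by blast
    have "continuous_on (ball x r) (\<lambda>x. LINT y:S|lborel. g x y)"
      using c[OF r(2)] continuous_on_subset ball_subset_cball by blast
    then show "isCont (\<lambda>x. LINT y:S|lborel. g x y) x"
      using r by (simp add: continuous_on_eq_continuous_at)
  qed
  fix x r assume r: "0 < r \<and> cball x r \<subseteq> U"
  have "mean (\<lambda>x. LINT y:S|lborel. g x y) x r = (LINT z:cball x r|lborel. LINT y:S|lborel. g z y * kern r (z - x))"
    by (simp add: mean_def)
  also have "\<dots> = (LINT y:S|lborel. LINT z:cball x r|lborel. g z y * kern r (z - x))"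
  proof (rule set_integral_swap[OF compact_cball S])
    have "continuous_on (cball x r \<times> S) (\<lambda>z. (case z of (x, y) \<Rightarrow> g x y) * kern r (fst z - x))"
      using r by (intro continuous_intros continuous_on_subset[OF g]) auto
    then show "continuous_on (cball x r \<times> S) (\<lambda>(z, y). g z y * kern r (z - x))"
      by (simp add: case_prod_beta)
  qed
  also have "\<dots> = (LINT y:S|lborel. g x y)"
  proof (rule set_lebesgue_integral_cong)
    show "\<forall>y. y \<in> S \<longrightarrow> (LINT z:cball x r|lborel. g z y * kern r (z - x)) = g x y"
      using harm_mean[OF h] r by (auto simp: mean_def)
    show "S \<in> sets lborel" using S by (simp add: borel_compact)
  qed
  finally show "mean (\<lambda>x. LINT y:S|lborel. g x y) x r = (LINT y:S|lborel. g x y)" .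
qed

lemma has_grad_lap_translate:
  assumes "has_grad_lap U F G L"
  shows "has_grad_lap {x. x - a \<in> U} (\<lambda>x. F (x - a)) (\<lambda>x. G (x - a)) (\<lambda>x. L (x - a))"
proof -
  obtain H where H: "open U" "\<forall>x\<in>U. (F has_derivative (\<lambda>h. G x \<bullet> h)) (at x)"
    "\<forall>x\<in>U. (G has_derivative H x) (at x)"
    "\<forall>b\<in>Basis. continuous_on U (\<lambda>x. H x b)" "\<forall>x\<in>U. L x = (\<Sum>b\<in>Basis. H x b \<bullet> b)"
    using assms unfolding has_grad_lap_def by blast
  have t: "((\<lambda>x. x - a) has_derivative (\<lambda>h. h)) (at x)" for x by (auto intro!: derivative_eq_intros)
  have "{x. x - a \<in> U} = (\<lambda>x. x - a) -` U" by auto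
  then have op: "open {x. x - a \<in> U}"
    using H(1) by (auto intro!: continuous_open_vimage continuous_intros)
  show ?thesis
  proof (rule has_grad_lapI[OF op, where H="\<lambda>x. H (x - a)"])
    show "((\<lambda>x. F (x - a)) has_derivative (\<lambda>h. G (x - a) \<bullet> h)) (at x)" if "x \<in> {x. x - a \<in> U}" for x
      using has_derivative_compose[OF t, of F] H(2) that by auto
    show "((\<lambda>x. G (x - a)) has_derivative H (x - a)) (at x)" if "x \<in> {x. x - a \<in> U}" for x
      using has_derivative_compose[OF t, of G] H(3) that by auto
    show "continuous_on {x. x - a \<in> U} (\<lambda>x. H (x - a) b)" if "b \<in> Basis" for b
      by (rule continuous_on_compose2[of U "\<lambda>x. H x b"]) (use H(4) that in \<open>auto intro!: continuous_intros\<close>)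
  qed (use H(5) in auto)
qed

lemma harm_translate:
  fixes F :: "'a::euclidean_space \<Rightarrow> real"
  assumes "harm U F"
  shows "harm {x. x - a \<in> U} (\<lambda>x. F (x - a))"
  unfolding harm_def
proof (intro conjI allI impI)
  show "continuous_on {x. x - a \<in> U} (\<lambda>x. F (x - a))"
    by (rule continuous_on_compose2[OF harm_continuous_on[OF assms]]) (auto intro!: continuous_intros)
  fix x r assume r: "0 < r \<and> cball x r \<subseteq> {x. x - a \<in> U}"
  have sub: "cball (x - a) r \<subseteq> U"
  proof
    fix z assume "z \<in> cball (x - a) r"
    then have "z + a \<in> cball x r" by (simp add: dist_norm algebra_simps)
    then show "z \<in> U" using r by auto
  qed
  have c: "continuous_on (cball (x - a) r) (\<lambda>y. F y * kern r (y - (x - a)))"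
    by (intro continuous_intros continuous_on_subset[OF harm_continuous_on[OF assms]] sub)
  have c2: "continuous_on (cball ((x - a) + a) r) (\<lambda>y. F (y - a) * kern r (y - a - (x - a)))"
    by (rule continuous_on_compose2[OF c]) (auto intro!: continuous_intros simp: dist_norm algebra_simps)
  have "mean (\<lambda>x. F (x - a)) x r = (LINT y:cball ((x - a) + a) r|lborel. F (y - a) * kern r (y - a - (x - a)))"
    by (simp add: mean_def)
  also have "\<dots> = mean F (x - a) r"
    by (subst set_integral_translate[OF _ c2]) (use r in \<open>auto simp: mean_def\<close>)
  finally show "mean (\<lambda>x. F (x - a)) x r = F (x - a)"
    using harm_mean[OF assms _ sub] r by simp
qed

text \<open>The Poisson kernel of the ball of radius |y| with pole \<open>y\<close>, up to a factor
  that depends only on |y|. The radius is tied to the pole because \<open>y\<close> will range over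
  a shell rather than over one sphere.\<close>

definition pois :: "'a::euclidean_space \<Rightarrow> 'a \<Rightarrow> real" where
  "pois x y = ((norm y)\<^sup>2 - (norm x)\<^sup>2) * norm (x - y) powr (- real DIM('a))"

lemma harm_pois:
  fixes y :: "'a::euclidean_space"
  shows "harm (- {y}) (\<lambda>x. pois x y)"
proof -
  let ?n = "real DIM('a)"
  have set: "{x. x - y \<in> - {0}} = - {y}" by auto
  have "has_grad_lap (- {0}) (\<lambda>x :: 'a. norm x powr (- ?n)) (\<lambda>x. ((- ?n) * norm x powr (- ?n - 2)) *\<^sub>R x)
           (\<lambda>x. (- ?n) * ((- ?n) + ?n - 2) * norm x powr (- ?n - 2))"
    by (rule has_grad_lap_norm_powr) auto
  from has_grad_lap_translate[OF this, of y]
  have 1: "has_grad_lap (- {y}) (\<lambda>x. norm (x - y) powr (- ?n)) (\<lambda>x. ((- ?n) * norm (x - y) powr (- ?n - 2)) *\<^sub>R (x - y))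
           (\<lambda>x. (- ?n) * ((- ?n) + ?n - 2) * norm (x - y) powr (- ?n - 2))"
    unfolding set .
  have 2: "has_grad_lap (- {y}) (\<lambda>x. (norm y)\<^sup>2 - (norm (x - 0))\<^sup>2) (\<lambda>x. 0 - 2 *\<^sub>R (x - 0)) (\<lambda>x. 0 - 2 * ?n)"
    by (intro has_grad_lap_diff has_grad_lap_const has_grad_lap_norm_sq) auto
  show ?thesis
    unfolding pois_def
  proof (rule harm_C2[OF has_grad_lap_cong[OF has_grad_lap_mult[OF 2 1]]])
    \<comment> \<open>With r^(-n) written as r^(-n-2) r^2 all terms carry the same power of r = |x -
      y|, and the coefficients cancel on expanding |x - y|^2.\<close>
    fix x assume x: "x \<in> - {y}"
    let ?r = "norm (x - y)"
    have r: "?r powr (- ?n) = ?r powr (- ?n - 2) * ?r\<^sup>2"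
      using x by (simp flip: powr_numeral powr_add)
    show "((norm y)\<^sup>2 - (norm (x - 0))\<^sup>2) * ((- ?n) * ((- ?n) + ?n - 2) * ?r powr (- ?n - 2))
        + 2 * ((0 - 2 *\<^sub>R (x - 0)) \<bullet> (((- ?n) * ?r powr (- ?n - 2)) *\<^sub>R (x - y)))
        + ?r powr (- ?n) * (0 - 2 * ?n) = 0"
      unfolding r by (simp add: power2_norm_eq_inner algebra_simps inner_commute)
  qed auto
qed

lemma pois_continuous:
  fixes A :: "('a::euclidean_space \<times> 'a) set"
  assumes "\<And>x y. (x, y) \<in> A \<Longrightarrow> x \<noteq> y"
  shows "continuous_on A (\<lambda>(x, y). pois x y)"
  unfolding pois_def case_prod_beta using assms
  by (intro continuous_intros) auto

text \<open>The reflection in the hyperplane orthogonal to \<open>x - z\<close>.\<close>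

lemma orthogonal_transformation_between:
  fixes x z :: "'a::euclidean_space"
  assumes "norm x = norm z"
  obtains T :: "'a \<Rightarrow> 'a" where "orthogonal_transformation T" "T x = z"
proof (cases "x = z")
  case True
  then show ?thesis using that[of "\<lambda>x. x"] by simp
next
  case False
  define w where "w = x - z"
  define T where "T y = y - (2 * (y \<bullet> w) / (w \<bullet> w)) *\<^sub>R w" for y
  have w: "w \<bullet> w \<noteq> 0" using False by (simp add: w_def)
  have "linear T"
    unfolding T_def by (intro linearI) (auto simp: inner_left_distrib algebra_simps add_divide_distrib)
  moreover have "T u \<bullet> T v = u \<bullet> v" for u v
  proof -
    have "T u \<bullet> T v = u \<bullet> v - 2 * (v \<bullet> w) / (w \<bullet> w) * (u \<bullet> w) - 2 * (u \<bullet> w) / (w \<bullet> w) * (w \<bullet> v)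
        + (2 * (u \<bullet> w) / (w \<bullet> w)) * (2 * (v \<bullet> w) / (w \<bullet> w)) * (w \<bullet> w)"
      unfolding T_def by (simp add: inner_diff_left inner_diff_right algebra_simps)
    also have "\<dots> = u \<bullet> v" using w by (simp add: field_simps inner_commute)
    finally show ?thesis .
  qed
  moreover have "T x = z"
  proof -
    have "x \<bullet> x = z \<bullet> z" using assms by (simp add: norm_eq)
    then have "2 * (x \<bullet> w) = w \<bullet> w" by (simp add: w_def inner_diff_left inner_diff_right inner_commute)
    then show ?thesis using w by (simp add: T_def) (simp add: w_def)
  qed
  ultimately show ?thesis using that[of T] by (simp add: orthogonal_transformation_def)
qed

text \<open>As a function of \<open>x\<close> the integral is harmonic, and it is radial because the
  shell and Lebesgue measure are invariant under orthogonal maps. A radial harmonic function on a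
  ball is constant, by the minimum principle on the ball whose boundary sphere passes through
  \<open>x\<close>.\<close>

lemma pois_integral_const:
  fixes x :: "'a::euclidean_space"
  assumes S: "S = {y :: 'a. p \<le> norm y \<and> norm y \<le> q}" and p: "0 < p" and x: "norm x < p"
  shows "(LINT y:S|lborel. pois x y) = (LINT y:S|lborel. pois 0 y)"
proof -
  have cS: "compact S"
  proof -
    have "S = cball 0 q \<inter> - ball 0 p" by (auto simp: S)
    then show ?thesis by (simp add: compact_Int_closed closed_Compl)
  qed
  define c where "c x = (LINT y:S|lborel. pois x y)" for x :: 'a
  have h: "harm (ball 0 p) c"
    unfolding c_def
    by (intro harm_integral open_ball cS pois_continuous harm_subset[OF harm_pois]) (auto simp: S)
  have rad: "c (T z) = c z" if T: "orthogonal_transformation T" and z: "norm z < p" for T z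
  proof -
    have Tz: "norm (T z) < p" using z orthogonal_transformation_norm[OF T] by simp
    have "continuous_on S (pois (T z))"
    proof -
      have "continuous_on S (\<lambda>y. case (T z, y) of (x, y) \<Rightarrow> pois x y)"
        by (rule continuous_on_compose2[OF pois_continuous[of "{T z} \<times> S"]]) 
          (use Tz in \<open>auto simp: S intro!: continuous_intros\<close>)
      then show ?thesis by simp
    qed
    from set_integrable_compact[OF cS this]
    have "(\<lambda>y. indicator S y *\<^sub>R pois (T z) y) \<in> borel_measurable borel"
      unfolding set_integrable_def using borel_measurable_integrable by fastforce
    from integral_lborel_orthogonal[OF T this]
    have "c (T z) = (LINT y|lborel. indicator S (T y) *\<^sub>R pois (T z) (T y))"
      by (simp add: c_def set_lebesgue_integral_def)
    also have "\<dots> = c z"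
      unfolding c_def set_lebesgue_integral_def
    proof (rule Bochner_Integration.integral_cong)
      fix y
      have "norm (T z - T y) = norm (z - y)"
        using orthogonal_transformation_norm[OF T, of "z - y"] 
        by (simp add: linear_diff[OF orthogonal_transformation_linear[OF T]])
      then show "indicator S (T y) *\<^sub>R pois (T z) (T y) = indicator S y *\<^sub>R pois z y"
        by (simp add: pois_def S indicator_def orthogonal_transformation_norm[OF T])
    qed simp
    finally show ?thesis .
  qed
  show ?thesis
  proof (cases "x = 0")
    case False
    define r where "r = norm x"
    have r: "0 < r" "r < p" using x False by (auto simp: r_def)
    have same: "c z = c x" if nz: "norm z = r" for z
    proof -
      obtain T where "orthogonal_transformation T" "T x = z"
        using orthogonal_transformation_between[of x z] nz by (auto simp: r_def)
      then show ?thesis using rad[of T x] x by auto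
    qed
    have cc: "continuous_on (cball 0 r) c"
      using harm_continuous_on[OF h] r by (auto intro: continuous_on_subset)
    \<comment> \<open>The signs \<open>s = 1\<close> and \<open>s = -1\<close> give the two
      inequalities between \<open>c 0\<close> and \<open>c x\<close>.\<close>
    have key: "0 \<le> s * c 0 + - s * c x" for s :: real
    proof (rule min_principle[of "ball 0 r" "\<lambda>z. s * c z + - s * c x" 0])
      show "continuous_on (ball 0 r) (\<lambda>z. s * c z + - s * c x)"
        by (intro continuous_intros continuous_on_subset[OF cc]) auto
      have su: "superh (ball 0 p) (\<lambda>z. s * c z + - s * c x)"
        by (intro harm_superh harm_add harm_cmult h harm_const) auto
      have op: "open {z \<in> ball 0 r. s * c z + - s * c x < 0}"
      proof -
        have "continuous_on (ball 0 r) (\<lambda>z. s * c z + - s * c x)"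
          by (intro continuous_intros continuous_on_subset[OF cc]) auto
        from continuous_open_preimage[OF this open_ball, of "{..<0}"] show ?thesis
          by (auto simp: vimage_def Int_def)
      qed
      show "superh {z \<in> ball 0 r. s * c z + - s * c x < 0} (\<lambda>z. s * c z + - s * c x)"
        by (rule superh_subset[OF su op]) (use r in auto)
      fix z :: 'a and e assume z: "z \<in> frontier (ball 0 r)" and e: "(0::real) < e"
      have "z \<in> cball 0 r" "norm z = r" using z r by (auto simp: frontier_ball)
      have "continuous_on (cball 0 r) (\<lambda>z. s * c z + - s * c x)" by (intro continuous_intros cc)
      then have "((\<lambda>z. s * c z + - s * c x) \<longlongrightarrow> s * c z + - s * c x) (at z within cball 0 r)"
        using \<open>z \<in> cball 0 r\<close> unfolding continuous_on_def by blast
      then have "((\<lambda>z. s * c z + - s * c x) \<longlongrightarrow> 0) (at z within cball 0 r)"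
        using same[OF \<open>norm z = r\<close>] by simp
      then have "((\<lambda>z. s * c z + - s * c x) \<longlongrightarrow> 0) (at z within ball 0 r)"
        by (rule tendsto_within_subset) auto
      then show "\<forall>\<^sub>F z in at z within ball 0 r. - e < s * c z + - s * c x"
        using e by (intro order_tendstoD(1)[where y=0]) auto
    qed (use r in auto)
    from key[of 1] key[of "-1"] show ?thesis by (simp add: c_def)
  qed simp
qed

text \<open>
  The Poisson kernels are averaged over a thin shell outside the ball, which avoids surface measure;
  in exchange the boundary values are attained only up to \<open>e\<close>. This suffices for Perron's method.
\<close>

lemma approximate_dirichlet_0:
  fixes F :: "'a::euclidean_space \<Rightarrow> real"
  assumes R: "0 < R" "R < R1" and F: "continuous_on (cball 0 R1) F" and e: "0 < e"
  shows "\<exists>u. harm (cball 0 R) u \<and> (\<forall>x. norm x = R \<longrightarrow> \<bar>u x - F x\<bar> \<le> e)"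
proof -
  let ?n = "real DIM('a)"
  have "uniformly_continuous_on (cball 0 R1) F"
    by (intro compact_uniformly_continuous F compact_cball)
  then obtain \<kappa> where \<kappa>: "\<kappa> > 0" "\<And>x y. x \<in> cball 0 R1 \<Longrightarrow> y \<in> cball 0 R1 \<Longrightarrow> dist y x < \<kappa> \<Longrightarrow> dist (F y) (F x) < e / 2"
    using e unfolding uniformly_continuous_on_def by (metis half_gt_zero)
  obtain B where "\<forall>x\<in>cball 0 R1. \<bar>F x\<bar> \<le> B"
    using compact_imp_bounded[OF compact_continuous_image[OF F compact_cball]] unfolding bounded_iff by auto
  then have B: "\<And>x. x \<in> cball 0 R1 \<Longrightarrow> \<bar>F x\<bar> \<le> B" by blast
  have B0: "0 \<le> B" using B[of 0] R by auto
  define m where "m = R\<^sup>2 * R1 powr (- ?n)"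
  have m: "m > 0" using R by (simp add: m_def)
  \<comment> \<open>Bounds the integrand at poles \<open>y\<close> further than \<kappa> from the
    boundary point \<open>x\<close>: there the kernel is at most ((R + 2 \<delta>)^2 - R^2)
    \<kappa>^(-n), which tends to 0 as the shell gets thin and can be absorbed into e/2 times the
    lower bound \<open>m\<close> of \<open>pois 0 y\<close>.\<close>
  define D where "D \<delta> = 2 * B * ((R + 2 * \<delta>)\<^sup>2 - R\<^sup>2) * \<kappa> powr (- ?n)" for \<delta>
  have "(D \<longlongrightarrow> 2 * B * ((R + 2 * 0)\<^sup>2 - R\<^sup>2) * \<kappa> powr (- ?n)) (at_right 0)"
    unfolding D_def by (intro tendsto_intros)
  then have "(D \<longlongrightarrow> 0) (at_right 0)" by simp
  then have "\<forall>\<^sub>F \<delta> in at_right 0. D \<delta> < e / 2 * m"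
    using e m by (intro order_tendstoD(2)[where y=0]) auto
  moreover have "\<forall>\<^sub>F \<delta> in at_right 0. \<delta> < (R1 - R) / 2" "\<forall>\<^sub>F \<delta> in at_right (0::real). 0 < \<delta>"
    using R by (auto simp: eventually_at_right_less intro!: order_tendstoD(2)[of _ 0] tendsto_eq_intros)
  ultimately have "\<forall>\<^sub>F \<delta> in at_right 0. D \<delta> < e / 2 * m \<and> \<delta> < (R1 - R) / 2 \<and> 0 < \<delta>"
    by eventually_elim auto
  then obtain \<delta> where \<delta>: "D \<delta> < e / 2 * m" "\<delta> < (R1 - R) / 2" "0 < \<delta>"
    using eventually_happens'[OF trivial_limit_at_right_real] by blast
  define S where "S = {y :: 'a. R + \<delta> \<le> norm y \<and> norm y \<le> R + 2 * \<delta>}"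
  have cS: "compact S"
  proof -
    have "S = cball 0 (R + 2 * \<delta>) \<inter> - ball 0 (R + \<delta>)" by (auto simp: S_def)
    then show ?thesis by (simp add: compact_Int_closed closed_Compl)
  qed
  have SR1: "S \<subseteq> cball 0 R1" using \<delta> by (auto simp: S_def)
  have FS: "continuous_on S F" using F SR1 continuous_on_subset by blast
  have cp: "continuous_on S (pois x)" if "norm x < R + \<delta>" for x
  proof -
    have "continuous_on S (\<lambda>y. case (x, y) of (x, y) \<Rightarrow> pois x y)"
      by (rule continuous_on_compose2[OF pois_continuous[of "{x} \<times> S"]]) 
        (use that in \<open>auto simp: S_def intro!: continuous_intros\<close>)
    then show ?thesis by simp
  qed
  define c where "c = (LINT y:S|lborel. pois 0 y)"
  have cx: "(LINT y:S|lborel. pois x y) = c" if "norm x < R + \<delta>" for x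
    unfolding c_def by (rule pois_integral_const[where S=S and p="R+\<delta>" and q="R+2*\<delta>"]) (use that R \<delta> in \<open>auto simp: S_def\<close>)
  have p0: "pois 0 y \<ge> m" if "y \<in> S" for y
  proof -
    have "R \<le> norm y" "norm y \<le> R1" "0 < norm y" using that \<delta> R by (auto simp: S_def)
    then have "R\<^sup>2 \<le> (norm y)\<^sup>2" "R1 powr (- ?n) \<le> norm y powr (- ?n)"
      using R by (auto intro!: power_mono powr_mono2')
    then show ?thesis unfolding pois_def m_def by (auto intro!: mult_mono)
  qed
  obtain b :: 'a where b: "b \<in> Basis" using nonempty_Basis by blast
  have c: "c > 0"
    unfolding c_def
  proof (rule set_integral_pos[OF cS, where x="(R + 3/2 * \<delta>) *\<^sub>R b"])
    let ?y = "(R + 3/2 * \<delta>) *\<^sub>R b"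
    have "open {y :: 'a. R + \<delta> < norm y \<and> norm y < R + 2 * \<delta>}"
      by (intro open_Collect_conj open_Collect_less continuous_intros)
    then have "{y. R + \<delta> < norm y \<and> norm y < R + 2 * \<delta>} \<subseteq> interior S"
      by (intro interior_maximal) (auto simp: S_def)
    then show y: "?y \<in> interior S" using b \<delta> R by auto
    have "?y \<in> S" using y interior_subset by blast
    then show "0 < pois 0 ?y" using p0[of ?y] m by simp
    show "continuous_on S (pois 0)" using cp[of 0] R \<delta> by simp
  qed (use p0 m in force)
  define u where "u x = (1 / c) * (LINT y:S|lborel. F y * pois x y)" for x
  have "harm (ball 0 (R + \<delta>)) u"
    unfolding u_def
  proof (intro harm_cmult harm_integral open_ball cS)
    have "continuous_on (ball 0 (R + \<delta>) \<times> S) (\<lambda>z. F (snd z) * (case z of (x, y) \<Rightarrow> pois x y))"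
      by (intro continuous_intros pois_continuous continuous_on_compose2[OF FS]) (auto simp: S_def)
    then show "continuous_on (ball 0 (R + \<delta>) \<times> S) (\<lambda>(x, y). F y * pois x y)"
      by (simp add: case_prod_beta)
    show "harm (ball 0 (R + \<delta>)) (\<lambda>x. pois x y)" if "y \<in> S" for y
      by (intro harm_subset[OF harm_pois]) (use that in \<open>auto simp: S_def\<close>)
  qed
  then have "harm (cball 0 R) u" by (rule harm_subset) (use \<delta> in auto)
  moreover have "\<bar>u x - F x\<bar> \<le> e" if x: "norm x = R" for x
  proof -
    have xd: "norm x < R + \<delta>" using x \<delta> by simp
    have i1: "set_integrable lborel S (\<lambda>y. F y * pois x y)" "set_integrable lborel S (\<lambda>y. F x * pois x y)"
       "set_integrable lborel S (\<lambda>y. \<bar>(F y - F x) * pois x y\<bar>)"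
       "set_integrable lborel S (\<lambda>y. e / 2 * pois x y)" "set_integrable lborel S (\<lambda>y. e / 2 * pois 0 y)"
      using R \<delta> by (intro set_integrable_compact cS continuous_intros FS cp xd, simp)+
    have "u x - F x = (1 / c) * ((LINT y:S|lborel. F y * pois x y) - (LINT y:S|lborel. F x * pois x y))"
      using c cx[OF xd] by (simp add: u_def field_simps)
    also have "\<dots> = (1 / c) * (LINT y:S|lborel. (F y - F x) * pois x y)"
      using set_integral_diff(2)[OF i1(1,2)] by (simp add: left_diff_distrib)
    finally have eq: "u x - F x = (1 / c) * (LINT y:S|lborel. (F y - F x) * pois x y)" .
    have "\<bar>LINT y:S|lborel. (F y - F x) * pois x y\<bar> \<le> (LINT y:S|lborel. \<bar>(F y - F x) * pois x y\<bar>)"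
      using set_integral_norm_bound[OF set_integral_diff(1)[OF i1(1,2)]] by (simp add: left_diff_distrib)
    also have "\<dots> \<le> (LINT y:S|lborel. e / 2 * pois x y + e / 2 * pois 0 y)"
    proof (rule set_integral_mono[OF i1(3) set_integral_add(1)[OF i1(4,5)]])
      fix y assume y: "y \<in> S"
      have ny: "R + \<delta> \<le> norm y" "norm y \<le> R + 2 * \<delta>" using y by (auto simp: S_def)
      have xy: "x \<in> cball 0 R1" "y \<in> cball 0 R1" using x R SR1 y by auto
      have "R\<^sup>2 \<le> (norm y)\<^sup>2" using ny R \<delta> by (intro power_mono) auto
      then have pp: "0 \<le> pois x y" using x by (simp add: pois_def)
      have pp0: "0 \<le> pois 0 y" using p0[OF y] m by simp
      show "\<bar>(F y - F x) * pois x y\<bar> \<le> e / 2 * pois x y + e / 2 * pois 0 y"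
      proof (cases "dist y x < \<kappa>")
        case True
        then have "\<bar>F y - F x\<bar> \<le> e / 2" using \<kappa>(2)[OF xy] by (simp add: dist_real_def)
        then have "\<bar>(F y - F x) * pois x y\<bar> \<le> e / 2 * pois x y"
          using mult_right_mono[OF _ pp] pp by (simp only: abs_mult abs_of_nonneg)
        then show ?thesis using pp0 e by (auto intro: add_increasing2)
      next
        case False
        have "(norm y)\<^sup>2 \<le> (R + 2 * \<delta>)\<^sup>2" using ny by (intro power_mono) auto
        moreover have "norm (x - y) powr (- ?n) \<le> \<kappa> powr (- ?n)"
          using False \<kappa>(1) by (intro powr_mono2') (auto simp: dist_norm norm_minus_commute)
        ultimately have "pois x y \<le> ((R + 2 * \<delta>)\<^sup>2 - R\<^sup>2) * \<kappa> powr (- ?n)"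
          unfolding pois_def x using \<open>R\<^sup>2 \<le> (norm y)\<^sup>2\<close> by (intro mult_mono) auto
        moreover have "\<bar>F y - F x\<bar> \<le> 2 * B" using B[OF xy(1)] B[OF xy(2)] by simp
        ultimately have "\<bar>(F y - F x) * pois x y\<bar> \<le> 2 * B * (((R + 2 * \<delta>)\<^sup>2 - R\<^sup>2) * \<kappa> powr (- ?n))"
          unfolding abs_mult using pp B0 by (intro mult_mono) auto
        also have "\<dots> \<le> e / 2 * m" using \<delta>(1) by (simp add: D_def mult.assoc)
        also have "\<dots> \<le> e / 2 * pois 0 y" using p0[OF y] e by simp
        finally show ?thesis using pp e by (auto intro: add_increasing)
      qed
    qed
    also have "\<dots> = e * c"
      using set_integral_add(2)[OF i1(4,5)] cx[OF xd] by (simp add: c_def[symmetric])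
    finally show "\<bar>u x - F x\<bar> \<le> e" using c unfolding eq by (simp add: abs_mult divide_simps)
  qed
  ultimately show ?thesis by blast
qed

lemma approximate_dirichlet:
  fixes F :: "'a::euclidean_space \<Rightarrow> real"
  assumes R: "0 < R" "R < R1" and F: "continuous_on (cball a R1) F" and e: "0 < e"
  obtains u where "harm (cball a R) u" "\<And>x. x \<in> sphere a R \<Longrightarrow> \<bar>u x - F x\<bar> \<le> e"
proof -
  have "continuous_on (cball 0 R1) (\<lambda>x. F (x + a))"
    by (rule continuous_on_compose2[OF F]) (auto intro!: continuous_intros simp: dist_norm)
  from approximate_dirichlet_0[OF R this e]
  obtain u where u: "harm (cball 0 R) u" "\<And>x. norm x = R \<Longrightarrow> \<bar>u x - F (x + a)\<bar> \<le> e" by blast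
  have "{x. x - a \<in> cball 0 R} = cball a R" by (auto simp: dist_norm norm_minus_commute)
  with harm_translate[OF u(1), of a] have "harm (cball a R) (\<lambda>x. u (x - a))" by simp
  moreover have "\<bar>u (x - a) - F x\<bar> \<le> e" if "x \<in> sphere a R" for x
    using u(2)[of "x - a"] that by (simp add: dist_norm norm_minus_commute)
  ultimately show ?thesis using that by blast
qed

section \<open>Least harmonic majorants\<close>

lemma superh_min_boundary:
  fixes F :: "'a::euclidean_space \<Rightarrow> real"
  assumes U: "bounded U" and c: "continuous_on (closure U) F" and F: "superh U F"
    and bd: "\<And>z. z \<in> frontier U \<Longrightarrow> 0 \<le> F z" and x: "x \<in> U"
  shows "0 \<le> F x"
proof (rule min_principle[of U F x])
  show op: "open U" using F by (rule superh_open)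
  show cU: "continuous_on U F" using c continuous_on_subset closure_subset by blast
  show "superh {x \<in> U. F x < 0} F"
  proof (rule superh_subset[OF F])
    show "open {x \<in> U. F x < 0}"
      using continuous_open_preimage[OF cU op, of "{..<0}"] by (auto simp: vimage_def Int_def)
  qed auto
  fix z e assume z: "z \<in> frontier U" and e: "(0::real) < e"
  have "z \<in> closure U" using z by (auto simp: frontier_def)
  then have "(F \<longlongrightarrow> F z) (at z within closure U)" using c unfolding continuous_on_def by blast
  then have "(F \<longlongrightarrow> F z) (at z within U)" by (rule tendsto_within_subset) (rule closure_subset)
  then show "\<forall>\<^sub>F x in at z within U. - e < F x"
    using bd[OF z] e by (intro order_tendstoD(1)[of F "F z"]) auto
qed (use U x in auto)

lemma superh_ball_ge:
  fixes F :: "'a::euclidean_space \<Rightarrow> real"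
  assumes "0 < R" "continuous_on (cball a R) F" "superh (ball a R) F" "\<And>z. z \<in> sphere a R \<Longrightarrow> 0 \<le> F z"
    and "x \<in> cball a R"
  shows "0 \<le> F x"
proof (cases "x \<in> ball a R")
  case True
  show ?thesis
  proof (rule superh_min_boundary[OF bounded_ball _ assms(3) _ True])
    show "continuous_on (closure (ball a R)) F" using assms(1,2) by (simp add: closure_ball)
    show "0 \<le> F z" if "z \<in> frontier (ball a R)" for z
      using assms(1,4) that by (simp add: frontier_ball)
  qed
next
  case False
  then show ?thesis using assms by (intro assms(4)) auto
qed

section \<open>Perron's method above a subharmonic obstacle\<close>

text \<open>The subharmonic \<open>g\<close> takes the role that boundary data play in the usual
  form of the method. \<open>F0\<close> makes the family of majorants nonempty and gives the local
  upper bounds for equicontinuity.\<close>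

locale perron =
  fixes C :: "'a::euclidean_space set" and g F0 :: "'a \<Rightarrow> real"
  assumes open_C: "open C" and g: "superh C (\<lambda>x. - g x)"
    and F0: "superh C F0" and gF0: "\<And>x. x \<in> C \<Longrightarrow> g x \<le> F0 x"
begin

definition "majorants = {F. superh C F \<and> (\<forall>x\<in>C. g x \<le> F x)}"

definition "env x = (INF F\<in>majorants. F x)"

lemma F0_majorant: "F0 \<in> majorants"
  using F0 gF0 by (auto simp: majorants_def)

lemma majorants_min: "F \<in> majorants \<Longrightarrow> G \<in> majorants \<Longrightarrow> (\<lambda>x. min (F x) (G x)) \<in> majorants"
  by (auto simp: majorants_def intro: superh_min)

lemma bdd_below_env: "x \<in> C \<Longrightarrow> bdd_below ((\<lambda>F. F x) ` majorants)"
  by (rule bdd_belowI[of _ "g x"]) (auto simp: majorants_def)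

lemma env_le: "x \<in> C \<Longrightarrow> F \<in> majorants \<Longrightarrow> env x \<le> F x"
  unfolding env_def by (rule cINF_lower[OF bdd_below_env])

lemma env_greatest: "(\<And>F. F \<in> majorants \<Longrightarrow> c \<le> F x) \<Longrightarrow> c \<le> env x"
  unfolding env_def using F0_majorant by (intro cINF_greatest) auto

lemma env_less: "x \<in> C \<Longrightarrow> env x < c \<Longrightarrow> \<exists>F\<in>majorants. F x < c"
  using env_greatest[of c x] by (meson not_less)

lemma continuous_on_g: "continuous_on C g"
  using continuous_on_minus[OF superh_continuous_on[OF g]] by simp

text \<open>The Dirichlet problem is solved only approximately, so the approximate solution is
  raised by e/2. Then \<open>F < u\<close> strictly on the sphere, the minimum of \<open>F\<close>
  and \<open>u\<close> equals \<open>F\<close> near the sphere, and gluing it with \<open>F\<close>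
  outside the ball gives another majorant. Its values inside are at most \<open>u\<close>, whence
  \<open>env \<le> u\<close>.\<close>

lemma harmonic_replacement:
  assumes R: "0 < R" "R < R1" "cball a R1 \<subseteq> C" and F: "F \<in> majorants" and e: "0 < e"
  obtains u where "harm (cball a R) u" "\<And>x. x \<in> cball a R \<Longrightarrow> u x \<le> F x + e"
    "\<And>x. x \<in> cball a R \<Longrightarrow> g x \<le> u x" "\<And>x. x \<in> ball a R \<Longrightarrow> env x \<le> u x"
proof -
  have sub: "cball a R \<subseteq> C" "ball a R \<subseteq> C" using R by auto
  have sF: "superh C F" and gF: "\<And>x. x \<in> C \<Longrightarrow> g x \<le> F x" using F by (auto simp: majorants_def)
  note cF = superh_continuous_on[OF sF]
  obtain u0 where u0: "harm (cball a R) u0" "\<And>x. x \<in> sphere a R \<Longrightarrow> \<bar>u0 x - F x\<bar> \<le> e / 4"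
    using approximate_dirichlet[OF R(1,2) continuous_on_subset[OF cF R(3)], of "e / 4"] e by auto
  define u where "u x = u0 x + e / 2" for x
  have hu: "harm (cball a R) u" unfolding u_def by (intro harm_add u0 harm_const)
  have cu: "continuous_on (cball a R) u" using hu by (rule harm_continuous_on)
  have hub: "harm (ball a R) u" using hu by (rule harm_subset) auto
  have us: "F x < u x \<and> u x \<le> F x + e" if "x \<in> sphere a R" for x
    using u0(2)[OF that] e unfolding u_def by linarith
  have uF: "u x \<le> F x + e" if "x \<in> cball a R" for x
  proof -
    have "0 \<le> (F x + (-1) * u x) + e"
    proof (rule superh_ball_ge[OF R(1) _ _ _ that])
      show "continuous_on (cball a R) (\<lambda>x. (F x + (-1) * u x) + e)"
        by (intro continuous_intros cu continuous_on_subset[OF cF] sub)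
      show "superh (ball a R) (\<lambda>x. (F x + (-1) * u x) + e)"
        using sub by (intro superh_add superh_const harm_superh harm_cmult hub superh_subset[OF sF]) auto
      show "0 \<le> (F z + (-1) * u z) + e" if "z \<in> sphere a R" for z
        using us[OF that] by simp
    qed
    then show ?thesis by simp
  qed
  have ug: "g x \<le> u x" if "x \<in> cball a R" for x
  proof -
    have "0 \<le> u x + - g x"
    proof (rule superh_ball_ge[OF R(1) _ _ _ that])
      show "continuous_on (cball a R) (\<lambda>x. u x + - g x)"
        by (intro continuous_intros cu continuous_on_subset[OF continuous_on_g] sub)
      show "superh (ball a R) (\<lambda>x. u x + - g x)"
        using sub by (intro superh_add harm_superh hub superh_subset[OF g]) auto
      show "0 \<le> u z + - g z" if z: "z \<in> sphere a R" for z
      proof -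
        have "z \<in> C" using z sub(1) by auto
        then show ?thesis using us[OF z] gF[of z] by simp
      qed
    qed
    then show ?thesis by simp
  qed
  define F1 where "F1 x = (if x \<in> ball a R then min (F x) (u x) else F x)" for x
  have "superh C F1"
  proof (rule superh_cong_local[OF open_C])
    fix x assume x: "x \<in> C"
    show "\<exists>V G. x \<in> V \<and> V \<subseteq> C \<and> superh V G \<and> (\<forall>y\<in>V. F1 y = G y)"
    proof (cases "x \<in> ball a R")
      case True
      have "superh (ball a R) (\<lambda>x. min (F x) (u x))"
        using sub by (intro superh_min harm_superh hub superh_subset[OF sF]) auto
      then show ?thesis using True sub by (intro exI[of _ "ball a R"] exI[of _ "\<lambda>x. min (F x) (u x)"]) (auto simp: F1_def)
    next
      case False
      \<comment> \<open>Near a point outside the open ball the minimum is always attained by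
        \<open>F\<close>: on the sphere by the strict inequality and continuity, further out because
        the ball is not reached.\<close>
      have "\<exists>d>0. \<forall>y\<in>ball a R. dist y x < d \<longrightarrow> F y < u y"
      proof (cases "x \<in> cball a R")
        case True
        then have "x \<in> sphere a R" using False by auto
        have "continuous_on (cball a R) (\<lambda>x. u x - F x)"
          by (intro continuous_intros cu continuous_on_subset[OF cF] sub)
        then have "((\<lambda>x. u x - F x) \<longlongrightarrow> u x - F x) (at x within cball a R)"
          using True unfolding continuous_on_def by blast
        then have "\<forall>\<^sub>F y in at x within cball a R. 0 < u y - F y"
          using us[OF \<open>x \<in> sphere a R\<close>] by (intro order_tendstoD(1)) auto
        then obtain d where d: "d > 0" "\<And>y. y \<in> cball a R \<Longrightarrow> y \<noteq> x \<Longrightarrow> dist y x < d \<Longrightarrow> 0 < u y - F y"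
          unfolding eventually_at by auto
        then have "F y < u y" if "y \<in> ball a R" "dist y x < d" for y
        proof -
          have "y \<in> cball a R" "y \<noteq> x" using that False by auto
          then show ?thesis using d(2)[of y] that by simp
        qed
        then show ?thesis using d(1) by blast
      next
        case out: False
        then have "\<not> dist y x < dist a x - R" if "y \<in> ball a R" for y
          using that dist_triangle[of a x y] by auto
        then show ?thesis using out by (intro exI[of _ "dist a x - R"]) auto
      qed
      then obtain d where d: "d > 0" "\<And>y. y \<in> ball a R \<Longrightarrow> dist y x < d \<Longrightarrow> F y < u y" by blast
      have "\<forall>y \<in> C \<inter> ball x d. F1 y = F y" using d by (auto simp: F1_def dist_commute intro: less_imp_le)
      moreover have "superh (C \<inter> ball x d) F" by (rule superh_subset[OF sF]) (use open_C in auto)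
      ultimately show ?thesis using x d by (intro exI[of _ "C \<inter> ball x d"] exI[of _ F]) auto
    qed
  qed
  moreover have "g x \<le> F1 x" if "x \<in> C" for x
    using gF[OF that] ug[of x] by (auto simp: F1_def)
  ultimately have "F1 \<in> majorants" by (simp add: majorants_def)
  then have "env x \<le> u x" if "x \<in> ball a R" for x
    using env_le[of x F1] that sub by (auto simp: F1_def)
  with hu uF ug show ?thesis by (rule that)
qed

lemma env_ge: "x \<in> C \<Longrightarrow> g x \<le> env x"
  by (rule env_greatest) (auto simp: majorants_def)

text \<open>Minima of finitely many majorants are majorants. Staying below \<open>F0\<close> is
  recorded because it yields a bound that is uniform over all the majorants chosen this way.\<close>

lemma finite_common_majorant:
  assumes "finite N" "N \<subseteq> C" "0 < e"
  shows "\<exists>F\<in>majorants. (\<forall>x\<in>C. F x \<le> F0 x) \<and> (\<forall>x\<in>N. F x \<le> env x + e)"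
  using assms(1,2)
proof induction
  case empty
  then show ?case using F0_majorant by auto
next
  case (insert p N)
  then obtain F where F: "F \<in> majorants" "\<forall>x\<in>C. F x \<le> F0 x" "\<forall>x\<in>N. F x \<le> env x + e" by auto
  obtain G where G: "G \<in> majorants" "G p < env p + e" using env_less[of p "env p + e"] insert assms(3) by auto
  show ?case
    using F G by (intro bexI[of _ "\<lambda>x. min (F x) (G x)"] majorants_min) (auto simp: min_le_iff_disj)
qed

text \<open>Harmonic replacements of majorants below \<open>F0\<close> lie between \<open>g\<close>
  and \<open>F0 + 1\<close>, so they share one Lipschitz constant \<open>K\<close> near
  \<open>a\<close>, which the envelope inherits. A single replacement that is close to the envelope
  on a finite net is therefore close to it on a whole ball, and its mean value property transfers to
  \<open>env\<close>.\<close>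

lemma env_harm_local:
  assumes a: "a \<in> C"
  shows "\<exists>R>0. ball a R \<subseteq> C \<and> harm (ball a R) env"
proof -
  obtain R1 where R1: "R1 > 0" "cball a R1 \<subseteq> C" using open_C a open_contains_cball by blast
  define R where "R = R1 / 2"
  have R: "0 < R" "R < R1" using R1 by (auto simp: R_def)
  have subR: "cball a R \<subseteq> C" using R R1 by auto
  \<comment> \<open>Balls of radius \<rho> centred in \<open>cball a \<rho>\<close> must stay inside
    \<open>cball a R\<close>, for the mean value property and for the Lipschitz estimate.\<close>
  define \<rho> where "\<rho> = R / 3"
  have \<rho>: "0 < \<rho>" "2 * \<rho> < R" using R by (auto simp: \<rho>_def)
  have "bounded (g ` cball a R)" "bounded (F0 ` cball a R)"
    using continuous_on_g superh_continuous_on[OF F0] subR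
    by (auto intro!: compact_imp_bounded compact_continuous_image intro: continuous_on_subset)
  then obtain M1 M2 where M12: "\<forall>x\<in>cball a R. \<bar>g x\<bar> \<le> M1" "\<forall>x\<in>cball a R. \<bar>F0 x\<bar> \<le> M2"
    unfolding bounded_iff by auto
  define M where "M = max M1 (M2 + 1)"
  obtain \<Lambda> where \<Lambda>: "0 \<le> \<Lambda>"
    "\<And>(F :: 'a \<Rightarrow> real) x0 B x y. continuous_on (cball x0 (2 * \<rho>)) F \<Longrightarrow>
      (\<And>z. z \<in> cball x0 (2 * \<rho>) \<Longrightarrow> \<bar>F z\<bar> \<le> B) \<Longrightarrow> x \<in> cball x0 \<rho> \<Longrightarrow> y \<in> cball x0 \<rho> \<Longrightarrow>
      \<bar>mean F x \<rho> - mean F y \<rho>\<bar> \<le> \<Lambda> * B * norm (x - y)"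
    using mean_Lipschitz[OF \<rho>(1), where 'a='a] by blast
  have "0 \<le> M1" using M12(1)[rule_format, of a] R by (auto intro: order_trans[OF abs_ge_zero])
  then have M0: "0 \<le> M" by (simp add: M_def)
  define K where "K = \<Lambda> * M"
  have K0: "0 \<le> K" using \<Lambda>(1) M0 by (simp add: K_def)
  have rep: "\<exists>u. harm (cball a R) u \<and> (\<forall>x\<in>cball a R. u x \<le> F x + e) \<and> (\<forall>x\<in>ball a R. env x \<le> u x) \<and>
      (\<forall>x\<in>cball a \<rho>. \<forall>y\<in>cball a \<rho>. \<bar>u x - u y\<bar> \<le> K * norm (x - y))"
    if F: "F \<in> majorants" "\<forall>x\<in>C. F x \<le> F0 x" and e: "0 < e" "e \<le> 1" for F e
  proof -
    obtain u where u: "harm (cball a R) u" "\<And>x. x \<in> cball a R \<Longrightarrow> u x \<le> F x + e"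
      "\<And>x. x \<in> cball a R \<Longrightarrow> g x \<le> u x" "\<And>x. x \<in> ball a R \<Longrightarrow> env x \<le> u x"
      using harmonic_replacement[OF R R1(2) F(1) e(1)] by blast
    have uM: "\<bar>u z\<bar> \<le> M" if "z \<in> cball a R" for z
    proof -
      have "F z \<le> F0 z" using F(2) that subR by blast
      then have "u z \<le> F0 z + 1" using u(2)[OF that] e by linarith
      moreover have "\<bar>g z\<bar> \<le> M1" "\<bar>F0 z\<bar> \<le> M2" using M12 that by auto
      moreover have "M1 \<le> M" "M2 + 1 \<le> M" by (auto simp: M_def)
      ultimately show ?thesis using u(3)[OF that] by linarith
    qed
    have mu: "mean u x \<rho> = u x" if "x \<in> cball a \<rho>" for x
      using that \<rho> by (intro harm_mean[OF u(1)]) (simp_all add: cball_subset_cball_iff dist_commute)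
    have "\<bar>u x - u y\<bar> \<le> K * norm (x - y)" if "x \<in> cball a \<rho>" "y \<in> cball a \<rho>" for x y
    proof -
      have "\<bar>mean u x \<rho> - mean u y \<rho>\<bar> \<le> \<Lambda> * M * norm (x - y)"
        using that \<rho> by (intro \<Lambda>(2)[of a] continuous_on_subset[OF harm_continuous_on[OF u(1)]] uM) auto
      then show ?thesis using mu[OF that(1)] mu[OF that(2)] by (simp add: K_def)
    qed
    then show ?thesis using u by blast
  qed
  have \<rho>R: "cball a \<rho> \<subseteq> ball a R" "cball a \<rho> \<subseteq> cball a R" using \<rho> by auto
  have \<rho>C: "cball a \<rho> \<subseteq> C" using \<rho>R subR by auto
  have lip: "env x \<le> env y + K * norm (x - y)" if xy: "x \<in> cball a \<rho>" "y \<in> cball a \<rho>" for x y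
  proof (rule field_le_epsilon)
    fix e :: real assume e: "0 < e"
    define e' where "e' = min 1 (e / 2)"
    have e': "0 < e'" "e' \<le> 1" "e' \<le> e / 2" using e by (auto simp: e'_def)
    have "y \<in> C" using xy \<rho>C by blast
    then obtain F where F: "F \<in> majorants" "\<forall>x\<in>C. F x \<le> F0 x" "F y \<le> env y + e'"
      using finite_common_majorant[of "{y}" e'] e' by auto
    obtain u where u: "\<forall>x\<in>cball a R. u x \<le> F x + e'" "\<forall>x\<in>ball a R. env x \<le> u x"
      "\<forall>x\<in>cball a \<rho>. \<forall>y\<in>cball a \<rho>. \<bar>u x - u y\<bar> \<le> K * norm (x - y)"
      using rep[OF F(1,2) e'(1,2)] by blast
    have "env x \<le> u x" "u y \<le> F y + e'" "\<bar>u x - u y\<bar> \<le> K * norm (x - y)"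
      using u xy \<rho>R by (blast, blast, blast)
    then show "env x \<le> env y + K * norm (x - y) + e" using F(3) e' by linarith
  qed
  have lip': "\<bar>env x - env y\<bar> \<le> K * norm (x - y)" if "x \<in> cball a \<rho>" "y \<in> cball a \<rho>" for x y
    using lip[OF that] lip[OF that(2,1)] by (simp add: norm_minus_commute abs_le_iff)
  have "K-lipschitz_on (cball a \<rho>) env"
    using lip' K0 by (intro lipschitz_onI) (auto simp: dist_real_def dist_norm)
  then have cE: "continuous_on (cball a \<rho>) env" by (rule lipschitz_on_continuous_on)
  have mean_eq: "mean env x r = env x" if r: "0 < r" "cball x r \<subseteq> cball a \<rho>" for x r
  proof (rule antisym)
    have "x \<in> cball x r" using r(1) by simp
    then have x: "x \<in> cball a \<rho>" using r(2) by blast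
    have subx: "cball x r \<subseteq> ball a R" "cball x r \<subseteq> cball a R" using r(2) \<rho>R by blast+
    have cx: "continuous_on (cball x r) env" using cE r continuous_on_subset by blast
    have *: "mean env x r \<le> F x + e \<and> env x \<le> u x" 
      if "harm (cball a R) u" "\<forall>x\<in>cball a R. u x \<le> F x + e" "\<forall>x\<in>ball a R. env x \<le> u x" for F e u
    proof -
      have "mean env x r \<le> mean u x r"
        using that subx r by (intro mean_mono cx continuous_on_subset[OF harm_continuous_on[OF that(1)]]) auto
      also have "\<dots> = u x" using harm_mean[OF that(1) r(1)] subx by blast
      also have "\<dots> \<le> F x + e" using that(2) x \<rho>R by blast
      finally show ?thesis using that(3) x \<rho>R by blast
    qed
    show "mean env x r \<le> env x"
    proof (rule field_le_epsilon)
      fix e :: real assume e: "0 < e"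
      define e' where "e' = min 1 (e / 2)"
      have e': "0 < e'" "e' \<le> 1" "e' \<le> e / 2" using e by (auto simp: e'_def)
      have "x \<in> C" using x \<rho>C by blast
      then obtain F where F: "F \<in> majorants" "\<forall>x\<in>C. F x \<le> F0 x" "F x \<le> env x + e'"
        using finite_common_majorant[of "{x}" e'] e' by auto
      obtain u where "harm (cball a R) u" "\<forall>x\<in>cball a R. u x \<le> F x + e'" "\<forall>x\<in>ball a R. env x \<le> u x"
        using rep[OF F(1,2) e'(1,2)] by blast
      from *[OF this] F(3) e' show "mean env x r \<le> env x + e" by linarith
    qed
    show "env x \<le> mean env x r"
    proof (rule field_le_epsilon)
      fix e :: real assume e: "0 < e"
      define e' where "e' = min 1 (e / 4)"
      have e': "0 < e'" "e' \<le> 1" "4 * e' \<le> e" using e by (auto simp: e'_def)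
      \<comment> \<open>Makes \<open>K * \<delta> \<le> e'\<close>. The total \<open>4 * e'\<close>
        below consists of two moves between \<open>y\<close> and a net point (one for
        \<open>u\<close>, one for \<open>env\<close>), the replacement error and the majorant
        error.\<close>
      define \<delta> where "\<delta> = e' / (K + 1)"
      have \<delta>: "0 < \<delta>" "K * \<delta> \<le> e'" using e' K0 by (auto simp: \<delta>_def field_simps)
      obtain N where N: "finite N" "N \<subseteq> cball x r" "cball x r \<subseteq> (\<Union>p\<in>N. ball p \<delta>)"
      proof (rule compactE_image[OF compact_cball[of x r], of "cball x r" "\<lambda>p. ball p \<delta>"])
        show "cball x r \<subseteq> (\<Union>c\<in>cball x r. ball c \<delta>)" using \<delta>(1) by force
      qed auto
      obtain F where F: "F \<in> majorants" "\<forall>x\<in>C. F x \<le> F0 x" "\<forall>p\<in>N. F p \<le> env p + e'"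
        using finite_common_majorant[OF N(1) order_trans[OF N(2) order_trans[OF r(2) \<rho>C]] e'(1)] by blast
      obtain u where u: "harm (cball a R) u" "\<forall>x\<in>cball a R. u x \<le> F x + e'" "\<forall>x\<in>ball a R. env x \<le> u x"
        "\<forall>x\<in>cball a \<rho>. \<forall>y\<in>cball a \<rho>. \<bar>u x - u y\<bar> \<le> K * norm (x - y)"
        using rep[OF F(1,2) e'(1,2)] by blast
      have close: "u y \<le> env y + 4 * e'" if y: "y \<in> cball x r" for y
      proof -
        obtain p where p: "p \<in> N" "dist p y < \<delta>" using N(3) y by auto
        have py: "p \<in> cball a \<rho>" "y \<in> cball a \<rho>" using p N r y by auto
        have "K * norm (p - y) \<le> e'" 
          using mult_left_mono[of "norm (p - y)" \<delta> K] p(2) K0 \<delta>(2) by (simp add: dist_norm)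
        moreover have "\<bar>u p - u y\<bar> \<le> K * norm (p - y)" using u(4) py by blast
        moreover have "u p \<le> F p + e'" using u(2) py \<rho>R by blast
        moreover have "F p \<le> env p + e'" using F(3) p by blast
        moreover have "\<bar>env p - env y\<bar> \<le> K * norm (p - y)" using lip' py by blast
        ultimately show ?thesis by linarith
      qed
      have "env x \<le> u x" using *[OF u(1-3)] by simp
      also have "u x = mean u x r" using harm_mean[OF u(1) r(1)] subx by simp
      also have "\<dots> \<le> mean (\<lambda>y. env y + 4 * e') x r"
        using close r subx
        by (intro mean_mono continuous_intros cx continuous_on_subset[OF harm_continuous_on[OF u(1)]]) auto
      also have "\<dots> = mean env x r + 4 * e'"
        using mean_const[OF r(1)] by (subst mean_add) (auto intro: cx)
      finally show "env x \<le> mean env x r + e" using e' by simp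
    qed
  qed
  have "harm (ball a \<rho>) env"
    unfolding harm_def
  proof (intro conjI allI impI)
    show "continuous_on (ball a \<rho>) env" using cE by (rule continuous_on_subset) auto
    fix x r assume "0 < r \<and> cball x r \<subseteq> ball a \<rho>"
    then show "mean env x r = env x" by (intro mean_eq) auto
  qed
  then show ?thesis using \<rho> \<rho>C by (intro exI[of _ \<rho>]) auto
qed

lemma env_harm: "harm C env"
  using harm_of_local[OF open_C] env_harm_local by blast

end

lemma least_harmonic_majorant:
  fixes C :: "'a::euclidean_space set"
  assumes "open C" "superh C (\<lambda>x. - g x)" "superh C F0" "\<And>x. x \<in> C \<Longrightarrow> g x \<le> F0 x"
  obtains T where "harm C T" "\<And>x. x \<in> C \<Longrightarrow> g x \<le> T x"
    "\<And>F x. superh C F \<Longrightarrow> (\<And>x. x \<in> C \<Longrightarrow> g x \<le> F x) \<Longrightarrow> x \<in> C \<Longrightarrow> T x \<le> F x"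
proof -
  interpret perron C g F0 using assms by unfold_locales
  show ?thesis
    by (rule that[of env]) (use env_harm env_ge env_le in \<open>auto simp: majorants_def\<close>)
qed

section \<open>Epigraphical cones\<close>

lemma normalize_diff_le:
  fixes x z :: "'a::real_normed_vector"
  assumes "x \<noteq> 0" "z \<noteq> 0"
  shows "norm (z /\<^sub>R norm z - x /\<^sub>R norm x) \<le> 2 * norm (z - x) / norm x"
proof -
  have "z /\<^sub>R norm z - x /\<^sub>R norm x = (z - x) /\<^sub>R norm x + ((norm x - norm z) / norm x) *\<^sub>R (z /\<^sub>R norm z)"
  proof -
    define k where "k = (norm x - norm z) / norm x"
    have "inverse (norm z) = inverse (norm x) + k * inverse (norm z)"
      using assms by (simp add: k_def field_simps)
    then have "z /\<^sub>R norm z = (inverse (norm x) + k * inverse (norm z)) *\<^sub>R z"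
      by (rule arg_cong)
    also have "\<dots> = z /\<^sub>R norm x + k *\<^sub>R (z /\<^sub>R norm z)"
      by (simp only: scaleR_add_left scaleR_scaleR)
    finally have "z /\<^sub>R norm z - x /\<^sub>R norm x = z /\<^sub>R norm x + k *\<^sub>R (z /\<^sub>R norm z) - x /\<^sub>R norm x"
      by (rule arg_cong)
    also have "\<dots> = (z - x) /\<^sub>R norm x + k *\<^sub>R (z /\<^sub>R norm z)" by (simp add: scaleR_diff_right)
    finally show ?thesis unfolding k_def .
  qed
  also have "norm \<dots> \<le> norm (z - x) / norm x + \<bar>norm x - norm z\<bar> / norm x"
  proof (intro norm_triangle_le add_mono)
    show "norm (((norm x - norm z) / norm x) *\<^sub>R (z /\<^sub>R norm z)) \<le> \<bar>norm x - norm z\<bar> / norm x"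
      using assms by (simp add: abs_mult mult.assoc)
  qed (simp add: divide_inverse mult.commute)
  also have "\<dots> \<le> 2 * norm (z - x) / norm x"
    using assms norm_triangle_ineq3[of x z] by (simp add: field_simps norm_minus_commute)
  finally show ?thesis .
qed

text \<open>The C^{1,1} hypothesis in scale-invariant form. Since \<open>g\<close> is homogeneous of
  degree 1, its second derivatives scale like 1/|p|, which explains the constant
  \<open>K1 / norm p\<close>; \<open>\<Gamma> p\<close> is in the role of the gradient of
  \<open>g\<close> at \<open>p\<close>.\<close>

locale epi_cone =
  fixes g :: "real ^ 'm \<Rightarrow> real" and \<Gamma> :: "real ^ 'm \<Rightarrow> real ^ 'm" and B K1 :: real
  assumes hom: "0 \<le> t \<Longrightarrow> g (t *\<^sub>R p) = t * g p"
    and B: "0 \<le> B" and g_Lipschitz: "\<bar>g p - g q\<bar> \<le> B * norm (p - q)"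
    and K1: "0 < K1"
    and g_quadratic: "p \<noteq> 0 \<Longrightarrow> norm (q - p) < norm p \<Longrightarrow>
        \<bar>g q - g p - \<Gamma> p \<bullet> (q - p)\<bar> \<le> K1 / norm p * (norm (q - p))\<^sup>2"
begin

definition "Cone = {z. g (fst z) < snd z}"

text \<open>Stands in for the distance to the boundary. The two are comparable because
  \<open>g\<close> is Lipschitz, and unlike the distance this function is explicit and exactly
  homogeneous.\<close>

definition "depth z = snd z - g (fst z)"

lemma g_0 [simp]: "g 0 = 0"
  using hom[of 0 0] by simp

lemma abs_g_le: "\<bar>g p\<bar> \<le> B * norm p"
  using g_Lipschitz[of p 0] by simp

lemma continuous_on_g [continuous_intros]: "continuous_on S f \<Longrightarrow> continuous_on S (\<lambda>x. g (f x))"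
proof -
  have "B-lipschitz_on UNIV g"
    using g_Lipschitz B by (intro lipschitz_onI) (auto simp: dist_real_def dist_norm)
  then have "continuous_on UNIV g" by (rule lipschitz_on_continuous_on)
  then show "continuous_on S f \<Longrightarrow> continuous_on S (\<lambda>x. g (f x))"
    using continuous_on_compose2 by blast
qed

lemma continuous_on_depth [continuous_intros]: "continuous_on S f \<Longrightarrow> continuous_on S (\<lambda>x. depth (f x))"
  unfolding depth_def by (intro continuous_intros)

lemma mem_Cone: "z \<in> Cone \<longleftrightarrow> 0 < depth z"
  by (simp add: Cone_def depth_def)

lemma open_Cone: "open Cone"
  unfolding Cone_def by (intro open_Collect_less continuous_intros)

lemma depth_scale: "0 \<le> t \<Longrightarrow> depth (t *\<^sub>R z) = t * depth z"
  by (simp add: depth_def hom algebra_simps)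

lemma Cone_scale: "0 < t \<Longrightarrow> t *\<^sub>R z \<in> Cone \<longleftrightarrow> z \<in> Cone"
  by (simp add: mem_Cone depth_scale zero_less_mult_iff)

lemma zero_notin_Cone: "0 \<notin> Cone"
  by (simp add: Cone_def)

lemma closure_Cone: "closure Cone = {z. 0 \<le> depth z}"
proof
  have "closed {z. 0 \<le> depth z}" by (intro closed_Collect_le continuous_intros)
  then show "closure Cone \<subseteq> {z. 0 \<le> depth z}" by (intro closure_minimal) (auto simp: mem_Cone)
  show "{z. 0 \<le> depth z} \<subseteq> closure Cone"
  proof
    fix z assume z: "z \<in> {z. 0 \<le> depth z}"
    have "(\<lambda>n. z + (0, inverse (real (Suc n)))) \<longlonglongrightarrow> z + (0, 0)"
      by (intro tendsto_intros LIMSEQ_inverse_real_of_nat)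
    then have "(\<lambda>n. z + (0, inverse (real (Suc n)))) \<longlonglongrightarrow> z" by (simp flip: zero_prod_def)
    moreover have "z + (0, inverse (real (Suc n))) \<in> Cone" for n
    proof -
      have "depth (z + (0, inverse (real (Suc n)))) = depth z + inverse (real (Suc n))" by (simp add: depth_def)
      moreover have "0 < inverse (real (Suc n))" by simp
      ultimately show ?thesis using z unfolding mem_Cone mem_Collect_eq by linarith
    qed
    ultimately show "z \<in> closure Cone" 
      unfolding closure_sequential by (intro exI[of _ "\<lambda>n. z + (0, inverse (real (Suc n)))"]) auto
  qed
qed

lemma frontier_Cone: "frontier Cone = {z. depth z = 0}"
  unfolding frontier_def closure_Cone interior_open[OF open_Cone] by (auto simp: mem_Cone)

lemma depth_le: "depth z \<le> (1 + B) * norm z"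
proof -
  have "snd z \<le> norm z" using norm_snd_le[of "snd z" "fst z"] by (simp add: abs_le_iff)
  moreover have "- g (fst z) \<le> B * norm z"
    using abs_g_le[of "fst z"] mult_left_mono[OF norm_fst_le[of "fst z" "snd z"] B] by simp
  ultimately show ?thesis by (simp add: depth_def algebra_simps)
qed

lemma depth_Lipschitz: "\<bar>depth z - depth w\<bar> \<le> (1 + B) * norm (z - w)"
proof -
  have "\<bar>snd z - snd w\<bar> \<le> norm (z - w)" using norm_snd_le[of "snd (z - w)" "fst (z - w)"] by (simp add: minus_prod_def)
  moreover have "\<bar>g (fst z) - g (fst w)\<bar> \<le> B * norm (z - w)"
    using g_Lipschitz[of "fst z" "fst w"] mult_left_mono[OF norm_fst_le[of "fst (z - w)" "snd (z - w)"] B] by (simp add: minus_prod_def)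
  ultimately show ?thesis by (simp add: depth_def algebra_simps)
qed

lemma cball_subset_Cone: "z \<in> Cone \<Longrightarrow> cball z (depth z / (2 * (1 + B))) \<subseteq> Cone"
proof
  fix w assume z: "z \<in> Cone" and w: "w \<in> cball z (depth z / (2 * (1 + B)))"
  have "(1 + B) * norm (z - w) \<le> (1 + B) * (depth z / (2 * (1 + B)))"
    using w B by (intro mult_left_mono) (auto simp: dist_norm)
  also have "\<dots> = depth z / 2" using B by (simp add: field_simps)
  finally have "(1 + B) * norm (z - w) < depth z" using z by (simp add: mem_Cone)
  then show "w \<in> Cone" using depth_Lipschitz[of z w] by (simp add: mem_Cone)
qed

lemma norm_le_fst_depth: "norm z \<le> (1 + B) * norm (fst z) + \<bar>depth z\<bar>"
proof -
  have "norm z \<le> norm (fst z) + norm (snd z)" using norm_Pair_le[of "fst z" "snd z"] by simp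
  also have "norm (snd z) \<le> B * norm (fst z) + \<bar>depth z\<bar>"
    using abs_g_le[of "fst z"] by (simp add: depth_def)
  finally show ?thesis by (simp add: algebra_simps)
qed

lemma connected_Cone: "connected Cone"
proof -
  have "Cone = (\<lambda>z. (fst z, g (fst z) + snd z)) ` (UNIV \<times> {0<..})"
  proof (intro equalityI subsetI)
    fix z assume "z \<in> Cone"
    then show "z \<in> (\<lambda>z. (fst z, g (fst z) + snd z)) ` (UNIV \<times> {0<..})"
      by (intro image_eqI[of _ _ "(fst z, snd z - g (fst z))"]) (auto simp: Cone_def)
  qed (auto simp: Cone_def)
  moreover have "connected ((\<lambda>z. (fst z, g (fst z) + snd z)) ` ((UNIV :: (real ^ 'm) set) \<times> {0::real<..}))"
    by (intro connected_continuous_image continuous_intros connected_Times connected_Ioi) auto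
  ultimately show ?thesis by simp
qed

text \<open>
  The vector \<open>(- \<Gamma> p, 1)\<close> is normal to the boundary at \<open>(p, g p)\<close>, and the barrier is built from
  the exterior tangent ball centred at \<open>(p, g p) - \<rho> (- \<Gamma> p, 1)\<close>.
\<close>

lemma depth_quadratic:
  assumes "p \<noteq> 0" "norm (z - (p, g p)) < norm p"
  shows "\<bar>depth z - (z - (p, g p)) \<bullet> (- \<Gamma> p, 1)\<bar> \<le> K1 / norm p * (norm (z - (p, g p)))\<^sup>2"
proof -
  have le: "norm (fst z - p) \<le> norm (z - (p, g p))" using norm_fst_le[of "fst z - p" "snd z - g p"] by (simp add: minus_prod_def)
  have "depth z - (z - (p, g p)) \<bullet> (- \<Gamma> p, 1) = - (g (fst z) - g p - \<Gamma> p \<bullet> (fst z - p))"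
    by (simp add: depth_def inner_prod_def inner_commute)
  also have "\<bar>\<dots>\<bar> \<le> K1 / norm p * (norm (fst z - p))\<^sup>2"
    using g_quadratic[of p "fst z"] assms le by simp
  also have "\<dots> \<le> K1 / norm p * (norm (z - (p, g p)))\<^sup>2"
    using K1 le by (intro mult_left_mono power_mono) auto
  finally show ?thesis .
qed

section \<open>Exterior barriers\<close>

text \<open>With c the centre of the exterior ball and q z = |z - c|^2 - (\<rho> |N|)^2, the barrier
  is A (1 - exp (-k q)): it is superharmonic outside the ball once k is large. All lengths are
  multiples of |p|, so one constant \<open>C0\<close> serves every boundary point other than the
  vertex.\<close>

lemma exterior_barrier:
  obtains C0 where "0 < C0"
    "\<And>p. p \<noteq> 0 \<Longrightarrow> \<exists>b G L. has_grad_lap (Cone \<inter> ball (p, g p) (norm p)) b G L \<and>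
        (\<forall>z \<in> Cone \<inter> ball (p, g p) (norm p). L z \<le> 0) \<and> continuous_on UNIV b \<and>
        (\<forall>z \<in> closure Cone \<inter> ball (p, g p) (norm p). 0 \<le> b z \<and> (norm p / 2 \<le> dist (p, g p) z \<longrightarrow> 1 \<le> b z)) \<and>
        (\<forall>d. 0 \<le> d \<and> d < norm p \<longrightarrow> b (p, g p + d) \<le> C0 * d / norm p)"
proof -
  define n where "n = real DIM((real ^ 'm) \<times> real)"
  have n: "n > 0" unfolding n_def using DIM_positive by simp
  \<comment> \<open>With \<rho> = \<kappa> |p| the quadratic error of the boundary, multiplied by 2
    \<rho>, is at most half of |z - x0|^2, so q \<ge> |z - x0|^2 / 2 on the closed cone.\<close>
  define \<kappa> where "\<kappa> = 1 / (4 * K1)"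
  have \<kappa>: "\<kappa> > 0" using K1 by (simp add: \<kappa>_def)
  \<comment> \<open>Normalises the barrier to be at least 1 at distance |p|/2 or more, where q \<ge>
    |p|^2 / 8 and hence k q \<ge> n / (16 \<kappa>^2).\<close>
  define A where "A = 1 / (1 - exp (- (n / (16 * \<kappa>\<^sup>2))))"
  have A: "A > 0" using n \<kappa> by (simp add: A_def)
  define C0 where "C0 = A * (n / (2 * \<kappa>\<^sup>2)) * (1 + 2 * \<kappa>)"
  have C0: "C0 > 0" using A n \<kappa> by (simp add: C0_def)
  show ?thesis
  proof (rule that[OF C0])
    fix p :: "real ^ 'm" assume p: "p \<noteq> 0"
    define s where "s = norm p"
    have s: "s > 0" using p by (simp add: s_def)
    define x0 where "x0 = (p, g p)"
    define N where "N = (- \<Gamma> p, 1::real)"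
    define \<rho> where "\<rho> = \<kappa> * s"
    have \<rho>: "\<rho> > 0" using \<kappa> s by (simp add: \<rho>_def)
    define c where "c = x0 - \<rho> *\<^sub>R N"
    \<comment> \<open>The Laplacian of the barrier has the sign of 2 n - 4 k |z - c|^2. It is
      nonpositive for |z - c| \<ge> \<rho>, which q \<ge> 0 guarantees because |N| \<ge> 1.\<close>
    define k where "k = n / (2 * \<rho>\<^sup>2)"
    have k: "k > 0" using n \<rho> by (simp add: k_def)
    define q where "q z = (norm (z - c))\<^sup>2 - (\<rho> * norm N)\<^sup>2" for z
    define b where "b z = A * (1 - exp (- k * q z))" for z
    have qe: "q z = (norm (z - x0))\<^sup>2 + 2 * \<rho> * ((z - x0) \<bullet> N)" for z
    proof -
      have zc: "z - c = (z - x0) + \<rho> *\<^sub>R N" by (simp add: c_def)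
      have "(norm (z - c))\<^sup>2 = (norm (z - x0))\<^sup>2 + 2 * ((z - x0) \<bullet> (\<rho> *\<^sub>R N)) + (norm (\<rho> *\<^sub>R N))\<^sup>2"
        unfolding zc power2_norm_eq_inner inner_add_left inner_add_right
        by (simp add: inner_commute)
      then show ?thesis using \<rho> by (simp add: q_def power_mult_distrib)
    qed
    have qlow: "(norm (z - x0))\<^sup>2 / 2 \<le> q z" if "z \<in> closure Cone" "z \<in> ball x0 s" for z
    proof -
      have d: "0 \<le> depth z" using that by (simp add: closure_Cone)
      have "norm (z - x0) < s" using that by (simp add: dist_norm norm_minus_commute)
      then have "\<bar>depth z - (z - x0) \<bullet> N\<bar> \<le> K1 / s * (norm (z - x0))\<^sup>2"
        using depth_quadratic[OF p, of z] by (simp add: s_def x0_def N_def)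
      then have "- (K1 / s * (norm (z - x0))\<^sup>2) \<le> (z - x0) \<bullet> N" using d by linarith
      then have "2 * \<rho> * (- (K1 / s * (norm (z - x0))\<^sup>2)) \<le> 2 * \<rho> * ((z - x0) \<bullet> N)"
        using \<rho> by (intro mult_left_mono) auto
      moreover have "2 * \<rho> * (- (K1 / s * (norm (z - x0))\<^sup>2)) = - ((norm (z - x0))\<^sup>2 / 2)"
        using s K1 by (simp add: \<rho>_def \<kappa>_def)
      ultimately show ?thesis unfolding qe by linarith
    qed
    have hq: "has_grad_lap UNIV q (\<lambda>z. 2 *\<^sub>R (z - c) - 0) (\<lambda>z. 2 * n - 0)"
      unfolding q_def[abs_def] n_def by (intro has_grad_lap_diff has_grad_lap_norm_sq has_grad_lap_const) auto
    have hb: "has_grad_lap UNIV b (\<lambda>z. (A * (k * exp (- k * q z))) *\<^sub>R (2 *\<^sub>R (z - c) - 0))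
       (\<lambda>z. (- (A * (k * k * exp (- k * q z)))) * (norm (2 *\<^sub>R (z - c) - 0))\<^sup>2 + (A * (k * exp (- k * q z))) * (2 * n - 0))"
      unfolding b_def[abs_def]
      by (rule has_grad_lap_chain[OF hq, where \<phi>="\<lambda>q. A * (1 - exp (- k * q))" and \<phi>'="\<lambda>q. A * (k * exp (- k * q))"
           and \<phi>''="\<lambda>q. - (A * (k * k * exp (- k * q)))"])
         (auto intro!: derivative_eq_intros continuous_intros has_grad_lap_continuous_on[OF hq])
    have bL: "(- (A * (k * k * exp (- k * q z)))) * (norm (2 *\<^sub>R (z - c) - 0))\<^sup>2 + (A * (k * exp (- k * q z))) * (2 * n - 0) \<le> 0"
      if "z \<in> Cone \<inter> ball x0 s" for z
    proof -
      have "0 \<le> q z" using qlow[of z] that closure_subset zero_le_power2[of "norm (z - x0)"]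
        by (smt (verit) Int_iff divide_nonneg_pos subsetD)
      then have "(\<rho> * norm N)\<^sup>2 \<le> (norm (z - c))\<^sup>2" by (simp add: q_def)
      moreover have "1 \<le> norm N" using norm_snd_le[of "1::real" "- \<Gamma> p"] by (simp add: N_def)
      then have "\<rho>\<^sup>2 * 1 \<le> \<rho>\<^sup>2 * (norm N)\<^sup>2" by (intro mult_left_mono) auto
      ultimately have "\<rho>\<^sup>2 \<le> (norm (z - c))\<^sup>2" by (simp add: power_mult_distrib)
      then have "2 * n \<le> 4 * k * (norm (z - c))\<^sup>2"
        using n \<rho> mult_left_mono[of "\<rho>\<^sup>2" "(norm (z - c))\<^sup>2" "2 * n"] by (simp add: k_def divide_simps mult_ac)
      then have "(A * (k * exp (- k * q z))) * (2 * n - 4 * k * (norm (z - c))\<^sup>2) \<le> 0"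
        using A k by (intro mult_nonneg_nonpos) auto
      moreover have "(norm (2 *\<^sub>R (z - c) - 0))\<^sup>2 = 4 * (norm (z - c))\<^sup>2"
        by (simp only: diff_zero norm_scaleR power_mult_distrib) simp
      ultimately show ?thesis by (simp only: ) (simp add: algebra_simps)
    qed
    have b_low: "0 \<le> b z \<and> (s / 2 \<le> dist x0 z \<longrightarrow> 1 \<le> b z)" if z: "z \<in> closure Cone" "z \<in> ball x0 s" for z
    proof (intro conjI impI)
      have q0: "0 \<le> q z" using qlow[OF z] zero_le_power2[of "norm (z - x0)"] by linarith
      then have "exp (- k * q z) \<le> 1" using k by simp
      then show "0 \<le> b z" using A by (simp add: b_def)
      assume "s / 2 \<le> dist x0 z"
      then have "(s / 2)\<^sup>2 \<le> (norm (z - x0))\<^sup>2" using s by (intro power_mono) (auto simp: dist_norm norm_minus_commute)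
      then have "s\<^sup>2 / 8 \<le> q z" using qlow[OF z] by (simp add: power_divide)
      then have "k * (s\<^sup>2 / 8) \<le> k * q z" using k by (intro mult_left_mono) auto
      moreover have "k * (s\<^sup>2 / 8) = n / (16 * \<kappa>\<^sup>2)" using s by (simp add: k_def \<rho>_def power_mult_distrib)
      ultimately have "exp (- k * q z) \<le> exp (- (n / (16 * \<kappa>\<^sup>2)))" by simp
      then have "A * (1 - exp (- (n / (16 * \<kappa>\<^sup>2)))) \<le> b z" using A by (simp add: b_def)
      moreover have "A * (1 - exp (- (n / (16 * \<kappa>\<^sup>2)))) = 1" using n \<kappa> by (simp add: A_def)
      ultimately show "1 \<le> b z" by simp
    qed
    have b_up: "b (p, g p + d) \<le> C0 * d / s" if d: "0 \<le> d" "d < s" for d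
    proof -
      have "q (p, g p + d) = d\<^sup>2 + 2 * \<rho> * d"
        unfolding qe by (simp add: x0_def N_def norm_Pair)
      also have "\<dots> \<le> d * s + 2 * \<rho> * d" using d by (simp add: power2_eq_square mult_left_mono)
      also have "\<dots> = d * s * (1 + 2 * \<kappa>)" by (simp add: \<rho>_def algebra_simps)
      finally have "k * q (p, g p + d) \<le> k * (d * s * (1 + 2 * \<kappa>))" using k by (intro mult_left_mono) auto
      moreover have "1 - exp (- k * q (p, g p + d)) \<le> k * q (p, g p + d)"
        using exp_ge_add_one_self[of "- k * q (p, g p + d)"] by simp
      ultimately have "b (p, g p + d) \<le> A * (k * (d * s * (1 + 2 * \<kappa>)))"
        unfolding b_def using A by (intro mult_left_mono) auto
      also have "\<dots> = C0 * d / s"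
        using s by (simp add: C0_def k_def \<rho>_def power_mult_distrib power2_eq_square mult_ac)
      finally show ?thesis .
    qed
    have hb': "has_grad_lap (Cone \<inter> ball x0 s) b (\<lambda>z. (A * (k * exp (- k * q z))) *\<^sub>R (2 *\<^sub>R (z - c) - 0))
       (\<lambda>z. (- (A * (k * k * exp (- k * q z)))) * (norm (2 *\<^sub>R (z - c) - 0))\<^sup>2 + (A * (k * exp (- k * q z))) * (2 * n - 0))"
      by (rule has_grad_lap_subset[OF hb]) (auto intro: open_Cone)
    show "\<exists>b G L. has_grad_lap (Cone \<inter> ball (p, g p) (norm p)) b G L \<and>
        (\<forall>z \<in> Cone \<inter> ball (p, g p) (norm p). L z \<le> 0) \<and> continuous_on UNIV b \<and>
        (\<forall>z \<in> closure Cone \<inter> ball (p, g p) (norm p). 0 \<le> b z \<and> (norm p / 2 \<le> dist (p, g p) z \<longrightarrow> 1 \<le> b z)) \<and>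
        (\<forall>d. 0 \<le> d \<and> d < norm p \<longrightarrow> b (p, g p + d) \<le> C0 * d / norm p)"
      unfolding x0_def[symmetric] s_def[symmetric]
      using hb' bL has_grad_lap_continuous_on[OF hb] b_low b_up by blast
  qed
qed

end

section \<open>From the annulus to scale-invariant estimates\<close>

lemma C11_epigraphical_cone_epi_cone:
  fixes C :: "((real ^ 'm) \<times> real) set"
  assumes "C11_epigraphical_cone C L K"
  obtains g \<Gamma> B K1 where "epi_cone g \<Gamma> B K1" "C = epi_cone.Cone g"
proof -
  define A where "A = ball (0::real ^ 'm) 2 - ball 0 1"
  obtain g :: "real ^ 'm \<Rightarrow> real" and G M where hom: "\<And>t x. 0 \<le> t \<Longrightarrow> g (t *\<^sub>R x) = t * g x"
    and C: "C = {(x', x\<^sub>n). x\<^sub>n > g x'}" and grad: "is_gradient_on A g G" and M: "M-lipschitz_on A G"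
    using assms unfolding C11_epigraphical_cone_def A_def Let_def by metis
  have M0: "0 \<le> M" using M lipschitz_on_nonneg by blast
  \<comment> \<open>The radius 3/2 lies strictly between 1 and 2, so the derivative within the
    annulus is a full derivative at \<open>P x\<close>. Homogeneity then carries it to every nonzero
    point.\<close>
  define P where "P x = (3 / 2) *\<^sub>R (x /\<^sub>R norm x)" for x :: "real ^ 'm"
  define \<Gamma> where "\<Gamma> x = G (P x)" for x
  have nP: "norm (P x) = 3 / 2" if "x \<noteq> 0" for x using that by (simp add: P_def)
  have PA: "P x \<in> A" if "x \<noteq> 0" for x using nP[OF that] by (simp add: A_def)
  have der: "(g has_derivative (\<lambda>h. \<Gamma> x \<bullet> h)) (at x)" if x: "x \<noteq> 0" for x
  proof -
    define t where "t = norm x / (3 / 2)"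
    have t: "t > 0" using x by (simp add: t_def)
    have Px: "P x = (1 / t) *\<^sub>R x" 
    proof -
      have "1 / t = 3 / 2 * inverse (norm x)" using x by (simp add: t_def field_simps)
      then show ?thesis unfolding P_def scaleR_scaleR by (rule arg_cong[OF sym])
    qed
    have "P x \<in> interior A"
    proof -
      have "open {y :: real ^ 'm. 1 < norm y \<and> norm y < 2}"
        by (intro open_Collect_conj open_Collect_less continuous_intros)
      then have "{y. 1 < norm y \<and> norm y < 2} \<subseteq> interior A"
        by (intro interior_maximal) (auto simp: A_def)
      then show ?thesis using nP[OF x] by auto
    qed
    then have "(g has_derivative (\<lambda>h. \<Gamma> x \<bullet> h)) (at (P x))"
      using grad PA[OF x] at_within_interior[of "P x" A] unfolding is_gradient_on_def \<Gamma>_def by auto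
    then have 1: "(g has_derivative (\<lambda>h. \<Gamma> x \<bullet> h)) (at ((1 / t) *\<^sub>R x))" by (simp add: Px)
    have "((\<lambda>y. g ((1 / t) *\<^sub>R y)) has_derivative (\<lambda>h. \<Gamma> x \<bullet> ((1 / t) *\<^sub>R h))) (at x)"
      by (rule has_derivative_compose[where f="\<lambda>y. (1 / t) *\<^sub>R y" and g=g, OF _ 1]) (auto intro!: derivative_eq_intros)
    then have "((\<lambda>y. t * g ((1 / t) *\<^sub>R y)) has_derivative (\<lambda>h. t * (\<Gamma> x \<bullet> ((1 / t) *\<^sub>R h)))) (at x)"
      by (rule has_derivative_mult_right)
    then show ?thesis using hom[of "1 / t"] t by simp
  qed
  have "bounded (G ` A)"
  proof (rule bounded_subset)
    show "bounded (cball (G (P (axis undefined 1))) (M * 4))" by simp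
    have e: "axis undefined 1 \<noteq> (0 :: real ^ 'm)" by (simp add: axis_eq_0_iff)
    show "G ` A \<subseteq> cball (G (P (axis undefined 1))) (M * 4)"
    proof
      fix y assume "y \<in> G ` A"
      then obtain x where x: "x \<in> A" "y = G x" by auto
      have "dist (G (P (axis undefined 1))) (G x) \<le> M * dist (P (axis undefined 1)) x"
        using lipschitz_onD[OF M PA[OF e] x(1)] .
      also have "dist (P (axis undefined 1)) x \<le> 3 / 2 + 2"
        using nP[OF e] x(1) norm_triangle_ineq4[of "P (axis undefined 1)" x] by (simp add: dist_norm A_def)
      then have "M * dist (P (axis undefined 1)) x \<le> M * 4" using M0 by (intro mult_left_mono) auto
      finally show "y \<in> cball (G (P (axis undefined 1))) (M * 4)" using x by simp
    qed
  qed
  then obtain B where B': "\<forall>x\<in>A. norm (G x) \<le> B" by (auto simp: bounded_iff)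
  have "P (axis undefined 1) \<in> A" by (intro PA) (simp add: axis_eq_0_iff)
  then have B0: "0 \<le> B" using B' order_trans[OF norm_ge_zero] by blast
  have \<Gamma>B: "norm (\<Gamma> x) \<le> B" if "x \<noteq> 0" for x using B' PA[OF that] by (simp add: \<Gamma>_def)
  have g0: "g 0 = 0" using hom[of 0 0] by simp
  have seg: "\<bar>g p - g q\<bar> \<le> B * norm (p - q)" if "0 \<notin> closed_segment p q" for p q
  proof (rule inner_gradient_Lipschitz[where T="closed_segment p q" and D=\<Gamma>])
    show "(g has_derivative (\<lambda>h. \<Gamma> z \<bullet> h)) (at z)" "norm (\<Gamma> z) \<le> B" if "z \<in> closed_segment p q" for z
      using der \<Gamma>B that \<open>0 \<notin> closed_segment p q\<close> by metis+
  qed auto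
  have g_B: "\<bar>g p\<bar> \<le> B * norm p" for p
  proof (cases "p = 0")
    case False
    \<comment> \<open>On this segment the Lipschitz bound holds, and
      \<open>g (2 *\<^sub>R p) = 2 * g p\<close> turns it into the bound of |g p| by B |p|.\<close>
    have "0 \<notin> closed_segment p (2 *\<^sub>R p)"
    proof
      assume "0 \<in> closed_segment p (2 *\<^sub>R p)"
      then obtain u where u: "0 = (1 - u) *\<^sub>R p + u *\<^sub>R (2 *\<^sub>R p)" "0 \<le> u" unfolding closed_segment_def by auto
      have "(1 - u) *\<^sub>R p + u *\<^sub>R (2 *\<^sub>R p) = ((1 - u) + u * 2) *\<^sub>R p"
        by (simp only: scaleR_scaleR scaleR_add_left)
      then have "((1 - u) + u * 2) *\<^sub>R p = 0" using u(1) by simp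
      then show False using False u by simp
    qed
    from seg[OF this] have "\<bar>g p - 2 * g p\<bar> \<le> B * norm (p - 2 *\<^sub>R p)" using hom[of 2 p] by simp
    moreover have "p - 2 *\<^sub>R p = - p" by (simp add: scaleR_2)
    ultimately show ?thesis by simp
  qed (simp add: g0)
  have lip: "\<bar>g p - g q\<bar> \<le> B * norm (p - q)" for p q
  proof (cases "0 \<in> closed_segment p q")
    case True
    then have "dist p q = dist p 0 + dist 0 q" using between between_mem_segment by metis
    then have "norm (p - q) = norm p + norm q" by (simp add: dist_norm)
    then show ?thesis using g_B[of p] g_B[of q] by (simp add: algebra_simps)
  qed (rule seg)
  \<comment> \<open>\<open>P\<close> has Lipschitz constant 3/2 times 2/|p| relative to
    \<open>p\<close>, which gives 3 M / |p| for \<open>\<Gamma>\<close>; adding 1 makes the constant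
    positive.\<close>
  define K1 where "K1 = 3 * M + 1"
  have quad: "\<bar>g q - g p - \<Gamma> p \<bullet> (q - p)\<bar> \<le> K1 / norm p * (norm (q - p))\<^sup>2"
    if p: "p \<noteq> 0" and qp: "norm (q - p) < norm p" for p q
  proof -
    have nz: "z \<noteq> 0" if "z \<in> cball p (norm (q - p))" for z
      using that qp by (auto simp: dist_norm)
    have "\<bar>(\<lambda>z. g z - \<Gamma> p \<bullet> z) q - (\<lambda>z. g z - \<Gamma> p \<bullet> z) p\<bar> \<le> (K1 / norm p * norm (q - p)) * norm (q - p)"
    proof (rule inner_gradient_Lipschitz[where T="cball p (norm (q - p))" and D="\<lambda>z. \<Gamma> z - \<Gamma> p"])
      fix z assume z: "z \<in> cball p (norm (q - p))"
      show "((\<lambda>z. g z - \<Gamma> p \<bullet> z) has_derivative (\<lambda>h. (\<Gamma> z - \<Gamma> p) \<bullet> h)) (at z)"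
        using der[OF nz[OF z]] by (auto intro!: derivative_eq_intros simp: inner_diff_left)
      have "norm (\<Gamma> z - \<Gamma> p) \<le> M * norm (P z - P p)"
        using lipschitz_onD[OF M PA[OF nz[OF z]] PA[OF p]] by (simp add: \<Gamma>_def dist_norm)
      also have "P z - P p = (3 / 2) *\<^sub>R (z /\<^sub>R norm z - p /\<^sub>R norm p)" by (simp add: P_def scaleR_diff_right)
      also have "norm \<dots> \<le> 3 / 2 * (2 * norm (z - p) / norm p)"
        using normalize_diff_le[OF p nz[OF z]] by simp
      finally have "norm (\<Gamma> z - \<Gamma> p) \<le> M * (3 / 2 * (2 * norm (z - p) / norm p))"
        using M0 by (simp add: mult_left_mono)
      also have "\<dots> = 3 * M * norm (z - p) / norm p" by simp
      also have "\<dots> \<le> K1 * norm (q - p) / norm p"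
        using z M0 p by (intro divide_right_mono mult_mono) (auto simp: K1_def dist_norm norm_minus_commute)
      finally show "norm (\<Gamma> z - \<Gamma> p) \<le> K1 / norm p * norm (q - p)" by simp
    qed (auto simp: dist_norm norm_minus_commute)
    then show ?thesis by (simp add: inner_diff_right power2_eq_square algebra_simps)
  qed
  have e: "epi_cone g \<Gamma> B K1"
    using hom B0 lip M0 quad by unfold_locales (auto simp: K1_def)
  moreover have "C = epi_cone.Cone g"
    unfolding C by (auto simp: epi_cone.Cone_def[OF e])
  ultimately show ?thesis using that by blast
qed

section \<open>The homogeneous harmonic function\<close>

lemma mean_unit:
  fixes F :: "'a::euclidean_space \<Rightarrow> real"
  assumes "0 < r" "continuous_on (cball a r) F"
  shows "mean F a r = (LINT z:cball 0 1|lborel. F (a + r *\<^sub>R z) * kern 1 z)"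
proof -
  have "continuous_on (cball a r) (\<lambda>y. F y * kern r (y - a))"
    by (intro continuous_intros assms)
  then have "mean F a r = r ^ DIM('a) * (LINT z:cball 0 1|lborel. F (a + r *\<^sub>R z) * kern r (r *\<^sub>R z))"
    unfolding mean_def by (subst set_integral_affine_cball[OF assms(1)]) auto
  also have "\<dots> = (LINT z:cball 0 1|lborel. r ^ DIM('a) * (F (a + r *\<^sub>R z) * kern r (r *\<^sub>R z)))" by simp
  also have "\<dots> = (LINT z:cball 0 1|lborel. F (a + r *\<^sub>R z) * kern 1 z)"
    using assms(1) by (intro set_lebesgue_integral_cong) (auto simp: kern_def power_mult_distrib)
  finally show ?thesis .
qed

lemma mean_scale:
  fixes F :: "'a::euclidean_space \<Rightarrow> real"
  assumes t: "0 < t" "0 < r" and F: "continuous_on (cball (t *\<^sub>R a) (t * r)) F"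
  shows "mean (\<lambda>x. F (t *\<^sub>R x)) a r = mean F (t *\<^sub>R a) (t * r)"
proof -
  have "continuous_on (cball a r) (\<lambda>x. F (t *\<^sub>R x))"
    by (rule continuous_on_compose2[OF F])
       (use t in \<open>auto intro!: continuous_intros simp: dist_norm simp flip: scaleR_diff_right\<close>)
  then show ?thesis
    using mean_unit[OF t(2), of a "\<lambda>x. F (t *\<^sub>R x)"] mean_unit[OF _ F] t by (simp add: scaleR_add_right)
qed

lemma superh_scale:
  fixes F :: "'a::euclidean_space \<Rightarrow> real"
  assumes F: "superh U F" and t: "0 < t"
  shows "superh {x. t *\<^sub>R x \<in> U} (\<lambda>x. F (t *\<^sub>R x))"
  unfolding superh_def
proof (intro conjI ballI)
  note cF = superh_continuous_on[OF F]
  show "continuous_on {x. t *\<^sub>R x \<in> U} (\<lambda>x. F (t *\<^sub>R x))"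
    by (rule continuous_on_compose2[OF cF]) (auto intro!: continuous_intros)
  fix x assume "x \<in> {x. t *\<^sub>R x \<in> U}"
  then obtain r where r: "r > 0" "\<And>s. 0 < s \<Longrightarrow> s < r \<Longrightarrow> cball (t *\<^sub>R x) s \<subseteq> U"
    "\<And>s. 0 < s \<Longrightarrow> s < r \<Longrightarrow> mean F (t *\<^sub>R x) s \<le> F (t *\<^sub>R x)"
    using F unfolding superh_def by blast
  show "\<exists>r>0. \<forall>s. 0 < s \<and> s < r \<longrightarrow> cball x s \<subseteq> {x. t *\<^sub>R x \<in> U} \<and> mean (\<lambda>x. F (t *\<^sub>R x)) x s \<le> F (t *\<^sub>R x)"
  proof (intro exI[of _ "r / t"] conjI allI impI)
    fix s assume s: "0 < s \<and> s < r / t"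
    then have ts: "0 < t * s" "t * s < r" using t by (auto simp: field_simps)
    show "cball x s \<subseteq> {x. t *\<^sub>R x \<in> U}"
    proof
      fix y assume "y \<in> cball x s"
      then have "t *\<^sub>R y \<in> cball (t *\<^sub>R x) (t * s)" using t by (simp add: dist_norm flip: scaleR_diff_right)
      then show "y \<in> {x. t *\<^sub>R x \<in> U}" using r(2)[OF ts] by blast
    qed
    have "mean (\<lambda>x. F (t *\<^sub>R x)) x s = mean F (t *\<^sub>R x) (t * s)"
      using s t continuous_on_subset[OF cF r(2)[OF ts]] by (intro mean_scale) auto
    then show "mean (\<lambda>x. F (t *\<^sub>R x)) x s \<le> F (t *\<^sub>R x)" using r(3)[OF ts] by simp
  qed (use r t in simp)
qed

lemma DIM_ge_2: "2 \<le> real DIM((real ^ 'm) \<times> real)"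
proof -
  have "1 \<le> CARD('m)" by (simp add: Suc_leI)
  then show ?thesis by simp
qed

lemma homogeneous_euler:
  fixes T :: "'a::euclidean_space \<Rightarrow> real"
  assumes "(T has_derivative (\<lambda>h. G \<bullet> h)) (at x)"
    and "\<And>t. 0 < t \<Longrightarrow> T (t *\<^sub>R x) = t powr \<alpha> * T x"
  shows "x \<bullet> G = \<alpha> * T x"
proof (rule DERIV_unique)
  have 1: "(T has_derivative (\<lambda>h. G \<bullet> h)) (at (1 *\<^sub>R x))" using assms by simp
  have "((\<lambda>t. T (t *\<^sub>R x)) has_derivative (\<lambda>t. G \<bullet> (t *\<^sub>R x))) (at 1)"
    by (rule has_derivative_compose[where f="\<lambda>t. t *\<^sub>R x" and g=T, OF _ 1]) (auto intro!: derivative_eq_intros)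
  then show "((\<lambda>t. T (t *\<^sub>R x)) has_real_derivative x \<bullet> G) (at 1)"
    unfolding has_field_derivative_def by (rule has_derivative_eq_rhs) (auto simp: inner_commute mult.commute)
  have "((\<lambda>t. t powr \<alpha> * T x) has_real_derivative \<alpha> * T x) (at 1)"
    by (auto intro!: derivative_eq_intros)
  then show "((\<lambda>t. T (t *\<^sub>R x)) has_real_derivative \<alpha> * T x) (at 1)"
    by (rule has_field_derivative_transform_within_open[of _ _ _ "{0<..}"]) (use assms in auto)
qed

context epi_cone
begin

section \<open>Exponents with a superharmonic majorant\<close>

text \<open>By Euler's identity the Laplacian of |x|^\<tau> F is |x|^\<tau> L + \<tau> (2 \<alpha> +
  \<tau> + n - 2) |x|^(\<tau>-2) F. Strict superharmonicity of \<open>F\<close> thus pays for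
  raising the degree from \<alpha> to \<alpha> + \<tau>.\<close>

lemma superh_norm_powr_mult:
  assumes dm: "dm = real DIM((real ^ 'm) \<times> real)" and FGL: "has_grad_lap Cone F G L" and eu: "\<And>x. x \<in> Cone \<Longrightarrow> x \<bullet> G x = \<alpha> * F x"
    and F: "\<And>x. x \<in> Cone \<Longrightarrow> F x \<le> K * norm x powr \<alpha>"
    and L: "\<And>x. x \<in> Cone \<Longrightarrow> L x \<le> - c * norm x powr (\<alpha> - 2)"
    and \<alpha>: "0 \<le> \<alpha>" and \<tau>: "0 \<le> \<tau>" "\<tau> * (2 * \<alpha> + \<tau> + dm - 2) * K \<le> c"
  shows "superh Cone (\<lambda>x. norm x powr \<tau> * F x)"
proof (rule superh_C2[OF has_grad_lap_mult[OF has_grad_lap_norm_powr[OF open_Cone zero_notin_Cone, folded dm] FGL]])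
  have n2: "2 \<le> dm" unfolding dm by (rule DIM_ge_2)
  fix x assume x: "x \<in> Cone"
  let ?r = "norm x"
  have r: "?r > 0" using x zero_notin_Cone by auto
  have p: "?r powr \<tau> * ?r powr (\<alpha> - 2) = ?r powr (\<tau> - 2) * ?r powr \<alpha>"
    by (simp add: algebra_simps flip: powr_add)
  define m where "m = \<tau> * (2 * \<alpha> + \<tau> + dm - 2)"
  have m: "0 \<le> m" using \<tau> \<alpha> n2 unfolding m_def by (intro mult_nonneg_nonneg) linarith+
  have "?r powr \<tau> * L x \<le> ?r powr \<tau> * (- c * ?r powr (\<alpha> - 2))"
    using L[OF x] by (intro mult_left_mono) auto
  moreover have "m * ?r powr (\<tau> - 2) * F x \<le> m * ?r powr (\<tau> - 2) * (K * ?r powr \<alpha>)"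
    using F[OF x] m by (intro mult_left_mono) auto
  moreover have "(m * K) * (?r powr (\<tau> - 2) * ?r powr \<alpha>) \<le> c * (?r powr (\<tau> - 2) * ?r powr \<alpha>)"
    using \<tau>(2) by (intro mult_right_mono) (auto simp: m_def)
  ultimately have "?r powr \<tau> * L x + m * ?r powr (\<tau> - 2) * F x \<le> 0"
    using p by (simp add: algebra_simps)
  moreover have "?r powr \<tau> * L x + 2 * (((\<tau> * ?r powr (\<tau> - 2)) *\<^sub>R x) \<bullet> G x)
       + F x * (\<tau> * (\<tau> + dm - 2) * ?r powr (\<tau> - 2)) = ?r powr \<tau> * L x + m * ?r powr (\<tau> - 2) * F x"
    using eu[OF x] by (simp add: m_def algebra_simps)
  ultimately show "?r powr \<tau> * L x + 2 * (((\<tau> * ?r powr (\<tau> - 2)) *\<^sub>R x) \<bullet> G x)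
       + F x * (\<tau> * (\<tau> + dm - 2) * ?r powr (\<tau> - 2)) \<le> 0" by simp
qed

text \<open>
  The degree \<open>\<beta>\<close> of the homogeneous harmonic function is the supremum of these exponents. If \<open>\<alpha>\<close> is
  close to \<open>\<beta>\<close>, then by \<open>majorizable_increase\<close> the least majorant of \<open>norm x powr \<alpha>\<close> is large
  somewhere on the sphere, so that after normalization its boundary values tend to \<open>0\<close>.
\<close>

definition "majorizable \<alpha> \<longleftrightarrow> 0 < \<alpha> \<and>
  (\<exists>F K. superh Cone F \<and> (\<forall>x\<in>Cone. norm x powr \<alpha> \<le> F x \<and> F x \<le> K * norm x powr \<alpha>))"

text \<open>Let t be the cosine of the angle to the axis. It stays away from -1 on the cone, because
  \<open>g\<close> is Lipschitz. Then M - exp (-k t), homogeneous of degree 0, is strictly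
  superharmonic for large k, and a small positive power of |x| can be multiplied in.\<close>

lemma majorizable_small: "\<exists>\<alpha>. majorizable \<alpha>"
proof -
  define e where "e = ((0, 1) :: (real ^ 'm) \<times> real)"
  \<comment> \<open>A lower bound for 1 - t^2 where t < 1/2: 3/4 covers 0 \<le> t < 1/2, and the
    Lipschitz bound gives 1 / (1 + B^2) for negative t.\<close>
  define \<eta> where "\<eta> = min (3 / 4) (1 / (1 + B\<^sup>2))"
  have B1: "0 < 1 + B\<^sup>2" by (simp add: add_pos_nonneg)
  have \<eta>: "0 < \<eta>" using B1 by (simp add: \<eta>_def)
  define dm where "dm = real DIM((real ^ 'm) \<times> real)"
  have n2: "2 \<le> dm" unfolding dm_def by (rule DIM_ge_2)
  \<comment> \<open>The Laplacian of t is -(n-1) t / |x|^2 and its squared gradient is (1 - t^2) /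
    |x|^2, which leads to the expression k^2 (1 - t^2) + k (n-1) t in \<open>key\<close>. For t <
    1/2 its first term is at least k n and beats the second; for t \<ge> 1/2 the second alone is at
    least k/2.\<close>
  define k where "k = dm / \<eta>"
  have k: "0 < k" using n2 \<eta> by (simp add: k_def)
  define t where "t x = (e \<bullet> x) * norm x powr (- 1)" for x :: "(real ^ 'm) \<times> real"
  have tb: "\<bar>t x\<bar> \<le> 1 \<and> (0 \<le> t x \<or> 1 / (1 + B\<^sup>2) \<le> 1 - (t x)\<^sup>2)" if x: "x \<in> Cone" for x
  proof -
    have r: "norm x > 0" using x zero_notin_Cone by auto
    have t: "t x = snd x / norm x" using r by (simp add: t_def e_def inner_prod_def powr_minus divide_inverse)
    have sn: "\<bar>snd x\<bar> \<le> norm x" using norm_snd_le[of "snd x" "fst x"] by simp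
    have 1: "\<bar>t x\<bar> \<le> 1" using sn r by (simp add: t abs_divide)
    show ?thesis
    proof (cases "0 \<le> t x")
      case False
      then have "snd x < 0" using r by (simp add: t zero_le_divide_iff)
      moreover have "- (B * norm (fst x)) < snd x"
        using x abs_g_le[of "fst x"] by (simp add: Cone_def)
      ultimately have "(snd x)\<^sup>2 \<le> (B * norm (fst x))\<^sup>2"
        by (intro power2_le_iff_abs_le[THEN iffD2]) (auto simp: B mult_nonneg_nonneg)
      moreover have "(norm x)\<^sup>2 = (norm (fst x))\<^sup>2 + (snd x)\<^sup>2" by (simp add: norm_prod_def)
      ultimately have "(1 + B\<^sup>2) * (snd x)\<^sup>2 \<le> B\<^sup>2 * (norm x)\<^sup>2"
        by (simp add: power_mult_distrib algebra_simps)
      then have "(1 + B\<^sup>2) * (t x)\<^sup>2 \<le> B\<^sup>2" using r by (simp add: t power_divide field_simps)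
      then have "1 / (1 + B\<^sup>2) \<le> 1 - (t x)\<^sup>2" using B1 by (simp add: field_simps)
      then show ?thesis using 1 by simp
    qed (use 1 in simp)
  qed
  have key: "k / 2 \<le> k\<^sup>2 * (1 - (t x)\<^sup>2) + k * (dm - 1) * t x" if x: "x \<in> Cone" for x
  proof -
    have t1: "(t x)\<^sup>2 \<le> 1" using tb[OF x] by (simp add: abs_square_le_1)
    show ?thesis
    proof (cases "1 / 2 \<le> t x")
      case True
      have "k * (1 * (1 / 2)) \<le> k * ((dm - 1) * t x)"
        using True n2 k by (intro mult_left_mono mult_mono) auto
      moreover have "0 \<le> k\<^sup>2 * (1 - (t x)\<^sup>2)" using t1 by simp
      ultimately show ?thesis unfolding mult.assoc by linarith
    next
      case False
      have "\<eta> \<le> 1 - (t x)\<^sup>2"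
      proof (cases "0 \<le> t x")
        case True
        then have "(t x)\<^sup>2 \<le> (1 / 2)\<^sup>2" using False by (intro power_mono) auto
        then show ?thesis by (simp add: \<eta>_def power_divide)
      next
        case neg: False
        then show ?thesis using tb[OF x] unfolding \<eta>_def by (intro min.coboundedI2) simp
      qed
      then have "k\<^sup>2 * \<eta> \<le> k\<^sup>2 * (1 - (t x)\<^sup>2)" by (intro mult_left_mono) auto
      moreover have "k\<^sup>2 * \<eta> = k * dm" using \<eta> by (simp add: k_def power2_eq_square)
      moreover have "- 1 \<le> t x" using tb[OF x] by (simp add: abs_le_iff)
      then have "k * (dm - 1) * (- 1) \<le> k * (dm - 1) * t x" using k n2 by (intro mult_left_mono) auto
      ultimately have "k \<le> k\<^sup>2 * (1 - (t x)\<^sup>2) + k * (dm - 1) * t x" by (simp add: algebra_simps)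
      then show ?thesis using k by simp
    qed
  qed
  define Gt where "Gt x = (e \<bullet> x) *\<^sub>R ((- 1 * norm x powr (- 1 - 2)) *\<^sub>R x) + norm x powr (- 1) *\<^sub>R e" for x :: "(real ^ 'm) \<times> real"
  have ht: "has_grad_lap Cone t Gt (\<lambda>x. - (dm - 1) * t x * norm x powr (- 2))"
    unfolding t_def[abs_def]
  proof (rule has_grad_lap_cong[OF has_grad_lap_mult[OF has_grad_lap_inner[OF open_Cone]
          has_grad_lap_norm_powr[OF open_Cone zero_notin_Cone, folded dm_def]]])
    fix x assume "x \<in> Cone"
    have "norm x powr (- 1 - 2) = norm x powr (- 1) * norm x powr (- 2)" unfolding powr_add[symmetric] by simp
    then show "(e \<bullet> x) * (- 1 * (- 1 + dm - 2) * norm x powr (- 1 - 2))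
        + 2 * (e \<bullet> ((- 1 * norm x powr (- 1 - 2)) *\<^sub>R x)) + norm x powr (- 1) * 0
       = - (dm - 1) * ((e \<bullet> x) * norm x powr (- 1)) * norm x powr (- 2)"
      by (simp add: algebra_simps add_divide_distrib diff_divide_distrib)
  qed (auto simp: Gt_def)
  define M where "M = 1 + exp k"
  define \<beta> where "\<beta> x = M - exp (- k * t x)" for x
  define L\<beta> where "L\<beta> x = (- (k * k * exp (- k * t x))) * (norm (Gt x))\<^sup>2
      + (k * exp (- k * t x)) * (- (dm - 1) * t x * norm x powr (- 2))" for x
  have h\<beta>: "has_grad_lap Cone \<beta> (\<lambda>x. (k * exp (- k * t x)) *\<^sub>R Gt x) L\<beta>"
    unfolding \<beta>_def[abs_def] L\<beta>_def[abs_def]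
    by (rule has_grad_lap_chain[OF ht, where \<phi>="\<lambda>s. M - exp (- k * s)" and \<phi>'="\<lambda>s. k * exp (- k * s)"
           and \<phi>''="\<lambda>s. - (k * k * exp (- k * s))"])
       (auto intro!: derivative_eq_intros continuous_intros has_grad_lap_continuous_on[OF ht])
  define c where "c = exp (- k) * (k / 2)"
  have c: "0 < c" using k by (simp add: c_def)
  have exb: "exp (- k) \<le> exp (- k * t x)" "exp (- k * t x) \<le> exp k" if "x \<in> Cone" for x
  proof -
    have "- 1 \<le> t x" "t x \<le> 1" using tb[OF that] by (auto simp: abs_le_iff)
    then have "k * t x \<le> k * 1" "k * (- 1) \<le> k * t x" using k by (intro mult_left_mono; simp)+
    then show "exp (- k) \<le> exp (- k * t x)" "exp (- k * t x) \<le> exp k" by simp_all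
  qed
  have \<beta>b: "1 \<le> \<beta> x" "\<beta> x \<le> M" if "x \<in> Cone" for x
    using exb[OF that] by (auto simp: \<beta>_def M_def)
  have eu: "x \<bullet> ((k * exp (- k * t x)) *\<^sub>R Gt x) = 0 * \<beta> x" if x: "x \<in> Cone" for x
  proof -
    have r: "norm x > 0" using x zero_notin_Cone by auto
    then have "norm x powr (- 1) = norm x powr (- 1 - 2) * (norm x)\<^sup>2"
      by (simp flip: powr_numeral powr_add)
    then have "x \<bullet> Gt x = 0"
      by (simp add: Gt_def inner_add_right inner_diff_right power2_norm_eq_inner inner_commute)
    then show ?thesis by simp
  qed
  have L\<beta>b: "L\<beta> x \<le> - c * norm x powr (0 - 2)" if x: "x \<in> Cone" for x
  proof -
    let ?r = "norm x"
    have r: "?r > 0" using x zero_notin_Cone by auto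
    have pw: "?r powr (- 1) = 1 / ?r" "?r powr (- 2) = 1 / ?r\<^sup>2" "?r powr (- 1 - 2) = 1 / ?r ^ 3" "?r powr (0 - 2) = 1 / ?r\<^sup>2"
      using r by (simp_all add: powr_minus powr_numeral divide_inverse)
    have tt: "e \<bullet> x = t x * ?r" using r by (simp add: t_def pw)
    have nG: "(norm (Gt x))\<^sup>2 = (1 - (t x)\<^sup>2) * ?r powr (- 2)"
    proof -
      have xx: "x \<bullet> x = ?r\<^sup>2" by (simp add: power2_norm_eq_inner)
      have G: "Gt x = (- (t x) / ?r\<^sup>2) *\<^sub>R x + (1 / ?r) *\<^sub>R e"
        unfolding Gt_def tt pw using r by (simp add: power3_eq_cube power2_eq_square)
      have "(norm (Gt x))\<^sup>2 = (- (t x) / ?r\<^sup>2)\<^sup>2 * (x \<bullet> x) + 2 * ((- (t x) / ?r\<^sup>2) * (1 / ?r)) * (e \<bullet> x) + (1 / ?r)\<^sup>2 * (e \<bullet> e)"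
        unfolding G power2_norm_eq_inner
        by (simp only: inner_add_left inner_add_right inner_scaleR_left inner_scaleR_right inner_commute[of x e])
           (simp add: power2_eq_square algebra_simps)
      also have "\<dots> = (t x)\<^sup>2 / ?r\<^sup>2 - 2 * (t x)\<^sup>2 / ?r\<^sup>2 + 1 / ?r\<^sup>2"
        unfolding tt xx using r by (simp add: e_def power2_eq_square inner_prod_def field_simps)
      also have "\<dots> = (1 - (t x)\<^sup>2) * ?r powr (- 2)" unfolding pw by (simp add: diff_divide_distrib)
      finally show ?thesis .
    qed
    have "L\<beta> x = - (exp (- k * t x) * (k\<^sup>2 * (1 - (t x)\<^sup>2) + k * (dm - 1) * t x)) * ?r powr (- 2)"
      unfolding L\<beta>_def nG by (simp add: power2_eq_square algebra_simps)
    moreover have "c \<le> exp (- k * t x) * (k\<^sup>2 * (1 - (t x)\<^sup>2) + k * (dm - 1) * t x)"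
      unfolding c_def using exb[OF x] key[OF x] k by (intro mult_mono) auto
    ultimately show ?thesis by (simp add: mult_right_mono)
  qed
  have M: "0 < M" by (simp add: M_def add_pos_pos)
  \<comment> \<open>Small enough that the cost of raising the degree from 0 to \<tau> is at most
    \<open>c\<close>.\<close>
  define \<tau> where "\<tau> = min 1 (c / ((1 + dm) * M))"
  have \<tau>: "0 < \<tau>" "\<tau> \<le> 1" using c M n2 by (auto simp: \<tau>_def)
  have "\<tau> * (2 * 0 + \<tau> + dm - 2) * M \<le> \<tau> * (1 + dm) * M"
    using \<tau> M n2 by (intro mult_right_mono mult_left_mono) auto
  also have "\<dots> \<le> c"
  proof -
    have "\<tau> * ((1 + dm) * M) \<le> c / ((1 + dm) * M) * ((1 + dm) * M)"
      using M n2 by (intro mult_right_mono) (auto simp: \<tau>_def)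
    also have "\<dots> = c" using M n2 by simp
    finally show ?thesis by (simp add: mult.assoc)
  qed
  finally have "superh Cone (\<lambda>x. norm x powr \<tau> * \<beta> x)"
    using \<beta>b \<tau> zero_notin_Cone
    by (intro superh_norm_powr_mult[OF dm_def h\<beta> eu _ L\<beta>b, where K=M]) (auto simp: powr_def)
  moreover have "norm x powr \<tau> \<le> norm x powr \<tau> * \<beta> x \<and> norm x powr \<tau> * \<beta> x \<le> M * norm x powr \<tau>" if "x \<in> Cone" for x
  proof
    show "norm x powr \<tau> \<le> norm x powr \<tau> * \<beta> x"
      using mult_left_mono[OF \<beta>b(1)[OF that], of "norm x powr \<tau>"] by simp
    show "norm x powr \<tau> * \<beta> x \<le> M * norm x powr \<tau>"
      using mult_left_mono[OF \<beta>b(2)[OF that], of "norm x powr \<tau>"] by (simp add: mult.commute)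
  qed
  ultimately show ?thesis using \<tau> unfolding majorizable_def by blast
qed

lemma superh_neg_norm_powr:
  assumes "0 < \<alpha>"
  shows "superh Cone (\<lambda>x. - (norm x powr \<alpha>))"
proof -
  have "superh Cone (\<lambda>x. (-1) * norm x powr \<alpha>)"
  proof (rule superh_C2[OF has_grad_lap_cmult[OF has_grad_lap_norm_powr[OF open_Cone zero_notin_Cone]]])
    show "- 1 * (\<alpha> * (\<alpha> + real DIM((real ^ 'm) \<times> real) - 2) * norm x powr (\<alpha> - 2)) \<le> 0" for x
    proof -
      have "0 \<le> \<alpha> * (\<alpha> + real DIM((real ^ 'm) \<times> real) - 2)"
        using assms DIM_ge_2[where 'm='m] by (intro mult_nonneg_nonneg) linarith+
      from mult_nonneg_nonneg[OF this powr_ge_zero[of "norm x" "\<alpha> - 2"]] show ?thesis by linarith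
    qed
  qed
  then show ?thesis by simp
qed

text \<open>Homogeneity comes from leastness: rescaling a majorant of |x|^\<alpha> by the factor of
  degree \<alpha> gives a majorant again, so the least one is invariant.\<close>

lemma least_majorant_norm_powr:
  assumes "majorizable \<alpha>"
  obtains T K where "harm Cone T" "\<And>x. x \<in> Cone \<Longrightarrow> norm x powr \<alpha> \<le> T x" "\<And>x. x \<in> Cone \<Longrightarrow> T x \<le> K * norm x powr \<alpha>"
    "\<And>t x. x \<in> Cone \<Longrightarrow> 0 < t \<Longrightarrow> T (t *\<^sub>R x) = t powr \<alpha> * T x"
    "\<And>F x. superh Cone F \<Longrightarrow> (\<And>x. x \<in> Cone \<Longrightarrow> norm x powr \<alpha> \<le> F x) \<Longrightarrow> x \<in> Cone \<Longrightarrow> T x \<le> F x"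
proof -
  obtain F K where F: "superh Cone F" "\<And>x. x \<in> Cone \<Longrightarrow> norm x powr \<alpha> \<le> F x"
    "\<And>x. x \<in> Cone \<Longrightarrow> F x \<le> K * norm x powr \<alpha>" and \<alpha>: "0 < \<alpha>"
    using assms unfolding majorizable_def by blast
  obtain T where T: "harm Cone T" "\<And>x. x \<in> Cone \<Longrightarrow> norm x powr \<alpha> \<le> T x"
    "\<And>F x. superh Cone F \<Longrightarrow> (\<And>x. x \<in> Cone \<Longrightarrow> norm x powr \<alpha> \<le> F x) \<Longrightarrow> x \<in> Cone \<Longrightarrow> T x \<le> F x"
    using least_harmonic_majorant[OF open_Cone superh_neg_norm_powr[OF \<alpha>] F(1,2)] by blast
  \<comment> \<open>One inequality for all \<open>t\<close> is enough: applied at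
    \<open>t *\<^sub>R x\<close> with factor \<open>1 / t\<close> it yields the reverse one.\<close>
  have le: "T x \<le> t powr (- \<alpha>) * T (t *\<^sub>R x)" if x: "x \<in> Cone" and t: "0 < t" for x t
  proof (rule T(3)[OF _ _ x])
    have "{x. t *\<^sub>R x \<in> Cone} = Cone" using Cone_scale[OF t] by auto
    then show "superh Cone (\<lambda>x. t powr (- \<alpha>) * T (t *\<^sub>R x))"
      using superh_scale[OF harm_superh[OF T(1) open_Cone] t] by (intro superh_cmult) auto
    fix y assume "y \<in> Cone"
    then have "norm (t *\<^sub>R y) powr \<alpha> \<le> T (t *\<^sub>R y)" using T(2) Cone_scale[OF t] by blast
    then have "t powr (- \<alpha>) * (t powr \<alpha> * norm y powr \<alpha>) \<le> t powr (- \<alpha>) * T (t *\<^sub>R y)"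
      using t by (intro mult_left_mono) (auto simp: powr_mult)
    moreover have "t powr (- \<alpha>) * (t powr \<alpha> * norm y powr \<alpha>) = norm y powr \<alpha>"
      using t by (simp add: powr_minus mult.assoc[symmetric])
    ultimately show "norm y powr \<alpha> \<le> t powr (- \<alpha>) * T (t *\<^sub>R y)" by simp
  qed
  show ?thesis
  proof (rule that[of T K])
    show "T x \<le> K * norm x powr \<alpha>" if "x \<in> Cone" for x
      using T(3)[OF F(1,2) that] F(3)[OF that] by linarith
    show "T (t *\<^sub>R x) = t powr \<alpha> * T x" if x: "x \<in> Cone" and t: "0 < t" for x t
    proof (rule antisym)
      have "T (t *\<^sub>R x) \<le> (1 / t) powr (- \<alpha>) * T ((1 / t) *\<^sub>R (t *\<^sub>R x))"
        using le[of "t *\<^sub>R x" "1 / t"] x t Cone_scale by auto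
      moreover have "(1 / t) powr (- \<alpha>) = t powr \<alpha>" using t by (simp add: powr_divide powr_minus_divide)
      ultimately show "T (t *\<^sub>R x) \<le> t powr \<alpha> * T x" using t by simp
      have "t powr \<alpha> * T x \<le> t powr \<alpha> * (t powr (- \<alpha>) * T (t *\<^sub>R x))"
        using le[OF x t] by (intro mult_left_mono) auto
      also have "\<dots> = T (t *\<^sub>R x)" using t by (simp add: powr_minus)
      finally show "t powr \<alpha> * T x \<le> T (t *\<^sub>R x)" .
    qed
  qed (use T in auto)
qed

text \<open>Subtracting half of |x|^\<alpha> makes the harmonic \<open>T\<close> strictly
  superharmonic, while it remains between |x|^\<alpha> / 2 and K |x|^\<alpha>. The admissible gain
  \<tau> shrinks as \<open>K\<close> grows, so a degree that cannot be raised by much must have a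
  large \<open>K\<close>.\<close>

lemma majorizable_increase:
  assumes T: "harm Cone T" "\<And>x. x \<in> Cone \<Longrightarrow> norm x powr \<alpha> \<le> T x" "\<And>x. x \<in> Cone \<Longrightarrow> T x \<le> K * norm x powr \<alpha>"
    "\<And>t x. x \<in> Cone \<Longrightarrow> 0 < t \<Longrightarrow> T (t *\<^sub>R x) = t powr \<alpha> * T x"
    and \<alpha>: "0 < \<alpha>" and \<tau>: "0 < \<tau>" "\<tau> * (2 * \<alpha> + \<tau> + real DIM((real ^ 'm) \<times> real) - 2) * K \<le> \<alpha>\<^sup>2 / 2"
  shows "majorizable (\<alpha> + \<tau>)"
proof -
  define dm where "dm = real DIM((real ^ 'm) \<times> real)"
  have n2: "2 \<le> dm" unfolding dm_def by (rule DIM_ge_2)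
  define F where "F x = T x - 1 / 2 * norm x powr \<alpha>" for x
  define G where "G x = grad T x - (1 / 2) *\<^sub>R ((\<alpha> * norm x powr (\<alpha> - 2)) *\<^sub>R x)" for x :: "(real ^ 'm) \<times> real"
  define L where "L x = 0 - 1 / 2 * (\<alpha> * (\<alpha> + dm - 2) * norm x powr (\<alpha> - 2))" for x :: "(real ^ 'm) \<times> real"
  have hT: "has_grad_lap Cone T (grad T) (\<lambda>x. 0)" by (rule harm_has_grad_lap[OF open_Cone T(1)])
  have hF: "has_grad_lap Cone F G L"
    unfolding F_def[abs_def] G_def[abs_def] L_def[abs_def]
    by (intro has_grad_lap_diff hT has_grad_lap_cmult
        has_grad_lap_norm_powr[OF open_Cone zero_notin_Cone, folded dm_def])
  have eu: "x \<bullet> G x = \<alpha> * F x" if x: "x \<in> Cone" for x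
  proof -
    have r: "norm x > 0" using x zero_notin_Cone by auto
    have "x \<bullet> grad T x = \<alpha> * T x"
      by (rule homogeneous_euler[OF has_grad_lap_derivative[OF hT x] T(4)[OF x]])
    moreover have "norm x powr (\<alpha> - 2) * (x \<bullet> x) = norm x powr \<alpha>"
      using r by (simp add: power2_norm_eq_inner[symmetric] flip: powr_numeral powr_add)
    ultimately show ?thesis by (simp add: G_def F_def inner_diff_right algebra_simps)
  qed
  have "superh Cone (\<lambda>x. norm x powr \<tau> * F x)"
  proof (rule superh_norm_powr_mult[OF dm_def hF eu, where K=K and c="\<alpha>\<^sup>2 / 2"])
    show "F x \<le> K * norm x powr \<alpha>" if "x \<in> Cone" for x
      using T(3)[OF that] powr_ge_zero[of "norm x" \<alpha>] unfolding F_def by linarith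
    show "L x \<le> - (\<alpha>\<^sup>2 / 2) * norm x powr (\<alpha> - 2)" for x
    proof -
      have "\<alpha>\<^sup>2 \<le> \<alpha> * (\<alpha> + dm - 2)" using \<alpha> n2 by (simp add: power2_eq_square)
      then have "\<alpha>\<^sup>2 * norm x powr (\<alpha> - 2) \<le> \<alpha> * (\<alpha> + dm - 2) * norm x powr (\<alpha> - 2)"
        by (intro mult_right_mono) auto
      then show ?thesis by (simp add: L_def)
    qed
  qed (use \<alpha> \<tau> in \<open>auto simp: dm_def\<close>)
  then have s: "superh Cone (\<lambda>x. 2 * (norm x powr \<tau> * F x))" by (intro superh_cmult) auto
  have pw: "norm x powr (\<alpha> + \<tau>) = norm x powr \<tau> * norm x powr \<alpha>" for x :: "(real ^ 'm) \<times> real"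
    by (simp add: powr_add mult.commute)
  have "norm x powr (\<alpha> + \<tau>) \<le> 2 * (norm x powr \<tau> * F x)" if "x \<in> Cone" for x
  proof -
    have "1 / 2 * norm x powr \<alpha> \<le> F x" using T(2)[OF that] by (simp add: F_def)
    then have "norm x powr \<tau> * (1 / 2 * norm x powr \<alpha>) \<le> norm x powr \<tau> * F x" by (intro mult_left_mono) auto
    then show ?thesis by (simp add: pw)
  qed
  moreover have "2 * (norm x powr \<tau> * F x) \<le> (2 * K) * norm x powr (\<alpha> + \<tau>)" if "x \<in> Cone" for x
  proof -
    have "F x \<le> K * norm x powr \<alpha>" using T(3)[OF that] powr_ge_zero[of "norm x" \<alpha>] unfolding F_def by linarith
    then have "norm x powr \<tau> * F x \<le> norm x powr \<tau> * (K * norm x powr \<alpha>)" by (intro mult_left_mono) auto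
    then show ?thesis by (simp add: pw mult_ac)
  qed
  ultimately show ?thesis using s \<alpha> \<tau> unfolding majorizable_def by (intro conjI exI[of _ "\<lambda>x. 2 * (norm x powr \<tau> * F x)"] exI[of _ "2 * K"]) auto
qed

end

section \<open>Compactness, boundary decay and the limit exponent\<close>

lemma countable_pointwise_convergent_subsequence:
  fixes f :: "nat \<Rightarrow> 'a \<Rightarrow> real"
  assumes D: "countable D" and M: "\<And>n x. x \<in> D \<Longrightarrow> \<bar>f n x\<bar> \<le> M x"
  obtains k where "strict_mono (k :: nat \<Rightarrow> nat)" "\<And>x. x \<in> D \<Longrightarrow> convergent (\<lambda>n. f (k n) x)"
proof (cases "D = {}")
  case True
  then show ?thesis using that[of id] by (auto simp: strict_mono_def)
next
  case False
  define d where "d = from_nat_into D"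
  have dD: "d n \<in> D" for n using False by (simp add: d_def from_nat_into)
  interpret subseqs "\<lambda>n r. convergent (\<lambda>i. f (r i) (d n))"
  proof
    fix n and s :: "nat \<Rightarrow> nat" assume "strict_mono s"
    have "bounded (range (\<lambda>i. f (s i) (d n)))" using M[OF dD] by (auto simp: bounded_iff)
    then obtain l r where "strict_mono (r :: nat \<Rightarrow> nat)" "((\<lambda>i. f (s i) (d n)) \<circ> r) \<longlonglongrightarrow> l"
      using bounded_imp_convergent_subsequence by blast
    then show "\<exists>r'. strict_mono r' \<and> convergent (\<lambda>i. f ((s \<circ> r') i) (d n))"
      by (auto simp: convergent_def comp_def)
  qed
  have "convergent (\<lambda>i. f (diagseq i) (d n))" for n
  proof -
    have "convergent (\<lambda>i. f ((diagseq \<circ> (+) (Suc n)) i) (d n))"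
    proof (rule diagseq_holds)
      show "convergent (\<lambda>i. f ((s \<circ> r) i) (d n))" 
        if "strict_mono r" "convergent (\<lambda>i. f (s i) (d n))" for n and s r :: "nat \<Rightarrow> nat"
        using convergent_subseq_convergent[OF that(2,1)] by (simp add: comp_def)
    qed
    then have "convergent (\<lambda>i. f (diagseq (i + Suc n)) (d n))" by (simp add: comp_def add.commute)
    then show ?thesis using convergent_ignore_initial_segment[of "\<lambda>i. f (diagseq i) (d n)" "Suc n"] by simp
  qed
  then have "convergent (\<lambda>i. f (diagseq i) x)" if "x \<in> D" for x
    using from_nat_into_surj[OF D that] by (auto simp: d_def)
  then show ?thesis using that[OF subseq_diagseq] by blast
qed

lemma harm_equi_Lipschitz:
  fixes U :: "'a::euclidean_space set"
  assumes "open U" "x \<in> U" and c: "continuous_on U b"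
  obtains R K where "0 < R" "0 \<le> K" "cball x R \<subseteq> U"
    "\<And>F y z. harm U F \<Longrightarrow> (\<And>w. w \<in> U \<Longrightarrow> \<bar>F w\<bar> \<le> b w) \<Longrightarrow> y \<in> cball x R \<Longrightarrow> z \<in> cball x R \<Longrightarrow>
       \<bar>F y - F z\<bar> \<le> K * norm (y - z)"
proof -
  obtain r where r: "r > 0" "cball x r \<subseteq> U" using assms(1,2) open_contains_cball by blast
  define R where "R = r / 2"
  have R: "0 < R" "cball x (2 * R) \<subseteq> U" "cball x R \<subseteq> U" using r by (auto simp: R_def)
  obtain \<Lambda> where \<Lambda>: "0 \<le> \<Lambda>"
    "\<And>(F :: 'a \<Rightarrow> real) x0 B x y. continuous_on (cball x0 (2 * R)) F \<Longrightarrow>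
      (\<And>z. z \<in> cball x0 (2 * R) \<Longrightarrow> \<bar>F z\<bar> \<le> B) \<Longrightarrow> x \<in> cball x0 R \<Longrightarrow> y \<in> cball x0 R \<Longrightarrow>
      \<bar>mean F x R - mean F y R\<bar> \<le> \<Lambda> * B * norm (x - y)"
    using mean_Lipschitz[OF R(1), where 'a='a] by blast
  have "bounded (b ` cball x (2 * R))"
    by (intro compact_imp_bounded compact_continuous_image continuous_on_subset[OF c] R compact_cball)
  then obtain B where B: "\<forall>w\<in>cball x (2 * R). \<bar>b w\<bar> \<le> B" by (auto simp: bounded_iff)
  have B0: "0 \<le> B" using B[rule_format, of x] R by (auto intro: order_trans[OF abs_ge_zero])
  show ?thesis
  proof (rule that[OF R(1) _ R(3), of "\<Lambda> * B"])
    show "0 \<le> \<Lambda> * B" using \<Lambda> B0 by simp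
    fix F y z assume F: "harm U F" "\<And>w. w \<in> U \<Longrightarrow> \<bar>F w\<bar> \<le> b w" and yz: "y \<in> cball x R" "z \<in> cball x R"
    have m: "mean F p R = F p" if "p \<in> cball x R" for p
    proof (rule harm_mean[OF F(1) R(1)])
      show "cball p R \<subseteq> U"
        using that by (intro order_trans[OF _ R(2)]) (simp add: cball_subset_cball_iff dist_commute)
    qed
    have "\<bar>mean F y R - mean F z R\<bar> \<le> \<Lambda> * B * norm (y - z)"
    proof (rule \<Lambda>(2)[OF continuous_on_subset[OF harm_continuous_on[OF F(1)] R(2)] _ yz])
      show "\<bar>F w\<bar> \<le> B" if w: "w \<in> cball x (2 * R)" for w
      proof -
        have "\<bar>F w\<bar> \<le> b w" using F(2) R(2) w by blast
        also have "b w \<le> \<bar>b w\<bar>" by simp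
        also have "\<bar>b w\<bar> \<le> B" using B w by blast
        finally show ?thesis .
      qed
    qed
    then show "\<bar>F y - F z\<bar> \<le> \<Lambda> * B * norm (y - z)" by (simp only: m[OF yz(1)] m[OF yz(2)])
  qed
qed

context epi_cone
begin

text \<open>The order of the quantifiers matters: a single \<open>C0\<close> serves all exponents,
  majorants and boundary points, and therefore survives the limit in the exponent.\<close>

definition "boundary_decay C0 \<longleftrightarrow> 0 < C0 \<and> (\<forall>\<alpha> T K p d. harm Cone T \<longrightarrow> (\<forall>x\<in>Cone. norm x powr \<alpha> \<le> T x) \<longrightarrow>
   (\<forall>x\<in>Cone. T x \<le> K * norm x powr \<alpha>) \<longrightarrow>
   (\<forall>F. superh Cone F \<longrightarrow> (\<forall>x\<in>Cone. norm x powr \<alpha> \<le> F x) \<longrightarrow> (\<forall>x\<in>Cone. T x \<le> F x)) \<longrightarrow>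
   0 < \<alpha> \<longrightarrow> 0 \<le> K \<longrightarrow> p \<noteq> 0 \<longrightarrow> 0 < d \<longrightarrow> d < norm p \<longrightarrow>
   T (p, g p + d) \<le> (norm (p, g p) + norm p) powr \<alpha> * (1 + K * (C0 * d / norm p)))"

text \<open>Near the boundary point \<open>T\<close> can be replaced by its minimum with a barrier
  function \<open>w\<close> without losing superharmonicity or the lower bound |x|^\<alpha>. Since
  \<open>T\<close> is the least majorant, \<open>T \<le> w\<close>.\<close>

lemma boundary_decay_exists: "\<exists>C0. boundary_decay C0"
proof -
  obtain C0 where C0: "0 < C0"
    "\<And>p. p \<noteq> 0 \<Longrightarrow> \<exists>b G L. has_grad_lap (Cone \<inter> ball (p, g p) (norm p)) b G L \<and>
        (\<forall>z \<in> Cone \<inter> ball (p, g p) (norm p). L z \<le> 0) \<and> continuous_on UNIV b \<and>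
        (\<forall>z \<in> closure Cone \<inter> ball (p, g p) (norm p). 0 \<le> b z \<and> (norm p / 2 \<le> dist (p, g p) z \<longrightarrow> 1 \<le> b z)) \<and>
        (\<forall>d. 0 \<le> d \<and> d < norm p \<longrightarrow> b (p, g p + d) \<le> C0 * d / norm p)"
    using exterior_barrier by blast
  have "boundary_decay C0"
    unfolding boundary_decay_def
  proof (intro conjI C0(1) allI impI)
    fix \<alpha> T K d and p :: "real ^ 'm"
    assume T: "harm Cone T" "\<forall>x\<in>Cone. norm x powr \<alpha> \<le> T x" "\<forall>x\<in>Cone. T x \<le> K * norm x powr \<alpha>"
      and least: "\<forall>F. superh Cone F \<longrightarrow> (\<forall>x\<in>Cone. norm x powr \<alpha> \<le> F x) \<longrightarrow> (\<forall>x\<in>Cone. T x \<le> F x)"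
      and \<alpha>: "0 < \<alpha>" and K: "0 \<le> K" and p: "p \<noteq> 0" and d: "0 < d" "d < norm p"
    define x0 where "x0 = (p, g p)"
    define s where "s = norm p"
    obtain b G L where b: "has_grad_lap (Cone \<inter> ball x0 s) b G L" "\<And>z. z \<in> Cone \<inter> ball x0 s \<Longrightarrow> L z \<le> 0"
      "\<And>z. z \<in> closure Cone \<inter> ball x0 s \<Longrightarrow> 0 \<le> b z" 
      "\<And>z. z \<in> closure Cone \<inter> ball x0 s \<Longrightarrow> s / 2 \<le> dist x0 z \<Longrightarrow> 1 \<le> b z"
      "\<And>d. 0 \<le> d \<Longrightarrow> d < s \<Longrightarrow> b (p, g p + d) \<le> C0 * d / s"
      using C0(2)[OF p] unfolding x0_def[symmetric] s_def[symmetric] by blast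
    define m where "m = (norm x0 + s) powr \<alpha>"
    have "0 < norm x0 + s" using p by (simp add: s_def add_nonneg_pos)
    then have m: "0 < m" by (simp add: m_def)
    have rm: "norm z powr \<alpha> \<le> m" if "dist x0 z < s" for z
    proof -
      have "norm z \<le> norm x0 + s" using that norm_triangle_sub[of z x0] by (simp add: dist_norm norm_minus_commute)
      then show ?thesis unfolding m_def using \<alpha> by (intro powr_mono2) auto
    qed
    have cl: "z \<in> closure Cone" if "z \<in> Cone" for z using that closure_subset by blast
    \<comment> \<open>The constant \<open>m\<close> bounds |z|^\<alpha> on the ball, so
      \<open>w\<close> is above the obstacle. Beyond distance s/2 the barrier is at least 1, so
      \<open>w\<close> exceeds \<open>K * m \<ge> T\<close> and the modification stops before the
      edge of the ball.\<close>
    define w where "w z = m + (K * m) * b z" for z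
    define F where "F z = (if dist x0 z < s then min (T z) (w z) else T z)" for z
    have "superh (Cone \<inter> ball x0 s) (\<lambda>z. (K * m) * b z)"
      using superh_C2[OF b(1,2)] K m by (intro superh_cmult) auto
    then have sw: "superh (Cone \<inter> ball x0 s) w"
      unfolding w_def[abs_def] using open_Cone by (intro superh_add superh_const) auto
    have sT: "superh Cone T" by (rule harm_superh[OF T(1) open_Cone])
    have "superh Cone F"
    proof (rule superh_cong_local[OF open_Cone])
      fix z assume z: "z \<in> Cone"
      show "\<exists>V G. z \<in> V \<and> V \<subseteq> Cone \<and> superh V G \<and> (\<forall>y\<in>V. F y = G y)"
      proof (cases "dist x0 z < s")
        case True
        have "superh (Cone \<inter> ball x0 s) (\<lambda>z. min (T z) (w z))"
          using open_Cone by (intro superh_min sw superh_subset[OF sT]) auto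
        then show ?thesis using z True
          by (intro exI[of _ "Cone \<inter> ball x0 s"] exI[of _ "\<lambda>z. min (T z) (w z)"]) (auto simp: F_def)
      next
        case False
        have "F y = T y" if y: "y \<in> Cone" "s / 2 < dist x0 y" for y
        proof (cases "dist x0 y < s")
          case True
          have "1 \<le> b y" using b(4)[of y] cl[OF y(1)] True y(2) by auto
          then have "K * m * 1 \<le> K * m * b y" using K m by (intro mult_left_mono) auto
          moreover have "T y \<le> K * m"
            using T(3) y(1) mult_left_mono[OF rm[OF True] K] by (meson order_trans)
          ultimately have "T y \<le> w y" unfolding w_def using m by simp
          then show ?thesis by (simp add: F_def)
        qed (simp add: F_def)
        moreover have "superh (Cone \<inter> - cball x0 (s / 2)) T"
          using open_Cone by (intro superh_subset[OF sT]) auto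
        moreover have "0 < s" using p by (simp add: s_def)
        then have "z \<in> Cone \<inter> - cball x0 (s / 2)" using z False by auto
        ultimately show ?thesis by (intro exI[of _ "Cone \<inter> - cball x0 (s / 2)"] exI[of _ T]) auto
      qed
    qed
    moreover have "norm z powr \<alpha> \<le> F z" if z: "z \<in> Cone" for z
    proof (cases "dist x0 z < s")
      case True
      have "0 \<le> (K * m) * b z" using b(3)[of z] cl[OF z] True K m by simp
      then have "norm z powr \<alpha> \<le> w z" using rm[OF True] by (simp add: w_def)
      then show ?thesis using T(2) z True by (simp add: F_def)
    next
      case False
      then show ?thesis using T(2) z by (simp add: F_def)
    qed
    ultimately have TF: "\<forall>x\<in>Cone. T x \<le> F x" using least by blast
    define z where "z = (p, g p + d)"
    have z: "z \<in> Cone" using d by (simp add: z_def Cone_def)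
    have "dist x0 z = d" using d by (simp add: x0_def z_def dist_norm norm_Pair)
    then have "T z \<le> w z" using TF z d by (auto simp: F_def s_def)
    also have "\<dots> \<le> m + (K * m) * (C0 * d / s)"
      unfolding w_def z_def using b(5)[of d] d K m by (intro add_mono mult_left_mono) (auto simp: s_def)
    also have "\<dots> = m * (1 + K * (C0 * d / s))" by (simp add: algebra_simps)
    finally show "T (p, g p + d) \<le> (norm (p, g p) + norm p) powr \<alpha> * (1 + K * (C0 * d / norm p))"
      by (simp add: z_def m_def x0_def s_def)
  qed
  then show ?thesis by blast
qed

definition "e = ((0, 1) :: (real ^ 'm) \<times> real)"

lemma e_Cone: "e \<in> Cone" and norm_e: "norm e = 1"
  by (simp_all add: e_def Cone_def norm_Pair)

definition "cap = Cone \<inter> sphere 0 1"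

text \<open>The last two facts are complementary. A large \<open>S\<close> makes the boundary term
  1/S small, a small \<open>S\<close> allows the exponent to be raised; close to the supremal
  exponent only the first can happen.\<close>

lemma normalized_harmonic:
  assumes C0: "boundary_decay C0" and \<alpha>: "majorizable \<alpha>"
  obtains h S where "1 \<le> S" "harm Cone h" "\<And>x. x \<in> Cone \<Longrightarrow> 0 < h x" "\<And>x. x \<in> Cone \<Longrightarrow> h x \<le> norm x powr \<alpha>"
    "\<And>t x. x \<in> Cone \<Longrightarrow> 0 < t \<Longrightarrow> h (t *\<^sub>R x) = t powr \<alpha> * h x"
    "\<exists>x\<in>cap. 1 / 2 < h x"
    "\<And>p d. p \<noteq> 0 \<Longrightarrow> 0 < d \<Longrightarrow> d < norm p \<Longrightarrow>
       h (p, g p + d) \<le> (norm (p, g p) + norm p) powr \<alpha> * (1 / S + C0 * d / norm p)"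
    "\<And>\<tau>. 0 < \<tau> \<Longrightarrow> \<tau> * (2 * \<alpha> + \<tau> + real DIM((real ^ 'm) \<times> real) - 2) * S \<le> \<alpha>\<^sup>2 / 2 \<Longrightarrow> majorizable (\<alpha> + \<tau>)"
proof -
  obtain T K where T: "harm Cone T" "\<And>x. x \<in> Cone \<Longrightarrow> norm x powr \<alpha> \<le> T x" "\<And>x. x \<in> Cone \<Longrightarrow> T x \<le> K * norm x powr \<alpha>"
    "\<And>t x. x \<in> Cone \<Longrightarrow> 0 < t \<Longrightarrow> T (t *\<^sub>R x) = t powr \<alpha> * T x"
    "\<And>F x. superh Cone F \<Longrightarrow> (\<And>x. x \<in> Cone \<Longrightarrow> norm x powr \<alpha> \<le> F x) \<Longrightarrow> x \<in> Cone \<Longrightarrow> T x \<le> F x"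
    using least_majorant_norm_powr[OF \<alpha>] by metis
  have \<alpha>0: "0 < \<alpha>" using \<alpha> by (simp add: majorizable_def)
  \<comment> \<open>By homogeneity this is the best constant \<open>K\<close>, and dividing by it
    makes the supremum over the cap equal to 1.\<close>
  define S where "S = (SUP x\<in>cap. T x)"
  have ne: "e \<in> cap" using e_Cone norm_e by (simp add: cap_def)
  have bdd: "bdd_above (T ` cap)"
  proof (rule bdd_aboveI2)
    show "T x \<le> K" if "x \<in> cap" for x using T(3)[of x] that by (simp add: cap_def)
  qed
  have S1: "1 \<le> S"
  proof -
    have "1 \<le> T e" using T(2)[OF e_Cone] norm_e by simp
    also have "\<dots> \<le> S" unfolding S_def by (rule cSUP_upper[OF ne bdd])
    finally show ?thesis .
  qed
  have TS: "T x \<le> S * norm x powr \<alpha>" if x: "x \<in> Cone" for x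
  proof -
    have r: "0 < norm x" using x zero_notin_Cone by auto
    define y where "y = (1 / norm x) *\<^sub>R x"
    have y: "y \<in> cap" using x r Cone_scale[of "1 / norm x" x] by (simp add: cap_def y_def)
    have "x = norm x *\<^sub>R y" using r by (simp add: y_def)
    then have "T x = norm x powr \<alpha> * T y" using T(4)[of y "norm x"] y r by (simp add: cap_def)
    also have "\<dots> \<le> norm x powr \<alpha> * S"
      unfolding S_def using cSUP_upper[OF y bdd] by (intro mult_left_mono) auto
    finally show ?thesis by (simp add: mult.commute)
  qed
  define h where "h x = (1 / S) * T x" for x
  show ?thesis
  proof (rule that[of S h])
    show "1 \<le> S" by (rule S1)
    show "harm Cone h" unfolding h_def[abs_def] by (intro harm_cmult T(1))
    show "0 < h x" if x: "x \<in> Cone" for x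
    proof -
      have "0 < norm x powr \<alpha>" using x zero_notin_Cone by auto
      then have "0 < T x" using T(2)[OF x] by linarith
      then show ?thesis using S1 by (simp add: h_def)
    qed
    show "h x \<le> norm x powr \<alpha>" if x: "x \<in> Cone" for x
      using TS[OF x] S1 by (simp add: h_def field_simps)
    show "h (t *\<^sub>R x) = t powr \<alpha> * h x" if "x \<in> Cone" "0 < t" for t x
      using T(4)[OF that] by (simp add: h_def)
    show "\<exists>x\<in>cap. 1 / 2 < h x"
    proof -
      have "S / 2 < S" using S1 by simp
      then obtain x where "x \<in> cap" "S / 2 < T x"
        using less_cSUP_iff[OF _ bdd, of "S / 2"] ne unfolding S_def by blast
      then show ?thesis using S1 by (intro bexI[of _ x]) (auto simp: h_def field_simps)
    qed
    show "h (p, g p + d) \<le> (norm (p, g p) + norm p) powr \<alpha> * (1 / S + C0 * d / norm p)"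
      if p: "p \<noteq> 0" "0 < d" "d < norm p" for p d
    proof -
      have "T (p, g p + d) \<le> (norm (p, g p) + norm p) powr \<alpha> * (1 + S * (C0 * d / norm p))"
        using C0 T(1,2,5) TS \<alpha>0 S1 p unfolding boundary_decay_def by (smt (verit))
      then have "(1 / S) * T (p, g p + d) \<le> (1 / S) * ((norm (p, g p) + norm p) powr \<alpha> * (1 + S * (C0 * d / norm p)))"
        using S1 by (intro mult_left_mono) auto
      also have "\<dots> = (norm (p, g p) + norm p) powr \<alpha> * (1 / S + C0 * d / norm p)"
        using S1 by (simp add: field_simps)
      finally show ?thesis by (simp add: h_def)
    qed
    show "majorizable (\<alpha> + \<tau>)" 
      if "0 < \<tau>" "\<tau> * (2 * \<alpha> + \<tau> + real DIM((real ^ 'm) \<times> real) - 2) * S \<le> \<alpha>\<^sup>2 / 2" for \<tau>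
      by (rule majorizable_increase[OF T(1,2) TS T(4) \<alpha>0 that])
  qed
qed

text \<open>Along the axis a function of degree \<alpha> grows by the factor (1 + R/4)^\<alpha> from
  \<open>e\<close> to \<open>(1 + R/4) *\<^sub>R e\<close>, and Harnack's inequality bounds this
  factor by a constant independent of \<alpha>.\<close>

lemma majorizable_bounded: "\<exists>M. \<forall>\<alpha>. majorizable \<alpha> \<longrightarrow> \<alpha> \<le> M"
proof -
  obtain C0 where C0: "boundary_decay C0" using boundary_decay_exists by blast
  obtain R where R: "R > 0" "cball e R \<subseteq> Cone" using open_Cone e_Cone open_contains_cball by blast
  obtain C where C: "0 < C"
    "\<And>(F :: (real ^ 'm) \<times> real \<Rightarrow> real) c x. harm (cball c R) F \<Longrightarrow> (\<And>y. y \<in> cball c R \<Longrightarrow> 0 \<le> F y) \<Longrightarrow> 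
       x \<in> cball c (R / 4) \<Longrightarrow> F x \<le> C * F c"
    using harm_Harnack[OF R(1)] by blast
  have "\<alpha> \<le> ln C / ln (1 + R / 4)" if \<alpha>: "majorizable \<alpha>" for \<alpha>
  proof -
    obtain h where h: "harm Cone h" "\<And>x. x \<in> Cone \<Longrightarrow> 0 < h x"
       "\<And>t x. x \<in> Cone \<Longrightarrow> 0 < t \<Longrightarrow> h (t *\<^sub>R x) = t powr \<alpha> * h x"
      using normalized_harmonic[OF C0 \<alpha>] by metis
    have "h ((1 + R / 4) *\<^sub>R e) \<le> C * h e"
    proof (rule C(2))
      show "harm (cball e R) h" by (rule harm_subset[OF h(1) R(2)])
      show "0 \<le> h y" if "y \<in> cball e R" for y using h(2)[of y] R(2) that by (auto intro: less_imp_le)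
      have "e - (1 + R / 4) *\<^sub>R e = - (R / 4) *\<^sub>R e" by (simp add: algebra_simps)
      then show "(1 + R / 4) *\<^sub>R e \<in> cball e (R / 4)" using R by (simp add: dist_norm norm_e)
    qed
    then have "(1 + R / 4) powr \<alpha> * h e \<le> C * h e" using h(3)[OF e_Cone, of "1 + R / 4"] R by simp
    then have "(1 + R / 4) powr \<alpha> \<le> C" using h(2)[OF e_Cone] by simp
    then have "ln ((1 + R / 4) powr \<alpha>) \<le> ln C" using R C(1) by (subst ln_le_cancel_iff) auto
    then have "\<alpha> * ln (1 + R / 4) \<le> ln C" using R by (simp add: ln_powr)
    then show ?thesis using R by (simp add: pos_le_divide_eq)
  qed
  then show ?thesis by blast
qed

text \<open>Exponents approaching the supremum \<beta> force S to infinity, so the terms 1/S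
  disappear from the boundary estimates in the limit. The same estimates keep points with h > 1/2
  away from the rim of the cap, so the limit function does not vanish identically, and the strong
  minimum principle makes it positive.\<close>

lemma homogeneous_harmonic_exists:
  obtains h \<beta> C1 where "0 < \<beta>" "harm Cone h" "\<And>x. x \<in> Cone \<Longrightarrow> 0 < h x" "\<And>x. x \<in> Cone \<Longrightarrow> h x \<le> norm x powr \<beta>"
    "\<And>t x. x \<in> Cone \<Longrightarrow> 0 < t \<Longrightarrow> h (t *\<^sub>R x) = t powr \<beta> * h x"
    "0 < C1" "\<And>p d. p \<noteq> 0 \<Longrightarrow> 0 < d \<Longrightarrow> d < norm p \<Longrightarrow>
       h (p, g p + d) \<le> (norm (p, g p) + norm p) powr \<beta> * (C1 * d / norm p)"
proof -
  obtain C0 where C0: "boundary_decay C0" using boundary_decay_exists by blast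
  have C0p: "0 < C0" using C0 by (simp add: boundary_decay_def)
  define dm where "dm = real DIM((real ^ 'm) \<times> real)"
  have n2: "2 \<le> dm" unfolding dm_def by (rule DIM_ge_2)
  define I where "I = {\<alpha>. majorizable \<alpha>}"
  have Ine: "I \<noteq> {}" using majorizable_small by (auto simp: I_def)
  have Ibdd: "bdd_above I" using majorizable_bounded by (auto simp: I_def bdd_above_def)
  define \<beta> where "\<beta> = Sup I"
  have Ile: "\<alpha> \<le> \<beta>" if "majorizable \<alpha>" for \<alpha>
    unfolding \<beta>_def using that Ibdd by (intro cSup_upper) (auto simp: I_def)
  have \<beta>: "0 < \<beta>" using majorizable_small Ile unfolding majorizable_def by force
  have "\<exists>\<alpha>. majorizable \<alpha> \<and> \<beta> / 2 < \<alpha> \<and> \<beta> - inverse (real (Suc n)) < \<alpha>" for n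
  proof -
    have "0 < inverse (real (Suc n))" by simp
    then have "max (\<beta> / 2) (\<beta> - inverse (real (Suc n))) < Sup I" using \<beta> unfolding \<beta>_def[symmetric] by linarith
    then obtain \<alpha> where "\<alpha> \<in> I" "max (\<beta> / 2) (\<beta> - inverse (real (Suc n))) < \<alpha>"
      using less_cSup_iff[OF Ine Ibdd] by blast
    then show ?thesis by (auto simp: I_def)
  qed
  then obtain \<alpha> where \<alpha>: "\<And>n. majorizable (\<alpha> n)" "\<And>n. \<beta> / 2 < \<alpha> n" "\<And>n. \<beta> - inverse (real (Suc n)) < \<alpha> n"
    by metis
  have \<alpha>0: "0 < \<alpha> n" "\<alpha> n \<le> \<beta>" for n using \<alpha>(2)[of n] \<beta> Ile[OF \<alpha>(1)] by auto
  have \<alpha>lim: "\<alpha> \<longlonglongrightarrow> \<beta>"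
  proof (rule tendsto_sandwich[of "\<lambda>n. \<beta> - inverse (real (Suc n))" _ _ "\<lambda>n. \<beta>"])
    have "(\<lambda>n. \<beta> - inverse (real (Suc n))) \<longlonglongrightarrow> \<beta> - 0"
      by (intro tendsto_intros LIMSEQ_inverse_real_of_nat)
    then show "(\<lambda>n. \<beta> - inverse (real (Suc n))) \<longlonglongrightarrow> \<beta>" by simp
  qed (use \<alpha>(3) \<alpha>0 in \<open>auto intro!: always_eventually less_imp_le\<close>)
  have "\<forall>n. \<exists>h S. 1 \<le> S \<and> harm Cone h \<and> (\<forall>x\<in>Cone. 0 < h x) \<and> (\<forall>x\<in>Cone. h x \<le> norm x powr \<alpha> n) \<and>
    (\<forall>x\<in>Cone. \<forall>t>0. h (t *\<^sub>R x) = t powr \<alpha> n * h x) \<and> (\<exists>x\<in>cap. 1 / 2 < h x) \<and>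
    (\<forall>p d. p \<noteq> 0 \<longrightarrow> 0 < d \<longrightarrow> d < norm p \<longrightarrow>
       h (p, g p + d) \<le> (norm (p, g p) + norm p) powr \<alpha> n * (1 / S + C0 * d / norm p)) \<and>
    (\<forall>\<tau>>0. \<tau> * (2 * \<alpha> n + \<tau> + dm - 2) * S \<le> (\<alpha> n)\<^sup>2 / 2 \<longrightarrow> majorizable (\<alpha> n + \<tau>))"
  proof
    fix n
    obtain h S where "1 \<le> S" "harm Cone h" "\<And>x. x \<in> Cone \<Longrightarrow> 0 < h x" "\<And>x. x \<in> Cone \<Longrightarrow> h x \<le> norm x powr \<alpha> n"
      "\<And>t x. x \<in> Cone \<Longrightarrow> 0 < t \<Longrightarrow> h (t *\<^sub>R x) = t powr \<alpha> n * h x"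
      "\<exists>x\<in>cap. 1 / 2 < h x"
      "\<And>p d. p \<noteq> 0 \<Longrightarrow> 0 < d \<Longrightarrow> d < norm p \<Longrightarrow>
         h (p, g p + d) \<le> (norm (p, g p) + norm p) powr \<alpha> n * (1 / S + C0 * d / norm p)"
      "\<And>\<tau>. 0 < \<tau> \<Longrightarrow> \<tau> * (2 * \<alpha> n + \<tau> + dm - 2) * S \<le> (\<alpha> n)\<^sup>2 / 2 \<Longrightarrow> majorizable (\<alpha> n + \<tau>)"
      unfolding dm_def by (rule normalized_harmonic[OF C0 \<alpha>(1)[of n]]) blast
    then show "\<exists>h S. 1 \<le> S \<and> harm Cone h \<and> (\<forall>x\<in>Cone. 0 < h x) \<and> (\<forall>x\<in>Cone. h x \<le> norm x powr \<alpha> n) \<and>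
      (\<forall>x\<in>Cone. \<forall>t>0. h (t *\<^sub>R x) = t powr \<alpha> n * h x) \<and> (\<exists>x\<in>cap. 1 / 2 < h x) \<and>
      (\<forall>p d. p \<noteq> 0 \<longrightarrow> 0 < d \<longrightarrow> d < norm p \<longrightarrow>
         h (p, g p + d) \<le> (norm (p, g p) + norm p) powr \<alpha> n * (1 / S + C0 * d / norm p)) \<and>
      (\<forall>\<tau>>0. \<tau> * (2 * \<alpha> n + \<tau> + dm - 2) * S \<le> (\<alpha> n)\<^sup>2 / 2 \<longrightarrow> majorizable (\<alpha> n + \<tau>))"
      by (intro exI[of _ h] exI[of _ S]) auto
  qed
  from choice[OF this] obtain h where "\<forall>n. \<exists>S. 1 \<le> S \<and> harm Cone (h n) \<and> (\<forall>x\<in>Cone. 0 < h n x) \<and> (\<forall>x\<in>Cone. h n x \<le> norm x powr \<alpha> n) \<and>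
    (\<forall>x\<in>Cone. \<forall>t>0. h n (t *\<^sub>R x) = t powr \<alpha> n * h n x) \<and> (\<exists>x\<in>cap. 1 / 2 < h n x) \<and>
    (\<forall>p d. p \<noteq> 0 \<longrightarrow> 0 < d \<longrightarrow> d < norm p \<longrightarrow>
       h n (p, g p + d) \<le> (norm (p, g p) + norm p) powr \<alpha> n * (1 / S + C0 * d / norm p)) \<and>
    (\<forall>\<tau>>0. \<tau> * (2 * \<alpha> n + \<tau> + dm - 2) * S \<le> (\<alpha> n)\<^sup>2 / 2 \<longrightarrow> majorizable (\<alpha> n + \<tau>))" ..
  from choice[OF this] obtain S where hS: "\<forall>n. 1 \<le> S n \<and> harm Cone (h n) \<and> (\<forall>x\<in>Cone. 0 < h n x) \<and> (\<forall>x\<in>Cone. h n x \<le> norm x powr \<alpha> n) \<and>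
    (\<forall>x\<in>Cone. \<forall>t>0. h n (t *\<^sub>R x) = t powr \<alpha> n * h n x) \<and> (\<exists>x\<in>cap. 1 / 2 < h n x) \<and>
    (\<forall>p d. p \<noteq> 0 \<longrightarrow> 0 < d \<longrightarrow> d < norm p \<longrightarrow>
       h n (p, g p + d) \<le> (norm (p, g p) + norm p) powr \<alpha> n * (1 / S n + C0 * d / norm p)) \<and>
    (\<forall>\<tau>>0. \<tau> * (2 * \<alpha> n + \<tau> + dm - 2) * S n \<le> (\<alpha> n)\<^sup>2 / 2 \<longrightarrow> majorizable (\<alpha> n + \<tau>))" ..
  have S1: "1 \<le> S n" and hh: "harm Cone (h n)" for n using hS by blast+
  have hpos: "0 < h n x" and hle: "h n x \<le> norm x powr \<alpha> n" if "x \<in> Cone" for n x using hS that by blast+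
  have hhom: "h n (t *\<^sub>R x) = t powr \<alpha> n * h n x" if "x \<in> Cone" "0 < t" for n x t using hS that by blast
  have hcap: "\<exists>x\<in>cap. 1 / 2 < h n x" for n using hS by blast
  have hbd: "h n (p, g p + d) \<le> (norm (p, g p) + norm p) powr \<alpha> n * (1 / S n + C0 * d / norm p)"
    if "p \<noteq> 0" "0 < d" "d < norm p" for n p d using hS that by blast
  have hinc: "majorizable (\<alpha> n + \<tau>)" if "0 < \<tau>" "\<tau> * (2 * \<alpha> n + \<tau> + dm - 2) * S n \<le> (\<alpha> n)\<^sup>2 / 2" for n \<tau>
    using hS that by blast
  have Slim: "(\<lambda>n. 1 / S n) \<longlonglongrightarrow> 0"
  proof -
    \<comment> \<open>Chosen so that 1/S n > A / (n+1) would make the gain \<tau> = 1/(n+1)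
      admissible in \<open>hinc\<close>. Since \<alpha> n > \<beta> - 1/(n+1), the raised exponent
      would exceed the supremum \<beta>. The factor 8 comes from \<alpha> n > \<beta>/2.\<close>
    define A where "A = (2 * \<beta> + 1 + dm) * 8 / \<beta>\<^sup>2"
    have A: "A > 0" using \<beta> n2 by (simp add: A_def)
    have "1 / S n \<le> A * inverse (real (Suc n)) \<or> 1 / S n \<le> 0" for n
    proof (rule ccontr)
      assume neg: "\<not> ?thesis"
      define \<tau> where "\<tau> = inverse (real (Suc n))"
      have \<tau>: "0 < \<tau>" "\<tau> \<le> 1" by (auto simp: \<tau>_def divide_simps)
      have "A * \<tau> < 1 / S n" using neg by (simp add: \<tau>_def)
      then have "A * \<tau> * S n < 1" using S1[of n] by (simp add: pos_less_divide_eq)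
      then have "\<beta>\<^sup>2 / 8 * (A * \<tau> * S n) \<le> \<beta>\<^sup>2 / 8 * 1" by (intro mult_left_mono) auto
      moreover have "\<beta>\<^sup>2 / 8 * (A * \<tau> * S n) = \<tau> * (2 * \<beta> + 1 + dm) * S n"
        using \<beta> by (simp add: A_def field_simps)
      ultimately have 1: "\<tau> * (2 * \<beta> + 1 + dm) * S n \<le> \<beta>\<^sup>2 / 8" by (simp only: mult_1_right)
      have "\<tau> * (2 * \<alpha> n + \<tau> + dm - 2) * S n \<le> \<tau> * (2 * \<beta> + 1 + dm) * S n"
        using \<tau> \<alpha>0[of n] S1[of n] by (intro mult_right_mono mult_left_mono) auto
      also note 1
      also have "\<beta>\<^sup>2 / 8 = (\<beta> / 2)\<^sup>2 / 2" by (simp add: power_divide)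
      also have "\<dots> \<le> (\<alpha> n)\<^sup>2 / 2" using \<alpha>(2)[of n] \<beta> by (intro divide_right_mono power_mono) auto
      finally have "majorizable (\<alpha> n + \<tau>)" using hinc \<tau> by blast
      then have "\<alpha> n + \<tau> \<le> \<beta>" by (rule Ile)
      then show False using \<alpha>(3)[of n] by (simp add: \<tau>_def)
    qed
    moreover have "0 < 1 / S n" for n using S1[of n] by simp
    ultimately have "1 / S n \<le> A * inverse (real (Suc n))" for n by (metis not_less)
    moreover have "(\<lambda>n. A * inverse (real (Suc n))) \<longlonglongrightarrow> A * 0"
      by (intro tendsto_intros LIMSEQ_inverse_real_of_nat)
    ultimately show ?thesis
      using S1 by (intro tendsto_sandwich[of "\<lambda>n. 0" "\<lambda>n. 1 / S n" _ "\<lambda>n. A * inverse (real (Suc n))"])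
        (auto intro!: always_eventually divide_nonneg_nonneg intro: order_trans[OF zero_le_one])
  qed
  define b where "b x = (1 + norm x) powr \<beta>" for x :: "(real ^ 'm) \<times> real"
  have cb: "continuous_on Cone b" unfolding b_def by (intro continuous_intros) (auto simp: add_nonneg_eq_0_iff)
  have hb: "\<bar>h n x\<bar> \<le> b x" if x: "x \<in> Cone" for n x
  proof -
    have "norm x powr \<alpha> n \<le> (1 + norm x) powr \<alpha> n" using \<alpha>0[of n] by (intro powr_mono2) auto
    also have "\<dots> \<le> b x" unfolding b_def using \<alpha>0[of n] by (intro powr_mono) auto
    finally show ?thesis using hle[OF x, of n] hpos[OF x, of n] by simp
  qed
  obtain D where D: "countable D" "\<And>X :: ((real ^ 'm) \<times> real) set. open X \<Longrightarrow> X \<noteq> {} \<Longrightarrow> \<exists>d\<in>D. d \<in> X"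
    using countable_dense_setE by blast
  have cD: "countable (D \<inter> Cone)" using D(1) by auto
  obtain k where k: "strict_mono k" "\<And>x. x \<in> D \<inter> Cone \<Longrightarrow> convergent (\<lambda>n. h (k n) x)"
    using countable_pointwise_convergent_subsequence[OF cD, of h b] hb by blast
  \<comment> \<open>Convergence on a countable dense set spreads to the whole cone by the common
    local Lipschitz constant.\<close>
  have conv: "convergent (\<lambda>n. h (k n) x)" if x: "x \<in> Cone" for x
  proof -
    obtain R K where RK: "0 < R" "0 \<le> K" "cball x R \<subseteq> Cone"
      "\<And>n y z. y \<in> cball x R \<Longrightarrow> z \<in> cball x R \<Longrightarrow> \<bar>h n y - h n z\<bar> \<le> K * norm (y - z)"
      using harm_equi_Lipschitz[OF open_Cone x cb] hh hb by metis
    have "Cauchy (\<lambda>n. h (k n) x)"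
      unfolding Cauchy_def
    proof (intro allI impI)
      fix e :: real assume e: "0 < e"
      define \<delta> where "\<delta> = min R (e / (3 * (K + 1)))"
      have \<delta>: "0 < \<delta>" "\<delta> \<le> R" "K * \<delta> \<le> e / 3"
      proof -
        show "0 < \<delta>" "\<delta> \<le> R" using RK e by (auto simp: \<delta>_def)
        have "K * \<delta> \<le> K * (e / (3 * (K + 1)))" using RK by (intro mult_left_mono) (auto simp: \<delta>_def)
        also have "\<dots> \<le> e / 3" using RK e by (simp add: field_simps)
        finally show "K * \<delta> \<le> e / 3" .
      qed
      obtain y where y: "y \<in> D" "y \<in> ball x \<delta>" using D(2)[of "ball x \<delta>"] \<delta>(1) by auto
      have yR: "y \<in> cball x R" "x \<in> cball x R" using y \<delta> RK(1) by auto
      then have "y \<in> D \<inter> Cone" using y RK(3) by blast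
      then have "Cauchy (\<lambda>n. h (k n) y)" using k(2) convergent_Cauchy by blast
      then obtain N where N: "\<And>m n. N \<le> m \<Longrightarrow> N \<le> n \<Longrightarrow> dist (h (k m) y) (h (k n) y) < e / 3"
        using e unfolding Cauchy_def by (metis zero_less_divide_iff zero_less_numeral)
      have close: "\<bar>h n x - h n y\<bar> \<le> e / 3" for n
      proof -
        have "K * norm (x - y) \<le> K * \<delta>" using y RK(2) by (intro mult_left_mono) (auto simp: dist_norm)
        then show ?thesis using RK(4)[OF yR(2,1), of n] \<delta>(3) by linarith
      qed
      show "\<exists>M. \<forall>m\<ge>M. \<forall>n\<ge>M. dist (h (k m) x) (h (k n) x) < e"
      proof (intro exI allI impI)
        fix m n assume "N \<le> m" "N \<le> n"
        then have "\<bar>h (k m) y - h (k n) y\<bar> < e / 3" using N by (simp add: dist_real_def)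
        then show "dist (h (k m) x) (h (k n) x) < e"
          using close[of "k m"] close[of "k n"] unfolding dist_real_def by linarith
      qed
    qed
    then show ?thesis by (rule Cauchy_convergent)
  qed
  define H where "H x = lim (\<lambda>n. h (k n) x)" for x
  have lim: "(\<lambda>n. h (k n) x) \<longlonglongrightarrow> H x" if "x \<in> Cone" for x
    unfolding H_def using conv[OF that] by (simp add: convergent_LIMSEQ_iff)
  have Hlip: "\<exists>R>0. \<exists>K\<ge>0. cball x R \<subseteq> Cone \<and> (\<forall>y\<in>cball x R. (\<forall>n. \<bar>h n y - h n x\<bar> \<le> K * norm (y - x)) \<and> \<bar>H y - H x\<bar> \<le> K * norm (y - x))"
    if x: "x \<in> Cone" for x
  proof -
    obtain R K where RK: "0 < R" "0 \<le> K" "cball x R \<subseteq> Cone"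
      "\<And>n y z. y \<in> cball x R \<Longrightarrow> z \<in> cball x R \<Longrightarrow> \<bar>h n y - h n z\<bar> \<le> K * norm (y - z)"
      using harm_equi_Lipschitz[OF open_Cone x cb] hh hb by metis
    have xR: "x \<in> cball x R" using RK(1) by simp
    have "\<bar>H y - H x\<bar> \<le> K * norm (y - x)" if y: "y \<in> cball x R" for y
    proof (rule LIMSEQ_le_const2)
      have "y \<in> Cone" using RK(3) y by blast
      then show "(\<lambda>n. \<bar>h (k n) y - h (k n) x\<bar>) \<longlonglongrightarrow> \<bar>H y - H x\<bar>" by (intro tendsto_intros lim x)
    qed (use RK(4)[OF y xR] in auto)
    then show ?thesis using RK(1-3) RK(4)[OF _ xR] by blast
  qed
  have cH: "continuous_on Cone H"
  proof (rule continuous_at_imp_continuous_on, rule ballI)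
    fix x assume x: "x \<in> Cone"
    obtain R K where RK: "R > 0" "K \<ge> 0" "\<forall>y\<in>cball x R. \<bar>H y - H x\<bar> \<le> K * norm (y - x)" using Hlip[OF x] by blast
    have "((\<lambda>y. H y - H x) \<longlongrightarrow> 0) (at x)"
    proof (rule Lim_null_comparison)
      have "\<forall>\<^sub>F y in at x. y \<in> ball x R" using RK(1) by (intro eventually_at_in_open') auto
      then show "\<forall>\<^sub>F y in at x. norm (H y - H x) \<le> K * norm (y - x)"
        by eventually_elim (use RK(3) in auto)
      have "((\<lambda>y. K * norm (y - x)) \<longlongrightarrow> K * norm (x - x)) (at x)" by (intro tendsto_intros)
      then show "((\<lambda>y. K * norm (y - x)) \<longlongrightarrow> 0) (at x)" by simp
    qed
    then show "isCont H x" unfolding isCont_def using Lim_null by blast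
  qed
  have hH: "harm Cone H"
  proof (rule harm_limit[OF hh cH _ lim])
    fix x r assume r: "0 < (r::real)" "cball x r \<subseteq> Cone"
    have "bounded (b ` cball x r)"
      by (intro compact_imp_bounded compact_continuous_image continuous_on_subset[OF cb] r compact_cball)
    then obtain B where "\<forall>y\<in>cball x r. \<bar>b y\<bar> \<le> B" by (auto simp: bounded_iff)
    then have "\<bar>h (k n) y\<bar> \<le> B" if y: "y \<in> cball x r" for n y
    proof -
      have "\<bar>h (k n) y\<bar> \<le> b y" using hb y r(2) by blast
      also have "\<dots> \<le> \<bar>b y\<bar>" by simp
      also have "\<dots> \<le> B" using y \<open>\<forall>y\<in>cball x r. \<bar>b y\<bar> \<le> B\<close> by blast
      finally show ?thesis .
    qed
    then show "\<exists>B. \<forall>n. \<forall>y\<in>cball x r. \<bar>h (k n) y\<bar> \<le> B" by blast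
  qed
  have \<alpha>k: "(\<lambda>n. \<alpha> (k n)) \<longlonglongrightarrow> \<beta>" using LIMSEQ_subseq_LIMSEQ[OF \<alpha>lim k(1)] by (simp add: comp_def)
  have Sk: "(\<lambda>n. 1 / S (k n)) \<longlonglongrightarrow> 0" using LIMSEQ_subseq_LIMSEQ[OF Slim k(1)] by (simp add: comp_def)
  have H0: "0 \<le> H x" if "x \<in> Cone" for x
    using hpos[OF that] by (intro LIMSEQ_le_const[OF lim[OF that]]) (auto intro: less_imp_le)
  have Hle: "H x \<le> norm x powr \<beta>" if x: "x \<in> Cone" for x
  proof (rule LIMSEQ_le[OF lim[OF x]])
    have "norm x \<noteq> 0" using x zero_notin_Cone by auto
    then show "(\<lambda>n. norm x powr \<alpha> (k n)) \<longlonglongrightarrow> norm x powr \<beta>" by (intro tendsto_intros \<alpha>k) auto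
  qed (use hle[OF x] in auto)
  have Hhom: "H (t *\<^sub>R x) = t powr \<beta> * H x" if x: "x \<in> Cone" and t: "0 < t" for t x
  proof -
    have "(\<lambda>n. t powr \<alpha> (k n) * h (k n) x) \<longlonglongrightarrow> t powr \<beta> * H x"
      using t by (intro tendsto_intros \<alpha>k lim x) auto
    moreover have "(\<lambda>n. t powr \<alpha> (k n) * h (k n) x) \<longlonglongrightarrow> H (t *\<^sub>R x)"
      using lim[of "t *\<^sub>R x"] Cone_scale[OF t] x hhom[OF x t] by simp
    ultimately show ?thesis using LIMSEQ_unique by blast
  qed
  have Hbd: "H (p, g p + d) \<le> (norm (p, g p) + norm p) powr \<beta> * (C0 * d / norm p)"
    if p: "p \<noteq> 0" "0 < d" "d < norm p" for p d
  proof (rule LIMSEQ_le)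
    show "(\<lambda>n. h (k n) (p, g p + d)) \<longlonglongrightarrow> H (p, g p + d)" using p by (intro lim) (simp add: Cone_def)
    have "norm (p, g p) + norm p \<noteq> 0" using p by (simp add: add_nonneg_eq_0_iff)
    then have "(\<lambda>n. (norm (p, g p) + norm p) powr \<alpha> (k n) * (1 / S (k n) + C0 * d / norm p))
      \<longlonglongrightarrow> (norm (p, g p) + norm p) powr \<beta> * (0 + C0 * d / norm p)"
      by (intro tendsto_intros \<alpha>k Sk) auto
    then show "(\<lambda>n. (norm (p, g p) + norm p) powr \<alpha> (k n) * (1 / S (k n) + C0 * d / norm p))
      \<longlonglongrightarrow> (norm (p, g p) + norm p) powr \<beta> * (C0 * d / norm p)" by simp
  qed (use hbd[OF p] in auto)
  have "\<exists>x\<in>Cone. 0 < H x"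
  proof -
    define M where "M = (3::real) powr \<beta>"
    have M1: "1 \<le> M" unfolding M_def using \<beta> by (intro ge_one_powr_ge_zero) auto
    \<comment> \<open>A point of the cap with depth at most 1/2 satisfies 1 \<le> (1 + B) |p| + 1/2,
      so its horizontal part p has norm at least \<open>s0\<close>.\<close>
    define s0 where "s0 = 1 / (2 * (1 + B))"
    have s0: "0 < s0" "s0 \<le> 1 / 2" using B by (auto simp: s0_def field_simps)
    \<comment> \<open>At depth below \<open>d0\<close> the distance term of the decay estimate
      contributes at most 1/8. For large n the term 1/S n contributes another 1/8, so points with h
      > 1/2 have depth at least \<open>d0\<close> and lie in the compact set
      \<open>Q\<close>.\<close>
    define d0 where "d0 = min (s0 / 2) (s0 / (8 * M * C0))"
    have d0: "0 < d0" "d0 < s0" "M * (C0 * d0 / s0) \<le> 1 / 8"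
    proof -
      show "0 < d0" "d0 < s0" using s0 M1 C0p by (auto simp: d0_def)
      have "M * (C0 * d0 / s0) \<le> M * (C0 * (s0 / (8 * M * C0)) / s0)"
        using s0 M1 C0p by (intro mult_left_mono divide_right_mono) (auto simp: d0_def)
      also have "\<dots> = 1 / 8" using s0 M1 C0p by (simp add: field_simps)
      finally show "M * (C0 * d0 / s0) \<le> 1 / 8" .
    qed
    define Q where "Q = {x. norm x = 1 \<and> d0 \<le> depth x}"
    have "closed Q" unfolding Q_def 
      by (intro closed_Collect_conj closed_Collect_eq closed_Collect_le continuous_intros)
    moreover have "Q \<subseteq> cball 0 1" by (auto simp: Q_def)
    ultimately have cQ: "compact Q" using compact_eq_bounded_closed bounded_subset bounded_cball by blast
    have QC: "x \<in> Cone" if "x \<in> Q" for x using that d0 by (simp add: Q_def mem_Cone)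
    from hcap obtain X where X: "\<And>n. X n \<in> cap" "\<And>n. 1 / 2 < h n (X n)" by metis
    have XC: "X n \<in> Cone" "norm (X n) = 1" for n using X(1)[of n] by (auto simp: cap_def)
    have "\<forall>\<^sub>F n in sequentially. 1 / S n < 1 / (8 * M)"
      using Slim M1 by (intro order_tendstoD(2)) auto
    then obtain N where N: "\<And>n. N \<le> n \<Longrightarrow> 1 / S n < 1 / (8 * M)" by (auto simp: eventually_sequentially)
    have XQ: "X n \<in> Q" if n: "N \<le> n" for n
    proof (rule ccontr)
      assume "X n \<notin> Q"
      then have dn: "depth (X n) < d0" using XC by (simp add: Q_def)
      define p where "p = fst (X n)"
      define d where "d = depth (X n)"
      have d: "0 < d" "d < d0" using dn XC(1)[of n] by (auto simp: d_def mem_Cone)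
      have "1 \<le> (1 + B) * norm p + d" using norm_le_fst_depth[of "X n"] XC[of n] d by (simp add: p_def d_def)
      then have "1 / 2 \<le> (1 + B) * norm p" using d d0 s0 by linarith
      then have sp: "s0 \<le> norm p" using B by (simp add: s0_def field_simps)
      then have p0: "p \<noteq> 0" "d < norm p" using s0 d d0 by auto
      have Xp: "X n = (p, g p + d)" by (simp add: p_def d_def depth_def)
      have np: "norm p \<le> 1" using norm_fst_le[of p "snd (X n)"] XC(2)[of n] by (simp add: p_def)
      have "norm (p, g p) \<le> norm (X n) + d"
      proof -
        have "(p, g p) = X n - (0, d)" by (simp add: Xp)
        then show ?thesis using norm_triangle_ineq4[of "X n" "(0, d)"] d by (simp add: norm_Pair)
      qed
      then have n3: "norm (p, g p) + norm p \<le> 3" using np XC(2)[of n] d d0 s0 by linarith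
      have "h n (X n) \<le> (norm (p, g p) + norm p) powr \<alpha> n * (1 / S n + C0 * d / norm p)"
        unfolding Xp by (rule hbd[OF p0(1) d(1) p0(2)])
      also have "\<dots> \<le> M * (1 / S n + C0 * d / norm p)"
      proof (rule mult_right_mono)
        have "(norm (p, g p) + norm p) powr \<alpha> n \<le> 3 powr \<alpha> n" using n3 \<alpha>0[of n] by (intro powr_mono2) auto
        also have "\<dots> \<le> M" unfolding M_def using \<alpha>0[of n] by (intro powr_mono) auto
        finally show "(norm (p, g p) + norm p) powr \<alpha> n \<le> M" .
        show "0 \<le> 1 / S n + C0 * d / norm p" using S1[of n] C0p d by (intro add_nonneg_nonneg divide_nonneg_nonneg) auto
      qed
      also have "\<dots> = M * (1 / S n) + M * (C0 * d / norm p)" by (simp add: algebra_simps)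
      also have "M * (C0 * d / norm p) \<le> M * (C0 * d0 / s0)"
        using M1 C0p d sp s0 by (intro mult_left_mono frac_le mult_mono) auto
      also note d0(3)
      also have "M * (1 / S n) \<le> M * (1 / (8 * M))" using N[OF n] M1 by (intro mult_left_mono) auto
      also have "M * (1 / (8 * M)) = 1 / 8" using M1 by simp
      finally show False using X(2)[of n] by simp
    qed
    have "\<forall>n. X (k (n + N)) \<in> Q" using XQ seq_suble[OF k(1)] by (meson le_add2 order_trans)
    then obtain x r where x: "x \<in> Q" "strict_mono (r :: nat \<Rightarrow> nat)" "((\<lambda>n. X (k (n + N))) \<circ> r) \<longlonglongrightarrow> x"
      using cQ unfolding compact_eq_seq_compact_metric seq_compact_def by metis
    have xC: "x \<in> Cone" using QC x(1) by blast
    obtain R K where RK: "R > 0" "K \<ge> 0" "\<And>y n. y \<in> cball x R \<Longrightarrow> \<bar>h n y - h n x\<bar> \<le> K * norm (y - x)" using Hlip[OF xC] by blast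
    define Y where "Y n = X (k (r n + N))" for n
    have Y: "Y \<longlonglongrightarrow> x" using x(3) unfolding Y_def[abs_def] by (simp add: comp_def)
    then have "(\<lambda>n. K * norm (Y n - x)) \<longlonglongrightarrow> K * norm (x - x)" by (intro tendsto_intros)
    \<comment> \<open>The equi-Lipschitz bound moves the value from the points \<open>Y n\<close> to
      their limit \<open>x\<close> at a loss below 1/4, so more than 1/4 of the 1/2
      survives.\<close>
    then have "\<forall>\<^sub>F n in sequentially. K * norm (Y n - x) < 1 / 4" by (intro order_tendstoD(2)) auto
    moreover have "\<forall>\<^sub>F n in sequentially. Y n \<in> ball x R"
      using Y RK(1) by (intro topological_tendstoD) auto
    ultimately have "\<forall>\<^sub>F n in sequentially. 1 / 4 \<le> h (k (r n + N)) x"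
    proof eventually_elim
      case (elim n)
      have "\<bar>h (k (r n + N)) (Y n) - h (k (r n + N)) x\<bar> \<le> K * norm (Y n - x)" using elim RK(3) by auto
      moreover have "1 / 2 < h (k (r n + N)) (Y n)" using X(2) by (simp add: Y_def)
      ultimately show ?case using elim by linarith
    qed
    moreover have "(\<lambda>n. h (k (r n + N)) x) \<longlonglongrightarrow> H x"
    proof -
      have "strict_mono (\<lambda>n. r n + N)" using x(2) by (simp add: strict_mono_def)
      from LIMSEQ_subseq_LIMSEQ[OF lim[OF xC] this] show ?thesis by (simp add: comp_def)
    qed
    ultimately have "1 / 4 \<le> H x" using tendsto_lowerbound by (metis sequentially_bot)
    then show ?thesis using xC by (intro bexI[of _ x]) auto
  qed
  then obtain q where q: "q \<in> Cone" "0 < H q" by blast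
  show ?thesis
  proof (rule that[OF \<beta> hH _ Hle Hhom C0p Hbd])
    show "0 < H x" if "x \<in> Cone" for x
      by (rule harm_pos_or_zero[OF open_Cone connected_Cone hH H0 q that])
  qed
qed

text \<open>Near a boundary point other than the vertex the depth is small compared with the
  horizontal part, so the barrier at the foot point vertically below \<open>x\<close> applies, and
  its scale is bounded below.\<close>

lemma near_boundary:
  assumes z: "z \<noteq> 0" "depth z = 0"
  obtains r where "0 < r" "0 < norm (fst z)"
    "\<And>x. x \<in> Cone \<Longrightarrow> dist z x < r \<Longrightarrow> norm (fst z) / 2 \<le> norm (fst x) \<and> depth x < norm (fst x) / 16"
proof -
  have "fst z \<noteq> 0"
  proof
    assume "fst z = 0"
    then have "snd z = 0" using z(2) by (simp add: depth_def)
    with \<open>fst z = 0\<close> z(1) show False by (simp add: prod_eq_iff)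
  qed
  then have p: "0 < norm (fst z)" by simp
  \<comment> \<open>The depth within this radius is at most |fst z| / 33, strictly below |fst z| /
    32 and hence below |fst x| / 16.\<close>
  define r where "r = norm (fst z) / 33 / (1 + B)"
  have r: "0 < r" using p B by (simp add: r_def)
  define k where "k = 1 + B"
  have "0 < k" using B by (simp add: k_def)
  then have "k * r = norm (fst z) / 33" by (simp add: r_def k_def[symmetric])
  then have rB: "(1 + B) * r < norm (fst z) / 32" using p unfolding k_def by linarith
  have r2: "r \<le> norm (fst z) / 2" 
  proof -
    have "1 * r \<le> (1 + B) * r" using B r by (intro mult_right_mono) auto
    then show ?thesis using rB p by linarith
  qed
  show ?thesis
  proof (rule that[OF r p])
    fix x assume x: "x \<in> Cone" "dist z x < r"
    have "norm (fst z - fst x) \<le> norm (z - x)" using norm_fst_le[of "fst z - fst x" "snd z - snd x"] by (simp add: minus_prod_def)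
    then have "norm (fst z) - norm (fst x) \<le> r" using x(2) norm_triangle_ineq2[of "fst z" "fst x"] by (simp add: dist_norm)
    then have 1: "norm (fst z) / 2 \<le> norm (fst x)" using r2 by linarith
    have "depth x \<le> (1 + B) * norm (z - x)" using depth_Lipschitz[of z x] z(2) by simp
    also have "\<dots> \<le> (1 + B) * r" using x(2) B by (intro mult_left_mono) (auto simp: dist_norm)
    finally have "depth x < norm (fst x) / 16" using rB 1 by linarith
    with 1 show "norm (fst z) / 2 \<le> norm (fst x) \<and> depth x < norm (fst x) / 16" by blast
  qed
qed

lemma pair_depth: "(fst x, g (fst x) + depth x) = x"
  by (simp add: depth_def)

lemma homogeneous_harmonic_depth:
  assumes C1: "0 < C1" "\<And>p d. p \<noteq> 0 \<Longrightarrow> 0 < d \<Longrightarrow> d < norm p \<Longrightarrow>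
       h (p, g p + d) \<le> (norm (p, g p) + norm p) powr \<beta> * (C1 * d / norm p)" and \<beta>: "0 < \<beta>"
    and z: "z \<noteq> 0" "depth z = 0"
  shows "\<exists>r>0. \<exists>C>0. \<forall>x\<in>Cone. dist z x < r \<longrightarrow> h x \<le> C * depth x"
proof -
  obtain r where r: "0 < r" "0 < norm (fst z)"
    "\<And>x. x \<in> Cone \<Longrightarrow> dist z x < r \<Longrightarrow> norm (fst z) / 2 \<le> norm (fst x) \<and> depth x < norm (fst x) / 16"
    using near_boundary[OF z] by metis
  define s where "s = norm (fst z)"
  define M where "M = (2 + B) * (norm z + r)"
  have "0 < 2 + B" "0 < norm z + r" using B r(1) by (auto intro: add_nonneg_pos)
  then have M: "0 < M" by (simp add: M_def)
  show ?thesis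
  proof (rule exI[of _ r], rule conjI[OF r(1)], rule exI[of _ "M powr \<beta> * (C1 / (s / 2))"], intro conjI ballI impI)
    show "0 < M powr \<beta> * (C1 / (s / 2))" using M C1 r by (simp add: s_def)
    fix x assume x: "x \<in> Cone" "dist z x < r"
    have d: "0 < depth x" using x by (simp add: mem_Cone)
    have b: "s / 2 \<le> norm (fst x)" "depth x < norm (fst x)" "fst x \<noteq> 0"
      using r(3)[OF x] d r(2) unfolding s_def by auto
    have "norm x \<le> norm z + r" using x(2) norm_triangle_sub[of x z] by (simp add: dist_norm norm_minus_commute)
    then have px: "norm (fst x) \<le> norm z + r" using norm_fst_le[of "fst x" "snd x"] by simp
    have "norm (fst x, g (fst x)) \<le> norm (fst x) + norm (g (fst x))" by (rule norm_Pair_le)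
    also have "\<dots> \<le> (1 + B) * norm (fst x)" using abs_g_le[of "fst x"] by (simp add: algebra_simps)
    finally have "norm (fst x, g (fst x)) + norm (fst x) \<le> (2 + B) * norm (fst x)" by (simp add: algebra_simps)
    also have "\<dots> \<le> M" unfolding M_def using px B by (intro mult_left_mono) auto
    finally have pw: "(norm (fst x, g (fst x)) + norm (fst x)) powr \<beta> \<le> M powr \<beta>" using \<beta> by (intro powr_mono2) auto
    have "h x \<le> (norm (fst x, g (fst x)) + norm (fst x)) powr \<beta> * (C1 * depth x / norm (fst x))"
      using C1(2)[OF b(3) d b(2)] by (simp add: pair_depth)
    also have "\<dots> \<le> M powr \<beta> * (C1 * depth x / (s / 2))"
      using pw b d C1(1) r(2) by (intro mult_mono frac_le) (auto simp: s_def)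
    finally show "h x \<le> M powr \<beta> * (C1 / (s / 2)) * depth x" by (simp add: mult_ac)
  qed
qed

section \<open>The homogeneous harmonic function as an eigenfunction\<close>

text \<open>On the cone the extension of degree 0 is |x|^(-\<beta>) h. The product rule with Euler's
  identity gives its Laplacian on the unit sphere as -\<beta> (\<beta> + n - 2) h. Continuity up to
  the boundary follows from the linear bound of \<open>h\<close> by \<open>depth\<close>.\<close>

lemma dirichlet_eigenvalue_homogeneous:
  fixes \<Sigma> :: "((real ^ 'm) \<times> real) set"
  assumes \<Sigma>: "\<Sigma> \<subseteq> sphere 0 1" "cone_over \<Sigma> = Cone"
    and \<beta>: "0 < \<beta>" and h: "harm Cone h" "\<And>x. x \<in> Cone \<Longrightarrow> 0 < h x"
    "\<And>t x. x \<in> Cone \<Longrightarrow> 0 < t \<Longrightarrow> h (t *\<^sub>R x) = t powr \<beta> * h x"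
    and C1: "0 < C1" "\<And>p d. p \<noteq> 0 \<Longrightarrow> 0 < d \<Longrightarrow> d < norm p \<Longrightarrow>
       h (p, g p + d) \<le> (norm (p, g p) + norm p) powr \<beta> * (C1 * d / norm p)"
  shows "dirichlet_eigenvalue \<Sigma> (\<beta> * (\<beta> + real DIM((real ^ 'm) \<times> real) - 2))"
proof -
  define dm where "dm = real DIM((real ^ 'm) \<times> real)"
  have "x \<in> \<Sigma> \<longleftrightarrow> x \<in> cone_over \<Sigma>" if "norm x = 1" for x
    using that by (auto simp: cone_over_def)
  then have \<Sigma>eq: "\<Sigma> = Cone \<inter> sphere 0 1" using \<Sigma> by auto
  \<comment> \<open>The value 0 off the open cone is the Dirichlet condition on the relative
    frontier of the cap.\<close>
  define w where "w x = (if x \<in> Cone then h x else 0)" for x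
  have ch: "continuous_on Cone h" using h(1) by (rule harm_continuous_on)
  have cw: "continuous_on (closure Cone - {0}) w"
    unfolding continuous_on_def
  proof
    fix z assume z: "z \<in> closure Cone - {0}"
    show "(w \<longlongrightarrow> w z) (at z within closure Cone - {0})"
    proof (cases "z \<in> Cone")
      case True
      have "(h \<longlongrightarrow> h z) (at z)"
        using ch True open_Cone by (simp add: continuous_on_eq_continuous_at isCont_def)
      moreover have "\<forall>\<^sub>F x in at z. w x = h x"
        using eventually_at_in_open'[OF open_Cone True] by eventually_elim (simp add: w_def)
      ultimately have "(w \<longlongrightarrow> h z) (at z)" by (rule Lim_transform_eventually[OF _ eventually_mono]) auto
      then show ?thesis using True by (simp add: w_def tendsto_within_subset[of _ _ _ UNIV])
    next
      case False
      then have dz: "z \<noteq> 0" "depth z = 0" using z by (auto simp: closure_Cone mem_Cone)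
      obtain r C where rC: "0 < r" "0 < C" "\<And>x. x \<in> Cone \<Longrightarrow> dist z x < r \<Longrightarrow> h x \<le> C * depth x"
      proof -
        have "\<exists>r>0. \<exists>C>0. \<forall>x\<in>Cone. dist z x < r \<longrightarrow> h x \<le> C * depth x"
          by (rule homogeneous_harmonic_depth[OF C1(1) _ \<beta> dz]) (rule C1(2))
        then show thesis using that by blast
      qed
      have "(w \<longlongrightarrow> 0) (at z within closure Cone - {0})"
      proof (rule Lim_null_comparison)
        have "\<forall>\<^sub>F x in at z within closure Cone - {0}. x \<in> ball z r"
          using rC(1) by (intro eventually_at_topological[THEN iffD2] exI[of _ "ball z r"]) auto
        moreover have "\<forall>\<^sub>F x in at z within closure Cone - {0}. x \<in> closure Cone - {0}"
          by (simp add: eventually_at_filter)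
        ultimately show "\<forall>\<^sub>F x in at z within closure Cone - {0}. norm (w x) \<le> C * depth x"
        proof eventually_elim
          case (elim x)
          show ?case
          proof (cases "x \<in> Cone")
            case True
            then show ?thesis using rC(3)[of x] elim h(2)[of x] by (simp add: w_def)
          next
            case False
            then show ?thesis using elim rC(2) by (simp add: w_def closure_Cone)
          qed
        qed
        have "continuous_on UNIV (\<lambda>x. C * depth x)" by (intro continuous_intros continuous_on_depth)
        then have "((\<lambda>x. C * depth x) \<longlongrightarrow> C * depth z) (at z)"
          unfolding continuous_on_def by (rule bspec) (rule UNIV_I)
        then show "((\<lambda>x. C * depth x) \<longlongrightarrow> 0) (at z within closure Cone - {0})"
          using dz by (simp add: tendsto_within_subset[of _ _ _ UNIV])
      qed
      then show ?thesis using False by (simp add: w_def)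
    qed
  qed
  have rad: "radial_ext w x = norm x powr (- \<beta>) * h x" if x: "x \<in> Cone" for x
  proof -
    have r: "0 < norm x" using x zero_notin_Cone by auto
    then have "x /\<^sub>R norm x \<in> Cone" using Cone_scale[of "inverse (norm x)"] x by simp
    then have "radial_ext w x = h (inverse (norm x) *\<^sub>R x)" by (simp add: radial_ext_def w_def)
    also have "\<dots> = inverse (norm x) powr \<beta> * h x" using h(3)[OF x] r by simp
    finally show ?thesis using r by (simp add: powr_minus inverse_powr)
  qed
  have hh: "has_grad_lap Cone h (grad h) (\<lambda>x. 0)" by (rule harm_has_grad_lap[OF open_Cone h(1)])
  note hm = has_grad_lap_mult[OF has_grad_lap_norm_powr[OF open_Cone zero_notin_Cone, of "- \<beta>", folded dm_def] hh]
  have hr: "has_grad_lap Cone (radial_ext w)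
     (\<lambda>x. norm x powr (- \<beta>) *\<^sub>R grad h x + h x *\<^sub>R ((- \<beta> * norm x powr (- \<beta> - 2)) *\<^sub>R x))
     (\<lambda>x. norm x powr (- \<beta>) * 0 + 2 * (((- \<beta> * norm x powr (- \<beta> - 2)) *\<^sub>R x) \<bullet> grad h x)
        + h x * (- \<beta> * (- \<beta> + dm - 2) * norm x powr (- \<beta> - 2)))"
    by (rule has_grad_lap_cong[OF hm]) (auto simp: rad)
  show ?thesis
    unfolding dirichlet_eigenvalue_def dm_def[symmetric]
  proof (intro exI[of _ w] conjI ballI)
    show "continuous_on (closure \<Sigma>) w"
    proof (rule continuous_on_subset[OF cw])
      have "closure \<Sigma> \<subseteq> sphere 0 1" using \<Sigma>(1) by (intro closure_minimal) auto
      moreover have "closure \<Sigma> \<subseteq> closure Cone" using \<Sigma>eq by (intro closure_mono) auto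
      ultimately show "closure \<Sigma> \<subseteq> closure Cone - {0}" by auto
    qed
    show "w x = 0" if x: "x \<in> top_of_set (sphere 0 1) frontier_of \<Sigma>" for x
    proof -
      have "openin (top_of_set (sphere 0 1)) \<Sigma>"
        unfolding \<Sigma>eq Int_commute[of Cone] by (rule openin_open_Int[OF open_Cone])
      then have "x \<notin> \<Sigma>" using x by (simp add: frontier_of_def interior_of_openin)
      moreover have "x \<in> sphere 0 1" using x frontier_of_subset_topspace by fastforce
      ultimately show ?thesis by (simp add: w_def \<Sigma>eq)
    qed
    show "\<exists>x\<in>\<Sigma>. w x \<noteq> 0"
      using e_Cone norm_e h(2)[OF e_Cone] by (intro bexI[of _ e]) (auto simp: \<Sigma>eq w_def)
    show "Ck_on 2 (cone_over \<Sigma>) (radial_ext w)"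
      unfolding \<Sigma>(2) by (rule has_grad_lap_Ck_on_2[OF hr])
    fix x assume "x \<in> \<Sigma>"
    then have x: "x \<in> Cone" "norm x = 1" by (auto simp: \<Sigma>eq)
    have eu: "x \<bullet> grad h x = \<beta> * h x"
      by (rule homogeneous_euler[OF has_grad_lap_derivative[OF hh x(1)] h(3)[OF x(1)]])
    show "- sphere_laplacian w x = \<beta> * (\<beta> + dm - 2) * w x"
      unfolding sphere_laplacian_def has_grad_lap_laplacian[OF hr x(1)]
      using x eu by (simp add: w_def algebra_simps)
  qed
qed

end

section \<open>Comparison principles for the singular equation\<close>

locale sing = epi_cone g \<Gamma> B K1 for g :: "real ^ 'm \<Rightarrow> real" and \<Gamma> B K1 +
  fixes f :: "(real ^ 'm) \<times> real \<Rightarrow> real" and \<gamma> lam Lam :: real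
  assumes gamma: "1 < \<gamma>" and lam: "0 < lam"
    and f_meas: "f \<in> borel_measurable (lebesgue_on (Cone \<inter> ball 0 1))"
    and f_bounds: "\<And>x. x \<in> Cone \<inter> ball 0 1 \<Longrightarrow> lam \<le> f x \<and> f x \<le> Lam"
begin

abbreviation "\<Omega> \<equiv> Cone \<inter> ball 0 1"
abbreviation "sol u \<equiv> singular_solution Cone \<gamma> f u"

lemma open_\<Omega>: "open \<Omega>" using open_Cone by auto

lemma sol_pos: "sol u \<Longrightarrow> x \<in> \<Omega> \<Longrightarrow> 0 < u x"
  by (simp add: singular_solution_def)

lemma sol_continuous_on: "sol u \<Longrightarrow> continuous_on (closure Cone \<inter> ball 0 1) u"
proof -
  assume "sol u"
  then have "continuous_on ((Cone \<inter> ball 0 1) \<union> (ball 0 1 \<inter> frontier Cone)) u"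
    by (simp add: singular_solution_def)
  moreover have "(Cone \<inter> ball 0 1) \<union> (ball 0 1 \<inter> frontier Cone) = closure Cone \<inter> ball 0 1"
    by (auto simp: closure_Cone frontier_Cone mem_Cone)
  ultimately show ?thesis by simp
qed

lemma sol_zero: "sol u \<Longrightarrow> z \<in> ball 0 1 \<Longrightarrow> depth z = 0 \<Longrightarrow> u z = 0"
  by (simp add: singular_solution_def frontier_Cone)

lemma \<Omega>_closure: "\<Omega> \<subseteq> closure Cone \<inter> ball 0 1" using closure_subset by auto

lemma sol_continuous_on_\<Omega>: "sol u \<Longrightarrow> continuous_on \<Omega> u"
  using sol_continuous_on continuous_on_subset \<Omega>_closure by blast

section \<open>The singular equation tested against bumps\<close>

text \<open>Since \<open>f\<close> is only measurable, the right-hand side is handled as a number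
  for each bump; the comparison arguments use its sign, its monotonicity in the solution and a lower
  bound.\<close>

definition "rhs u a r = (LINT x|lebesgue_on \<Omega>. f x * u x powr (- \<gamma>) * bump a r x)"

text \<open>Connects the integrals over \<open>lebesgue_on \<Omega>\<close> of the distributional
  equation with the \<open>lborel\<close> integrals of the mean value calculus.\<close>

lemma lebesgue_on_cball_integral:
  fixes k :: "(real ^ 'm) \<times> real \<Rightarrow> real"
  assumes sub: "cball a r \<subseteq> \<Omega>" and k: "continuous_on (cball a r) k" and k0: "\<And>x. x \<in> \<Omega> - cball a r \<Longrightarrow> k x = 0"
  shows "integrable (lebesgue_on \<Omega>) k" "(LINT x|lebesgue_on \<Omega>. k x) = (LINT y:cball a r|lborel. k y)"
proof -
  have m\<Omega>: "\<Omega> \<inter> space lebesgue \<in> sets lebesgue" using open_\<Omega> by (simp add: borel_open)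
  have i: "integrable lborel (\<lambda>x. indicator (cball a r) x *\<^sub>R k x)"
    using set_integrable_compact[OF compact_cball k] by (simp add: set_integrable_def)
  have eq: "indicator \<Omega> x *\<^sub>R k x = indicator (cball a r) x *\<^sub>R k x" for x
    using sub k0[of x] by (auto simp: indicator_def)
  have il: "integrable lebesgue (\<lambda>x. indicator (cball a r) x *\<^sub>R k x)"
    using integrable_completion[of "\<lambda>x. indicator (cball a r) x *\<^sub>R k x" lborel] i borel_measurable_integrable[OF i] by blast
  show "integrable (lebesgue_on \<Omega>) k"
    unfolding integrable_restrict_space[OF m\<Omega>] eq by (rule il)
  show "(LINT x|lebesgue_on \<Omega>. k x) = (LINT y:cball a r|lborel. k y)"
    unfolding integral_restrict_space[OF m\<Omega>] eq set_lebesgue_integral_def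
    by (rule integral_completion[OF borel_measurable_integrable[OF i]])
qed

lemma rhs_integrable:
  assumes u: "sol u" and sub: "cball a r \<subseteq> \<Omega>" and r: "0 < r"
  shows "integrable (lebesgue_on \<Omega>) (\<lambda>x. f x * u x powr (- \<gamma>) * bump a r x)"
proof -
  have cu: "continuous_on \<Omega> (\<lambda>x. u x powr (- \<gamma>) * bump a r x)"
    using sol_pos[OF u] by (intro continuous_intros sol_continuous_on_\<Omega>[OF u] continuous_on_bump) force
  have z: "bump a r x = 0" if "x \<notin> cball a r" for x
    using that r by (intro bump_eq_0) (auto simp: dist_norm norm_minus_commute)
  have m: "(\<lambda>x. f x * (u x powr (- \<gamma>) * bump a r x)) \<in> borel_measurable (lebesgue_on \<Omega>)"
    using open_\<Omega> by (intro borel_measurable_times f_meas continuous_imp_measurable_on_sets_lebesgue[OF cu]) (simp add: borel_open)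
  have i: "integrable (lebesgue_on \<Omega>) (\<lambda>x. Lam * (u x powr (- \<gamma>) * bump a r x))"
    by (rule lebesgue_on_cball_integral(1)[OF sub]) (auto intro!: continuous_intros continuous_on_subset[OF cu sub] simp: z)
  have "integrable (lebesgue_on \<Omega>) (\<lambda>x. f x * (u x powr (- \<gamma>) * bump a r x))"
  proof (rule Bochner_Integration.integrable_bound[OF i m])
    have "norm (f x * (u x powr (- \<gamma>) * bump a r x)) \<le> norm (Lam * (u x powr (- \<gamma>) * bump a r x))" if "x \<in> \<Omega>" for x
      using f_bounds[OF that] lam by (simp add: abs_mult mult_right_mono)
    then show "AE x in lebesgue_on \<Omega>. norm (f x * (u x powr (- \<gamma>) * bump a r x)) \<le> norm (Lam * (u x powr (- \<gamma>) * bump a r x))"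
      by (intro AE_I2) (simp add: space_restrict_space)
  qed
  then show ?thesis by (simp add: mult.assoc)
qed

lemma sol_bump:
  assumes u: "sol u" and sub: "cball a r \<subseteq> \<Omega>" and r: "0 < r"
  shows "(LINT y:cball a r|lborel. u y * bump_lap a r y) = - rhs u a r"
proof -
  have "neg_laplacian_distr_eq \<Omega> u (\<lambda>x. f x * u x powr (- \<gamma>))" using u by (simp add: singular_solution_def)
  then have "- (LINT x|lebesgue_on \<Omega>. u x * bump_lap a r x) = rhs u a r"
    using bump_in_test_functions[OF r sub] by (simp add: neg_laplacian_distr_eq_def rhs_def laplacian_bump[of a r, symmetric])
  moreover have "(LINT x|lebesgue_on \<Omega>. u x * bump_lap a r x) = (LINT y:cball a r|lborel. u y * bump_lap a r y)"
  proof (rule lebesgue_on_cball_integral(2)[OF sub])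
    show "continuous_on (cball a r) (\<lambda>x. u x * bump_lap a r x)"
      by (intro continuous_intros continuous_on_bump continuous_on_subset[OF sol_continuous_on_\<Omega>[OF u] sub])
    show "u x * bump_lap a r x = 0" if "x \<in> \<Omega> - cball a r" for x
      using that r bump_lap_eq_0[of r x a] by (simp add: dist_norm norm_minus_commute)
  qed
  ultimately show ?thesis by simp
qed

lemma rhs_nonneg: "0 \<le> rhs u a r"
  unfolding rhs_def
proof (rule integral_nonneg_AE, rule AE_I2)
  fix x assume "x \<in> space (lebesgue_on \<Omega>)"
  then have "0 \<le> f x" using f_bounds[of x] lam by (simp add: space_restrict_space)
  then show "0 \<le> f x * u x powr (- \<gamma>) * bump a r x" using bump_nonneg[of a r x] by simp
qed

lemma rhs_mono:
  assumes u: "sol u" "sol v" and sub: "cball a r \<subseteq> \<Omega>" and r: "0 < r" and le: "\<And>x. x \<in> cball a r \<Longrightarrow> v x \<le> u x"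
  shows "rhs u a r \<le> rhs v a r"
  unfolding rhs_def
proof (rule integral_mono[OF rhs_integrable[OF u(1) sub r] rhs_integrable[OF u(2) sub r]])
  fix x assume "x \<in> space (lebesgue_on \<Omega>)"
  then have x: "x \<in> \<Omega>" by (simp add: space_restrict_space)
  show "f x * u x powr (- \<gamma>) * bump a r x \<le> f x * v x powr (- \<gamma>) * bump a r x"
  proof (cases "x \<in> cball a r")
    case True
    have "u x powr (- \<gamma>) \<le> v x powr (- \<gamma>)"
      using le[OF True] sol_pos[OF u(2) x] gamma by (intro powr_mono2') auto
    then show ?thesis using f_bounds[OF x] lam bump_nonneg[of a r x]
      by (intro mult_right_mono mult_left_mono) auto
  next
    case False
    then have "bump a r x = 0" using r by (intro bump_eq_0) (auto simp: dist_norm norm_minus_commute)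
    then show ?thesis by simp
  qed
qed

lemma rhs_ge:
  assumes v: "sol v" and sub: "cball a r \<subseteq> \<Omega>" and r: "0 < r" and q: "continuous_on (cball a r) q"
    and le: "\<And>x. x \<in> cball a r \<Longrightarrow> q x \<le> lam * v x powr (- \<gamma>)"
  shows "(LINT y:cball a r|lborel. q y * bump a r y) \<le> rhs v a r"
proof -
  define k where "k x = (if x \<in> cball a r then q x * bump a r x else 0)" for x
  have ck: "continuous_on (cball a r) k"
    by (rule continuous_on_eq[where f="\<lambda>x. q x * bump a r x"]) (auto intro!: continuous_intros q continuous_on_bump simp: k_def)
  have "(LINT y:cball a r|lborel. q y * bump a r y) = (LINT y:cball a r|lborel. k y)"
    by (rule set_lebesgue_integral_cong) (auto simp: k_def)
  also have "\<dots> = (LINT x|lebesgue_on \<Omega>. k x)"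
    by (rule lebesgue_on_cball_integral(2)[OF sub ck, symmetric]) (simp add: k_def)
  also have "\<dots> \<le> rhs v a r"
    unfolding rhs_def
  proof (rule integral_mono[OF lebesgue_on_cball_integral(1)[OF sub ck] rhs_integrable[OF v sub r]])
    show "k x = 0" if "x \<in> \<Omega> - cball a r" for x using that by (simp add: k_def)
    fix x assume "x \<in> space (lebesgue_on \<Omega>)"
    then have x: "x \<in> \<Omega>" by (simp add: space_restrict_space)
    show "k x \<le> f x * v x powr (- \<gamma>) * bump a r x"
    proof (cases "x \<in> cball a r")
      case True
      have "q x \<le> f x * v x powr (- \<gamma>)"
        using le[OF True] mult_right_mono[of lam "f x" "v x powr (- \<gamma>)"] f_bounds[OF x] by simp
      then show ?thesis using True bump_nonneg[of a r x] by (simp add: k_def mult_right_mono)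
    next
      case False
      then show ?thesis using f_bounds[OF x] lam bump_nonneg[of a r x] by (simp add: k_def)
    qed
  qed
  finally show ?thesis .
qed

section \<open>Comparison with solutions and with classical subsolutions\<close>

lemma open_sublevel:
  assumes "open W" "continuous_on W F"
  shows "open {x \<in> W. F x < (0::real)}"
  using continuous_open_preimage[OF assms(2,1), of "{..<0}"] by (auto simp: vimage_def Int_def)

text \<open>Where \<kappa> v + H < u one has v < u, because \<kappa> \<ge> 1 and H \<ge> 0. As the
  nonlinearity decreases in the solution, the right-hand side of u is then at most that of v, and
  \<kappa> v + H - u is superharmonic there. The case \<kappa> = 1 serves the smooth part of the
  boundary, \<kappa> = 1 + \<epsilon> the vertex.\<close>

lemma difference_comparison:
  assumes u: "sol u" "sol v" and W: "open W" "W \<subseteq> \<Omega>" and \<kappa>: "1 \<le> \<kappa>"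
    and H: "has_grad_lap W H G L" "\<And>x. x \<in> W \<Longrightarrow> L x \<le> 0" "\<And>x. x \<in> W \<Longrightarrow> 0 \<le> H x"
    and bd: "\<And>z e. z \<in> frontier W \<Longrightarrow> 0 < e \<Longrightarrow> \<forall>\<^sub>F x in at z within W. - e < \<kappa> * v x + H x - u x"
    and x: "x \<in> W"
  shows "u x \<le> \<kappa> * v x + H x"
proof -
  have cu: "continuous_on W u" "continuous_on W v" "continuous_on W H" "continuous_on W L"
    using sol_continuous_on_\<Omega>[OF u(1)] sol_continuous_on_\<Omega>[OF u(2)] W(2) has_grad_lap_continuous_on[OF H(1)]
      has_grad_lap_continuous_on_lap[OF H(1)]
    by (auto intro: continuous_on_subset)
  define F where "F x = \<kappa> * v x + H x - u x" for x
  have cF: "continuous_on W F" unfolding F_def by (intro continuous_intros cu)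
  have oW: "open {x \<in> W. F x < 0}" by (rule open_sublevel[OF W(1) cF])
  have "0 \<le> F x"
  proof (rule min_principle[OF W(1) _ cF _ _ x])
    show "bounded W" using W(2) bounded_subset[OF bounded_ball] by blast
    show "superh {x \<in> W. F x < 0} F"
    proof (rule superhI_bump[OF oW])
      show "continuous_on {x \<in> W. F x < 0} F" using cF by (rule continuous_on_subset) auto
      fix a r assume r: "0 < (r::real)" and sub: "cball a r \<subseteq> {x \<in> W. F x < 0}"
      have subW: "cball a r \<subseteq> W" and sub\<Omega>: "cball a r \<subseteq> \<Omega>" using sub W(2) by auto
      have i: "set_integrable lborel (cball a r) (\<lambda>y. w y * bump_lap a r y)" if "continuous_on W w" for w
        by (intro set_integrable_compact continuous_intros continuous_on_bump continuous_on_subset[OF that subW] compact_cball)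
      have "(LINT y:cball a r|lborel. F y * bump_lap a r y)
         = (LINT y:cball a r|lborel. (\<kappa> * (v y * bump_lap a r y) + H y * bump_lap a r y) - u y * bump_lap a r y)"
        by (simp add: F_def algebra_simps)
      also have "\<dots> = \<kappa> * (LINT y:cball a r|lborel. v y * bump_lap a r y)
           + (LINT y:cball a r|lborel. H y * bump_lap a r y) - (LINT y:cball a r|lborel. u y * bump_lap a r y)"
        using i[OF cu(1)] i[OF cu(2)] i[OF cu(3)] by (subst set_integral_diff(2) set_integral_add(2), auto)+
      also have "\<dots> = - \<kappa> * rhs v a r + (LINT y:cball a r|lborel. L y * bump a r y) + rhs u a r"
        by (simp add: sol_bump[OF u(1) sub\<Omega> r] sol_bump[OF u(2) sub\<Omega> r] integration_by_parts_bump[OF H(1) r subW])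
      also have "\<dots> \<le> 0"
      proof -
        have "v y \<le> u y" if "y \<in> cball a r" for y
        proof -
          have y: "y \<in> W" "F y < 0" using sub that by auto
          then have "y \<in> \<Omega>" using W(2) by blast
          note y = y this
          have "1 * v y \<le> \<kappa> * v y" using \<kappa> sol_pos[OF u(2) y(3)] by (intro mult_right_mono) auto
          then show ?thesis using y(2) H(3)[OF y(1)] by (simp add: F_def)
        qed
        then have "rhs u a r \<le> rhs v a r" by (rule rhs_mono[OF u sub\<Omega> r])
        moreover have "1 * rhs v a r \<le> \<kappa> * rhs v a r" using \<kappa> rhs_nonneg by (intro mult_right_mono)
        moreover have "(LINT y:cball a r|lborel. L y * bump a r y) \<le> (LINT y:cball a r|lborel. 0)"
          by (intro set_integral_mono set_integrable_compact continuous_intros continuous_on_bump continuous_on_subset[OF cu(4) subW] compact_cball)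
             (use H(2) subW bump_nonneg[of a r] in \<open>auto intro!: mult_nonpos_nonneg\<close>)
        ultimately show ?thesis by (simp add: set_lebesgue_integral_def)
      qed
      finally show "(LINT y:cball a r|lborel. F y * bump_lap a r y) \<le> 0" .
    qed
  qed (use bd in \<open>auto simp: F_def\<close>)
  then show ?thesis by (simp add: F_def)
qed

text \<open>Where v < s the function s is positive, and -L \<le> lam s^(-\<gamma>) \<le> lam
  v^(-\<gamma>) \<le> f v^(-\<gamma>), so v - s is superharmonic exactly where it could be
  negative.\<close>

lemma subsolution_comparison:
  assumes v: "sol v" and W: "open W" "W \<subseteq> \<Omega>"
    and s: "has_grad_lap W s G L" "\<And>x. x \<in> W \<Longrightarrow> 0 < s x \<Longrightarrow> - L x \<le> lam * s x powr (- \<gamma>)"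
    and bd: "\<And>z e. z \<in> frontier W \<Longrightarrow> 0 < e \<Longrightarrow> \<forall>\<^sub>F x in at z within W. - e < v x - s x"
    and x: "x \<in> W"
  shows "s x \<le> v x"
proof -
  have cu: "continuous_on W v" "continuous_on W s" "continuous_on W L"
    using sol_continuous_on_\<Omega>[OF v] W(2) has_grad_lap_continuous_on[OF s(1)] has_grad_lap_continuous_on_lap[OF s(1)]
    by (auto intro: continuous_on_subset)
  define F where "F x = v x - s x" for x
  have cF: "continuous_on W F" unfolding F_def by (intro continuous_intros cu)
  have oW: "open {x \<in> W. F x < 0}" by (rule open_sublevel[OF W(1) cF])
  have "0 \<le> F x"
  proof (rule min_principle[OF W(1) _ cF _ _ x])
    show "bounded W" using W(2) bounded_subset[OF bounded_ball] by blast
    show "superh {x \<in> W. F x < 0} F"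
    proof (rule superhI_bump[OF oW])
      show "continuous_on {x \<in> W. F x < 0} F" using cF by (rule continuous_on_subset) auto
      fix a r assume r: "0 < (r::real)" and sub: "cball a r \<subseteq> {x \<in> W. F x < 0}"
      have subW: "cball a r \<subseteq> W" and sub\<Omega>: "cball a r \<subseteq> \<Omega>" using sub W(2) by auto
      have i: "set_integrable lborel (cball a r) (\<lambda>y. w y * bump_lap a r y)" if "continuous_on W w" for w
        by (intro set_integrable_compact continuous_intros continuous_on_bump continuous_on_subset[OF that subW] compact_cball)
      have "(LINT y:cball a r|lborel. F y * bump_lap a r y)
         = (LINT y:cball a r|lborel. v y * bump_lap a r y - s y * bump_lap a r y)"
        by (simp add: F_def algebra_simps)
      also have "\<dots> = (LINT y:cball a r|lborel. v y * bump_lap a r y) - (LINT y:cball a r|lborel. s y * bump_lap a r y)"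
        using i[OF cu(1)] i[OF cu(2)] by (rule set_integral_diff(2))
      also have "\<dots> = - rhs v a r - (LINT y:cball a r|lborel. L y * bump a r y)"
        by (simp add: sol_bump[OF v sub\<Omega> r] integration_by_parts_bump[OF s(1) r subW])
      also have "\<dots> \<le> 0"
      proof -
        have "(LINT y:cball a r|lborel. ((-1) * L y) * bump a r y) \<le> rhs v a r"
        proof (rule rhs_ge[OF v sub\<Omega> r])
          show "continuous_on (cball a r) (\<lambda>y. (-1) * L y)" by (intro continuous_intros continuous_on_subset[OF cu(3) subW])
          fix y assume "y \<in> cball a r"
          then have y: "y \<in> W" "v y < s y" using sub by (auto simp: F_def)
          then have "y \<in> \<Omega>" using W(2) by blast
          note y = y this
          have "s y powr (- \<gamma>) \<le> v y powr (- \<gamma>)"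
            using y sol_pos[OF v y(3)] gamma by (intro powr_mono2') auto
          then have "lam * s y powr (- \<gamma>) \<le> lam * v y powr (- \<gamma>)" using lam by (intro mult_left_mono) auto
          then show "(-1) * L y \<le> lam * v y powr (- \<gamma>)" using s(2)[OF y(1)] y(2) sol_pos[OF v y(3)] by simp
        qed
        then show ?thesis by (simp only: mult.assoc set_integral_mult_right)
      qed
      finally show "(LINT y:cball a r|lborel. F y * bump_lap a r y) \<le> 0" .
    qed
  qed (use bd in \<open>auto simp: F_def\<close>)
  then show ?thesis by (simp add: F_def)
qed

end

section \<open>The quotient of two solutions\<close>

lemma locally_dominated:
  fixes F G :: "'a::metric_space \<Rightarrow> real"
  assumes U: "open U" "z \<in> U" and c: "continuous_on U F" "continuous_on U G" and G: "0 < G z"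
  obtains r C where "0 < r" "0 < C" "\<And>x. dist z x < r \<Longrightarrow> F x \<le> C * G x"
proof -
  define C where "C = (\<bar>F z\<bar> + 1) / (G z / 2)"
  have C: "0 < C" using G by (auto simp: C_def intro!: divide_pos_pos)
  have "F z < \<bar>F z\<bar> + 1" "G z / 2 < G z" using G by auto
  moreover have "continuous (at z) F" "continuous (at z) G"
    using c U by (auto simp: continuous_on_eq_continuous_at)
  ultimately have "\<forall>\<^sub>F x in nhds z. F x < \<bar>F z\<bar> + 1" "\<forall>\<^sub>F x in nhds z. G z / 2 < G x"
    unfolding isCont_def tendsto_at_iff_tendsto_nhds by (blast intro: order_tendstoD)+
  then have "\<forall>\<^sub>F x in nhds z. F x < \<bar>F z\<bar> + 1 \<and> G z / 2 < G x" by eventually_elim simp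
  then obtain r where r: "0 < r" "\<And>x. dist x z < r \<Longrightarrow> F x < \<bar>F z\<bar> + 1 \<and> G z / 2 < G x"
    unfolding eventually_nhds_metric by blast
  show ?thesis
  proof (rule that[OF r(1) C])
    fix x assume "dist z x < r"
    then have x: "F x < \<bar>F z\<bar> + 1" "G z / 2 < G x" using r(2)[of x] by (auto simp: dist_commute)
    have "\<bar>F z\<bar> + 1 = C * (G z / 2)" using G by (simp add: C_def)
    also have "\<dots> \<le> C * G x" using x(2) C by (intro mult_left_mono) auto
    finally show "F x \<le> C * G x" using x(1) by linarith
  qed
qed

text \<open>The sum of the finitely many local constants works for all pieces at once because
  \<open>G\<close> is positive.\<close>

lemma compact_dominated:
  fixes F G :: "'a::metric_space \<Rightarrow> real"
  assumes S: "compact S" and G: "\<And>x. x \<in> A \<Longrightarrow> 0 < G x"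
    and loc: "\<And>z. z \<in> S \<Longrightarrow> \<exists>r>0. \<exists>C>0. \<forall>x\<in>A. dist z x < r \<longrightarrow> F x \<le> C * G x"
  obtains C where "0 < C" "\<And>x. x \<in> A \<inter> S \<Longrightarrow> F x \<le> C * G x"
proof -
  obtain r C where rC: "\<And>z. z \<in> S \<Longrightarrow> 0 < r z \<and> 0 < C z \<and> (\<forall>x\<in>A. dist z x < r z \<longrightarrow> F x \<le> C z * G x)"
    using loc by metis
  obtain T where T: "T \<subseteq> S" "finite T" "S \<subseteq> (\<Union>z\<in>T. ball z (r z))"
  proof (rule compactE_image[OF S, of S "\<lambda>z. ball z (r z)"])
    show "S \<subseteq> (\<Union>z\<in>S. ball z (r z))" using rC by force
  qed auto
  define D where "D = 1 + (\<Sum>z\<in>T. C z)"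
  have s: "0 \<le> (\<Sum>z\<in>T. C z)" using rC T(1) by (intro sum_nonneg) (meson less_imp_le subsetD)
  have D: "C z \<le> D" if "z \<in> T" for z
  proof -
    have "C z \<le> (\<Sum>z\<in>T. C z)"
      by (rule member_le_sum[OF that _ T(2)]) (use rC T(1) in \<open>meson DiffD1 less_imp_le subsetD\<close>)
    then show ?thesis by (simp add: D_def)
  qed
  show ?thesis
  proof (rule that[of D])
    show "0 < D" using s by (simp add: D_def)
    fix x assume x: "x \<in> A \<inter> S"
    then obtain z where z: "z \<in> T" "dist z x < r z" using T(3) by auto
    then have "F x \<le> C z * G x" using rC T(1) x by blast
    also have "\<dots> \<le> D * G x" using D[OF z(1)] G[of x] x by (intro mult_right_mono) auto
    finally show "F x \<le> D * G x" .
  qed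
qed

context sing
begin

section \<open>Solutions near the boundary away from the vertex\<close>

text \<open>The natural degree of the equation: \<phi> - 2 = -\<phi> \<gamma>, so for a function of
  degree \<phi> both sides of the equation have the same degree.\<close>

definition "\<phi> = 2 / (1 + \<gamma>)"

lemma \<phi>: "0 < \<phi>" "\<phi> < 1" "\<phi> * (1 + \<gamma>) = 2" "- (\<phi> * \<gamma>) = \<phi> - 2"
proof -
  show "0 < \<phi>" "\<phi> < 1" using gamma by (auto simp: \<phi>_def)
  show 3: "\<phi> * (1 + \<gamma>) = 2" using gamma unfolding \<phi>_def by (intro nonzero_eq_divide_eq[THEN iffD1, OF _ refl]) simp
  then show "- (\<phi> * \<gamma>) = \<phi> - 2" by (simp add: algebra_simps)
qed

text \<open>The comparison takes place in a ball around \<open>x\<close> whose radius is a fixed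
  fraction of \<open>depth x\<close>. Only positivity of \<open>v\<close> is used on the sphere,
  where the subsolution vanishes.\<close>

lemma sol_lower_bound:
  assumes v: "sol v"
  obtains c where "0 < c" "\<And>x. x \<in> Cone \<inter> ball 0 (1/2) \<Longrightarrow> c * depth x powr \<phi> \<le> v x"
proof -
  define n where "n = real DIM((real ^ 'm) \<times> real)"
  have n: "0 < n" unfolding n_def using DIM_positive by simp
  \<comment> \<open>With A = \<epsilon> \<rho>^(-\<phi>) this gives A^(1+\<gamma>) (4 + 2 n)
    \<rho>^2 = lam. The number (4 + 2 n) \<rho>^2 bounds the bracket in minus the Laplacian of
    q^\<phi>: 4 \<rho>^2 from the gradient term and 2 n \<rho>^2 from the Laplacian of q.\<close>
  define \<epsilon> where "\<epsilon> = (lam / (4 + 2 * n)) powr (1 / (1 + \<gamma>))"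
  have \<epsilon>: "0 < \<epsilon>" using lam n by (simp add: \<epsilon>_def)
  have \<epsilon>p: "\<epsilon> powr (1 + \<gamma>) = lam / (4 + 2 * n)" using lam n gamma by (simp add: \<epsilon>_def powr_powr)
  define k where "k = 1 / (2 * (1 + B))"
  have k: "0 < k" using B by (simp add: k_def)
  show ?thesis
  proof (rule that[of "\<epsilon> * k powr \<phi>"])
    show "0 < \<epsilon> * k powr \<phi>" using \<epsilon> k by simp
    fix x assume x: "x \<in> Cone \<inter> ball 0 (1/2)"
    then have d: "0 < depth x" by (simp add: mem_Cone)
    define \<rho> where "\<rho> = k * depth x"
    have \<rho>: "0 < \<rho>" using k d by (simp add: \<rho>_def)
    have "\<rho> \<le> k * ((1 + B) * norm x)" unfolding \<rho>_def using depth_le[of x] k by (intro mult_left_mono) auto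
    also have "\<dots> = k * (2 * (1 + B)) * norm x / 2" by simp
    also have "k * (2 * (1 + B)) = 1" using B unfolding k_def by (intro nonzero_eq_divide_eq[THEN iffD1, OF _ refl]) simp
    also have "1 * norm x / 2 = norm x / 2" by simp
    finally have \<rho>x: "\<rho> \<le> norm x / 2" .
    define A where "A = \<epsilon> * \<rho> powr (- \<phi>)"
    have A: "0 < A" using \<epsilon> \<rho> by (simp add: A_def)
    have "A powr (1 + \<gamma>) = \<epsilon> powr (1 + \<gamma>) * \<rho> powr (- (\<phi> * (1 + \<gamma>)))"
      unfolding A_def using \<epsilon> \<rho> by (simp add: powr_mult powr_powr)
    also have "\<dots> = lam / (4 + 2 * n) / \<rho>\<^sup>2" unfolding \<epsilon>p \<phi>(3) using \<rho> by (simp add: powr_minus divide_inverse)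
    finally have Ap: "A * A powr \<gamma> * ((4 + 2 * n) * \<rho>\<^sup>2) = lam" using A n \<rho> by (simp add: powr_add)
    define q where "q y = \<rho>\<^sup>2 - (norm (y - x))\<^sup>2" for y
    have q: "0 < q y" if "y \<in> ball x \<rho>" for y
      unfolding q_def using that by (simp add: dist_norm norm_minus_commute power_strict_mono)
    have hq: "has_grad_lap (ball x \<rho>) q (\<lambda>y. 0 - 2 *\<^sub>R (y - x)) (\<lambda>y. 0 - 2 * n)"
      unfolding q_def n_def by (intro has_grad_lap_diff has_grad_lap_const has_grad_lap_norm_sq open_ball)
    have cq: "continuous_on (ball x \<rho>) q" by (rule has_grad_lap_continuous_on[OF hq])
    have "has_grad_lap (ball x \<rho>) (\<lambda>y. q y powr \<phi>) (\<lambda>y. (\<phi> * q y powr (\<phi> - 1)) *\<^sub>R (0 - 2 *\<^sub>R (y - x)))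
       (\<lambda>y. (\<phi> * ((\<phi> - 1) * q y powr (\<phi> - 1 - 1))) * (norm (0 - 2 *\<^sub>R (y - x)))\<^sup>2 + (\<phi> * q y powr (\<phi> - 1)) * (0 - 2 * n))"
    proof (rule has_grad_lap_chain[OF hq])
      fix y assume "y \<in> ball x \<rho>"
      note qy = q[OF this]
      show "((\<lambda>t. t powr \<phi>) has_real_derivative \<phi> * q y powr (\<phi> - 1)) (at (q y))"
        using qy by (rule has_real_derivative_powr)
      show "((\<lambda>t. \<phi> * t powr (\<phi> - 1)) has_real_derivative \<phi> * ((\<phi> - 1) * q y powr (\<phi> - 1 - 1))) (at (q y))"
        by (intro DERIV_cmult has_real_derivative_powr qy)
    next
      show "continuous_on (ball x \<rho>) (\<lambda>y. \<phi> * ((\<phi> - 1) * q y powr (\<phi> - 1 - 1)))"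
        using q by (intro continuous_intros cq) force
    qed
    note hs = has_grad_lap_cmult[OF this, of A]
    have "A * q x powr \<phi> \<le> v x"
    proof (rule subsolution_comparison[OF v open_ball _ hs])
      have "ball x \<rho> \<subseteq> Cone" using cball_subset_Cone[of x] x ball_subset_cball by (force simp: \<rho>_def k_def)
      moreover have "ball x \<rho> \<subseteq> ball 0 1" 
      proof
        fix y assume "y \<in> ball x \<rho>"
        then have "norm (y - x) < \<rho>" by (simp add: dist_norm norm_minus_commute)
        moreover have "norm x < 1 / 2" using x by simp
        moreover have "norm y \<le> norm x + norm (y - x)" using norm_triangle_ineq[of x "y - x"] by simp
        ultimately show "y \<in> ball 0 1" using \<rho>x by simp
      qed
      ultimately show "ball x \<rho> \<subseteq> \<Omega>" by blast
      show "x \<in> ball x \<rho>" using \<rho> by simp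
    next
      fix y assume y: "y \<in> ball x \<rho>"
      note qy = q[OF y]
      have t: "(norm (y - x))\<^sup>2 \<le> \<rho>\<^sup>2" "q y \<le> \<rho>\<^sup>2" using qy by (auto simp: q_def)
      have e1: "(norm (0 - 2 *\<^sub>R (y - x)))\<^sup>2 = 4 * (norm (y - x))\<^sup>2" by (simp add: power_mult_distrib del: scaleR_diff_right)
      have e2: "q y powr (\<phi> - 1) = q y powr (\<phi> - 2) * q y"
        using qy powr_add[of "q y" "\<phi> - 2" 1] by simp
      have "- (A * (\<phi> * ((\<phi> - 1) * q y powr (\<phi> - 1 - 1)) * (norm (0 - 2 *\<^sub>R (y - x)))\<^sup>2 + \<phi> * q y powr (\<phi> - 1) * (0 - 2 * n)))
        = A * q y powr (\<phi> - 2) * (\<phi> * ((1 - \<phi>) * (4 * (norm (y - x))\<^sup>2) + 2 * n * q y))"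
        unfolding e1 e2 by (simp add: algebra_simps)
      also have "\<dots> \<le> A * q y powr (\<phi> - 2) * ((4 + 2 * n) * \<rho>\<^sup>2)"
      proof (rule mult_left_mono)
        have "(1 - \<phi>) * (4 * (norm (y - x))\<^sup>2) \<le> 1 * (4 * \<rho>\<^sup>2)" using \<phi> t by (intro mult_mono) auto
        moreover have "2 * n * q y \<le> 2 * n * \<rho>\<^sup>2" using n t by (intro mult_left_mono) auto
        moreover have "0 \<le> (1 - \<phi>) * (4 * (norm (y - x))\<^sup>2)" "0 \<le> 2 * n * q y" using \<phi> n qy by auto
        ultimately have "(1 - \<phi>) * (4 * (norm (y - x))\<^sup>2) + 2 * n * q y \<le> (4 + 2 * n) * \<rho>\<^sup>2"
          "0 \<le> (1 - \<phi>) * (4 * (norm (y - x))\<^sup>2) + 2 * n * q y" by (auto simp: algebra_simps)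
        then show "\<phi> * ((1 - \<phi>) * (4 * (norm (y - x))\<^sup>2) + 2 * n * q y) \<le> (4 + 2 * n) * \<rho>\<^sup>2"
          using \<phi> mult_mono[of \<phi> 1 "(1 - \<phi>) * (4 * (norm (y - x))\<^sup>2) + 2 * n * q y" "(4 + 2 * n) * \<rho>\<^sup>2"] by linarith
      qed (use A in auto)
      also have "\<dots> = lam * (A powr (- \<gamma>) * q y powr (\<phi> - 2))"
        unfolding Ap[symmetric] using A by (simp add: powr_minus)
      also have "\<dots> = lam * (A * q y powr \<phi>) powr (- \<gamma>)"
        using A qy \<phi>(4) by (simp add: powr_mult powr_powr)
      finally show "- (A * (\<phi> * ((\<phi> - 1) * q y powr (\<phi> - 1 - 1)) * (norm (0 - 2 *\<^sub>R (y - x)))\<^sup>2 + \<phi> * q y powr (\<phi> - 1) * (0 - 2 * n)))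
        \<le> lam * (A * q y powr \<phi>) powr - \<gamma>" .
    next
      fix z and e :: real assume z: "z \<in> frontier (ball x \<rho>)" and e: "0 < e"
      have "norm (z - x) = \<rho>" using z \<rho> by (simp add: frontier_ball dist_norm norm_minus_commute)
      then have qz: "q z = 0" by (simp add: q_def)
      have "(q \<longlongrightarrow> q z) (at z within ball x \<rho>)" unfolding q_def by (intro tendsto_intros)
      then have q0: "(q \<longlongrightarrow> 0) (at z within ball x \<rho>)" by (simp add: qz)
      have inb: "\<forall>\<^sub>F y in at z within ball x \<rho>. y \<in> ball x \<rho>" by (simp add: eventually_at_filter)
      have "((\<lambda>y. q y powr \<phi>) \<longlongrightarrow> 0) (at z within ball x \<rho>)"
      proof (rule tendsto_zero_powrI[OF q0 tendsto_const _ \<phi>(1)])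
        show "\<forall>\<^sub>F y in at z within ball x \<rho>. 0 \<le> q y" using inb by eventually_elim (use q in force)
      qed
      then have "((\<lambda>y. A * q y powr \<phi>) \<longlongrightarrow> A * 0) (at z within ball x \<rho>)" by (intro tendsto_mult tendsto_const)
      then have "\<forall>\<^sub>F y in at z within ball x \<rho>. A * q y powr \<phi> < e" using e by (intro order_tendstoD(2)) auto
      then show "\<forall>\<^sub>F y in at z within ball x \<rho>. - e < v y - A * q y powr \<phi>"
        using inb
      proof eventually_elim
        case (elim y)
        have "y \<in> Cone" using cball_subset_Cone[of x] x elim(2) ball_subset_cball by (force simp: \<rho>_def k_def)
        moreover have "norm y < 1"
        proof -
          have "norm (y - x) < \<rho>" using elim(2) by (simp add: dist_norm norm_minus_commute)
          moreover have "norm x < 1 / 2" using x by simp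
          moreover have "norm y \<le> norm x + norm (y - x)" using norm_triangle_ineq[of x "y - x"] by simp
          ultimately show ?thesis using \<rho>x by simp
        qed
        ultimately show ?case using sol_pos[OF v, of y] elim(1) by simp
      qed
    qed
    moreover have "A * q x powr \<phi> = \<epsilon> * k powr \<phi> * depth x powr \<phi>"
    proof -
      have "q x powr \<phi> = \<rho> powr \<phi> * \<rho> powr \<phi>" using \<rho> by (simp add: q_def power2_eq_square powr_mult)
      then have "A * q x powr \<phi> = \<epsilon> * \<rho> powr \<phi>" using \<rho> by (simp add: A_def powr_minus)
      then show ?thesis using k d by (simp add: \<rho>_def powr_mult)
    qed
    ultimately show "\<epsilon> * k powr \<phi> * depth x powr \<phi> \<le> v x" by simp
  qed
qed

lemma sol_small:
  assumes u: "sol u" and z: "depth z = 0" "norm z < 1" and W: "W \<subseteq> \<Omega>" and e: "0 < \<delta>"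
  shows "\<forall>\<^sub>F x in at z within W. u x < \<delta>"
proof -
  have "z \<in> closure Cone \<inter> ball 0 1" using z by (simp add: closure_Cone)
  then have "(u \<longlongrightarrow> u z) (at z within closure Cone \<inter> ball 0 1)"
    using sol_continuous_on[OF u] unfolding continuous_on_def by blast
  then have "(u \<longlongrightarrow> u z) (at z within W)"
    by (rule tendsto_within_subset) (use W \<Omega>_closure in blast)
  moreover have "u z < \<delta>" using sol_zero[OF u _ z(1)] z(2) e by simp
  ultimately show ?thesis by (rule order_tendstoD(2))
qed

lemma frontier_Cone_ball:
  assumes "z \<in> frontier (Cone \<inter> ball a r)"
  shows "dist a z \<le> r" "depth z = 0 \<or> z \<in> Cone \<and> dist a z = r"
proof -
  have o: "open (Cone \<inter> ball a r)" using open_Cone by auto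
  have z: "z \<in> closure (Cone \<inter> ball a r)" "z \<notin> Cone \<inter> ball a r"
    using assms unfolding frontier_def interior_open[OF o] by blast+
  have "closure (Cone \<inter> ball a r) \<subseteq> closure Cone" by (rule closure_mono) blast
  moreover have "closure (Cone \<inter> ball a r) \<subseteq> cball a r"
    using ball_subset_cball by (intro closure_minimal closed_cball) blast
  ultimately have "0 \<le> depth z" and d: "dist a z \<le> r" using z(1) by (auto simp: closure_Cone)
  then show "dist a z \<le> r" "depth z = 0 \<or> z \<in> Cone \<and> dist a z = r" using z(2) by (auto simp: mem_Cone)
qed

text \<open>In the part of the cone near the foot point of \<open>x\<close>, u is compared with v +
  M b, where b is the barrier and M bounds u. On the cone boundary u vanishes; on the spherical part
  M b \<ge> M \<ge> u. Evaluating b at \<open>x\<close> gives the linear bound in the depth.\<close>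

lemma sol_difference_depth:
  assumes u: "sol u" "sol v" and z: "z \<noteq> 0" "depth z = 0" "norm z < 1 / 2"
  shows "\<exists>r>0. \<exists>C>0. \<forall>x\<in>Cone. dist z x < r \<longrightarrow> u x \<le> v x + C * depth x"
proof -
  obtain r where r: "0 < r" "0 < norm (fst z)"
    "\<And>x. x \<in> Cone \<Longrightarrow> dist z x < r \<Longrightarrow> norm (fst z) / 2 \<le> norm (fst x) \<and> depth x < norm (fst x) / 16"
    using near_boundary[OF z(1,2)] by metis
  obtain C0 where C0: "0 < C0"
    "\<And>p. p \<noteq> 0 \<Longrightarrow> \<exists>b G L. has_grad_lap (Cone \<inter> ball (p, g p) (norm p)) b G L \<and>
        (\<forall>z \<in> Cone \<inter> ball (p, g p) (norm p). L z \<le> 0) \<and> continuous_on UNIV b \<and>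
        (\<forall>z \<in> closure Cone \<inter> ball (p, g p) (norm p). 0 \<le> b z \<and> (norm p / 2 \<le> dist (p, g p) z \<longrightarrow> 1 \<le> b z)) \<and>
        (\<forall>d. 0 \<le> d \<and> d < norm p \<longrightarrow> b (p, g p + d) \<le> C0 * d / norm p)"
    using exterior_barrier by blast
  \<comment> \<open>The radius 63/64 contains the comparison region: |x0| < 9/16, s < 33/64, and
    9/16 + 3 s / 4 stays below 63/64.\<close>
  define S where "S = closure Cone \<inter> cball 0 (63/64)"
  have "compact S" unfolding S_def by (intro closed_Int_compact compact_cball closed_closure)
  moreover have "continuous_on S u" by (rule continuous_on_subset[OF sol_continuous_on[OF u(1)]]) (auto simp: S_def)
  ultimately have "bounded (u ` S)" by (intro compact_imp_bounded compact_continuous_image)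
  then obtain M where M: "0 < M" "\<And>x. x \<in> S \<Longrightarrow> \<bar>u x\<bar> \<le> M" unfolding bounded_pos by auto
  define C where "C = M * C0 / (norm (fst z) / 2)"
  have C: "0 < C" using M C0(1) r(2) by (simp add: C_def)
  define r' where "r' = min r (1 / 64)"
  have r': "0 < r'" using r(1) by (simp add: r'_def)
  have "u x \<le> v x + C * depth x" if x: "x \<in> Cone" "dist z x < r'" for x
  proof -
    have d: "0 < depth x" using x by (simp add: mem_Cone)
    define p where "p = fst x"
    define s where "s = norm p"
    define x0 where "x0 = (p, g p)"
    have s: "norm (fst z) / 2 \<le> s" "depth x < s / 16" using r(3)[of x] x by (auto simp: s_def p_def r'_def)
    then have s0: "0 < s" "p \<noteq> 0" using r(2) by (auto simp: s_def)
    have "norm x \<le> norm z + norm (z - x)" using norm_triangle_ineq4[of z "z - x"] by simp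
    then have nx: "norm x < 33 / 64" using x(2) z(3) by (simp add: r'_def dist_norm)
    then have sx: "s < 33 / 64" using norm_fst_le[of "fst x" "snd x"] by (simp add: s_def p_def)
    have dx: "dist x0 x = depth x"
    proof -
      have "x0 - x = (0, - depth x)" by (simp add: x0_def p_def depth_def prod_eq_iff)
      then show ?thesis using d by (simp add: dist_norm norm_Pair)
    qed
    have "norm x0 \<le> norm x + dist x0 x" using norm_triangle_ineq[of x "x0 - x"] by (simp add: dist_norm)
    then have nx0: "norm x0 < 9 / 16" using dx s nx sx by linarith
    obtain b G L where b: "has_grad_lap (Cone \<inter> ball x0 s) b G L" "\<And>y. y \<in> Cone \<inter> ball x0 s \<Longrightarrow> L y \<le> 0"
      "\<And>y. y \<in> closure Cone \<inter> ball x0 s \<Longrightarrow> 0 \<le> b y" "\<And>y. y \<in> closure Cone \<inter> ball x0 s \<Longrightarrow> s / 2 \<le> dist x0 y \<Longrightarrow> 1 \<le> b y"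
      "\<And>d. 0 \<le> d \<Longrightarrow> d < s \<Longrightarrow> b (p, g p + d) \<le> C0 * d / s"
      using C0(2)[OF s0(2)] unfolding x0_def[symmetric] s_def[symmetric] by metis
    \<comment> \<open>Radius 3 s / 4 keeps the frontier inside the domain of the barrier, and leaves
      a margin s/4 to the sphere of radius s/2 beyond which the barrier is at least 1.\<close>
    define W where "W = Cone \<inter> ball x0 (3 * s / 4)"
    have oW: "open W" using open_Cone by (auto simp: W_def)
    have Wb: "W \<subseteq> Cone \<inter> ball x0 s" using s0 by (auto simp: W_def)
    have Wc: "Cone \<inter> ball x0 s \<subseteq> closure Cone \<inter> ball x0 s" using closure_subset by auto
    have nW: "norm y < 63 / 64" if "dist x0 y \<le> 3 * s / 4" for y
    proof -
      have "norm y \<le> norm x0 + dist x0 y" using norm_triangle_ineq4[of x0 "x0 - y"] by (simp add: dist_norm)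
      then show ?thesis using nx0 sx that by linarith
    qed
    have yW: "y \<in> closure Cone \<and> y \<in> Cone \<and> norm y < 63 / 64" if "y \<in> W" for y
      using that nW[of y] closure_subset[of Cone] by (auto simp: W_def)
    have WS: "W \<subseteq> S" 
    proof
      fix y assume "y \<in> W"
      then show "y \<in> S" using yW[of y] by (simp add: S_def)
    qed
    have W\<Omega>: "W \<subseteq> \<Omega>"
    proof
      fix y assume "y \<in> W"
      then show "y \<in> \<Omega>" using yW[of y] by simp
    qed
    have "u x \<le> 1 * v x + M * b x"
    proof (rule difference_comparison[OF u oW W\<Omega> order_refl has_grad_lap_cmult[OF has_grad_lap_subset[OF b(1) oW Wb]]])
      show "M * L y \<le> 0" if "y \<in> W" for y using b(2)[OF subsetD[OF Wb that]] M(1) by (intro mult_nonneg_nonpos) auto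
      show "0 \<le> M * b y" if "y \<in> W" for y using b(3)[OF subsetD[OF Wc subsetD[OF Wb that]]] M(1) by (intro mult_nonneg_nonneg) auto
      show "x \<in> W" using x dx s s0 by (simp add: W_def)
    next
      fix w and e :: real assume w: "w \<in> frontier W" and e: "0 < e"
      have iW: "\<forall>\<^sub>F y in at w within W. y \<in> W" by (simp add: eventually_at_filter)
      have w2: "dist x0 w \<le> 3 * s / 4" "depth w = 0 \<or> w \<in> Cone \<and> dist x0 w = 3 * s / 4"
        using frontier_Cone_ball[OF w[unfolded W_def]] by auto
      from w2(2) have "\<forall>\<^sub>F y in at w within W. u y < e + M * b y"
      proof
        assume "depth w = 0"
        then have "\<forall>\<^sub>F y in at w within W. u y < e" using sol_small[OF u(1) _ _ W\<Omega> e] nW[OF w2(1)] by simp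
        then show ?thesis using iW
        proof eventually_elim
          case (elim y)
          have "0 \<le> M * b y" using b(3)[OF subsetD[OF Wc subsetD[OF Wb elim(2)]]] M(1) by (intro mult_nonneg_nonneg) auto
          then show ?case using elim(1) by simp
        qed
      next
        assume w3: "w \<in> Cone \<and> dist x0 w = 3 * s / 4"
        have "\<forall>\<^sub>F y in at w within W. y \<in> ball w (s / 4)"
          using s0 by (intro eventually_at_topological[THEN iffD2] exI[of _ "ball w (s / 4)"]) auto
        then show ?thesis using iW
        proof eventually_elim
          case (elim y)
          have "s / 2 \<le> dist x0 y" using elim(1) w3 dist_triangle[of x0 w y] by (simp add: dist_commute)
          then have "1 \<le> b y" using b(4)[of y] elim(2) Wb Wc by blast
          then have "M * 1 \<le> M * b y" using M(1) by (intro mult_left_mono) auto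
          moreover have "u y \<le> M" using M(2)[of y] WS elim(2) by auto
          ultimately show ?case using e by linarith
        qed
      qed
      then show "\<forall>\<^sub>F y in at w within W. - e < 1 * v y + M * b y - u y"
        using iW
      proof eventually_elim
        case (elim y)
        then show ?case using sol_pos[OF u(2) subsetD[OF W\<Omega> elim(2)]] by simp
      qed
    qed
    moreover have "b x \<le> C0 * depth x / (norm (fst z) / 2)"
    proof -
      have "b x \<le> C0 * depth x / s" using b(5)[of "depth x"] d s s0 by (simp add: p_def pair_depth)
      also have "\<dots> \<le> C0 * depth x / (norm (fst z) / 2)" using s r(2) C0(1) d by (intro divide_left_mono mult_pos_pos) auto
      finally show ?thesis .
    qed
    then have "M * b x \<le> M * (C0 * depth x / (norm (fst z) / 2))" using M(1) by (intro mult_left_mono) auto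
    moreover have "M * (C0 * depth x / (norm (fst z) / 2)) = C * depth x" by (simp add: C_def)
    ultimately show ?thesis by linarith
  qed
  then show ?thesis using r' C by blast
qed

text \<open>Since \<phi> < 1, the depth is the small factor depth^(1-\<phi>) times depth^\<phi>, and
  the latter is controlled by \<open>v\<close>.\<close>

lemma depth_below_sol:
  assumes v: "sol v" and z: "depth z = 0" "norm z < 1 / 2" and C: "0 < C" and \<epsilon>: "0 < \<epsilon>"
  shows "\<exists>r>0. \<forall>x\<in>Cone. dist z x < r \<longrightarrow> C * depth x \<le> \<epsilon> * v x"
proof -
  obtain c where c: "0 < c" "\<And>x. x \<in> Cone \<inter> ball 0 (1/2) \<Longrightarrow> c * depth x powr \<phi> \<le> v x"
    using sol_lower_bound[OF v] by blast
  \<comment> \<open>The depth at which C t^(1-\<phi>) = \<epsilon> c.\<close>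
  define t where "t = (\<epsilon> * c / C) powr (1 / (1 - \<phi>))"
  have t: "0 < t" using \<epsilon> c C by (simp add: t_def)
  have tp: "t powr (1 - \<phi>) = \<epsilon> * c / C" using \<epsilon> c C \<phi> by (simp add: t_def powr_powr)
  define r where "r = min (1 / 2 - norm z) (t / (1 + B))"
  have r: "0 < r" using z t B by (simp add: r_def)
  have "C * depth x \<le> \<epsilon> * v x" if x: "x \<in> Cone" "dist z x < r" for x
  proof -
    have d: "0 < depth x" using x by (simp add: mem_Cone)
    have "norm x \<le> norm z + norm (z - x)" using norm_triangle_ineq4[of z "z - x"] by simp
    then have nx: "x \<in> ball 0 (1/2)" using x(2) by (simp add: r_def dist_norm)
    have "depth x \<le> (1 + B) * norm (x - z)" using depth_Lipschitz[of x z] z(1) by simp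
    also have "\<dots> \<le> (1 + B) * (t / (1 + B))" using x(2) B by (intro mult_left_mono) (auto simp: r_def dist_norm norm_minus_commute)
    finally have "depth x \<le> t" using B by simp
    then have "depth x powr (1 - \<phi>) \<le> \<epsilon> * c / C" unfolding tp[symmetric] using d \<phi> by (intro powr_mono2) auto
    then have "C * (depth x powr (1 - \<phi>) * depth x powr \<phi>) \<le> C * (\<epsilon> * c / C * depth x powr \<phi>)"
      using C by (intro mult_left_mono mult_right_mono) auto
    then have "C * depth x \<le> \<epsilon> * (c * depth x powr \<phi>)" using d C by (simp add: powr_add[symmetric] mult_ac)
    also have "\<dots> \<le> \<epsilon> * v x" using c(2)[of x] x nx \<epsilon> by (intro mult_left_mono) auto
    finally show ?thesis .
  qed
  then show ?thesis using r by blast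
qed

lemma sol_ratio_near_boundary:
  assumes u: "sol u" "sol v" and z: "z \<noteq> 0" "depth z = 0" "norm z < 1 / 2" and \<epsilon>: "0 < \<epsilon>"
  shows "\<exists>r>0. \<forall>x\<in>Cone. dist z x < r \<longrightarrow> u x \<le> (1 + \<epsilon>) * v x"
proof -
  obtain r C where r: "0 < r" "0 < C" "\<And>x. x \<in> Cone \<Longrightarrow> dist z x < r \<Longrightarrow> u x \<le> v x + C * depth x"
    using sol_difference_depth[OF u z] by blast
  obtain r' where r': "0 < r'" "\<And>x. x \<in> Cone \<Longrightarrow> dist z x < r' \<Longrightarrow> C * depth x \<le> \<epsilon> * v x"
    using depth_below_sol[OF u(2) z(2,3) r(2) \<epsilon>] by blast
  have "u x \<le> (1 + \<epsilon>) * v x" if "x \<in> Cone" "dist z x < min r r'" for x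
    using r(3)[of x] r'(2)[of x] that by (simp add: algebra_simps)
  then show ?thesis using r(1) r'(1) by (metis min_less_iff_conj)
qed

end

section \<open>The logarithmic subsolution and the vertex\<close>

lemma has_grad_lap_log_powr:
  fixes U :: "'a::euclidean_space set"
  assumes U: "open U" "\<And>x. x \<in> U \<Longrightarrow> x \<noteq> 0 \<and> norm x < 1"
  shows "has_grad_lap U (\<lambda>x. (- ln (norm x)) powr a) (\<lambda>x. (- a * (- ln (norm x)) powr (a - 1) / (norm x)\<^sup>2) *\<^sub>R x)
    (\<lambda>x. (a * (a - 1) * (- ln (norm x)) powr (a - 2) + a * (2 - real DIM('a)) * (- ln (norm x)) powr (a - 1)) / (norm x)\<^sup>2)"
proof -
  \<comment> \<open>Chosen so that l (|x|^2) = -ln |x|; the chain rule can then start from the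
    smooth function |x|^2.\<close>
  define l where "l t = - ln t / 2" for t :: real
  define n where "n = real DIM('a)"
  have N: "has_grad_lap U (\<lambda>x::'a. (norm (x - 0))\<^sup>2) (\<lambda>x. 2 *\<^sub>R (x - 0)) (\<lambda>x. 2 * n)"
    unfolding n_def by (rule has_grad_lap_norm_sq[OF U(1)])
  have l: "l ((norm (x - 0))\<^sup>2) = - ln (norm x)" "0 < - ln (norm x)" "0 < (norm (x - 0))\<^sup>2" "0 < l ((norm (x - 0))\<^sup>2)" if "x \<in> U" for x
    using U(2)[OF that] by (auto simp: l_def ln_realpow)
  have dl: "(l has_real_derivative - 1 / (2 * t)) (at t)" if "0 < t" for t
    unfolding l_def using that by (auto intro!: derivative_eq_intros)
  have "has_grad_lap U (\<lambda>x. l ((norm (x - 0))\<^sup>2) powr a)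
     (\<lambda>x. (a * l ((norm (x - 0))\<^sup>2) powr (a - 1) * (- 1 / (2 * (norm (x - 0))\<^sup>2))) *\<^sub>R 2 *\<^sub>R (x - 0))
     (\<lambda>x. (a * ((a - 1) * l ((norm (x - 0))\<^sup>2) powr (a - 2) / (4 * ((norm (x - 0))\<^sup>2)\<^sup>2) + l ((norm (x - 0))\<^sup>2) powr (a - 1) / (2 * ((norm (x - 0))\<^sup>2)\<^sup>2)))
        * (norm (2 *\<^sub>R (x - 0)))\<^sup>2 + (a * l ((norm (x - 0))\<^sup>2) powr (a - 1) * (- 1 / (2 * (norm (x - 0))\<^sup>2))) * (2 * n))"
  proof (rule has_grad_lap_chain[OF N])
    fix x assume x: "x \<in> U"
    define t where "t = (norm (x - 0))\<^sup>2"
    have t: "0 < t" "0 < l t" using l(3,4)[OF x] unfolding t_def by auto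
    show "((\<lambda>t. l t powr a) has_real_derivative a * l ((norm (x - 0))\<^sup>2) powr (a - 1) * (- 1 / (2 * (norm (x - 0))\<^sup>2))) (at ((norm (x - 0))\<^sup>2))"
      unfolding t_def[symmetric] using DERIV_fun_powr[OF dl[OF t(1)] t(2), of a] by simp
    have "((\<lambda>t. l t powr (a - 1)) has_real_derivative (a - 1) * l t powr (a - 2) * (- 1 / (2 * t))) (at t)"
      using DERIV_fun_powr[OF dl[OF t(1)] t(2), of "a - 1"] by simp
    moreover have "((\<lambda>t. - 1 / (2 * t)) has_real_derivative 1 / (2 * t\<^sup>2)) (at t)"
      using t by (auto intro!: derivative_eq_intros simp: power2_eq_square)
    ultimately have "((\<lambda>t. l t powr (a - 1) * (- 1 / (2 * t))) has_real_derivative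
        (a - 1) * l t powr (a - 2) * (- 1 / (2 * t)) * (- 1 / (2 * t)) + 1 / (2 * t\<^sup>2) * l t powr (a - 1)) (at t)"
      by (rule DERIV_mult)
    then have "((\<lambda>t. a * (l t powr (a - 1) * (- 1 / (2 * t)))) has_real_derivative
        a * ((a - 1) * l t powr (a - 2) * (- 1 / (2 * t)) * (- 1 / (2 * t)) + 1 / (2 * t\<^sup>2) * l t powr (a - 1))) (at t)"
      by (rule DERIV_cmult)
    moreover have "a * ((a - 1) * l t powr (a - 2) * (- 1 / (2 * t)) * (- 1 / (2 * t)) + 1 / (2 * t\<^sup>2) * l t powr (a - 1))
       = a * ((a - 1) * l t powr (a - 2) / (4 * t\<^sup>2) + l t powr (a - 1) / (2 * t\<^sup>2))"
      by (simp add: power2_eq_square)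
    ultimately show "((\<lambda>t. a * l t powr (a - 1) * (- 1 / (2 * t))) has_real_derivative
      a * ((a - 1) * l ((norm (x - 0))\<^sup>2) powr (a - 2) / (4 * ((norm (x - 0))\<^sup>2)\<^sup>2) + l ((norm (x - 0))\<^sup>2) powr (a - 1) / (2 * ((norm (x - 0))\<^sup>2)\<^sup>2)))
       (at ((norm (x - 0))\<^sup>2))"
      unfolding t_def[symmetric] by (simp only: mult.assoc)
  next
    have cl: "continuous_on U (\<lambda>x. l ((norm (x - 0))\<^sup>2))"
      unfolding l_def using l(3) by (intro continuous_intros) force+
    show "continuous_on U (\<lambda>x. a * ((a - 1) * l ((norm (x - 0))\<^sup>2) powr (a - 2) / (4 * ((norm (x - 0))\<^sup>2)\<^sup>2) + l ((norm (x - 0))\<^sup>2) powr (a - 1) / (2 * ((norm (x - 0))\<^sup>2)\<^sup>2)))"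
      using l(3,4) by (intro continuous_intros cl) force+
  qed
  then show ?thesis
    unfolding n_def[symmetric]
  proof (rule has_grad_lap_cong)
    fix x assume x: "x \<in> U"
    define q where "q = (norm x)\<^sup>2"
    have q: "0 < q" using l(3)[OF x] by (simp add: q_def)
    have lq: "l q = - ln (norm x)" using l(1)[OF x] by (simp add: q_def)
    have nq: "(norm (2 *\<^sub>R (x - 0)))\<^sup>2 = 4 * q" by (simp add: q_def power_mult_distrib)
    have qq: "(norm (x - 0))\<^sup>2 = q" by (simp add: q_def)
    show "l ((norm (x - 0))\<^sup>2) powr a = (- ln (norm x)) powr a" unfolding qq lq ..
    show "(a * l ((norm (x - 0))\<^sup>2) powr (a - 1) * (- 1 / (2 * (norm (x - 0))\<^sup>2))) *\<^sub>R 2 *\<^sub>R (x - 0) =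
         (- a * (- ln (norm x)) powr (a - 1) / (norm x)\<^sup>2) *\<^sub>R x"
      unfolding qq lq q_def[symmetric] by simp
    show "(a * ((a - 1) * l ((norm (x - 0))\<^sup>2) powr (a - 2) / (4 * ((norm (x - 0))\<^sup>2)\<^sup>2) + l ((norm (x - 0))\<^sup>2) powr (a - 1) / (2 * ((norm (x - 0))\<^sup>2)\<^sup>2)))
        * (norm (2 *\<^sub>R (x - 0)))\<^sup>2 + (a * l ((norm (x - 0))\<^sup>2) powr (a - 1) * (- 1 / (2 * (norm (x - 0))\<^sup>2))) * (2 * n)
       = (a * (a - 1) * (- ln (norm x)) powr (a - 2) + a * (2 - n) * (- ln (norm x)) powr (a - 1)) / (norm x)\<^sup>2"
      unfolding nq unfolding qq lq q_def[symmetric] using q by (simp add: field_simps power2_eq_square)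
  qed
qed

text \<open>Explains the radius 1/3 of the region \<open>W\<close>: it lies below 1/e, so the
  logarithm is at least 1 and its powers are ordered by their exponents.\<close>

lemma log_norm_ge_1:
  fixes x :: "'a::real_normed_vector"
  assumes "norm x \<le> 1 / 3" "x \<noteq> 0"
  shows "1 \<le> - ln (norm x)"
proof -
  have "norm x * exp 1 \<le> 1 / 3 * 3" using assms exp_le by (intro mult_mono) auto
  then have "norm x \<le> exp (- 1)" by (simp add: exp_minus divide_simps)
  then have "ln (norm x) \<le> ln (exp (- 1))" using assms by (intro ln_mono) auto
  then show ?thesis by simp
qed

locale sing_harm = sing g \<Gamma> B K1 f \<gamma> lam Lam
  for g :: "real ^ 'm \<Rightarrow> real" and \<Gamma> B K1 f \<gamma> lam Lam +
  fixes h :: "(real ^ 'm) \<times> real \<Rightarrow> real" and \<beta> :: real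
  assumes \<beta>: "\<phi> \<le> \<beta>" and h_harm: "harm Cone h" and h_pos: "x \<in> Cone \<Longrightarrow> 0 < h x"
    and h_le: "x \<in> Cone \<Longrightarrow> h x \<le> norm x powr \<beta>"
    and h_hom: "x \<in> Cone \<Longrightarrow> 0 < t \<Longrightarrow> h (t *\<^sub>R x) = t powr \<beta> * h x"
    and h_depth: "z \<noteq> 0 \<Longrightarrow> depth z = 0 \<Longrightarrow> \<exists>r>0. \<exists>C>0. \<forall>x\<in>Cone. dist z x < r \<longrightarrow> h x \<le> C * depth x"
begin

definition "W = Cone \<inter> ball 0 (1/3)"

lemma open_W: "open W" and W_\<Omega>: "W \<subseteq> \<Omega>"
  using open_Cone by (auto simp: W_def)

lemma W_ne: "x \<in> W \<Longrightarrow> x \<noteq> 0 \<and> norm x < 1 / 3 \<and> x \<in> Cone"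
  using zero_notin_Cone by (auto simp: W_def)

lemma eventually_in_W: "\<forall>\<^sub>F x in at z within W. x \<in> W"
  by (simp add: eventually_at_filter)

lemma frontier_W:
  assumes "z \<in> frontier W"
  shows "norm z \<le> 1 / 3" "depth z = 0 \<or> z \<in> Cone \<and> norm z = 1 / 3"
  using frontier_Cone_ball[OF assms[unfolded W_def]] by auto

lemma h_grad_lap: "has_grad_lap W h (grad h) (\<lambda>x. 0)"
  by (rule has_grad_lap_subset[OF harm_has_grad_lap[OF open_Cone h_harm] open_W]) (auto simp: W_def)

text \<open>Gives the zero boundary values of the logarithmic subsolution. Away from the vertex the
  logarithm is bounded and \<open>h\<close> decays with the depth; at the vertex half of the power
  |x|^\<beta> absorbs the logarithm.\<close>

lemma h_log_small:
  assumes z: "depth z = 0" "norm z \<le> 1 / 3" and a: "0 < a" "a \<le> 1" and d: "0 < \<delta>"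
  shows "\<forall>\<^sub>F x in at z within W. h x * (- ln (norm x)) powr a < \<delta>"
proof (cases "z = 0")
  case False
  obtain r C where rC: "0 < r" "0 < C" "\<And>x. x \<in> Cone \<Longrightarrow> dist z x < r \<Longrightarrow> h x \<le> C * depth x"
    using h_depth[OF False z(1)] by blast
  have "- ln (norm z) > 0" using log_norm_ge_1[OF z(2) False] by simp
  then have "((\<lambda>x. C * depth x * (- ln (norm x)) powr a) \<longlongrightarrow> C * depth z * (- ln (norm z)) powr a) (at z within W)"
    using False
  proof -
    have "continuous_on UNIV depth" by (intro continuous_intros)
    then have "(depth \<longlongrightarrow> depth z) (at z)" unfolding continuous_on_def by (rule bspec) (rule UNIV_I)
    then have "(depth \<longlongrightarrow> depth z) (at z within W)" by (rule tendsto_within_subset) simp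
    then show ?thesis using False \<open>- ln (norm z) > 0\<close> by (intro tendsto_intros) auto
  qed
  then have "\<forall>\<^sub>F x in at z within W. C * depth x * (- ln (norm x)) powr a < \<delta>"
    using z(1) d by (intro order_tendstoD(2)) auto
  moreover have "\<forall>\<^sub>F x in at z within W. x \<in> ball z r"
    using rC(1) by (intro eventually_at_topological[THEN iffD2] exI[of _ "ball z r"]) auto
  ultimately show ?thesis using eventually_in_W
  proof eventually_elim
    case (elim x)
    have "h x * (- ln (norm x)) powr a \<le> C * depth x * (- ln (norm x)) powr a"
      using rC(3)[of x] elim(2) W_ne[OF elim(3)] by (intro mult_right_mono) auto
    then show ?case using elim(1) by linarith
  qed
next
  case True
  have \<beta>0: "0 < \<beta>" using \<beta> \<phi>(1) by linarith
  have "((\<lambda>x. norm x powr (\<beta> / 2)) \<longlongrightarrow> 0) (at z within W)"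
  proof (rule tendsto_zero_powrI[OF _ tendsto_const])
    have "(norm \<longlongrightarrow> norm z) (at z within W)" by (intro tendsto_intros)
    then show "(norm \<longlongrightarrow> 0) (at z within W)" using True by simp
  qed (use \<beta>0 in auto)
  then have "((\<lambda>x. 2 / \<beta> * norm x powr (\<beta> / 2)) \<longlongrightarrow> 2 / \<beta> * 0) (at z within W)" by (intro tendsto_mult tendsto_const)
  then have "\<forall>\<^sub>F x in at z within W. 2 / \<beta> * norm x powr (\<beta> / 2) < \<delta>" using d by (intro order_tendstoD(2)) auto
  then show ?thesis using eventually_in_W
  proof eventually_elim
    case (elim x)
    note x = W_ne[OF elim(2)]
    define l where "l = - ln (norm x)"
    have l: "1 \<le> l" using log_norm_ge_1[of x] x by (simp add: l_def)
    \<comment> \<open>The chain yields l^a \<le> (2/\<beta>) |x|^(-\<beta>/2), so the product with h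
      \<le> |x|^\<beta> is at most (2/\<beta>) |x|^(\<beta>/2).\<close>
    have "l powr a \<le> l powr 1" using l a by (intro powr_mono) auto
    also have "\<dots> = ln (1 / norm x)" using l x by (simp add: l_def ln_div)
    also have "\<dots> \<le> (1 / norm x) powr (\<beta> / 2) / (\<beta> / 2)" using x \<beta>0 by (intro ln_powr_bound) auto
    also have "\<dots> = 2 / \<beta> * norm x powr (- (\<beta> / 2))" using x by (simp add: powr_minus powr_divide divide_simps)
    finally have "h x * l powr a \<le> norm x powr \<beta> * (2 / \<beta> * norm x powr (- (\<beta> / 2)))"
      using h_le[of x] h_pos[of x] x by (intro mult_mono) auto
    also have "\<dots> = 2 / \<beta> * (norm x powr \<beta> * norm x powr (- (\<beta> / 2)))" by simp
    also have "norm x powr \<beta> * norm x powr (- (\<beta> / 2)) = norm x powr (\<beta> / 2)"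
      by (simp add: powr_add[symmetric])
    finally show ?case using elim(1) by (simp add: l_def)
  qed
qed

text \<open>On the closed cap |x| = 1/3 the points inside the cone take care of themselves by
  continuity and positivity of \<open>G\<close>; a local estimate has to be supplied only at the
  rim.\<close>

lemma cap_dominated:
  fixes F G :: "(real ^ 'm) \<times> real \<Rightarrow> real"
  assumes F: "continuous_on \<Omega> F" "continuous_on \<Omega> G" and G: "\<And>x. x \<in> \<Omega> \<Longrightarrow> 0 < G x"
    and bd: "\<And>z. z \<noteq> 0 \<Longrightarrow> depth z = 0 \<Longrightarrow> norm z = 1 / 3 \<Longrightarrow> \<exists>r>0. \<exists>C>0. \<forall>x\<in>Cone. dist z x < r \<longrightarrow> F x \<le> C * G x"
  obtains C where "0 < C" "\<And>x. x \<in> Cone \<Longrightarrow> norm x = 1 / 3 \<Longrightarrow> F x \<le> C * G x"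
proof -
  obtain C where C: "0 < C" "\<And>x. x \<in> \<Omega> \<inter> (closure Cone \<inter> sphere 0 (1/3)) \<Longrightarrow> F x \<le> C * G x"
  proof (rule compact_dominated[of "closure Cone \<inter> sphere 0 (1/3)" \<Omega> G F])
    show "compact (closure Cone \<inter> sphere 0 (1/3))" by (intro closed_Int_compact closed_closure compact_sphere)
    fix z assume z: "z \<in> closure Cone \<inter> sphere 0 (1/3)"
    show "\<exists>r>0. \<exists>C>0. \<forall>x\<in>\<Omega>. dist z x < r \<longrightarrow> F x \<le> C * G x"
    proof (cases "z \<in> Cone")
      case True
      then have "z \<in> \<Omega>" using z by simp
      then show ?thesis using locally_dominated[OF open_\<Omega> _ F, of z] G[of z] by metis
    next
      case False
      then have "z \<noteq> 0" "depth z = 0" "norm z = 1 / 3" using z by (auto simp: closure_Cone mem_Cone)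
      then show ?thesis using bd[of z] by blast
    qed
  qed (use G in auto)
  show ?thesis
  proof (rule that[OF C(1)])
    fix x assume "x \<in> Cone" "norm x = 1 / 3"
    then show "F x \<le> C * G x" using C(2)[of x] closure_subset[of Cone] by auto
  qed
qed

lemma continuous_on_h: "continuous_on \<Omega> h"
  using harm_continuous_on[OF h_harm] by (rule continuous_on_subset) auto

text \<open>Minus the Laplacian of \<epsilon> h l^a, with l = -ln |x|, is at most \<epsilon> (n + 2
  \<beta>) (h / |x|^2) l^(a-1). Since h^(1+\<gamma>) \<le> |x|^2, this is at most lam (\<epsilon> h
  l^a)^(-\<gamma>) for small \<epsilon>, the powers of l being equal by the choice of a.\<close>

lemma sol_log_lower_bound:
  assumes v: "sol v"
  obtains \<epsilon> where "0 < \<epsilon>" "\<And>x. x \<in> W \<Longrightarrow> \<epsilon> * (h x * (- ln (norm x)) powr (\<phi> / 2)) \<le> v x"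
proof -
  define n where "n = real DIM((real ^ 'm) \<times> real)"
  have n: "2 \<le> n" unfolding n_def by (rule DIM_ge_2)
  define a where "a = \<phi> / 2"
  have a: "0 < a" "a < 1" "- (a * \<gamma>) = a - 1" using \<phi> by (auto simp: a_def)
  have \<beta>0: "0 < \<beta>" using \<beta> \<phi>(1) by linarith
  obtain C where C: "0 < C" "\<And>x. x \<in> Cone \<Longrightarrow> norm x = 1 / 3 \<Longrightarrow> h x \<le> C * v x"
  proof (rule cap_dominated[OF continuous_on_h sol_continuous_on_\<Omega>[OF v] sol_pos[OF v]])
    fix z :: "(real ^ 'm) \<times> real" assume z: "z \<noteq> 0" "depth z = 0" "norm z = 1 / 3"
    obtain r C where r: "0 < r" "0 < C" "\<And>x. x \<in> Cone \<Longrightarrow> dist z x < r \<Longrightarrow> h x \<le> C * depth x"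
      using h_depth[OF z(1,2)] by blast
    obtain r' where r': "0 < r'" "\<And>x. x \<in> Cone \<Longrightarrow> dist z x < r' \<Longrightarrow> C * depth x \<le> 1 * v x"
      using depth_below_sol[OF v z(2) _ r(2), of 1] z(3) by auto
    have "h x \<le> 1 * v x" if "x \<in> Cone" "dist z x < min r r'" for x
      using r(3)[of x] r'(2)[of x] that by simp
    then show "\<exists>r>0. \<exists>C>0. \<forall>x\<in>Cone. dist z x < r \<longrightarrow> h x \<le> C * v x"
      using r(1) r'(1) by (metis min_less_iff_conj zero_less_one)
  qed (assumption, rule that)
  define M where "M = (- ln (1 / 3)) powr a"
  have M: "0 < M" by (simp add: M_def ln_div)
  \<comment> \<open>The first entry gives the differential inequality, the second puts the
    subsolution below \<open>v\<close> on |x| = 1/3, where h \<le> C v and the logarithmic factor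
    equals \<open>M\<close>.\<close>
  define \<epsilon> where "\<epsilon> = min ((lam / (n + 2 * \<beta>)) powr (1 / (1 + \<gamma>))) (1 / (C * M))"
  have \<epsilon>: "0 < \<epsilon>" using lam n \<beta>0 C M by (simp add: \<epsilon>_def)
  have "\<epsilon> powr (1 + \<gamma>) \<le> ((lam / (n + 2 * \<beta>)) powr (1 / (1 + \<gamma>))) powr (1 + \<gamma>)"
    using \<epsilon> gamma by (intro powr_mono2) (auto simp: \<epsilon>_def)
  also have "\<dots> = lam / (n + 2 * \<beta>)" using lam n \<beta>0 gamma by (simp add: powr_powr)
  finally have \<epsilon>1: "\<epsilon> powr (1 + \<gamma>) * (n + 2 * \<beta>) \<le> lam" using n \<beta>0 by (simp add: pos_le_divide_eq)
  have "\<epsilon> * (C * M) \<le> 1 / (C * M) * (C * M)" using C M by (intro mult_right_mono) (auto simp: \<epsilon>_def)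
  then have \<epsilon>2: "\<epsilon> * (C * M) \<le> 1" using C M by simp
  have lg: "has_grad_lap W (\<lambda>x. (- ln (norm x)) powr a) (\<lambda>x. (- a * (- ln (norm x)) powr (a - 1) / (norm x)\<^sup>2) *\<^sub>R x)
    (\<lambda>x. (a * (a - 1) * (- ln (norm x)) powr (a - 2) + a * (2 - n) * (- ln (norm x)) powr (a - 1)) / (norm x)\<^sup>2)"
    unfolding n_def by (rule has_grad_lap_log_powr[OF open_W]) (use W_ne in force)
  note hs = has_grad_lap_cmult[OF has_grad_lap_mult[OF h_grad_lap lg], of \<epsilon>]
  show ?thesis
  proof (rule that[OF \<epsilon>], unfold a_def[symmetric])
    fix x assume xW: "x \<in> W"
    show "\<epsilon> * (h x * (- ln (norm x)) powr a) \<le> v x"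
    proof (rule subsolution_comparison[OF v open_W W_\<Omega> hs _ _ xW])
      fix x assume xW: "x \<in> W"
      then have x: "x \<in> Cone" "x \<noteq> 0" "norm x < 1 / 3" using W_ne by auto
      define l where "l = - ln (norm x)"
      have l: "1 \<le> l" using log_norm_ge_1[of x] x by (simp add: l_def)
      define q where "q = (norm x)\<^sup>2"
      have q: "0 < q" using x by (simp add: q_def)
      define H where "H = h x"
      have H: "0 < H" using h_pos[OF x(1)] by (simp add: H_def)
      have eu: "x \<bullet> grad h x = \<beta> * H"
        unfolding H_def by (rule homogeneous_euler[OF has_grad_lap_derivative[OF h_grad_lap xW] h_hom[OF x(1)]])
      \<comment> \<open>Here \<phi> \<le> \<beta> is used: for |x| < 1 the larger exponent gives the
        smaller power. The power 1 + \<gamma> of this bound is |x|^2, because \<phi> (1 + \<gamma>)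
        = 2.\<close>
      have "H \<le> norm x powr \<phi>"
      proof -
        have "H \<le> norm x powr \<beta>" unfolding H_def by (rule h_le[OF x(1)])
        also have "\<dots> \<le> norm x powr \<phi>" using \<beta> x by (intro powr_mono') auto
        finally show ?thesis .
      qed
      then have "H powr (1 + \<gamma>) \<le> (norm x powr \<phi>) powr (1 + \<gamma>)" using H gamma by (intro powr_mono2) auto
      also have "\<dots> = q" using x by (simp add: powr_powr \<phi>(3) q_def)
      finally have Hq: "H powr (1 + \<gamma>) / q \<le> 1" using q by simp
      have gi: "grad h x \<bullet> ((- a * l powr (a - 1) / q) *\<^sub>R x) = - a * l powr (a - 1) / q * (\<beta> * H)"
        by (simp add: inner_commute[of "grad h x"] eu)
      have "- (\<epsilon> * (h x * ((a * (a - 1) * (- ln (norm x)) powr (a - 2) + a * (2 - n) * (- ln (norm x)) powr (a - 1)) / (norm x)\<^sup>2) +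
             2 * (grad h x \<bullet> ((- a * (- ln (norm x)) powr (a - 1) / (norm x)\<^sup>2) *\<^sub>R x)) + (- ln (norm x)) powr a * 0))
         = \<epsilon> * (H / q) * (a * (1 - a) * l powr (a - 2) + a * (n - 2 + 2 * \<beta>) * l powr (a - 1))"
        unfolding l_def[symmetric] q_def[symmetric] gi H_def[symmetric] using q by (simp add: field_simps)
      also have "\<dots> \<le> \<epsilon> * (H / q) * ((n + 2 * \<beta>) * l powr (a - 1))"
      proof (rule mult_left_mono)
        have "l powr (a - 2) \<le> l powr (a - 1)" using l by (intro powr_mono) auto
        then have "a * (1 - a) * l powr (a - 2) \<le> 1 * l powr (a - 1)" using a by (intro mult_mono mult_le_one) auto
        moreover have "a * (n - 2 + 2 * \<beta>) * l powr (a - 1) \<le> 1 * (n - 2 + 2 * \<beta>) * l powr (a - 1)"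
          using a n \<beta>0 by (intro mult_right_mono) auto
        moreover have "(n + 2 * \<beta>) * l powr (a - 1) = 1 * (n - 2 + 2 * \<beta>) * l powr (a - 1) + 1 * l powr (a - 1) + l powr (a - 1)"
          by (simp add: algebra_simps)
        moreover have "0 \<le> l powr (a - 1)" by simp
        ultimately show "a * (1 - a) * l powr (a - 2) + a * (n - 2 + 2 * \<beta>) * l powr (a - 1) \<le> (n + 2 * \<beta>) * l powr (a - 1)"
          by linarith
      qed (use \<epsilon> H q in auto)
      also have "\<dots> = \<epsilon> powr (1 + \<gamma>) * (n + 2 * \<beta>) * (H powr (1 + \<gamma>) / q) * (\<epsilon> powr (- \<gamma>) * H powr (- \<gamma>) * l powr (a - 1))"
      proof -
        have "\<epsilon> powr (1 + \<gamma>) * \<epsilon> powr (- \<gamma>) = \<epsilon>" "H powr (1 + \<gamma>) * H powr (- \<gamma>) = H"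
          using \<epsilon> H by (simp_all add: powr_add[symmetric])
        moreover have "c1 * d * (k1 / q) * (c2 * k2 * m) = c1 * c2 * (k1 * k2 / q) * (d * m)" for c1 c2 d k1 k2 m :: real by simp
        ultimately show ?thesis by (simp only:)
      qed
      also have "\<dots> \<le> lam * 1 * (\<epsilon> powr (- \<gamma>) * H powr (- \<gamma>) * l powr (a - 1))"
        using \<epsilon>1 Hq lam q by (intro mult_right_mono mult_mono) auto
      also have "\<dots> = lam * (\<epsilon> * (H * l powr a)) powr (- \<gamma>)"
        using \<epsilon> H l a(3) by (simp add: powr_mult powr_powr)
      finally show "- (\<epsilon> * (h x * ((a * (a - 1) * (- ln (norm x)) powr (a - 2) + a * (2 - n) * (- ln (norm x)) powr (a - 1)) / (norm x)\<^sup>2) +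
             2 * (grad h x \<bullet> ((- a * (- ln (norm x)) powr (a - 1) / (norm x)\<^sup>2) *\<^sub>R x)) + (- ln (norm x)) powr a * 0))
          \<le> lam * (\<epsilon> * (h x * (- ln (norm x)) powr a)) powr - \<gamma>"
        by (simp only: l_def H_def)
    next
      fix z and d :: real assume z: "z \<in> frontier W" and d: "0 < d"
      from frontier_W(2)[OF z] show "\<forall>\<^sub>F x in at z within W. - d < v x - \<epsilon> * (h x * (- ln (norm x)) powr a)"
      proof
        assume "depth z = 0"
        then have "\<forall>\<^sub>F x in at z within W. h x * (- ln (norm x)) powr a < d / \<epsilon>"
          using h_log_small[of z a "d / \<epsilon>"] frontier_W(1)[OF z] a d \<epsilon> by simp
        then show ?thesis using eventually_in_W
        proof eventually_elim
          case (elim x)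
          have "\<epsilon> * (h x * (- ln (norm x)) powr a) < d" using elim(1) \<epsilon> by (simp add: pos_less_divide_eq mult.commute)
          then show ?case using sol_pos[OF v subsetD[OF W_\<Omega> elim(2)]] by simp
        qed
      next
        assume z': "z \<in> Cone \<and> norm z = 1 / 3"
        then have z\<Omega>: "z \<in> \<Omega>" by simp
        have zM: "(- ln (norm z)) powr a = M" using z' unfolding M_def by metis
        have "\<epsilon> * (h z * (- ln (norm z)) powr a) \<le> \<epsilon> * (C * v z * M)"
          unfolding zM using C(2)[of z] z' \<epsilon> M by (intro mult_left_mono mult_right_mono) auto
        also have "\<dots> = \<epsilon> * (C * M) * v z" by simp
        also have "\<dots> \<le> 1 * v z" using \<epsilon>2 sol_pos[OF v z\<Omega>] by (intro mult_right_mono) auto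
        finally have "- d < v z - \<epsilon> * (h z * (- ln (norm z)) powr a)" using d by simp
        moreover have "((\<lambda>x. v x - \<epsilon> * (h x * (- ln (norm x)) powr a)) \<longlongrightarrow> v z - \<epsilon> * (h z * (- ln (norm z)) powr a)) (at z within W)"
        proof -
          have "(v \<longlongrightarrow> v z) (at z within \<Omega>)" "(h \<longlongrightarrow> h z) (at z within \<Omega>)"
            using sol_continuous_on_\<Omega>[OF v] continuous_on_h z\<Omega> unfolding continuous_on_def by blast+
          then have "(v \<longlongrightarrow> v z) (at z within W)" "(h \<longlongrightarrow> h z) (at z within W)"
            using W_\<Omega> by (auto intro: tendsto_within_subset)
          moreover have z0: "norm z \<noteq> 0" using z' by linarith
          moreover have "- ln (norm z) \<noteq> 0" using z' z0 log_norm_ge_1[of z] by auto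
          ultimately show ?thesis by (intro tendsto_intros) auto
        qed
        ultimately show ?thesis by (rule order_tendstoD(1)[rotated])
      qed
    qed
  qed
qed

lemma sol_le_plus_h:
  assumes u: "sol u" "sol v" and \<epsilon>: "0 < \<epsilon>"
  obtains C where "0 < C" "\<And>x. x \<in> W \<Longrightarrow> u x \<le> (1 + \<epsilon>) * v x + C * h x"
proof -
  have cF: "continuous_on \<Omega> (\<lambda>x. u x - (1 + \<epsilon>) * v x)"
    by (intro continuous_intros sol_continuous_on_\<Omega> u)
  obtain C where C: "0 < C" "\<And>x. x \<in> Cone \<Longrightarrow> norm x = 1 / 3 \<Longrightarrow> u x - (1 + \<epsilon>) * v x \<le> C * h x"
  proof (rule cap_dominated[OF cF continuous_on_h])
    show "0 < h x" if "x \<in> \<Omega>" for x using h_pos that by simp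
    fix z :: "(real ^ 'm) \<times> real" assume z: "z \<noteq> 0" "depth z = 0" "norm z = 1 / 3"
    obtain r where r: "0 < r" "\<And>x. x \<in> Cone \<Longrightarrow> dist z x < r \<Longrightarrow> u x \<le> (1 + \<epsilon>) * v x"
      using sol_ratio_near_boundary[OF u z(1,2) _ \<epsilon>] z(3) by auto
    \<comment> \<open>At the rim the left-hand side is already nonpositive, so no lower bound for
      \<open>h\<close> other than positivity enters.\<close>
    have "u x - (1 + \<epsilon>) * v x \<le> 1 * h x" if "x \<in> Cone" "dist z x < r" for x
      using r(2)[OF that] h_pos[OF that(1)] by linarith
    then show "\<exists>r>0. \<exists>C>0. \<forall>x\<in>Cone. dist z x < r \<longrightarrow> u x - (1 + \<epsilon>) * v x \<le> C * h x"
      using r(1) zero_less_one by blast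
  qed (rule that)
  show ?thesis
  proof (rule that[OF C(1)])
    fix x assume x: "x \<in> W"
    show "u x \<le> (1 + \<epsilon>) * v x + C * h x"
    proof (rule difference_comparison[OF u open_W W_\<Omega> _ has_grad_lap_cmult[OF h_grad_lap] _ _ _ x])
      show "0 \<le> C * h y" if "y \<in> W" for y using C(1) h_pos[of y] W_ne[OF that] by simp
    next
      fix z and d :: real assume z: "z \<in> frontier W" and d: "0 < d"
      from frontier_W(2)[OF z] show "\<forall>\<^sub>F x in at z within W. - d < (1 + \<epsilon>) * v x + C * h x - u x"
      proof
        assume "depth z = 0"
        then have "\<forall>\<^sub>F x in at z within W. u x < d"
          using sol_small[OF u(1) _ _ W_\<Omega> d] frontier_W(1)[OF z] by simp
        then show ?thesis using eventually_in_W
        proof eventually_elim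
          case (elim x)
          have "0 \<le> (1 + \<epsilon>) * v x" "0 \<le> C * h x"
            using sol_pos[OF u(2) subsetD[OF W_\<Omega> elim(2)]] \<epsilon> C(1) h_pos[of x] W_ne[OF elim(2)] by auto
          then show ?case using elim(1) by linarith
        qed
      next
        assume z': "z \<in> Cone \<and> norm z = 1 / 3"
        then have z\<Omega>: "z \<in> \<Omega>" by simp
        have "- d < (1 + \<epsilon>) * v z + C * h z - u z" using C(2)[of z] z' d by linarith
        moreover have "((\<lambda>x. (1 + \<epsilon>) * v x + C * h x - u x) \<longlongrightarrow> (1 + \<epsilon>) * v z + C * h z - u z) (at z within W)"
        proof -
          have "(v \<longlongrightarrow> v z) (at z within \<Omega>)" "(h \<longlongrightarrow> h z) (at z within \<Omega>)" "(u \<longlongrightarrow> u z) (at z within \<Omega>)"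
            using sol_continuous_on_\<Omega>[OF u(1)] sol_continuous_on_\<Omega>[OF u(2)] continuous_on_h z\<Omega> unfolding continuous_on_def by blast+
          then have "(v \<longlongrightarrow> v z) (at z within W)" "(h \<longlongrightarrow> h z) (at z within W)" "(u \<longlongrightarrow> u z) (at z within W)"
            using W_\<Omega> by (auto intro: tendsto_within_subset)
          then show ?thesis by (intro tendsto_intros)
        qed
        ultimately show ?thesis by (rule order_tendstoD(1)[rotated])
      qed
    qed (use \<epsilon> in auto)
  qed
qed

text \<open>The lower bound for \<open>v\<close> carries a factor that grows without bound at the
  vertex, so C h becomes at most half of \<epsilon> v there; the other half of \<epsilon> is the one
  in the comparison.\<close>

lemma sol_ratio_near_zero:
  assumes u: "sol u" "sol v" and \<epsilon>: "0 < \<epsilon>"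
  shows "\<exists>r>0. \<forall>x\<in>Cone. dist 0 x < r \<longrightarrow> u x \<le> (1 + \<epsilon>) * v x"
proof -
  have "0 < \<epsilon> / 2" using \<epsilon> by simp
  then obtain C where C: "0 < C" "\<And>x. x \<in> W \<Longrightarrow> u x \<le> (1 + \<epsilon> / 2) * v x + C * h x"
    using sol_le_plus_h[OF u] by blast
  obtain \<delta> where \<delta>: "0 < \<delta>" "\<And>x. x \<in> W \<Longrightarrow> \<delta> * (h x * (- ln (norm x)) powr (\<phi> / 2)) \<le> v x"
    using sol_log_lower_bound[OF u(2)] by blast
  \<comment> \<open>The size of the logarithm from which \<delta> T^(\<phi>/2) \<ge> 2 C /
    \<epsilon>; points with |x| < exp (-T) have at least this logarithm.\<close>
  define T where "T = (2 * C / (\<epsilon> * \<delta>)) powr (2 / \<phi>)"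
  have T: "0 < T" "T powr (\<phi> / 2) = 2 * C / (\<epsilon> * \<delta>)"
    using C \<delta> \<epsilon> \<phi>(1) by (auto simp: T_def powr_powr)
  define r where "r = min (1 / 3) (exp (- T))"
  have r: "0 < r" by (simp add: r_def)
  have "u x \<le> (1 + \<epsilon>) * v x" if x: "x \<in> Cone" "dist 0 x < r" for x
  proof -
    have xW: "x \<in> W" using x by (simp add: W_def r_def)
    then have x0: "0 < norm x" using W_ne by simp
    have "ln (norm x) \<le> ln (exp (- T))" using x x0 by (intro ln_mono) (auto simp: r_def)
    then have "T \<le> - ln (norm x)" by simp
    then have "T powr (\<phi> / 2) \<le> (- ln (norm x)) powr (\<phi> / 2)" using T(1) \<phi>(1) by (intro powr_mono2) auto
    then have "\<delta> * (h x * (2 * C / (\<epsilon> * \<delta>))) \<le> \<delta> * (h x * (- ln (norm x)) powr (\<phi> / 2))"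
      unfolding T(2) using \<delta>(1) h_pos[OF x(1)] by (intro mult_left_mono) auto
    also have "\<dots> \<le> v x" by (rule \<delta>(2)[OF xW])
    finally have "2 * (C * h x) / \<epsilon> \<le> v x" using \<delta>(1) by (simp add: mult_ac)
    then have "C * h x \<le> \<epsilon> / 2 * v x" using \<epsilon> by (simp add: field_simps)
    then show ?thesis using C(2)[OF xW] by (simp add: algebra_simps)
  qed
  then show ?thesis using r by blast
qed

section \<open>The limit of the quotient and its extension\<close>

text \<open>The one-sided estimates are symmetric in the two solutions; used in both orders, they
  squeeze the quotient to 1, at the vertex as well as at the other boundary points.\<close>

lemma sol_ratio_tendsto:
  assumes u: "sol u" "sol v" and z: "depth z = 0" "norm z < 1 / 2"
  shows "((\<lambda>x. u x / v x) \<longlongrightarrow> 1) (at z within \<Omega>)"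
proof (rule tendstoI)
  fix d :: real assume d: "0 < d"
  have *: "\<exists>r>0. \<forall>x\<in>Cone. dist z x < r \<longrightarrow> u' x \<le> (1 + d / 2) * v' x" if "sol u'" "sol v'" for u' v'
    using sol_ratio_near_boundary[OF that _ z, of "d / 2"] sol_ratio_near_zero[OF that, of "d / 2"] d by (cases "z = 0") auto
  obtain r1 where r1: "0 < r1" "\<And>x. x \<in> Cone \<Longrightarrow> dist z x < r1 \<Longrightarrow> u x \<le> (1 + d / 2) * v x"
    using *[OF u] by blast
  obtain r2 where r2: "0 < r2" "\<And>x. x \<in> Cone \<Longrightarrow> dist z x < r2 \<Longrightarrow> v x \<le> (1 + d / 2) * u x"
    using *[OF u(2,1)] by blast
  have "\<forall>\<^sub>F x in at z within \<Omega>. x \<in> ball z (min r1 r2)"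
    using r1(1) r2(1) by (intro eventually_at_topological[THEN iffD2] exI[of _ "ball z (min r1 r2)"]) auto
  moreover have "\<forall>\<^sub>F x in at z within \<Omega>. x \<in> \<Omega>" by (simp add: eventually_at_filter)
  ultimately show "\<forall>\<^sub>F x in at z within \<Omega>. dist (u x / v x) 1 < d"
  proof eventually_elim
    case (elim x)
    have p: "0 < u x" "0 < v x" using sol_pos[OF u(1) elim(2)] sol_pos[OF u(2) elim(2)] by auto
    have 1: "u x \<le> (1 + d / 2) * v x" and 2: "v x \<le> (1 + d / 2) * u x"
      using r1(2)[of x] r2(2)[of x] elim by auto
    have dv: "0 < d * v x" using d p by simp
    have "u x \<le> v x + (d * v x) / 2" using 1 by (simp add: algebra_simps)
    then have "u x - v x < d * v x" using dv by linarith
    moreover have "v x - u x < d * v x"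
    proof (cases "u x \<le> v x")
      case True
      then have "d * u x \<le> d * v x" using d by (intro mult_left_mono) auto
      moreover have "v x \<le> u x + (d * u x) / 2" using 2 by (simp add: algebra_simps)
      ultimately show ?thesis using dv True by linarith
    next
      case False
      then show ?thesis using dv by linarith
    qed
    ultimately have "\<bar>u x - v x\<bar> < d * v x" by linarith
    moreover have "u x / v x - 1 = (u x - v x) / v x" using p by (simp add: diff_divide_distrib)
    ultimately show ?case using p by (simp add: dist_real_def pos_divide_less_eq)
  qed
qed

lemma sol_ratio_extends:
  assumes u: "sol u" "sol v" and \<rho>: "0 < \<rho>" "\<rho> < 1 / 2"
  obtains R c C where "continuous_on (closure (\<Omega> \<inter> ball 0 \<rho>)) R" "\<And>x. x \<in> \<Omega> \<Longrightarrow> R x = u x / v x"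
    "0 < c" "\<And>x. x \<in> closure (\<Omega> \<inter> ball 0 \<rho>) \<Longrightarrow> c \<le> R x \<and> R x \<le> C"
proof -
  \<comment> \<open>Within the closed ball of radius \<rho> < 1/2, the points of the closed cone
    outside \<open>\<Omega>\<close> are boundary points of the cone, where 1 is the limit of the
    quotient.\<close>
  define R where "R x = (if x \<in> \<Omega> then u x / v x else 1)" for x
  define S where "S = closure Cone \<inter> cball 0 \<rho>"
  have "closure (\<Omega> \<inter> ball 0 \<rho>) \<subseteq> closure Cone" by (rule closure_mono) blast
  moreover have "closure (\<Omega> \<inter> ball 0 \<rho>) \<subseteq> cball 0 \<rho>" using ball_subset_cball by (intro closure_minimal closed_cball) blast
  ultimately have sub: "closure (\<Omega> \<inter> ball 0 \<rho>) \<subseteq> S" by (simp add: S_def)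
  have cS: "compact S" unfolding S_def by (intro closed_Int_compact closed_closure compact_cball)
  have cR: "continuous_on S R"
    unfolding continuous_on_def
  proof
    fix z assume z: "z \<in> S"
    show "(R \<longlongrightarrow> R z) (at z within S)"
    proof (cases "z \<in> Cone")
      case True
      then have z\<Omega>: "z \<in> \<Omega>" using z \<rho> by (simp add: S_def)
      have "continuous_on \<Omega> (\<lambda>x. u x / v x)"
        using sol_pos[OF u(2)] by (intro continuous_intros sol_continuous_on_\<Omega> u) force
      then have "isCont (\<lambda>x. u x / v x) z" using open_\<Omega> z\<Omega> by (simp add: continuous_on_eq_continuous_at)
      then have "((\<lambda>x. u x / v x) \<longlongrightarrow> u z / v z) (at z)" unfolding isCont_def .
      moreover have "\<forall>\<^sub>F x in at z. u x / v x = R x"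
        using eventually_at_in_open'[OF open_\<Omega> z\<Omega>] by eventually_elim (simp add: R_def)
      ultimately have "(R \<longlongrightarrow> u z / v z) (at z)" by (rule Lim_transform_eventually)
      then have "(R \<longlongrightarrow> u z / v z) (at z within S)" by (rule tendsto_within_subset) simp
      then show ?thesis using z\<Omega> by (simp add: R_def)
    next
      case False
      then have dz: "depth z = 0" "norm z < 1 / 2" using z \<rho> by (auto simp: S_def closure_Cone mem_Cone)
      have t: "((\<lambda>x. u x / v x) \<longlongrightarrow> 1) (at z within \<Omega>)" by (rule sol_ratio_tendsto[OF u dz])
      have "(R \<longlongrightarrow> 1) (at z within S)"
      proof (rule tendstoI)
        fix d :: real assume d: "0 < d"
        from tendstoD[OF t d] have "\<forall>\<^sub>F x in at z within UNIV. x \<in> \<Omega> \<longrightarrow> dist (u x / v x) 1 < d"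
          by (auto simp: eventually_at_filter elim: eventually_mono)
        then have "\<forall>\<^sub>F x in at z within UNIV. dist (R x) 1 < d"
          by eventually_elim (use d in \<open>simp add: R_def\<close>)
        then show "\<forall>\<^sub>F x in at z within S. dist (R x) 1 < d" by (rule eventually_at_filter[THEN iffD2, OF eventually_mono[OF eventually_at_filter[THEN iffD1]]]) auto
      qed
      then show ?thesis using False by (simp add: R_def)
    qed
  qed
  have pos: "0 < R x" for x using sol_pos[OF u(1), of x] sol_pos[OF u(2), of x] by (simp add: R_def)
  have "0 \<in> S" using \<rho> by (simp add: S_def closure_Cone depth_def)
  then have Sne: "S \<noteq> {}" by blast
  obtain a where a: "a \<in> S" "\<And>y. y \<in> S \<Longrightarrow> R a \<le> R y" using continuous_attains_inf[OF cS Sne cR] by blast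
  obtain b where b: "b \<in> S" "\<And>y. y \<in> S \<Longrightarrow> R y \<le> R b" using continuous_attains_sup[OF cS Sne cR] by blast
  show ?thesis
  proof (rule that[of R "R a" "R b"])
    show "continuous_on (closure (\<Omega> \<inter> ball 0 \<rho>)) R" by (rule continuous_on_subset[OF cR sub])
    show "R x = u x / v x" if "x \<in> \<Omega>" for x using that by (simp add: R_def)
    show "0 < R a" by (rule pos)
    show "R a \<le> R x \<and> R x \<le> R b" if "x \<in> closure (\<Omega> \<inter> ball 0 \<rho>)" for x
      using a(2) b(2) subsetD[OF sub that] by blast
  qed
qed

end

theorem theorem1p4:
  fixes \<Sigma> :: "((real ^ 'm) \<times> real) set"
    and \<Omega> :: "((real ^ 'm) \<times> real) set"
    and f u v :: "(real ^ 'm) \<times> real \<Rightarrow> real"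
    and \<gamma> L K lam Lam :: real
  assumes gamma: "\<gamma> > 1"
    and Sigma: "\<Sigma> \<subseteq> sphere 0 1"
    and cone: "C11_epigraphical_cone (cone_over \<Sigma>) L K"
    and frequency: "is_frequency \<Sigma> (2 / (1 + \<gamma>))"
    and Omega: "\<Omega> = cone_over \<Sigma> \<inter> ball 0 1"
    and f_meas: "f \<in> borel_measurable (lebesgue_on \<Omega>)"
    and lam: "0 < lam"
    and f_bounds: "\<And>x. x \<in> \<Omega> \<Longrightarrow> lam \<le> f x \<and> f x \<le> Lam"
    and u: "singular_solution (cone_over \<Sigma>) \<gamma> f u"
    and v: "singular_solution (cone_over \<Sigma>) \<gamma> f v"
    and distinct: "\<exists>x\<in>\<Omega>. u x \<noteq> v x"
  shows "(\<exists>R. continuous_on (closure (\<Omega> \<inter> ball 0 (1/16))) R \<and>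
              (\<forall>x \<in> \<Omega> \<inter> closure (\<Omega> \<inter> ball 0 (1/16)). R x = u x / v x) \<and>
              (\<exists>c C. 0 < c \<and> (\<forall>x \<in> closure (\<Omega> \<inter> ball 0 (1/16)). c \<le> R x \<and> R x \<le> C))) \<and>
         (\<forall>z \<in> ball 0 (1/16) \<inter> frontier (cone_over \<Sigma>).
              ((\<lambda>x. u x / v x) \<longlongrightarrow> 1) (at z within \<Omega>))"
proof -
  obtain g \<Gamma> B K1 where E: "epi_cone g \<Gamma> B K1" and C: "cone_over \<Sigma> = epi_cone.Cone g"
    using C11_epigraphical_cone_epi_cone[OF cone] by blast
  interpret E: epi_cone g \<Gamma> B K1 by (rule E)
  interpret sing g \<Gamma> B K1 f \<gamma> lam Lam
    by unfold_locales (use gamma lam f_meas f_bounds Omega C in auto)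
  obtain h \<beta> C1 where h: "0 < \<beta>" "harm E.Cone h" "\<And>x. x \<in> E.Cone \<Longrightarrow> 0 < h x" "\<And>x. x \<in> E.Cone \<Longrightarrow> h x \<le> norm x powr \<beta>"
    "\<And>t x. x \<in> E.Cone \<Longrightarrow> 0 < t \<Longrightarrow> h (t *\<^sub>R x) = t powr \<beta> * h x"
    "0 < C1" "\<And>p d. p \<noteq> 0 \<Longrightarrow> 0 < d \<Longrightarrow> d < norm p \<Longrightarrow>
       h (p, g p + d) \<le> (norm (p, g p) + norm p) powr \<beta> * (C1 * d / norm p)"
    by (rule E.homogeneous_harmonic_exists) (rule that)
  define n where "n = real DIM((real ^ 'm) \<times> real)"
  have n: "2 \<le> n" unfolding n_def by (rule DIM_ge_2)
  obtain \<mu> where \<mu>: "first_dirichlet_eigenvalue \<Sigma> \<mu>" "\<phi> * (\<phi> + n - 2) = \<mu>"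
    using frequency unfolding is_frequency_def \<phi>_def n_def by blast
  have ev: "dirichlet_eigenvalue \<Sigma> (\<beta> * (\<beta> + n - 2))"
    unfolding n_def by (rule E.dirichlet_eigenvalue_homogeneous[OF Sigma C h(1,2,3,5,6,7)])
  \<comment> \<open>Minimality of the first eigenvalue, applied to the eigenvalue that belongs to
    \<open>h\<close>. Because t (t + n - 2) increases strictly for t > 0, this orders the
    exponents.\<close>
  have le: "\<phi> * (\<phi> + n - 2) \<le> \<beta> * (\<beta> + n - 2)"
    using \<mu> ev unfolding first_dirichlet_eigenvalue_def by blast
  have "\<phi> \<le> \<beta>"
  proof (rule ccontr)
    assume "\<not> \<phi> \<le> \<beta>"
    then have "\<beta> * (\<beta> + n - 2) < \<phi> * (\<phi> + n - 2)" using h(1) n by (intro mult_strict_mono) auto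
    then show False using le by linarith
  qed
  interpret sing_harm g \<Gamma> B K1 f \<gamma> lam Lam h \<beta>
  proof unfold_locales
    show "\<exists>r>0. \<exists>C>0. \<forall>x\<in>E.Cone. dist z x < r \<longrightarrow> h x \<le> C * E.depth x" if "z \<noteq> 0" "E.depth z = 0" for z
      by (rule E.homogeneous_harmonic_depth[OF h(6,7,1) that])
  qed (use h \<open>\<phi> \<le> \<beta>\<close> in auto)
  have \<Omega>: "\<Omega> = E.Cone \<inter> ball 0 1" using Omega C by simp
  have sol: "singular_solution E.Cone \<gamma> f u" "singular_solution E.Cone \<gamma> f v" using u v C by auto
  obtain R c C' where R: "continuous_on (closure (\<Omega> \<inter> ball 0 (1/16))) R" "\<And>x. x \<in> \<Omega> \<Longrightarrow> R x = u x / v x"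
    "0 < c" "\<And>x. x \<in> closure (\<Omega> \<inter> ball 0 (1/16)) \<Longrightarrow> c \<le> R x \<and> R x \<le> C'"
    using sol_ratio_extends[OF sol, of "1 / 16"] unfolding \<Omega> by auto
  show ?thesis
  proof (intro conjI ballI)
    show "\<exists>R. continuous_on (closure (\<Omega> \<inter> ball 0 (1/16))) R \<and>
              (\<forall>x \<in> \<Omega> \<inter> closure (\<Omega> \<inter> ball 0 (1/16)). R x = u x / v x) \<and>
              (\<exists>c C. 0 < c \<and> (\<forall>x \<in> closure (\<Omega> \<inter> ball 0 (1/16)). c \<le> R x \<and> R x \<le> C))"
      using R by blast
    fix z assume "z \<in> ball 0 (1/16) \<inter> frontier (cone_over \<Sigma>)"
    then have "E.depth z = 0" "norm z < 1 / 2" by (auto simp: C E.frontier_Cone)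
    then show "((\<lambda>x. u x / v x) \<longlongrightarrow> 1) (at z within \<Omega>)"
      unfolding \<Omega> by (rule sol_ratio_tendsto[OF sol])
  qed
qed

end
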